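(* For each dimension $d\ge 3$ there exist an inverse temperature $\beta$ and an integer $q_0$ such that for every $q\ge q_0$ there is a translation-invariant absolutely summable interaction $\Phi'$ on $\{1,\dots,q\}^{\mathbb{Z}^d}$, invariant under the cyclic relabelling $l\mapsto l+1 \pmod q$ of the spin values (discrete clock rotation invariance), such that the set of Gibbs measures $\mathcal{G}_{\Phi'}$ of $\Phi'$ (with uniform a priori measure on $\{1,\dots,q\}$) contains uncountably many translation-invariant ergodic measures. (Concretely, $\Phi'$ is an interaction for which $T(\mu)$ is Gibbsian, where $\mu$ ranges over the Gibbs measures of the nearest-neighbour XY model on $\mathbb{Z}^d$ at inverse temperature $\beta$ and $T$ is the discretisation of $\mathbb{S}^1$ into $q$ equal arcs.)
   Context: The nearest-neighbour XY model on $\mathbb{Z}^d$ has spins in $\mathbb{S}^1$ with uniform a priori measure and formal Hamiltonian $-\beta\sum_{\langle i,j\rangle}\sigma_i\cdot\sigma_j$. The discretisation $T:\mathbb{S}^1\to\{1,\dots,q\}$ maps a spin to the index of the arc of length $2\pi/q$ containing it (arcs labelled cyclically). Gibbs measures are defined through the DLR equations. *)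

theory Defs
  imports "HOL-Probability.Probability"
begin

text \<open>Lattice sites of Z^d are functions 'd => int for a finite index type 'd
  (d = CARD('d)).  Configurations are functions from sites to spin values.\<close>

definition site_add :: "('d \<Rightarrow> int) \<Rightarrow> ('d \<Rightarrow> int) \<Rightarrow> ('d \<Rightarrow> int)" where
  "site_add x a = (\<lambda>i. x i + a i)"

definition adj :: "('d::finite \<Rightarrow> int) \<Rightarrow> ('d \<Rightarrow> int) \<Rightarrow> bool" where
  "adj i j \<longleftrightarrow> (\<Sum>k\<in>UNIV. \<bar>i k - j k\<bar>) = 1"

definition tr :: "('d \<Rightarrow> int) \<Rightarrow> (('d \<Rightarrow> int) \<Rightarrow> 's) \<Rightarrow> (('d \<Rightarrow> int) \<Rightarrow> 's)" where
  "tr a w = (\<lambda>x. w (site_add x a))"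

definition conf_space :: "'s measure \<Rightarrow> (('d \<Rightarrow> int) \<Rightarrow> 's) measure" where
  "conf_space nu = PiM UNIV (\<lambda>_. nu)"

definition merge_conf :: "('d \<Rightarrow> int) set \<Rightarrow> (('d \<Rightarrow> int) \<Rightarrow> 's) \<Rightarrow> (('d \<Rightarrow> int) \<Rightarrow> 's) \<Rightarrow> (('d \<Rightarrow> int) \<Rightarrow> 's)" where
  "merge_conf L s w = (\<lambda>x. if x \<in> L then s x else w x)"

text \<open>Gibbs specification gamma_L(E | w) for a Hamiltonian family H L (energy in
  the finite volume L, including interaction with the boundary) and a priori
  measure nu: density exp(-H) with respect to the product a priori measure on L.\<close>
definition spec ::
  "'s measure \<Rightarrow> (('d \<Rightarrow> int) set \<Rightarrow> (('d \<Rightarrow> int) \<Rightarrow> 's) \<Rightarrow> real)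
    \<Rightarrow> ('d \<Rightarrow> int) set \<Rightarrow> (('d \<Rightarrow> int) \<Rightarrow> 's) set \<Rightarrow> (('d \<Rightarrow> int) \<Rightarrow> 's) \<Rightarrow> real" where
  "spec nu H L E w =
     (\<integral>s. exp (- H L (merge_conf L s w)) * indicator E (merge_conf L s w) \<partial>(PiM L (\<lambda>_. nu)))
     / (\<integral>s. exp (- H L (merge_conf L s w)) \<partial>(PiM L (\<lambda>_. nu)))"

definition gibbs_measures ::
  "'s measure \<Rightarrow> (('d \<Rightarrow> int) set \<Rightarrow> (('d \<Rightarrow> int) \<Rightarrow> 's) \<Rightarrow> real)
    \<Rightarrow> (('d \<Rightarrow> int) \<Rightarrow> 's) measure set" where
  "gibbs_measures nu H = {mu. prob_space mu \<and> sets mu = sets (conf_space nu) \<and>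
     (\<forall>L. finite L \<longrightarrow> (\<forall>E\<in>sets mu. measure mu E = (\<integral>w. spec nu H L E w \<partial>mu)))}"

definition translation_invariant :: "'s measure \<Rightarrow> (('d \<Rightarrow> int) \<Rightarrow> 's) measure \<Rightarrow> bool" where
  "translation_invariant nu mu \<longleftrightarrow> (\<forall>a. distr mu (conf_space nu) (tr a) = mu)"

definition ergodic :: "'s measure \<Rightarrow> (('d \<Rightarrow> int) \<Rightarrow> 's) measure \<Rightarrow> bool" where
  "ergodic nu mu \<longleftrightarrow> translation_invariant nu mu \<and>
     (\<forall>E\<in>sets mu. (\<forall>a. tr a -` E \<inter> space mu = E) \<longrightarrow> measure mu E = 0 \<or> measure mu E = 1)"

text \<open>Spins in S^1 are represented by angles, a priori measure uniform on [0, 2 pi);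
  sigma_i . sigma_j = cos (theta_i - theta_j).  The finite-volume Hamiltonian
  -beta * sum over nearest-neighbour bonds meeting L; ordered pairs are summed
  and halved so each bond counts once.\<close>
definition XY_prior :: "real measure" where
  "XY_prior = uniform_measure lborel {0..<2*pi}"

definition H_XY :: "real \<Rightarrow> ('d::finite \<Rightarrow> int) set \<Rightarrow> (('d \<Rightarrow> int) \<Rightarrow> real) \<Rightarrow> real" where
  "H_XY beta L w = - beta * (\<Sum>(i,j)\<in>{(i,j). adj i j \<and> (i \<in> L \<or> j \<in> L)}. cos (w i - w j)) / 2"

definition disc :: "nat \<Rightarrow> real \<Rightarrow> nat" where
  "disc q t = nat \<lfloor>(t - 2*pi*\<lfloor>t/(2*pi)\<rfloor>) * real q / (2*pi)\<rfloor> + 1"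

definition clock_prior :: "nat \<Rightarrow> nat measure" where
  "clock_prior q = uniform_count_measure {1..q}"

definition conf :: "nat \<Rightarrow> (('d \<Rightarrow> int) \<Rightarrow> nat) set" where
  "conf q = {w. \<forall>x. w x \<in> {1..q}}"

definition is_interaction :: "nat \<Rightarrow> (('d \<Rightarrow> int) set \<Rightarrow> (('d \<Rightarrow> int) \<Rightarrow> nat) \<Rightarrow> real) \<Rightarrow> bool" where
  "is_interaction q Phi \<longleftrightarrow>
     (\<forall>A w w'. (\<forall>x\<in>A. w x = w' x) \<longrightarrow> Phi A w = Phi A w') \<and>
     (\<forall>a A. \<forall>w\<in>conf q. Phi ((\<lambda>x. site_add x a) ` A) w = Phi A (tr a w)) \<and>
     (\<lambda>A. SUP w\<in>conf q. \<bar>Phi A w\<bar>) summable_on {A. finite A \<and> (\<lambda>_. 0) \<in> A}"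

definition clock_invariant :: "nat \<Rightarrow> (('d \<Rightarrow> int) set \<Rightarrow> (('d \<Rightarrow> int) \<Rightarrow> nat) \<Rightarrow> real) \<Rightarrow> bool" where
  "clock_invariant q Phi \<longleftrightarrow> (\<forall>A. \<forall>w\<in>conf q. Phi A (\<lambda>x. w x mod q + 1) = Phi A w)"

definition H_int :: "(('d \<Rightarrow> int) set \<Rightarrow> (('d \<Rightarrow> int) \<Rightarrow> nat) \<Rightarrow> real) \<Rightarrow> ('d \<Rightarrow> int) set \<Rightarrow> (('d \<Rightarrow> int) \<Rightarrow> nat) \<Rightarrow> real" where
  "H_int Phi L w = (\<Sum>\<^sub>\<infinity>A\<in>{A. finite A \<and> A \<inter> L \<noteq> {}}. Phi A w)"

end

theory Submission imports Defs begin

text \<open>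
 Finite-volume states with boundary condition 0 dominate: by the doubling argument of Messager, Miracle-Sole
 and Pfister, phases in the interaction, in the boundary condition or in the observable only decrease
 expectations of \<open>cos (linf k w)\<close>.  Hence these expectations decrease with the volume and have a limit, and the limit
 state \<open>mu\<close> is a translation-invariant Gibbs measure.  It is ergodic: conditioning \<open>mu\<close> on an invariant event
 gives a Gibbs measure to which the domination applies again; the same holds for the complement, so both
 conditional measures have the same characters as \<open>mu\<close>.

 The magnetization of \<open>mu\<close> is positive at low temperature in three dimensions.  Averaging the domination
 inequality over random phases on the bonds, distributed with the single-bond Gibbs weight, and using
 Nishimori's gauge transformation reduces a lower bound to the second moment of an estimator built from random
 directed paths from the origin to the boundary, which is finite because two independent paths can be arranged
 to have an exponentially small probability of many common bonds.

 Given the arcs, the positions of the spins inside the arcs interact by weak pair factors when \<open>q\<close> is large.  The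
 Moebius coefficients of the logarithm of their partition function have a summable majorant that is uniform in
 the arcs and in the boundary weights; together with the bare pair energies they form \<open>Phi\<close>.

 Rotating \<open>mu\<close> by an angle and discretising gives ergodic Gibbs measures for \<open>Phi\<close>, and the discretised
 magnetization is a continuous function of the angle that changes sign, so it takes uncountably many values.
\<close>

section \<open>Directed lattice paths with few common bonds\<close>

text \<open>Three dimensions are the borderline case for the paths. A directed simple walk with two
  transversal coordinates hits a given site after time \<open>k\<close> with probability of order
  \<open>1/k\<close>, which is not summable. The walks built here spread like
  \<open>k powr (3/4)\<close> in each coordinate, so the probability is of order
  \<open>k powr (-3/2)\<close>; this is the reason for variables of size \<open>8^N\<close> on
  blocks of length \<open>16^N\<close>.

  The temperature is fixed by the magnetization, and only then is \<open>q\<close> taken large. The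
  interaction between arcs is therefore never weak; what becomes weak is the dependence on the
  positions inside the arcs. So the strong part is kept as an explicit pair energy, and the
  expansion is applied only to the positions, conditioned on the arcs.

  The supremum over configurations stands inside the sum that defines absolute summability, and
  conditional weights have to be compared uniformly in the outer spins. Hence the norm of a set
  function is replaced by a common majorant for a whole family of them.\<close>

type_synonym 'd site = "'d => int"

section \<open>Integer walks driven by independent variables on blocks of all scales\<close>

definition levels :: "nat => nat set" where
 "levels n = {2..n+2}"

definition blk_ix :: "nat => (bool \<times> nat \<times> nat) set" where
 "blk_ix n = UNIV \<times> levels n \<times> {..n}"

definition blk_space :: "nat => (bool \<times> nat \<times> nat => nat) set" where
 "blk_space n = (\<Pi>\<^sub>E i\<in>blk_ix n. {..<8^fst (snd i)})"

text \<open>On a block of length \<open>16^N\<close> the drift of scale \<open>N\<close> is constant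
  and adds up to the integer \<open>U (b, N, j)\<close> over the whole block. Altering one variable
  thus moves the walk after the block by an integer and leaves the walk before the block
  unchanged.\<close>

definition drift :: "nat => (bool \<times> nat \<times> nat => nat) => bool => nat => real" where
 "drift n U b s = (\<Sum>N\<in>levels n. real (U (b, N, s div 16^N)) / 16^N)"

definition walk :: "nat => (bool \<times> nat \<times> nat => nat) => bool => nat => nat" where
 "walk n U b t = nat \<lfloor>\<Sum>s<t. drift n U b s\<rfloor>"

lemma finite_levels [simp]: "finite (levels n)"
 by (simp add: levels_def)

lemma finite_blk_space: "finite (blk_space n)"
 by (auto simp: blk_space_def blk_ix_def intro!: finite_PiE)

lemma blk_space_nonempty: "blk_space n \<noteq> {}"
 by (auto simp: blk_space_def PiE_eq_empty_iff lessThan_empty_iff)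

lemma drift_nonneg: "0 \<le> drift n U b s"
 by (auto simp: drift_def intro!: sum_nonneg)

text \<open>The scales start at 2 so that the largest possible drifts \<open>8^N / 16^N\<close> add
  up to at most 1/2. A drift below 1 is what restricts the walks to steps 0 and 1.\<close>

lemma sum_half_powers: "(\<Sum>N\<in>levels n. (1/2)^N :: real) \<le> 1/2"
proof -
 have "(\<Sum>N\<in>levels n. (1/2)^N :: real) = 1/2 - (1/2)^(n+2)"
 proof (induction n)
  case 0 then show ?case by (simp add: levels_def power2_eq_square)
 next
  case (Suc n)
  have "levels (Suc n) = insert (n+3) (levels n)" "n+3 \<notin> levels n" by (auto simp: levels_def)
  then show ?case using Suc by (simp add: power_add power2_eq_square power3_eq_cube)
 qed
 then show ?thesis by (simp del: power_Suc)
qed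

lemma drift_less_1:
 assumes "U \<in> blk_space n" "s \<le> n"
 shows "drift n U b s < 1"
proof -
 have "drift n U b s \<le> (\<Sum>N\<in>levels n. (1/2)^N)"
  unfolding drift_def
 proof (rule sum_mono)
  fix N assume N: "N \<in> levels n"
  have "s div 16^N \<le> n"
   using assms(2) div_le_dividend le_trans by blast
  then have "(b, N, s div 16^N) \<in> blk_ix n"
   using N by (auto simp: blk_ix_def)
  then have "U (b, N, s div 16^N) < 8^N"
   using assms(1) by (fastforce simp: blk_space_def PiE_iff)
  then have "real (U (b, N, s div 16^N)) \<le> 8^N"
   by (metis less_imp_le of_nat_le_iff of_nat_numeral of_nat_power)
  then have "real (U (b, N, s div 16^N)) / 16^N \<le> 8^N/16^N"
   by (intro divide_right_mono) auto
  also have "... = (1/2)^N"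
   by (simp add: power_divide[symmetric])
  finally show "real (U (b, N, s div 16^N)) / 16^N \<le> (1/2)^N" .
 qed
 also have "... < 1" using sum_half_powers[of n] by linarith
 finally show ?thesis .
qed

lemma walk_0: "walk n U b 0 = 0"
 by (simp add: walk_def)

lemma walk_step:
 assumes "U \<in> blk_space n" "t \<le> n"
 shows "walk n U b (Suc t) = walk n U b t \<or> walk n U b (Suc t) = Suc (walk n U b t)"
proof -
 have "0 \<le> (\<Sum>s<t. drift n U b s)" by (simp add: drift_nonneg sum_nonneg)
 then show ?thesis
  using drift_nonneg[of n U b t] drift_less_1[OF assms, of b]
  unfolding walk_def by (simp) linarith
qed

lemma walk_le: "U \<in> blk_space n ==> t \<le> Suc n ==> walk n U b t \<le> t"
proof (induction t)
 case (Suc t)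
 then show ?case using walk_step[of U n t b] by auto
qed (simp add: walk_0)

lemma card_div_eq:
 assumes "0 < (L::nat)" "(j+1)*L \<le> k"
 shows "card {s. s < k \<and> s div L = j} = L"
proof -
 have *: "s div L = j \<longleftrightarrow> j*L \<le> s \<and> s < (j+1)*L" for s
  using less_eq_div_iff_mult_less_eq[OF assms(1), of j s] div_less_iff_less_mult[OF assms(1), of s "j+1"]
  by linarith
 have "{s. s < k \<and> s div L = j} = {j*L..<(j+1)*L}"
  unfolding * using less_le_trans[OF _ assms(2)] by fastforce
 then show ?thesis using assms by simp
qed

text \<open>Block \<open>j\<close> consists of \<open>16^N\<close> times, each changed by a
  \<open>16^N\<close>-th of the difference; that the block ends by time \<open>k\<close> makes the
  total change the full integer.\<close>

lemma drift_sum_update: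
 assumes N: "N \<in> levels n" and k: "(j+1)*16^N \<le> k"
 shows "(\<Sum>s<k. drift n (U((b,N,j) := v)) b s) = (\<Sum>s<k. drift n U b s) + (real v - real (U (b,N,j)))"
proof -
 have d: "drift n (U((b,N,j) := v)) b s = drift n U b s + (if s div 16^N = j then (real v - real (U (b,N,j)))/16^N else 0)" for s
 proof -
  have "drift n (U((b,N,j) := v)) b s - drift n U b s
   = (\<Sum>N'\<in>levels n. if N' = N then (if s div 16^N = j then (real v - real (U (b,N,j)))/16^N else 0) else 0)"
   unfolding drift_def sum_subtractf[symmetric]
   by (intro sum.cong) (auto simp: diff_divide_distrib)
  also have "... = (if s div 16^N = j then (real v - real (U (b,N,j)))/16^N else 0)"
   using N by (subst sum.delta) auto
  finally show ?thesis by simp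
 qed
 have "(\<Sum>s<k. if s div 16^N = j then (real v - real (U (b,N,j)))/16^N else 0)
   = (\<Sum>s\<in>{s. s < k \<and> s div 16^N = j}. (real v - real (U (b,N,j)))/16^N)"
  by (subst sum.inter_filter[symmetric]) (auto intro!: sum.cong)
 also have "... = real v - real (U (b,N,j))"
  using card_div_eq[of "16^N" j k] k by simp
 finally show ?thesis unfolding d sum.distrib by simp
qed

lemma drift_update_other:
 assumes "b' \<noteq> b \<or> s < j*16^N"
 shows "drift n (U((b',N,j) := v)) b s = drift n U b s"
proof -
 have "s div 16^N < j" if "s < j*16^N" using that
  by (simp add: less_mult_imp_div_less)
 then have "U (b, N', s div 16^N') = (U((b',N,j) := v)) (b, N', s div 16^N')" for N'
  using assms by auto
 then show ?thesis unfolding drift_def by simp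
qed

lemma walk_update_past:
 assumes "t \<le> j*16^N"
 shows "walk n (U((b',N,j) := v)) b t = walk n U b t"
proof -
 have "(\<Sum>s<t. drift n (U((b',N,j) := v)) b s) = (\<Sum>s<t. drift n U b s)"
  using assms by (intro sum.cong refl drift_update_other) auto
 then show ?thesis by (simp add: walk_def)
qed

lemma walk_update_other:
 assumes "b' \<noteq> b"
 shows "walk n (U((b',N,j) := v)) b t = walk n U b t"
 using drift_update_other[of b' b] assms unfolding walk_def by simp

text \<open>An integer change of the real sum passes through the floor, so the position at time
  \<open>k\<close> determines the block variable once all others are known.\<close>

lemma walk_update_inj:
 assumes N: "N \<in> levels n" and k: "(j+1)*16^N \<le> k"
  and eq: "walk n (U((b,N,j) := v)) b k = walk n U b k"
 shows "v = U (b,N,j)"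
proof -
 let ?S = "\<lambda>U. \<Sum>s<k. drift n U b s"
 have "\<lfloor>?S (U((b,N,j) := v))\<rfloor> = \<lfloor>?S U\<rfloor>"
  using eq unfolding walk_def
  by (simp add: drift_nonneg sum_nonneg eq_nat_nat_iff)
 moreover have "?S (U((b,N,j) := v)) = ?S U + of_int (int v - int (U (b,N,j)))"
  using drift_sum_update[OF N k] by simp
 ultimately show ?thesis by (simp only: floor_add_int[symmetric])
qed

section \<open>Hitting estimates and exponential moments of the number of meetings\<close>

definition past_fun :: "nat => nat => ((bool \<times> nat \<times> nat => nat) => real) => bool" where
 "past_fun n m f \<longleftrightarrow> (\<forall>U U'. (\<forall>b. \<forall>t\<le>m. walk n U b t = walk n U' b t) --> f U = f U')"

text \<open>The two uniform variables of a full dyadic block inside \<open>[m, k]\<close> shift the two walks at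
 time \<open>k\<close> by arbitrary integers without changing them before time \<open>m\<close>.\<close>
lemma hit_count_block:
 assumes N: "2 \<le> N" and mk: "m + 2*16^N \<le> k" and k: "k \<le> n+1"
  and f: "past_fun n m f" and f0: "\<And>U. 0 \<le> f U"
 shows "64^N * (\<Sum>U\<in>{U\<in>blk_space n. walk n U False k = x \<and> walk n U True k = y}. f U)
  \<le> (\<Sum>U\<in>blk_space n. f U)"
proof -
 \<comment> \<open>The first block of scale \<open>N\<close> that starts after \<open>m\<close>; the
   slack \<open>2*16^N\<close> in the hypothesis ensures that it also ends by
   \<open>k\<close>.\<close>
 define j where "j = m div 16^N + 1"
 define i0 where "i0 = (False, N, j)"
 define i1 where "i1 = (True, N, j)"
 let ?H = "{U\<in>blk_space n. walk n U False k = x \<and> walk n U True k = y}"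
 let ?V = "{..<8^N :: nat}"
 have m: "m \<le> j*16^N"
  unfolding j_def using dividend_less_div_times[of "16^N" m] by (simp add: add.commute less_imp_le)
 have "m div 16^N * 16^N \<le> m" by simp
 then have jk: "(j+1)*16^N \<le> k" using mk unfolding j_def by (simp only: add_mult_distrib mult_1 mult_2)
 have "N < 2^N" by (rule less_exp)
 also have "(2::nat)^N \<le> 16^N" by (intro power_mono) auto
 finally have "N < 16^N" .
 then have Nn: "N \<in> levels n" using N mk k by (auto simp: levels_def)
 have "(j+1) * 1 \<le> (j+1) * 16^N" by (intro mult_le_mono) auto
 then have "(j+1) * 1 \<le> n+1" by (rule le_trans[OF _ le_trans[OF jk k]])
 then have jn: "j \<le> n" by simp
 have ix: "i0 \<in> blk_ix n" "i1 \<in> blk_ix n"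
  using Nn jn by (auto simp: i0_def i1_def blk_ix_def)
 have ne: "i0 \<noteq> i1" by (simp add: i0_def i1_def)
 \<comment> \<open>Resampling the two block variables maps \<open>64^N\<close> copies of the hitting
   event into the space. The map is injective because the prescribed positions at time
   \<open>k\<close> determine the overwritten values, and it preserves \<open>f\<close>, which sees
   only times up to \<open>m\<close>.\<close>
 define ph where "ph = (\<lambda>(U, v0, v1). U(i0 := v0, i1 := v1) :: bool \<times> nat \<times> nat => nat)"
 have fin: "finite ?H" using finite_blk_space[of n] by simp
 have im: "ph ` (?H \<times> ?V \<times> ?V) \<subseteq> blk_space n"
  using ix by (auto simp: ph_def blk_space_def PiE_iff extensional_def i0_def i1_def)
 have fph: "f (ph (U, v0, v1)) = f U" for U v0 v1
 proof -
  have "walk n (ph (U, v0, v1)) b t = walk n U b t" if "t \<le> m" for b t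
   using that m unfolding ph_def i0_def i1_def by (simp add: walk_update_past)
  then show ?thesis using f unfolding past_fun_def by blast
 qed
 have inj: "inj_on ph (?H \<times> ?V \<times> ?V)"
 proof (rule inj_onI)
  fix z z' assume z: "z \<in> ?H \<times> ?V \<times> ?V" and z': "z' \<in> ?H \<times> ?V \<times> ?V" and hz: "ph z = ph z'"
  obtain U v0 v1 U' v0' v1' where zz: "z = (U, v0, v1)" "z' = (U', v0', v1')"
   by (metis prod_cases3)
  have h: "ph (U, v0, v1) = ph (U', v0', v1')"
   and x: "walk n U' False k = walk n U False k" "walk n U' True k = walk n U True k"
   using z z' hz unfolding zz by auto
  have pt: "(ph (U, v0, v1)) i = (ph (U', v0', v1')) i" for i using h by simp
  have v: "v0 = v0'" "v1 = v1'" using pt[of i0] pt[of i1] ne by (auto simp: ph_def)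
  have off: "U i = U' i" if "i \<noteq> i0" "i \<noteq> i1" for i using pt[of i] that by (auto simp: ph_def)
  have U': "U' = U(i0 := U' i0, i1 := U' i1)" using off by auto
  have "walk n (U(i0 := U' i0)) False k = walk n U False k"
   using x(1) U' walk_update_other[of True False n "U(i0 := U' i0)" N j "U' i1" k]
   unfolding i1_def by simp
  then have a: "U' i0 = U i0"
   unfolding i0_def by (rule walk_update_inj[OF Nn jk])
  then have "U' = U(i1 := U' i1)" using U' by (metis fun_upd_triv)
  then have "walk n (U(i1 := U' i1)) True k = walk n U True k" using x(2) by simp
  then have "U' i1 = U i1"
   unfolding i1_def by (rule walk_update_inj[OF Nn jk])
  with a off have "U = U'" by (intro ext) metis
  then show "z = z'" using v zz by simp
 qed
 have "(\<Sum>z\<in>?H \<times> ?V \<times> ?V. f (ph z)) = (\<Sum>z\<in>?H \<times> ?V \<times> ?V. f (fst z))"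
  by (intro sum.cong) (auto simp: fph)
 also have "... = (\<Sum>U\<in>?H. \<Sum>v\<in>?V \<times> ?V. f U)"
  by (subst sum.cartesian_product) (auto intro!: sum.cong)
 also have "... = 64^N * (\<Sum>U\<in>?H. f U)"
  by (simp add: sum_distrib_left card_cartesian_product power_mult_distrib[symmetric])
 finally have "64^N * (\<Sum>U\<in>?H. f U) = (\<Sum>z\<in>?H \<times> ?V \<times> ?V. f (ph z))" by simp
 also have "... = (\<Sum>U\<in>ph ` (?H \<times> ?V \<times> ?V). f U)"
  using inj by (simp add: sum.reindex)
 also have "... \<le> (\<Sum>U\<in>blk_space n. f U)"
  using im f0 finite_blk_space by (intro sum_mono2) auto
 finally show ?thesis .
qed

text \<open>Two coordinates with spread exponent 3/4 give the exponent 3/2, which exceeds 1 and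
  makes the weights summable. The constant is \<open>512 = 2*16^2\<close>: from this gap on, the
  scale chosen in \<open>hit_count\<close> is at least 2, and shorter gaps have weight at least
  1.\<close>

definition gap_weight :: "nat => real" where
 "gap_weight k = (512 / real k) powr (3/2)"

lemma gap_weight_nonneg: "0 \<le> gap_weight k" by (simp add: gap_weight_def)

lemma summable_gap_weight: "summable gap_weight"
proof -
 have "gap_weight k = 512 powr (3/2) * (real k powr (-3/2))" for k
  by (cases "k = 0") (auto simp: gap_weight_def powr_divide powr_minus_divide)
 then have "gap_weight = (\<lambda>k. 512 powr (3/2) * (real k powr (-3/2)))" by blast
 moreover have "summable (\<lambda>k. real k powr (-3/2))"
  by (subst summable_real_powr_iff) auto
 ultimately show ?thesis using summable_mult[of "\<lambda>k. real k powr (-3/2)" "512 powr (3/2)"] by metis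
qed

lemma hit_count:
 assumes mk: "m < k" and k: "k \<le> n+1"
  and f: "past_fun n m f" and f0: "\<And>U. 0 \<le> f U"
 shows "(\<Sum>U\<in>{U\<in>blk_space n. walk n U False k = x \<and> walk n U True k = y}. f U)
  \<le> gap_weight (k - m) * (\<Sum>U\<in>blk_space n. f U)"
proof (cases "k - m < 512")
 case True
 have "1 \<le> gap_weight (k - m)"
  unfolding gap_weight_def using True mk by (intro ge_one_powr_ge_zero) auto
 moreover have "(\<Sum>U\<in>{U\<in>blk_space n. walk n U False k = x \<and> walk n U True k = y}. f U)
   \<le> 1 * (\<Sum>U\<in>blk_space n. f U)"
  using f0 finite_blk_space by (auto intro!: sum_mono2)
 ultimately show ?thesis
  using f0 by (meson mult_right_mono order_trans sum_nonneg)
next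
 case False
 define g where "g = k - m"
 have g: "512 \<le> g" using False by (simp add: g_def)
 \<comment> \<open>The largest power of 16 below half the gap. It is at least \<open>g/32\<close>,
   so the gain \<open>64^N\<close> is at least \<open>(g/32) powr (3/2)\<close>.\<close>
 obtain N where N: "16^N \<le> g div 2" "g div 2 < 16^(N+1)"
 proof -
  have "1 \<le> g div 2" using g by simp
  then show ?thesis using ex_power_ivl1[of 16 "g div 2"] that by auto
 qed
 have "2 \<le> N"
 proof (rule ccontr)
  assume "\<not> 2 \<le> N"
  then have "16^(N+1) \<le> (16::nat)^2" by (intro power_increasing) auto
  then show False using N(2) g by simp
 qed
 have le: "m + 2*16^N \<le> k" using N(1) g by (simp add: g_def)
 let ?S = "\<Sum>U\<in>{U\<in>blk_space n. walk n U False k = x \<and> walk n U True k = y}. f U"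
 have h: "64^N * ?S \<le> (\<Sum>U\<in>blk_space n. f U)"
  by (rule hit_count_block[OF \<open>2 \<le> N\<close> le k f f0])
 have "real g / 32 \<le> 16^N"
 proof -
  have "g < 2 * 16^(N+1)" using N(2) by simp
  then have "real g < real (2 * 16^(N+1))" by (simp only: of_nat_less_iff)
  then show ?thesis by simp
 qed
 then have "(real g / 32) powr (3/2) \<le> (16^N) powr (3/2)"
  by (intro powr_mono2) auto
 also have "(16^N::real) powr (3/2) = 64^N"
 proof -
  have "(16::real) powr (3/2) = 64"
  proof -
   have "(16::real) powr (3/2) = (4 powr 2) powr (3/2)" by simp
   also have "... = 4 powr 3" by (simp only: powr_powr) simp
   finally show ?thesis by simp
  qed
  moreover have "(16^N::real) powr (3/2) = (16 powr (3/2)) ^ N"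
   by (simp only: powr_realpow[symmetric] powr_powr mult.commute zero_less_numeral powr_gt_zero)
  ultimately show ?thesis by simp
 qed
 finally have b: "(real g / 32) powr (3/2) \<le> 64^N" .
 have "gap_weight g * (real g / 32) powr (3/2) = (512 / 32) powr (3/2)"
  unfolding gap_weight_def using g by (simp add: powr_mult[symmetric])
 also have "... \<ge> 1" by (intro ge_one_powr_ge_zero) auto
 finally have "1 \<le> gap_weight g * 64^N"
  using b gap_weight_nonneg[of g] by (meson mult_left_mono order_trans)
 moreover have S0: "0 \<le> ?S" using f0 by (auto intro!: sum_nonneg)
 ultimately have "1 * ?S \<le> (gap_weight g * 64^N) * ?S"
  by (intro mult_right_mono)
 also have "... \<le> gap_weight g * (\<Sum>U\<in>blk_space n. f U)"
  using h gap_weight_nonneg[of g] by (simp add: mult.assoc mult_left_mono)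
 finally show ?thesis by (simp add: g_def)
qed

text \<open>The l1 bound for a one-sided convolution; it closes the renewal inequality in the next
  lemma.\<close>

lemma sum_convolution_le:
 fixes e p :: "nat => real"
 assumes "\<And>k. 0 \<le> e k" "\<And>k. 0 \<le> p k" "summable p"
 shows "(\<Sum>k=1..n. \<Sum>m=1..<k. p (k - m) * e m) \<le> suminf p * (\<Sum>m=1..n. e m)"
proof -
 have "(\<Sum>k=1..n. \<Sum>m=1..<k. p (k - m) * e m) = (\<Sum>m=1..n. \<Sum>k\<in>{m<..n}. p (k - m) * e m)"
  by (subst sum.Sigma, simp, simp, subst sum.Sigma, simp, simp)
    (rule sum.reindex_bij_witness[of _ "\<lambda>(m,k). (k,m)" "\<lambda>(k,m). (m,k)"], auto)
 also have "... = (\<Sum>m=1..n. (\<Sum>k\<in>{m<..n}. p (k - m)) * e m)"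
  by (simp add: sum_distrib_right)
 also have "... \<le> (\<Sum>m=1..n. suminf p * e m)"
 proof (intro sum_mono mult_right_mono)
  fix m
  have "(\<Sum>k\<in>{m<..n}. p (k - m)) = (\<Sum>i\<in>(\<lambda>k. k - m) ` {m<..n}. p i)"
   by (subst sum.reindex) (auto intro!: inj_onI)
  also have "... \<le> suminf p" using assms by (intro sum_le_suminf) auto
  finally show "(\<Sum>k\<in>{m<..n}. p (k - m)) \<le> suminf p" .
 qed (use assms in auto)
 finally show ?thesis by (simp add: sum_distrib_left)
qed

text \<open>A renewal argument against the fixed trajectory \<open>(x, y)\<close>. Telescoping the
  power over the hits gives \<open>Dsum\<close>; \<open>e k\<close> collects the hits at time
  \<open>k\<close>, weighted by the hits before. An earlier hit at \<open>m\<close> is an event of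
  the past, so a further hit at \<open>k\<close> costs \<open>gap_weight (k - m)\<close>, and the
  smallness of \<open>eta\<close> allows the convolution term to be absorbed.\<close>

lemma walk_hits_exp_moment:
 assumes eta: "0 < eta" "eta * suminf gap_weight \<le> 1/2"
 shows "(\<Sum>U\<in>blk_space n. (1+eta) ^ card {t\<in>{1..n}. walk n U False t = x t \<and> walk n U True t = y t})
  \<le> 2 * real (card (blk_space n))"
proof -
 define h where "h U t \<longleftrightarrow> walk n U False t = x t \<and> walk n U True t = y t" for U t
 define D where "D k U = (1+eta) ^ card {t\<in>{1..k}. h U t}" for k U
 define e where "e k = (\<Sum>U\<in>{U\<in>blk_space n. h U k}. D (k - 1) U)" for k
 let ?O = "blk_space n"
 let ?P = "suminf gap_weight"
 have Dpos: "0 \<le> D k U" for k U using eta by (simp add: D_def)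
 have e0: "0 \<le> e k" for k by (simp add: e_def sum_nonneg Dpos)
 have past: "past_fun n m (D m)" for m
  unfolding past_fun_def D_def h_def by (auto intro!: arg_cong[where f=card] arg_cong2[where f=power])
 have Dstep: "D (Suc k) U = D k U + (if h U (Suc k) then eta * D k U else 0)" for k U
 proof -
  have "{t\<in>{1..Suc k}. h U t} = (if h U (Suc k) then insert (Suc k) {t\<in>{1..k}. h U t} else {t\<in>{1..k}. h U t})"
   by (auto simp: le_Suc_eq)
  then show ?thesis by (simp add: D_def algebra_simps)
 qed
 have Dsum: "D k U = 1 + eta * (\<Sum>m=1..k. if h U m then D (m-1) U else 0)" for k U
 proof (induction k)
  case 0 then show ?case by (simp add: D_def)
 next
  case (Suc k) then show ?case by (auto simp: Dstep algebra_simps)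
 qed
 have ek: "e k \<le> gap_weight k * card ?O + eta * (\<Sum>m=1..<k. gap_weight (k-m) * e m)"
  if k: "k \<in> {1..n}" for k
 proof -
  let ?H = "{U\<in>?O. h U k}"
  have *: "{1..k-1} = {1..<k}" using k by auto
  have "e k = (\<Sum>U\<in>?H. 1) + eta * (\<Sum>m=1..<k. \<Sum>U\<in>?H. if h U m then D (m-1) U else 0)"
   unfolding e_def Dsum[of "k-1"] * by (simp add: sum.distrib sum_distrib_left sum.swap[of _ _ ?H])
  moreover have "(\<Sum>U\<in>?H. 1) \<le> gap_weight (k - 0) * (\<Sum>U\<in>?O. 1)"
   using k unfolding h_def by (intro hit_count) (auto simp: past_fun_def)
  moreover have "(\<Sum>U\<in>?H. if h U m then D (m-1) U else 0) \<le> gap_weight (k-m) * e m" if m: "m \<in> {1..<k}" for m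
  proof -
   have "past_fun n m (\<lambda>U. if h U m then D (m-1) U else 0)"
   proof (unfold past_fun_def, intro allI impI)
    fix U U' assume w: "\<forall>b. \<forall>t\<le>m. walk n U b t = walk n U' b t"
    then have "D (m-1) U = D (m-1) U'"
     using past[of "m-1"] unfolding past_fun_def by (meson diff_le_self le_trans)
    moreover have "h U m = h U' m" using w by (simp add: h_def)
    ultimately show "(if h U m then D (m-1) U else 0) = (if h U' m then D (m-1) U' else 0)" by simp
   qed
   then have "(\<Sum>U\<in>?H. if h U m then D (m-1) U else 0)
     \<le> gap_weight (k - m) * (\<Sum>U\<in>?O. if h U m then D (m-1) U else 0)"
    using m k Dpos unfolding h_def[of _ k] by (intro hit_count) auto
   also have "(\<Sum>U\<in>?O. if h U m then D (m-1) U else 0) = e m"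
    unfolding e_def by (rule sum.inter_filter[symmetric, OF finite_blk_space])
   finally show ?thesis .
  qed
  moreover have "eta * (\<Sum>m=1..<k. \<Sum>U\<in>?H. if h U m then D (m-1) U else 0)
    \<le> eta * (\<Sum>m=1..<k. gap_weight (k-m) * e m)"
   using eta calculation(3) by (intro mult_left_mono sum_mono) auto
  ultimately show ?thesis by simp
 qed
 let ?E = "\<Sum>k=1..n. e k"
 have "?E \<le> (\<Sum>k=1..n. gap_weight k * card ?O + eta * (\<Sum>m=1..<k. gap_weight (k-m) * e m))"
  using ek by (intro sum_mono)
 also have "... = (\<Sum>k=1..n. gap_weight k) * card ?O + eta * (\<Sum>k=1..n. \<Sum>m=1..<k. gap_weight (k-m) * e m)"
  by (simp add: sum.distrib sum_distrib_right sum_distrib_left)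
 also have "... \<le> ?P * card ?O + eta * (?P * ?E)"
  using eta by (intro add_mono mult_right_mono mult_left_mono sum_convolution_le e0
   gap_weight_nonneg summable_gap_weight sum_le_suminf) auto
 finally have "?E \<le> ?P * card ?O + (eta * ?P) * ?E" by simp
 also have "... \<le> ?P * card ?O + 1/2 * ?E"
  using eta e0 by (intro add_left_mono mult_right_mono sum_nonneg) auto
 finally have E: "?E \<le> 2 * ?P * card ?O" by simp
 have "(\<Sum>U\<in>?O. D n U) = card ?O + eta * (\<Sum>m=1..n. \<Sum>U\<in>?O. if h U m then D (m-1) U else 0)"
  unfolding Dsum[of n] by (simp add: sum.distrib sum_distrib_left sum.swap[of _ _ ?O])
 also have "(\<Sum>m=1..n. \<Sum>U\<in>?O. if h U m then D (m-1) U else 0) = ?E"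
  unfolding e_def by (intro sum.cong refl sum.inter_filter[symmetric, OF finite_blk_space])
 also have "card ?O + eta * ?E \<le> card ?O + (2 * (eta * ?P)) * card ?O"
  using E eta mult_left_mono[OF E, of eta] by (simp add: algebra_simps)
 also have "... \<le> real (card ?O) + 1 * real (card ?O)"
  using eta by (intro add_left_mono mult_right_mono) auto
 finally show ?thesis by (simp add: D_def h_def)
qed

section \<open>From pairs of walks to directed lattice paths\<close>

definition box :: "nat => 'd site set" where
 "box n = {x. \<forall>i. \<bar>x i\<bar> \<le> int n}"

definition vec3 :: "'d => 'd => 'd => int => int => int => 'd => int" where
 "vec3 d1 d2 d3 a b c = (\<lambda>i. if i = d1 then a else if i = d2 then b else if i = d3 then c else 0)"

lemma vec3_l1:
 assumes "distinct [d1, d2, d3 :: 'd::finite]"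
 shows "(\<Sum>i\<in>UNIV. \<bar>vec3 d1 d2 d3 a b c i - vec3 d1 d2 d3 a' b' c' i\<bar>) = \<bar>a-a'\<bar> + \<bar>b-b'\<bar> + \<bar>c-c'\<bar>"
proof -
 have "(\<Sum>i\<in>UNIV. \<bar>vec3 d1 d2 d3 a b c i - vec3 d1 d2 d3 a' b' c' i\<bar>)
   = (\<Sum>i\<in>{d1,d2,d3}. \<bar>vec3 d1 d2 d3 a b c i - vec3 d1 d2 d3 a' b' c' i\<bar>)"
  by (rule sum.mono_neutral_right) (auto simp: vec3_def)
 then show ?thesis using assms by (auto simp: vec3_def)
qed

text \<open>The first coordinate is a clock that always advances; in each period of three times the
  other two coordinates get one turn each, taken only if the walk moves. The shifted divisions
  ensure that at most one coordinate changes per time.\<close>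

definition path_pos :: "'d => 'd => 'd => nat => (bool \<times> nat \<times> nat => nat) => nat => 'd => int" where
 "path_pos d1 d2 d3 n U t = vec3 d1 d2 d3 (int ((t+2) div 3))
   (int (walk n U False ((t+1) div 3))) (int (walk n U True (t div 3)))"

definition path_moves :: "'d => 'd => 'd => nat => (bool \<times> nat \<times> nat => nat) => nat set" where
 "path_moves d1 d2 d3 n U = {t. t \<le> 3*n \<and> path_pos d1 d2 d3 n U t \<noteq> path_pos d1 d2 d3 n U (t+1)}"

definition path_edges :: "'d => 'd => 'd => nat => (bool \<times> nat \<times> nat => nat) => ('d site \<times> 'd site) set" where
 "path_edges d1 d2 d3 n U = (\<lambda>t. (path_pos d1 d2 d3 n U t, path_pos d1 d2 d3 n U (t+1))) ` path_moves d1 d2 d3 n U"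

text \<open>The clock coordinate and the direction of a bond reveal the time at which a path crosses
  it, so two paths can share a bond only at equal times.\<close>

definition edge_time :: "'d => 'd => 'd site \<times> 'd site => int" where
 "edge_time d1 d2 e = (let u = fst e; v = snd e in
   if v d1 \<noteq> u d1 then 3 * u d1 else if v d2 \<noteq> u d2 then 3 * u d1 - 2 else 3 * u d1 - 1)"

lemma mod3_cases:
 obtains k where "t = 3*k" | k where "t = 3*k+1" | k where "t = 3*k+(2::nat)"
proof -
 have "t = 3*(t div 3) + t mod 3" "t mod 3 < 3" by simp_all
 then show ?thesis using that by (metis One_nat_def add_0_right less_2_cases less_Suc_eq numeral_2_eq_2 numeral_3_eq_3)
qed

lemma edge_time_eq:
 assumes d: "distinct [d1, d2, d3 :: 'd::finite]" and U: "U \<in> blk_space n" and t: "t \<in> path_moves d1 d2 d3 n U"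
 shows "edge_time d1 d2 (path_pos d1 d2 d3 n U t, path_pos d1 d2 d3 n U (t+1)) = int t"
  and "adj (path_pos d1 d2 d3 n U t) (path_pos d1 d2 d3 n U (t+1))"
proof -
 have le: "t \<le> 3*n" using t by (simp add: path_moves_def)
 have ne: "path_pos d1 d2 d3 n U t \<noteq> path_pos d1 d2 d3 n U (t+1)" using t by (simp add: path_moves_def)
 have "edge_time d1 d2 (path_pos d1 d2 d3 n U t, path_pos d1 d2 d3 n U (t+1)) = int t \<and>
   adj (path_pos d1 d2 d3 n U t) (path_pos d1 d2 d3 n U (t+1))"
 proof (cases rule: mod3_cases[of t])
  case (1 k)
  have t3: "(t+2) div 3 = k" "(t+1) div 3 = k" "t div 3 = k" "(t+1+2) div 3 = k+1" "(t+1+1) div 3 = k"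
   using 1 by presburger+
  have p: "path_pos d1 d2 d3 n U t = vec3 d1 d2 d3 (int k) (int (walk n U False k)) (int (walk n U True k))"
   "path_pos d1 d2 d3 n U (t+1) = vec3 d1 d2 d3 (int (k+1)) (int (walk n U False k)) (int (walk n U True k))"
   by (simp_all only: path_pos_def t3)
  then show ?thesis using d unfolding p adj_def vec3_l1[OF d]
   by (auto simp: edge_time_def vec3_def 1)
 next
  case (2 k)
  have t3: "(t+2) div 3 = k+1" "(t+1) div 3 = k" "t div 3 = k" "(t+1+2) div 3 = k+1" "(t+1+1) div 3 = k+1"
   using 2 by presburger+
  have p: "path_pos d1 d2 d3 n U t = vec3 d1 d2 d3 (int (k+1)) (int (walk n U False k)) (int (walk n U True k))"
   "path_pos d1 d2 d3 n U (t+1) = vec3 d1 d2 d3 (int (k+1)) (int (walk n U False (k+1))) (int (walk n U True k))"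
   by (simp_all only: path_pos_def t3)
  have "walk n U False (k+1) = walk n U False k \<or> walk n U False (k+1) = walk n U False k + 1"
   using walk_step[OF U, of k False] le 2 by auto
  then have w: "walk n U False (k+1) = walk n U False k + 1" using ne unfolding p by auto
  show ?thesis using d unfolding p w adj_def vec3_l1[OF d]
   by (auto simp: edge_time_def vec3_def 2)
 next
  case (3 k)
  have t3: "(t+2) div 3 = k+1" "(t+1) div 3 = k+1" "t div 3 = k" "(t+1+2) div 3 = k+1" "(t+1+1) div 3 = k+1"
   using 3 by presburger+
  have p: "path_pos d1 d2 d3 n U t = vec3 d1 d2 d3 (int (k+1)) (int (walk n U False (k+1))) (int (walk n U True k))"
   "path_pos d1 d2 d3 n U (t+1) = vec3 d1 d2 d3 (int (k+1)) (int (walk n U False (k+1))) (int (walk n U True (k+1)))"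
   by (simp_all only: path_pos_def t3)
  have "walk n U True (k+1) = walk n U True k \<or> walk n U True (k+1) = walk n U True k + 1"
   using walk_step[OF U, of k True] le 3 by auto
  then have w: "walk n U True (k+1) = walk n U True k + 1" using ne unfolding p by auto
  show ?thesis using d unfolding p w adj_def vec3_l1[OF d]
   by (auto simp: edge_time_def vec3_def 3)
 qed
 then show "edge_time d1 d2 (path_pos d1 d2 d3 n U t, path_pos d1 d2 d3 n U (t+1)) = int t"
  and "adj (path_pos d1 d2 d3 n U t) (path_pos d1 d2 d3 n U (t+1))" by auto
qed

lemma vec3_eqD:
 assumes "distinct [d1, d2, d3]" "vec3 d1 d2 d3 a b c = vec3 d1 d2 d3 a' b' c'"
 shows "a = a'" "b = b'" "c = c'"
 using fun_cong[OF assms(2), of d1] fun_cong[OF assms(2), of d2] fun_cong[OF assms(2), of d3] assms(1)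
 by (auto simp: vec3_def)

text \<open>A common bond at time \<open>3*k-1\<close>, \<open>3*k\<close> or \<open>3*k+1\<close>
  forces both walks of the two paths to agree at time \<open>k\<close>. Hence at most three common
  bonds per meeting, and the final 3 accounts for \<open>k = 0\<close>, which the counted set leaves
  out.\<close>

lemma path_edges_shared:
 assumes d: "distinct [d1, d2, d3 :: 'd::finite]" and U: "U \<in> blk_space n" and U': "U' \<in> blk_space n"
 shows "card (path_edges d1 d2 d3 n U \<inter> path_edges d1 d2 d3 n U') \<le>
  3 * card {t\<in>{1..n}. walk n U False t = walk n U' False t \<and> walk n U True t = walk n U' True t} + 3"
proof -
 let ?p = "path_pos d1 d2 d3 n"
 define h where "h t \<longleftrightarrow> walk n U False t = walk n U' False t \<and> walk n U True t = walk n U' True t" for t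
 let ?K = "insert 0 {t\<in>{1..n}. h t}"
 let ?S = "(\<lambda>(k, r). 3 * int k + int r - 1) ` (?K \<times> {..<3::nat})"
 let ?E = "path_edges d1 d2 d3 n U \<inter> path_edges d1 d2 d3 n U'"
 have E: "\<exists>t. e = (?p U t, ?p U (t+1)) \<and> edge_time d1 d2 e = int t \<and> int t \<in> ?S" if e: "e \<in> ?E" for e
 proof -
  obtain t t' where t: "t \<in> path_moves d1 d2 d3 n U" "e = (?p U t, ?p U (t+1))"
   and t': "t' \<in> path_moves d1 d2 d3 n U'" "e = (?p U' t', ?p U' (t'+1))"
   using e unfolding path_edges_def by (elim IntE imageE) simp
  have et: "edge_time d1 d2 e = int t" using edge_time_eq(1)[OF d U t(1)] t(2) by simp
  moreover have "edge_time d1 d2 e = int t'" using edge_time_eq(1)[OF d U' t'(1)] t'(2) by simp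
  ultimately have [simp]: "t' = t" by simp
  have eq: "?p U t = ?p U' t" "?p U (t+1) = ?p U' (t+1)" using t(2) t'(2) by auto
  have le: "t \<le> 3*n" using t(1) by (simp add: path_moves_def)
  note v = vec3_eqD[OF d eq(1)[unfolded path_pos_def]] vec3_eqD[OF d eq(2)[unfolded path_pos_def]]
  have "\<exists>k r. int t = 3 * int k + int r - 1 \<and> r < 3 \<and> h k \<and> k \<le> n"
  proof (cases rule: mod3_cases[of t])
   case (1 k)
   have "(t+1) div 3 = k" "t div 3 = k" using 1 by presburger+
   then have "h k" using v(2,3) by (simp add: h_def)
   then show ?thesis using le 1 by (intro exI[of _ k] exI[of _ 1]) auto
  next
   case (2 k)
   have "(t+1) div 3 = k" "t div 3 = k" using 2 by presburger+
   then have "h k" using v(2,3) by (simp add: h_def)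
   then show ?thesis using le 2 by (intro exI[of _ k] exI[of _ 2]) auto
  next
   case (3 k)
   have "(t+1+1) div 3 = k+1" "(t+1) div 3 = k+1" using 3 by presburger+
   then have "h (k+1)" using v(5,6) by (simp add: h_def)
   then show ?thesis using le 3 by (intro exI[of _ "k+1"] exI[of _ 0]) auto
  qed
  then have "int t \<in> ?S" by (force simp: image_iff Bex_def)
  then show ?thesis using et t(2) by blast
 qed
 have "inj_on (edge_time d1 d2) ?E"
 proof (rule inj_onI)
  fix e e' assume "e \<in> ?E" "e' \<in> ?E" "edge_time d1 d2 e = edge_time d1 d2 e'"
  moreover from this obtain t t' where "e = (?p U t, ?p U (t+1))" "edge_time d1 d2 e = int t"
   "e' = (?p U t', ?p U (t'+1))" "edge_time d1 d2 e' = int t'" using E by meson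
  ultimately show "e = e'" by simp
 qed
 then have "card ?E = card (edge_time d1 d2 ` ?E)" by (simp add: card_image)
 also have "... \<le> card ?S"
 proof (rule card_mono)
  show "edge_time d1 d2 ` ?E \<subseteq> ?S"
  proof (rule image_subsetI)
   fix e assume "e \<in> ?E"
   from E[OF this] obtain t where "edge_time d1 d2 e = int t" "int t \<in> ?S" by blast
   then show "edge_time d1 d2 e \<in> ?S" by (simp only:)
  qed
 qed simp
 also have "... \<le> card (?K \<times> {..<3::nat})" by (rule card_image_le) simp
 also have "... = 3 * card ?K" by (simp add: card_cartesian_product)
 also have "... \<le> 3 * card {t\<in>{1..n}. h t} + 3" by (simp add: card_insert_if)
 finally show ?thesis by (simp add: h_def)
qed

lemma path_edges_telescope:
 assumes d: "distinct [d1, d2, d3 :: 'd::finite]" and U: "U \<in> blk_space n"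
  and th: "\<And>x. x \<notin> box n ==> th x = (0::real)"
 shows "(\<Sum>(i,j)\<in>path_edges d1 d2 d3 n U. th i - th j) = th (\<lambda>_. 0)"
proof -
 let ?p = "path_pos d1 d2 d3 n U"
 let ?M = "path_moves d1 d2 d3 n U"
 have "inj_on (\<lambda>t. (?p t, ?p (t+1))) ?M"
  using edge_time_eq(1)[OF d U] by (intro inj_onI) (metis of_nat_eq_iff)
 then have "(\<Sum>(i,j)\<in>path_edges d1 d2 d3 n U. th i - th j) = (\<Sum>t\<in>?M. th (?p t) - th (?p (t+1)))"
  by (simp add: path_edges_def sum.reindex)
 also have "... = (\<Sum>t<3*n+1. th (?p t) - th (?p (Suc t)))"
  by (rule sum.mono_neutral_cong_left) (auto simp: path_moves_def)
 also have "... = th (?p 0) - th (?p (3*n+1))" by (rule sum_lessThan_telescope')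
 also have "?p 0 = (\<lambda>_. 0)" by (auto simp: path_pos_def vec3_def walk_0)
 \<comment> \<open>At time \<open>3*n+1\<close> the clock coordinate equals
   \<open>n+1\<close>.\<close>
 also have "?p (3*n+1) \<notin> box n"
  by (auto simp: box_def path_pos_def vec3_def intro!: exI[of _ d1])
 then have "th (?p (3*n+1)) = 0" by (rule th)
 finally show ?thesis by simp
qed

lemma path_edges_subset:
 assumes d: "distinct [d1, d2, d3 :: 'd::finite]" and U: "U \<in> blk_space n"
 shows "path_edges d1 d2 d3 n U \<subseteq> {(i,j). adj i j \<and> (i \<in> box n \<or> j \<in> box n)}"
proof clarify
 fix i j assume "(i, j) \<in> path_edges d1 d2 d3 n U"
 then obtain t where t: "t \<in> path_moves d1 d2 d3 n U" "i = path_pos d1 d2 d3 n U t" "j = path_pos d1 d2 d3 n U (t+1)"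
  by (auto simp: path_edges_def)
 have "(t+1) div 3 \<le> n" "t div 3 \<le> n" "(t+2) div 3 \<le> n" using t(1) by (auto simp: path_moves_def)
 moreover from this have "walk n U False ((t+1) div 3) \<le> n" "walk n U True (t div 3) \<le> n"
  using walk_le[OF U] by (meson le_SucI le_trans)+
 ultimately have "i \<in> box n" unfolding t(2) by (simp add: box_def path_pos_def vec3_def)
 then show "adj i j \<and> (i \<in> box n \<or> j \<in> box n)" using edge_time_eq(2)[OF d U t(1)] t by simp
qed

lemma card3_distinct:
 assumes "CARD('d::finite) \<ge> 3"
 shows "\<exists>d1 d2 d3 :: 'd. distinct [d1, d2, d3]"
proof -
 obtain A :: "'d set" where A: "card A = 3" using obtain_subset_with_card_n[OF assms] by metis
 then show ?thesis by (auto simp: card_3_iff)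
qed

theorem directed_paths:
 assumes "CARD('d::finite) \<ge> 3"
 shows "\<exists>eta>0. \<forall>n. \<exists>(Om :: (bool \<times> nat \<times> nat => nat) set) (\<gamma> :: _ => ('d site \<times> 'd site) set).
  finite Om \<and> Om \<noteq> {} \<and>
  (\<forall>U\<in>Om. \<gamma> U \<subseteq> {(i,j). adj i j \<and> (i \<in> box n \<or> j \<in> box n)} \<and>
    (\<forall>th. (\<forall>x. x \<notin> box n --> th x = (0::real)) --> (\<Sum>(i,j)\<in>\<gamma> U. th i - th j) = th (\<lambda>_. 0))) \<and>
  (\<Sum>U\<in>Om. \<Sum>U'\<in>Om. (1+eta) ^ card (\<gamma> U \<inter> \<gamma> U')) \<le> 4 * (real (card Om))\<^sup>2"
proof -
 obtain d1 d2 d3 :: 'd where d: "distinct [d1, d2, d3]" using card3_distinct[OF assms] by blast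
 let ?P = "suminf gap_weight"
 have P: "0 \<le> ?P" by (intro suminf_nonneg summable_gap_weight gap_weight_nonneg)
 define eta where "eta = 1 / (2 * (?P + 1))"
 have eta: "0 < eta" "eta \<le> 1" "eta * ?P \<le> 1/2" using P by (auto simp: eta_def field_simps)
 \<comment> \<open>Three bonds per meeting produce \<open>(1+e)^3\<close>, which is at most
   \<open>1 + 7*e\<close> for \<open>e \<le> 1\<close>.\<close>
 define e where "e = eta / 7"
 have e: "0 < e" using eta by (simp add: e_def)
 have e3: "(1+e)^3 \<le> 1 + eta"
 proof -
  have "e \<le> 1" using eta by (simp add: e_def)
  then have "e^2 \<le> e" "e^3 \<le> e" using e power_decreasing[of 1 2 e] power_decreasing[of 1 3 e] by auto
  moreover have "(1+e)^3 = 1 + 3*e + 3*e^2 + e^3" by (simp add: power3_eq_cube power2_eq_square algebra_simps)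
  ultimately show ?thesis by (simp add: e_def)
 qed
 show ?thesis
 proof (intro exI[of _ e] conjI e allI)
  fix n
  let ?O = "blk_space n" and ?g = "path_edges d1 d2 d3 n"
  have "(\<Sum>U\<in>?O. (1+e) ^ card (?g U \<inter> ?g U')) \<le> 4 * real (card ?O)" if U': "U' \<in> ?O" for U'
  proof -
   have "(1+e) ^ card (?g U \<inter> ?g U') \<le> 2 * (1+eta) ^ card {t\<in>{1..n}. walk n U False t = walk n U' False t \<and> walk n U True t = walk n U' True t}"
    if U: "U \<in> ?O" for U
   proof -
    let ?h = "card {t\<in>{1..n}. walk n U False t = walk n U' False t \<and> walk n U True t = walk n U' True t}"
    have "(1+e) ^ card (?g U \<inter> ?g U') \<le> (1+e)^(3 * ?h + 3)"
     using e path_edges_shared[OF d U U'] by (intro power_increasing) auto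
    also have "3 * ?h + 3 = 3 * Suc ?h" by simp
    also have "(1+e)^(3 * Suc ?h) = ((1+e)^3)^(Suc ?h)" by (rule power_mult)
    also have "... \<le> (1+eta)^(Suc ?h)" using e e3 by (intro power_mono) auto
    \<comment> \<open>The meeting at time 0 costs one more factor \<open>1+eta \<le> 2\<close>; with
      the factor 2 of the moment bound this gives the 4 of the statement.\<close>
    also have "... \<le> 2 * (1+eta)^?h" using eta by (simp add: mult_right_mono)
    finally show ?thesis .
   qed
   then have "(\<Sum>U\<in>?O. (1+e) ^ card (?g U \<inter> ?g U')) \<le>
     2 * (\<Sum>U\<in>?O. (1+eta) ^ card {t\<in>{1..n}. walk n U False t = walk n U' False t \<and> walk n U True t = walk n U' True t})"
    unfolding sum_distrib_left by (intro sum_mono)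
   also have "... \<le> 2 * (2 * real (card ?O))"
    using walk_hits_exp_moment[OF eta(1,3), of n "walk n U' False" "walk n U' True"] by (intro mult_left_mono) auto
   finally show ?thesis by simp
  qed
  then have "(\<Sum>U'\<in>?O. \<Sum>U\<in>?O. (1+e) ^ card (?g U \<inter> ?g U')) \<le> (\<Sum>U'\<in>?O. 4 * real (card ?O))"
   by (intro sum_mono)
  also have "... = 4 * (real (card ?O))\<^sup>2" by (simp add: power2_eq_square)
  finally have fin: "(\<Sum>U\<in>?O. \<Sum>U'\<in>?O. (1+e) ^ card (?g U \<inter> ?g U')) \<le> 4 * (real (card ?O))\<^sup>2"
   by (subst sum.swap)
  show "\<exists>(Om :: (bool \<times> nat \<times> nat => nat) set) (\<gamma> :: _ => ('d site \<times> 'd site) set).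
   finite Om \<and> Om \<noteq> {} \<and>
   (\<forall>U\<in>Om. \<gamma> U \<subseteq> {(i,j). adj i j \<and> (i \<in> box n \<or> j \<in> box n)} \<and>
    (\<forall>th. (\<forall>x. x \<notin> box n --> th x = (0::real)) --> (\<Sum>(i,j)\<in>\<gamma> U. th i - th j) = th (\<lambda>_. 0))) \<and>
   (\<Sum>U\<in>Om. \<Sum>U'\<in>Om. (1+e) ^ card (\<gamma> U \<inter> \<gamma> U')) \<le> 4 * (real (card Om))\<^sup>2"
   using finite_blk_space blk_space_nonempty path_edges_subset[OF d] path_edges_telescope[OF d] fin
   by (intro exI[of _ ?O] exI[of _ ?g]) blast
 qed
qed

section \<open>Moebius coefficients of logarithms of partition functions\<close>

definition mob :: "('v set => real) => 'v set => real" where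
 "mob g A = (-1)^card A * (\<Sum>T\<in>Pow A. (-1)^card T * g T)"

lemma mob_inversion:
 assumes "finite B"
 shows "g B = (\<Sum>A\<in>Pow B. mob g A)"
proof -
 have "g B = (\<Sum>T\<in>Pow B. (-1)^card T * (\<Sum>S\<in>Pow T. (-1)^card S * g S))"
  by (rule inclusion_exclusion_symmetric[OF refl assms])
 then show ?thesis by (simp add: mob_def)
qed

lemma mob_cong: "(\<And>B. B \<subseteq> A ==> g B = h B) ==> mob g A = mob h A"
 unfolding mob_def by (intro arg_cong2[where f=times] sum.cong refl) auto

lemma mob_sum_Pow:
 assumes "finite A"
 shows "mob (\<lambda>B. \<Sum>T\<in>Pow B. c T) A = c A"
proof -
 define f where "f T = (-1)^card T * c T" for T :: "'a set"
 have "(\<Sum>T\<in>Pow S. c T) = (\<Sum>T\<in>Pow S. (-1)^card T * f T)" for S :: "'a set"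
  by (intro sum.cong) (auto simp: f_def mult.assoc[symmetric] power_add[symmetric] simp flip: mult_2)
 from inclusion_exclusion_symmetric[where g="\<lambda>S. \<Sum>T\<in>Pow S. c T" and f=f, OF this assms]
 have "(-1)^card A * f A = mob (\<lambda>B. \<Sum>T\<in>Pow B. c T) A" by (simp add: mob_def)
 then show ?thesis by (auto simp: f_def mult.assoc[symmetric] power_add[symmetric] simp flip: mult_2)
qed

text \<open>The way coefficients are computed in what follows: any representation as a sum over
  subsets, valid inside \<open>V\<close>, must be the Moebius one.\<close>

lemma mob_unique:
 assumes "finite V" "A \<subseteq> V" "\<And>B. B \<subseteq> V ==> g B = (\<Sum>T\<in>Pow B. c T)"
 shows "mob g A = c A"
proof -
 have "mob g A = mob (\<lambda>B. \<Sum>T\<in>Pow B. c T) A" using assms by (intro mob_cong) auto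
 then show ?thesis using mob_sum_Pow assms finite_subset by metis
qed

lemma mob_add: "mob (\<lambda>B. g B + h B) A = mob g A + mob h A"
 by (simp add: mob_def sum.distrib distrib_left)

text \<open>Both factors are sums over subsets of \<open>B\<close>, and a pair of subsets
  contributes to its union. This convolution over unions is what makes the l1 norm of the
  coefficients submultiplicative.\<close>

lemma mob_mult:
 assumes "finite V" "C \<subseteq> V"
 shows "mob (\<lambda>B. g B * h B) C = (\<Sum>(A,A')\<in>{(A,A')\<in>Pow V \<times> Pow V. A \<union> A' = C}. mob g A * mob h A')"
proof (rule mob_unique[OF assms])
 fix B assume B: "B \<subseteq> V"
 then have fB: "finite B" using assms finite_subset by auto
 have "g B * h B = (\<Sum>(A,A')\<in>Pow B \<times> Pow B. mob g A * mob h A')"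
  by (simp only: mob_inversion[OF fB] sum_product sum.cartesian_product)
 also have "... = (\<Sum>C\<in>Pow B. \<Sum>(A,A')\<in>{z\<in>Pow B \<times> Pow B. fst z \<union> snd z = C}. mob g A * mob h A')"
  using fB by (intro sum.group[symmetric]) auto
 also have "... = (\<Sum>C\<in>Pow B. \<Sum>(A,A')\<in>{(A,A')\<in>Pow V \<times> Pow V. A \<union> A' = C}. mob g A * mob h A')"
  using B by (intro sum.cong refl arg_cong[where f="sum _"]) auto
 finally show "g B * h B = (\<Sum>C\<in>Pow B. \<Sum>(A,A')\<in>{(A,A')\<in>Pow V \<times> Pow V. A \<union> A' = C}. mob g A * mob h A')" .
qed

text \<open>The smallest possible \<open>c\<close> is the norm, uniform over the family \<open>G\<close>, of a Banach algebra of set functions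
 (the sum of the absolute values of the Moebius coefficients).\<close>
definition mob_bd :: "'v set => ('v set => real) set => real => bool" where
 "mob_bd V G c \<longleftrightarrow> (\<exists>b. (\<forall>A\<subseteq>V. 0 \<le> b A) \<and> (\<Sum>A\<in>Pow V. b A) \<le> c \<and> (\<forall>g\<in>G. \<forall>A\<subseteq>V. \<bar>mob g A\<bar> \<le> b A))"

text \<open>Agreement is asked for subsets of \<open>V\<close> only, because the recursions for
  partition functions hold only there.\<close>

lemma mob_bd_mono:
 assumes "mob_bd V G c" "c \<le> d" "\<And>h. h \<in> H ==> \<exists>g\<in>G. \<forall>B\<subseteq>V. h B = g B"
 shows "mob_bd V H d"
proof -
 obtain b where b: "\<forall>A\<subseteq>V. 0 \<le> b A" "(\<Sum>A\<in>Pow V. b A) \<le> c" "\<forall>g\<in>G. \<forall>A\<subseteq>V. \<bar>mob g A\<bar> \<le> b A"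
  using assms(1) unfolding mob_bd_def by blast
 have "\<bar>mob h A\<bar> \<le> b A" if h: "h \<in> H" and A: "A \<subseteq> V" for h A
 proof -
  obtain g where g: "g \<in> G" "\<forall>B\<subseteq>V. h B = g B" using assms(3)[OF h] by blast
  then have "mob h A = mob g A" using A by (intro mob_cong) auto
  then show ?thesis using b(3) g A by auto
 qed
 then show ?thesis unfolding mob_bd_def using b assms(2) by (intro exI[of _ b]) auto
qed

lemma mob_bd_mult:
 assumes V: "finite V" and "mob_bd V G c" "mob_bd V H d"
 shows "mob_bd V {\<lambda>B. g B * h B | g h. g \<in> G \<and> h \<in> H} (c * d)"
proof -
 obtain b where b: "\<forall>A\<subseteq>V. 0 \<le> b A" "(\<Sum>A\<in>Pow V. b A) \<le> c" "\<forall>g\<in>G. \<forall>A\<subseteq>V. \<bar>mob g A\<bar> \<le> b A"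
  using assms(2) unfolding mob_bd_def by blast
 obtain b' where b': "\<forall>A\<subseteq>V. 0 \<le> b' A" "(\<Sum>A\<in>Pow V. b' A) \<le> d" "\<forall>g\<in>H. \<forall>A\<subseteq>V. \<bar>mob g A\<bar> \<le> b' A"
  using assms(3) unfolding mob_bd_def by blast
 define B where "B C = (\<Sum>(A,A')\<in>{(A,A')\<in>Pow V \<times> Pow V. A \<union> A' = C}. b A * b' A')" for C
 have fP: "finite (Pow V \<times> Pow V)" using V by simp
 have "(\<Sum>C\<in>Pow V. B C) = (\<Sum>C\<in>Pow V. \<Sum>(A,A')\<in>{z\<in>Pow V \<times> Pow V. fst z \<union> snd z = C}. b A * b' A')"
  unfolding B_def by (intro sum.cong refl arg_cong[where f="sum _"]) auto
 also have "... = (\<Sum>(A,A')\<in>Pow V \<times> Pow V. b A * b' A')"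
  using V by (intro sum.group) auto
 also have "... = (\<Sum>A\<in>Pow V. b A) * (\<Sum>A\<in>Pow V. b' A)"
  by (simp only: sum_product sum.cartesian_product)
 also have "... \<le> c * d"
 proof -
  have "0 \<le> (\<Sum>A\<in>Pow V. b A)" "0 \<le> (\<Sum>A\<in>Pow V. b' A)" using b(1) b'(1) by (auto intro!: sum_nonneg)
  then show ?thesis using b(2) b'(2) by (intro mult_mono) linarith+
 qed
 finally have "(\<Sum>C\<in>Pow V. B C) \<le> c * d" .
 moreover have "\<forall>A\<subseteq>V. 0 \<le> B A" unfolding B_def using b(1) b'(1) by (auto intro!: sum_nonneg)
 moreover have "\<bar>mob (\<lambda>B. g B * h B) C\<bar> \<le> B C" if "g \<in> G" "h \<in> H" "C \<subseteq> V" for g h C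
  unfolding mob_mult[OF V that(3)] B_def
 proof (rule order_trans[OF sum_abs], rule sum_mono, clarsimp simp: abs_mult)
  fix A A' assume "A \<subseteq> V" "A' \<subseteq> V"
  then show "\<bar>mob g A\<bar> * \<bar>mob h A'\<bar> \<le> b A * b' A'"
   using b b' that by (intro mult_mono) auto
 qed
 ultimately show ?thesis unfolding mob_bd_def by (intro exI[of _ B]) auto
qed

lemma mob_bd_add:
 assumes "mob_bd V G c" "mob_bd V H d"
 shows "mob_bd V {\<lambda>B. g B + h B | g h. g \<in> G \<and> h \<in> H} (c + d)"
proof -
 obtain b where b: "\<forall>A\<subseteq>V. 0 \<le> b A" "(\<Sum>A\<in>Pow V. b A) \<le> c" "\<forall>g\<in>G. \<forall>A\<subseteq>V. \<bar>mob g A\<bar> \<le> b A"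
  using assms(1) unfolding mob_bd_def by blast
 obtain b' where b': "\<forall>A\<subseteq>V. 0 \<le> b' A" "(\<Sum>A\<in>Pow V. b' A) \<le> d" "\<forall>g\<in>H. \<forall>A\<subseteq>V. \<bar>mob g A\<bar> \<le> b' A"
  using assms(2) unfolding mob_bd_def by blast
 have "\<bar>mob (\<lambda>B. g B + h B) A\<bar> \<le> b A + b' A" if "g \<in> G" "h \<in> H" "A \<subseteq> V" for g h A
 proof -
  have "\<bar>mob g A\<bar> \<le> b A" "\<bar>mob h A\<bar> \<le> b' A" using b(3) b'(3) that by auto
  then show ?thesis unfolding mob_add by linarith
 qed
 moreover have "(\<Sum>A\<in>Pow V. b A + b' A) \<le> c + d" using b(2) b'(2) by (simp add: sum.distrib)
 ultimately show ?thesis unfolding mob_bd_def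
  using b(1) b'(1) by (intro exI[of _ "\<lambda>A. b A + b' A"]) auto
qed

lemma mob_const: "finite A ==> mob (\<lambda>_. c) A = (if A = {} then c else 0)"
 using mob_sum_Pow[of A "\<lambda>A. if A = {} then c else 0"]
 by (subst mob_cong[where h="\<lambda>B. \<Sum>T\<in>Pow B. if T = {} then c else 0"])
   (auto simp: finite_subset sum.delta)

lemma mob_bd_const:
 assumes "finite V"
 shows "mob_bd V {\<lambda>_. 1} 1"
 unfolding mob_bd_def using assms
 by (intro exI[of _ "\<lambda>A. if A = {} then 1 else 0"]) (auto simp: mob_const finite_subset)

text \<open>The norm dominates the supremum norm by Moebius inversion, so a norm below 1 also gives
  pointwise convergence of geometric and logarithmic series.\<close>

lemma mob_bd_bound:
 assumes "finite V" "mob_bd V G c" "g \<in> G" "B \<subseteq> V"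
 shows "\<bar>g B\<bar> \<le> c"
proof -
 obtain b where b: "\<forall>A\<subseteq>V. 0 \<le> b A" "(\<Sum>A\<in>Pow V. b A) \<le> c" "\<forall>g\<in>G. \<forall>A\<subseteq>V. \<bar>mob g A\<bar> \<le> b A"
  using assms(2) unfolding mob_bd_def by blast
 have "\<bar>g B\<bar> = \<bar>\<Sum>A\<in>Pow B. mob g A\<bar>" using mob_inversion assms finite_subset by metis
 also have "... \<le> (\<Sum>A\<in>Pow B. \<bar>mob g A\<bar>)" by (rule sum_abs)
 also have "... \<le> (\<Sum>A\<in>Pow B. b A)" using b(3) assms(3,4) by (intro sum_mono) auto
 also have "... \<le> (\<Sum>A\<in>Pow V. b A)" using assms b(1) by (intro sum_mono2) auto
 finally show ?thesis using b(2) by simp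
qed

lemma mob_bd_nonneg: "mob_bd V G c ==> 0 \<le> c"
 unfolding mob_bd_def by (meson PowD order_trans sum_nonneg)

lemma mob_bd_power:
 assumes V: "finite V" and "mob_bd V G c"
 shows "mob_bd V {\<lambda>B. g B ^ n | g. g \<in> G} (c ^ n)"
proof (induction n)
 case 0 then show ?case by (rule mob_bd_mono[OF mob_bd_const[OF V]]) auto
next
 case (Suc n)
 show ?case by (rule mob_bd_mono[OF mob_bd_mult[OF V assms(2) Suc]]) auto
qed

text \<open>Each power has one majorant for the whole family, and the sum of these majorants serves
  the series. Coefficients bounded by 1 cover both \<open>1 / (1 + g)\<close> and
  \<open>ln (1 + g)\<close>.\<close>

lemma mob_bd_series:
 fixes a :: "nat => real"
 assumes V: "finite V" and G: "mob_bd V G c" and c: "c < 1" and a: "\<And>n. \<bar>a n\<bar> \<le> 1"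
 shows "mob_bd V {\<lambda>B. \<Sum>n. a n * g B ^ n | g. g \<in> G} (1 / (1 - c))"
proof -
 have c0: "0 \<le> c" by (rule mob_bd_nonneg[OF G])
 have "\<forall>n. \<exists>b. (\<forall>A\<subseteq>V. 0 \<le> b A) \<and> (\<Sum>A\<in>Pow V. b A) \<le> c^n \<and> (\<forall>g\<in>G. \<forall>A\<subseteq>V. \<bar>mob (\<lambda>B. g B ^ n) A\<bar> \<le> b A)"
 proof
  fix n
  obtain b where b: "\<forall>A\<subseteq>V. 0 \<le> b A" "(\<Sum>A\<in>Pow V. b A) \<le> c^n"
   "\<forall>g\<in>{\<lambda>B. g B ^ n | g. g \<in> G}. \<forall>A\<subseteq>V. \<bar>mob g A\<bar> \<le> b A"
   using mob_bd_power[OF V G, of n] unfolding mob_bd_def by blast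
  show "\<exists>b. (\<forall>A\<subseteq>V. 0 \<le> b A) \<and> (\<Sum>A\<in>Pow V. b A) \<le> c^n \<and> (\<forall>g\<in>G. \<forall>A\<subseteq>V. \<bar>mob (\<lambda>B. g B ^ n) A\<bar> \<le> b A)"
   using b by (intro exI[of _ b]) blast
 qed
 then obtain b where b: "\<And>n A. A \<subseteq> V ==> 0 \<le> b n A" "\<And>n. (\<Sum>A\<in>Pow V. b n A) \<le> c^n"
   "\<And>n g A. g \<in> G ==> A \<subseteq> V ==> \<bar>mob (\<lambda>B. g B ^ n) A\<bar> \<le> b n A"
  by metis
 have bc: "b n A \<le> c^n" if "A \<subseteq> V" for n A
 proof -
  have "b n A \<le> (\<Sum>A\<in>Pow V. b n A)" using that V b(1) by (intro member_le_sum) auto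
  then show ?thesis using b(2)[of n] by simp
 qed
 have sc: "summable (\<lambda>n. c^n)" using c c0 by (simp add: summable_geometric)
 have sb: "summable (\<lambda>n. b n A)" if "A \<subseteq> V" for A
  using bc[OF that] b(1)[OF that] by (intro summable_comparison_test'[OF sc, of 0]) auto
 have mobn: "\<bar>mob (\<lambda>B. \<Sum>n. a n * g B ^ n) A\<bar> \<le> (\<Sum>n. b n A)" if g: "g \<in> G" and A: "A \<subseteq> V" for g A
 proof -
  have sg: "summable (\<lambda>n. a n * g B ^ n)" if "B \<subseteq> V" for B
  proof (rule summable_comparison_test'[OF sc, of 0])
   fix n
   have "\<bar>g B\<bar>^n \<le> c^n" using mob_bd_bound[OF V G g that] by (intro power_mono) auto
   then show "norm (a n * g B ^ n) \<le> c^n"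
    using mult_mono[OF a[of n], of "\<bar>g B\<bar>^n" "c^n"] by (simp add: abs_mult power_abs)
  qed
  have fA: "finite A" using A V finite_subset by auto
  have "mob (\<lambda>B. \<Sum>n. a n * g B ^ n) A = (-1)^card A * (\<Sum>T\<in>Pow A. \<Sum>n. (-1)^card T * (a n * g T ^ n))"
   using A by (auto simp: mob_def suminf_mult sg intro!: sum.cong)
  also have "... = (\<Sum>n. (-1)^card A * (\<Sum>T\<in>Pow A. (-1)^card T * (a n * g T ^ n)))"
   using A by (subst suminf_sum[symmetric]) (auto intro!: suminf_mult[symmetric] summable_sum summable_mult sg)
  also have "... = (\<Sum>n. a n * mob (\<lambda>B. g B ^ n) A)"
   by (simp add: mob_def sum_distrib_left algebra_simps)
  finally have eq: "mob (\<lambda>B. \<Sum>n. a n * g B ^ n) A = (\<Sum>n. a n * mob (\<lambda>B. g B ^ n) A)" .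
  have le: "norm (a n * mob (\<lambda>B. g B ^ n) A) \<le> b n A" for n
   using mult_mono[OF a[of n] b(3)[OF g A, of n]] by (simp add: abs_mult)
  have sn: "summable (\<lambda>n. norm (a n * mob (\<lambda>B. g B ^ n) A))"
   using le by (intro summable_comparison_test'[OF sb[OF A], of 0]) auto
  have "\<bar>\<Sum>n. a n * mob (\<lambda>B. g B ^ n) A\<bar> \<le> (\<Sum>n. norm (a n * mob (\<lambda>B. g B ^ n) A))"
   using summable_norm[OF sn] by simp
  also have "... \<le> (\<Sum>n. b n A)" by (rule suminf_le[OF le sn sb[OF A]])
  finally show ?thesis unfolding eq .
 qed
 have "(\<Sum>A\<in>Pow V. \<Sum>n. b n A) = (\<Sum>n. \<Sum>A\<in>Pow V. b n A)"
  using sb by (subst suminf_sum) auto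
 also have "... \<le> (\<Sum>n. c^n)"
  using sb b(2) sc by (intro suminf_le summable_sum) auto
 also have "... = 1 / (1 - c)" using c c0 by (simp add: suminf_geometric)
 finally have "(\<Sum>A\<in>Pow V. \<Sum>n. b n A) \<le> 1 / (1 - c)" .
 then show ?thesis unfolding mob_bd_def
  using mobn b(1) sb by (intro exI[of _ "\<lambda>A. \<Sum>n. b n A"]) (auto intro!: suminf_nonneg)
qed

lemma mob_bd_inverse:
 assumes V: "finite V" and G: "mob_bd V G c" and c: "c < 1"
 shows "mob_bd V {\<lambda>B. 1 / (1 + g B) | g. g \<in> G} (1 / (1 - c))"
proof (rule mob_bd_mono[OF mob_bd_series[OF V G c, of "\<lambda>n. (-1)^n"]])
 fix h assume "h \<in> {\<lambda>B. 1 / (1 + g B) | g. g \<in> G}"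
 then obtain g where g: "g \<in> G" "h = (\<lambda>B. 1 / (1 + g B))" by blast
 have "h B = (\<Sum>n. (-1)^n * g B ^ n)" if "B \<subseteq> V" for B
 proof -
  have "\<bar>- g B\<bar> < 1" using mob_bd_bound[OF V G g(1) that] c by simp
  then have "(\<Sum>n. (- g B)^n) = 1 / (1 - (- g B))" by (intro suminf_geometric) auto
  then show ?thesis by (simp add: g(2) power_minus[of "g B"])
 qed
 then show "\<exists>g'\<in>{\<lambda>B. \<Sum>n. (-1)^n * g B ^ n | g. g \<in> G}. \<forall>B\<subseteq>V. h B = g' B"
  by (intro bexI[of _ "\<lambda>B. \<Sum>n. (-1)^n * g B ^ n"] CollectI exI[of _ g]) (simp_all add: g(1))
qed auto

lemma mob_bd_ln:
 assumes V: "finite V" and G: "mob_bd V G c" and c: "c < 1"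
 shows "mob_bd V {\<lambda>B. ln (1 + g B) | g. g \<in> G} (c * (1 / (1 - c)))"
proof -
 let ?a = "\<lambda>n. (-1)^n * (1 / real (n + 1))"
 have a: "\<bar>?a n\<bar> \<le> 1" for n by (simp add: abs_mult)
 show ?thesis
 proof (rule mob_bd_mono[OF mob_bd_mult[OF V G mob_bd_series[OF V G c a]]])
  fix h assume "h \<in> {\<lambda>B. ln (1 + g B) | g. g \<in> G}"
  then obtain g where g: "g \<in> G" "h = (\<lambda>B. ln (1 + g B))" by blast
  have "h B = g B * (\<Sum>n. ?a n * g B ^ n)" if "B \<subseteq> V" for B
  proof -
   have l: "\<bar>g B\<bar> < 1" using mob_bd_bound[OF V G g(1) that] c by simp
   have "summable (\<lambda>n. ?a n * g B ^ n)"
   proof (rule summable_comparison_test'[of "\<lambda>n. \<bar>g B\<bar>^n" 0])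
    show "summable (\<lambda>n. \<bar>g B\<bar>^n)" using l by (simp add: summable_geometric)
    show "norm (?a n * g B ^ n) \<le> \<bar>g B\<bar>^n" for n
     using mult_mono[OF a[of n], of "\<bar>g B\<bar>^n" "\<bar>g B\<bar>^n"] by (simp add: abs_mult power_abs)
   qed
   then have "g B * (\<Sum>n. ?a n * g B ^ n) = (\<Sum>n. g B * (?a n * g B ^ n))"
    by (rule suminf_mult[symmetric])
   also have "... = (\<Sum>n. ?a n * ((1 + g B) - 1)^(Suc n))"
    by (simp add: algebra_simps)
   also have "... = ln (1 + g B)" using l by (intro ln_series[symmetric]) auto
   finally show ?thesis by (simp add: g(2))
  qed
  then show "\<exists>g'\<in>{\<lambda>B. g B * h B | g h. g \<in> G \<and> h \<in> {\<lambda>B. \<Sum>n. ?a n * g B ^ n | g. g \<in> G}}. \<forall>B\<subseteq>V. h B = g' B"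
   by (intro bexI[of _ "\<lambda>B. g B * (\<Sum>n. ?a n * g B ^ n)"] CollectI exI[of _ g]
      exI[of _ "\<lambda>B. \<Sum>n. ?a n * g B ^ n"] conjI refl g(1)) simp_all
 qed auto
qed

text \<open>Transports coefficients from the volume \<open>V - {y}\<close> to \<open>V\<close>, as
  needed when an induction removes the site \<open>y\<close>.\<close>

lemma mob_shift:
 assumes "finite V" "y \<in> V" "A \<subseteq> V"
 shows "mob (\<lambda>B. if y \<in> B then g (B - {y}) else 0) A = (if y \<in> A then mob g (A - {y}) else 0)"
proof (rule mob_unique[OF assms(1,3)])
 fix B assume B: "B \<subseteq> V"
 then have fB: "finite B" using assms finite_subset by auto
 show "(if y \<in> B then g (B - {y}) else 0) = (\<Sum>T\<in>Pow B. if y \<in> T then mob g (T - {y}) else 0)"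
 proof (cases "y \<in> B")
  case True
  have "(\<Sum>T\<in>Pow B. if y \<in> T then mob g (T - {y}) else 0) = (\<Sum>T\<in>{T\<in>Pow B. y \<in> T}. mob g (T - {y}))"
   using fB by (intro sum.inter_filter[symmetric]) simp
  also have "... = (\<Sum>T\<in>Pow (B - {y}). mob g T)"
   using True by (intro sum.reindex_bij_witness[of _ "insert y" "\<lambda>T. T - {y}"]) auto
  also have "... = g (B - {y})" using mob_inversion[of "B - {y}" g] fB by simp
  finally show ?thesis using True by simp
 next
  case False
  then have "(\<Sum>T\<in>Pow B. if y \<in> T then mob g (T - {y}) else 0) = 0" by (intro sum.neutral) auto
  then show ?thesis using False by simp
 qed
qed

lemma mob_bd_shift:
 assumes V: "finite V" "y \<in> V" and G: "mob_bd (V - {y}) G c"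
 shows "mob_bd V {\<lambda>B. if y \<in> B then g (B - {y}) else 0 | g. g \<in> G} c"
proof -
 obtain b where b: "\<forall>A\<subseteq>V-{y}. 0 \<le> b A" "(\<Sum>A\<in>Pow (V-{y}). b A) \<le> c" "\<forall>g\<in>G. \<forall>A\<subseteq>V-{y}. \<bar>mob g A\<bar> \<le> b A"
  using G unfolding mob_bd_def by blast
 define b' where "b' A = (if y \<in> A then b (A - {y}) else 0)" for A
 have "(\<Sum>A\<in>Pow V. b' A) = (\<Sum>T\<in>{T\<in>Pow V. y \<in> T}. b (T - {y}))"
  unfolding b'_def using V by (intro sum.inter_filter[symmetric]) simp
 also have "... = (\<Sum>T\<in>Pow (V - {y}). b T)"
  using V by (intro sum.reindex_bij_witness[of _ "insert y" "\<lambda>T. T - {y}"]) auto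
 finally have "(\<Sum>A\<in>Pow V. b' A) \<le> c" using b(2) by simp
 moreover have "0 \<le> b' A" if "A \<subseteq> V" for A
 proof -
  have "A - {y} \<subseteq> V - {y}" using that by auto
  then show ?thesis using b(1) by (auto simp: b'_def)
 qed
 moreover have "\<bar>mob (\<lambda>B. if y \<in> B then g (B - {y}) else 0) A\<bar> \<le> b' A" if "g \<in> G" "A \<subseteq> V" for g A
 proof -
  have "A - {y} \<subseteq> V - {y}" using that by auto
  then show ?thesis using b(3) that(1) by (auto simp: b'_def mob_shift[OF V that(2)])
 qed
 ultimately show ?thesis unfolding mob_bd_def by (intro exI[of _ b']) auto
qed

text \<open>A coefficient is a finite sum and passes through the integral; the signed weight
  \<open>rh\<close> then contributes only its total variation, and one majorant serves all
  weights.\<close>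

lemma mob_bd_integral:
 assumes V: "finite V" and G: "mob_bd V G c" and r: "0 \<le> r"
  and H: "\<And>h. h \<in> H ==> \<exists>rh q. (\<forall>t\<in>space M. q t \<in> G) \<and> (\<forall>B\<subseteq>V. integrable M (\<lambda>t. rh t * q t B))
    \<and> integrable M rh \<and> (\<integral>t. \<bar>rh t\<bar> \<partial>M) \<le> r \<and> (\<forall>B\<subseteq>V. h B = (\<integral>t. rh t * q t B \<partial>M))"
 shows "mob_bd V H (r * c)"
proof -
 obtain b where b: "\<forall>A\<subseteq>V. 0 \<le> b A" "(\<Sum>A\<in>Pow V. b A) \<le> c" "\<forall>g\<in>G. \<forall>A\<subseteq>V. \<bar>mob g A\<bar> \<le> b A"
  using G unfolding mob_bd_def by blast
 have "\<bar>mob h A\<bar> \<le> r * b A" if h: "h \<in> H" and A: "A \<subseteq> V" for h A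
 proof -
  obtain rh q where *: "(\<forall>t\<in>space M. q t \<in> G) \<and> (\<forall>B\<subseteq>V. integrable M (\<lambda>t. rh t * q t B))
    \<and> integrable M rh \<and> (\<integral>t. \<bar>rh t\<bar> \<partial>M) \<le> r \<and> (\<forall>B\<subseteq>V. h B = (\<integral>t. rh t * q t B \<partial>M))"
   using H[OF h] by (elim exE)
  then have q: "\<And>t. t \<in> space M ==> q t \<in> G" and i: "\<And>B. B \<subseteq> V ==> integrable M (\<lambda>t. rh t * q t B)"
   and rh: "integrable M rh" "(\<integral>t. \<bar>rh t\<bar> \<partial>M) \<le> r" and hq: "\<And>B. B \<subseteq> V ==> h B = (\<integral>t. rh t * q t B \<partial>M)"
   by simp_all
  have "mob h A = (-1)^card A * (\<Sum>T\<in>Pow A. (-1)^card T * (\<integral>t. rh t * q t T \<partial>M))"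
   using A hq by (auto simp: mob_def intro!: sum.cong)
  also have "... = (-1)^card A * (\<integral>t. (\<Sum>T\<in>Pow A. (-1)^card T * (rh t * q t T)) \<partial>M)"
   using A i by (subst Bochner_Integration.integral_sum) auto
  also have "... = (\<integral>t. (-1)^card A * (\<Sum>T\<in>Pow A. (-1)^card T * (rh t * q t T)) \<partial>M)" by simp
  also have "... = (\<integral>t. rh t * mob (q t) A \<partial>M)"
   by (intro Bochner_Integration.integral_cong) (auto simp: mob_def sum_distrib_left algebra_simps)
  finally have eq: "mob h A = (\<integral>t. rh t * mob (q t) A \<partial>M)" .
  have "\<bar>mob h A\<bar> \<le> (\<integral>t. \<bar>rh t\<bar> * b A \<partial>M)"
   unfolding eq
  proof (rule order_trans[OF integral_abs_bound], rule integral_mono')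
   show "integrable M (\<lambda>t. \<bar>rh t\<bar> * b A)" using rh(1) by auto
   show "\<bar>rh t * mob (q t) A\<bar> \<le> \<bar>rh t\<bar> * b A" if "t \<in> space M" for t
    using b(3) q[OF that] A by (auto simp: abs_mult intro!: mult_left_mono)
  qed (use b A in auto)
  also have "... = (\<integral>t. \<bar>rh t\<bar> \<partial>M) * b A" by simp
  also have "... \<le> r * b A" using rh(2) b(1) A by (intro mult_right_mono) auto
  finally show ?thesis .
 qed
 moreover have "(\<Sum>A\<in>Pow V. r * b A) \<le> r * c"
  using b(2) r by (simp add: sum_distrib_left[symmetric] mult_left_mono)
 ultimately show ?thesis unfolding mob_bd_def using b(1) r by (intro exI[of _ "\<lambda>A. r * b A"]) auto
qed

lemma mob_bd_zero: "mob_bd V {\<lambda>_. 0} 0"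
 unfolding mob_bd_def by (intro exI[of _ "\<lambda>_. 0"]) (auto simp: mob_def)

text \<open>Bounds for the increment under adding \<open>x\<close> control exactly the coefficients
  of the sets that contain \<open>x\<close>, which are those that absolute summability adds
  up.\<close>

lemma mob_insert_diff:
 assumes "finite A" "x \<notin> A"
 shows "mob (\<lambda>B. g (insert x B) - g B) A = mob g (insert x A)"
proof -
 have "(\<Sum>T\<in>Pow (insert x A). (-1)^card T * g T)
   = (\<Sum>T\<in>Pow A. (-1)^card T * g T) + (\<Sum>T\<in>insert x ` Pow A. (-1)^card T * g T)"
  unfolding Pow_insert using assms by (intro sum.union_disjoint) auto
 also have "(\<Sum>T\<in>insert x ` Pow A. (-1)^card T * g T) = (\<Sum>T\<in>Pow A. (-1)^card (insert x T) * g (insert x T))"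
  using assms by (subst sum.reindex) (auto intro!: inj_onI)
 also have "... = (\<Sum>T\<in>Pow A. - ((-1)^card T * g (insert x T)))"
  using assms by (intro sum.cong refl) (auto simp: card_insert_if finite_subset)
 finally have "(\<Sum>T\<in>Pow (insert x A). (-1)^card T * g T)
  = - (\<Sum>T\<in>Pow A. (-1)^card T * (g (insert x T) - g T))"
  by (simp add: sum_subtractf sum_negf right_diff_distrib)
 then show ?thesis using assms by (simp add: mob_def)
qed

section \<open>Pair models with weak interaction factors\<close>

locale pair_model = prob_space M for M :: "'a measure" +
 fixes E :: "('v \<times> 'v) set" and D :: nat and eps :: real
 assumes sym_E: "sym E" and irrefl_E: "(i, i) \<notin> E"
  and fin_nb: "finite (E `` {z})" and card_nb: "card (E `` {z}) \<le> D"
  and eps: "0 < eps" "eps < 1" "(1 + 2 * eps)^D \<le> 4/3"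
begin

text \<open>Closeness to 1 is imposed on the product of the two orientations, because
  \<open>wt\<close> runs over ordered pairs and every bond contributes both.\<close>

definition adm_f :: "('v => 'v => 'a => 'a => real) => bool" where
 "adm_f f \<longleftrightarrow> (\<forall>i j. case_prod (f i j) \<in> borel_measurable (M \<Otimes>\<^sub>M M)) \<and>
   (\<forall>i j. \<forall>t\<in>space M. \<forall>s\<in>space M. 0 < f i j t s) \<and>
   (\<exists>K. \<forall>i j. \<forall>t\<in>space M. \<forall>s\<in>space M. f i j t s \<le> K) \<and>
   (\<forall>i j. (i, j) \<notin> E --> f i j = (\<lambda>_ _. 1)) \<and>
   (\<forall>i j. \<forall>t\<in>space M. \<forall>s\<in>space M. \<bar>f i j t s * f j i s t - 1\<bar> \<le> eps)"

text \<open>One-site weights may be far from constant. Boundary influences can therefore be put into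
  them without affecting any bound.\<close>

definition adm_u :: "('v => 'a => real) => bool" where
 "adm_u u \<longleftrightarrow> (\<forall>y. u y \<in> borel_measurable M) \<and> (\<forall>y. \<forall>t\<in>space M. 0 < u y t) \<and>
   (\<forall>y. \<exists>K. \<forall>t\<in>space M. u y t \<le> K)"

definition adm_h :: "('a => real) => bool" where
 "adm_h h \<longleftrightarrow> h \<in> borel_measurable M \<and> (\<forall>t\<in>space M. \<bar>h t - 1\<bar> \<le> eps)"

definition wt :: "'v set => ('v => 'v => 'a => 'a => real) => ('v => 'a => real) => ('v => 'a) => real" where
 "wt B f u x = (\<Prod>(i,j)\<in>B\<times>B. f i j (x i) (x j)) * (\<Prod>y\<in>B. u y (x y))"

definition Zf :: "'v set => ('v => 'v => 'a => 'a => real) => ('v => 'a => real) => real" where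
 "Zf B f u = (\<integral>x. wt B f u x \<partial>PiM B (\<lambda>_. M))"

lemma prod_sf: "product_sigma_finite (\<lambda>_::'v. M)"
 by (rule product_sigma_finite.intro) (rule sigma_finite_measure_axioms)

lemma prob_PiM: "prob_space (PiM B (\<lambda>_::'v. M))"
 by (rule prob_space_PiM) (rule prob_space_axioms)

lemma wt_measurable:
 assumes f: "adm_f f" and u: "adm_u u" and B: "finite B"
 shows "wt B f u \<in> borel_measurable (PiM B (\<lambda>_. M))"
proof -
 have "(\<lambda>x. f i j (x i) (x j)) \<in> borel_measurable (PiM B (\<lambda>_. M))" if "i \<in> B" "j \<in> B" for i j
 proof -
  have "(\<lambda>x. (x i, x j)) \<in> measurable (PiM B (\<lambda>_. M)) (M \<Otimes>\<^sub>M M)" using that by measurable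
  from measurable_compose[OF this, of "case_prod (f i j)" borel] f show ?thesis by (simp add: adm_f_def)
 qed
 moreover have "(\<lambda>x. u y (x y)) \<in> borel_measurable (PiM B (\<lambda>_. M))" if "y \<in> B" for y
  using measurable_compose[OF measurable_component_singleton[OF that, of "\<lambda>_. M"], of "u y" borel] u
  by (auto simp: adm_u_def)
 ultimately show ?thesis
  unfolding wt_def case_prod_beta by (intro borel_measurable_times borel_measurable_prod) auto
qed

lemma wt_pos:
 assumes f: "adm_f f" and u: "adm_u u" and x: "\<And>y. y \<in> B ==> x y \<in> space M"
 shows "0 < wt B f u x"
 unfolding wt_def using assms by (intro mult_pos_pos prod_pos) (auto simp: adm_f_def adm_u_def)

lemma wt_bounded:
 assumes f: "adm_f f" and u: "adm_u u" and B: "finite B"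
 shows "\<exists>K. \<forall>x. (\<forall>y\<in>B. x y \<in> space M) --> wt B f u x \<le> K"
proof -
 obtain K where K: "\<And>i j t s. t \<in> space M ==> s \<in> space M ==> f i j t s \<le> K"
  using f unfolding adm_f_def by metis
 have "\<forall>y. \<exists>K. \<forall>t\<in>space M. u y t \<le> K" using u by (simp add: adm_u_def)
 then obtain L where L: "\<And>y t. t \<in> space M ==> u y t \<le> L y" by metis
 have "wt B f u x \<le> (\<Prod>(i,j)\<in>B\<times>B. K) * (\<Prod>y\<in>B. L y)" if x: "\<forall>y\<in>B. x y \<in> space M" for x
  unfolding wt_def
 proof (rule mult_mono)
  show "(\<Prod>(i,j)\<in>B\<times>B. f i j (x i) (x j)) \<le> (\<Prod>(i,j)\<in>B\<times>B. K)"
   using x K f by (intro prod_mono) (auto simp: adm_f_def less_imp_le)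
  show "(\<Prod>y\<in>B. u y (x y)) \<le> (\<Prod>y\<in>B. L y)"
   using x L u by (intro prod_mono) (auto simp: adm_u_def less_imp_le)
  show "0 \<le> (\<Prod>y\<in>B. u y (x y))" using x u by (intro prod_nonneg) (auto simp: adm_u_def less_imp_le)
  have "0 \<le> K" if "i \<in> B" for i
   using K[of "x i" "x i" i i] f x that unfolding adm_f_def by (meson less_le_trans less_imp_le)
  then show "0 \<le> (\<Prod>(i,j)\<in>B\<times>B. K)" by (intro prod_nonneg) auto
 qed
 then show ?thesis by blast
qed

lemma wt_integrable:
 assumes f: "adm_f f" and u: "adm_u u" and B: "finite B"
 shows "integrable (PiM B (\<lambda>_. M)) (wt B f u)"
proof -
 interpret P: prob_space "PiM B (\<lambda>_. M)" by (rule prob_PiM)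
 obtain K where K: "\<And>x. \<forall>y\<in>B. x y \<in> space M ==> wt B f u x \<le> K" using wt_bounded[OF assms] by blast
 show ?thesis
 proof (rule P.integrable_const_bound[of _ K])
  show "AE x in PiM B (\<lambda>_. M). norm (wt B f u x) \<le> K"
  proof (rule AE_I2)
   fix x assume "x \<in> space (PiM B (\<lambda>_. M))"
   then have "\<forall>y\<in>B. x y \<in> space M" by (auto simp: space_PiM)
   then show "norm (wt B f u x) \<le> K" using K[of x] wt_pos[OF f u, of B x] by auto
  qed
 qed (rule wt_measurable[OF assms])
qed

lemma integral_pos_prob:
 fixes g :: "'b => real"
 assumes "prob_space N" "integrable N g" "\<And>x. x \<in> space N ==> 0 < g x"
 shows "0 < (\<integral>x. g x \<partial>N)"
proof -
 interpret N: prob_space N by fact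
 have "0 \<le> (\<integral>x. g x \<partial>N)" using assms(3) by (intro Bochner_Integration.integral_nonneg) (simp add: less_imp_le)
 moreover have "(\<integral>x. g x \<partial>N) \<noteq> 0"
 proof
  assume "(\<integral>x. g x \<partial>N) = 0"
  then have "AE x in N. g x = 0"
   using integral_nonneg_eq_0_iff_AE[OF assms(2)] assms(3) by (auto simp: less_imp_le)
  then have "AE x in N. False"
   by (rule AE_mp) (use assms(3) in \<open>force intro!: AE_I2\<close>)
  then show False by (simp add: N.AE_False)
 qed
 ultimately show ?thesis by linarith
qed

lemma Zf_pos:
 assumes "adm_f f" "adm_u u" "finite B"
 shows "0 < Zf B f u"
 unfolding Zf_def
 by (intro integral_pos_prob prob_PiM wt_integrable assms wt_pos) (auto simp: space_PiM)

lemma Zf_cong: "(\<And>y. y \<in> B ==> u y = u' y) ==> Zf B f u = Zf B f u'"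
 unfolding Zf_def wt_def by (simp cong: prod.cong)

text \<open>Fixing the variable at \<open>z\<close> to \<open>t\<close> only changes the one-site
  weights of the remaining sites, so the class of models is closed under conditioning on a
  site.\<close>

definition ext_u where "ext_u f u z t = (\<lambda>y s. u y s * (f z y t s * f y z s t))"

lemma measurable_slice:
 assumes f: "adm_f f" and t: "t \<in> space M"
 shows "(\<lambda>s. f z y t s * f y z s t) \<in> borel_measurable M"
proof -
 have c: "case_prod (f z y) \<in> borel_measurable (M \<Otimes>\<^sub>M M)" "case_prod (f y z) \<in> borel_measurable (M \<Otimes>\<^sub>M M)"
  using f by (auto simp: adm_f_def)
 have m: "(\<lambda>s. (t, s)) \<in> measurable M (M \<Otimes>\<^sub>M M)" "(\<lambda>s. (s, t)) \<in> measurable M (M \<Otimes>\<^sub>M M)"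
  using t by measurable
 show ?thesis
  using borel_measurable_times[OF measurable_compose[OF m(1) c(1)] measurable_compose[OF m(2) c(2)]] by simp
qed

lemma adm_h_slice:
 assumes f: "adm_f f" and t: "t \<in> space M"
 shows "adm_h (\<lambda>s. f z y t s * f y z s t)"
 using measurable_slice[OF assms] f t by (auto simp: adm_h_def adm_f_def)

lemma adm_h_pos: "adm_h h ==> t \<in> space M ==> 0 < h t \<and> h t \<le> 2"
 using eps unfolding adm_h_def by (smt (verit))

lemma adm_u_mult:
 assumes u: "adm_u u" and g: "\<And>y. adm_h (g y)"
 shows "adm_u (\<lambda>y s. u y s * g y s)"
proof -
 have "\<exists>K. \<forall>t\<in>space M. u y t * g y t \<le> K" for y
 proof -
  obtain K where K: "\<forall>t\<in>space M. u y t \<le> K" using u unfolding adm_u_def by blast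
  have "u y t * g y t \<le> K * 2" if "t \<in> space M" for t
  proof -
   have "0 < u y t" "u y t \<le> K" using K u that by (auto simp: adm_u_def)
   then show ?thesis using adm_h_pos[OF g that, of y] by (intro mult_mono) auto
  qed
  then show ?thesis by blast
 qed
 moreover have "0 < u y t * g y t" if "t \<in> space M" for y t
  using u adm_h_pos[OF g that, of y] that by (auto simp: adm_u_def)
 moreover have "(\<lambda>s. u y s * g y s) \<in> borel_measurable M" for y
  using u g by (intro borel_measurable_times) (auto simp: adm_u_def adm_h_def)
 ultimately show ?thesis unfolding adm_u_def by blast
qed

lemma adm_u_upd:
 assumes u: "adm_u u" and h: "adm_h h"
 shows "adm_u (u(y := \<lambda>s. u y s * h s))"
proof -
 have one: "adm_h (\<lambda>_. 1)" using eps by (simp add: adm_h_def)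
 have "u(y := \<lambda>s. u y s * h s) = (\<lambda>z s. u z s * (if z = y then h else (\<lambda>_. 1)) s)" by auto
 then show ?thesis using adm_u_mult[OF u, of "\<lambda>z. if z = y then h else (\<lambda>_. 1)"] h one by simp
qed

lemma wt_insert:
 assumes f: "adm_f f" and B: "finite B" "z \<notin> B"
 shows "wt (insert z B) f u (x(z := t)) = u z t * wt B f (ext_u f u z t) x"
proof -
 let ?x = "x(z := t)"
 have zz: "f z z = (\<lambda>_ _. 1)" using f irrefl_E by (simp add: adm_f_def)
 have "(\<Prod>(i,j)\<in>insert z B \<times> insert z B. f i j (?x i) (?x j))
   = (\<Prod>i\<in>insert z B. \<Prod>j\<in>insert z B. f i j (?x i) (?x j))"
  by (simp add: prod.cartesian_product)
 also have "... = (\<Prod>j\<in>B. f z j t (x j)) * (\<Prod>i\<in>B. f i z (x i) t * (\<Prod>j\<in>B. f i j (x i) (x j)))"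
  using B zz by (auto cong: prod.cong simp: prod.insert intro!: arg_cong2[where f=times] prod.cong)
 also have "... = (\<Prod>(i,j)\<in>B \<times> B. f i j (x i) (x j)) * (\<Prod>j\<in>B. f z j t (x j) * f j z (x j) t)"
  by (simp add: prod.distrib prod.cartesian_product)
 finally have 1: "(\<Prod>(i,j)\<in>insert z B \<times> insert z B. f i j (?x i) (?x j)) = ..." .
 have 2: "(\<Prod>y\<in>insert z B. u y (?x y)) = u z t * (\<Prod>y\<in>B. u y (x y))"
  using B by (auto intro!: arg_cong2[where f=times] prod.cong)
 show ?thesis unfolding wt_def 1 2 ext_u_def by (simp add: prod.distrib)
qed

lemma Zf_insert:
 assumes f: "adm_f f" and u: "adm_u u" and B: "finite B" "z \<notin> B"
 shows "Zf (insert z B) f u = (\<integral>t. u z t * Zf B f (ext_u f u z t) \<partial>M)"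
  and "(\<lambda>t. u z t * Zf B f (ext_u f u z t)) \<in> borel_measurable M"
proof -
 interpret P: product_sigma_finite "\<lambda>_::'v. M" by (rule prod_sf)
 interpret PB: prob_space "PiM B (\<lambda>_. M)" by (rule prob_PiM)
 interpret PP: pair_prob_space "PiM B (\<lambda>_. M)" M ..
 have int: "integrable (PiM (insert z B) (\<lambda>_. M)) (wt (insert z B) f u)"
  using f u B by (intro wt_integrable) auto
 obtain K where K: "\<And>x. \<forall>y\<in>insert z B. x y \<in> space M ==> wt (insert z B) f u x \<le> K"
  using wt_bounded[OF f u, of "insert z B"] B by auto
 have m: "(\<lambda>(x, t). wt (insert z B) f u (x(z := t))) \<in> borel_measurable (PiM B (\<lambda>_. M) \<Otimes>\<^sub>M M)"
  using measurable_compose[OF measurable_add_dim wt_measurable[OF f u, of "insert z B"]] B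
  by (simp add: case_prod_beta)
 have i2: "integrable (PiM B (\<lambda>_. M) \<Otimes>\<^sub>M M) (\<lambda>(x, t). wt (insert z B) f u (x(z := t)))"
 proof (rule PP.integrable_const_bound[of _ K], rule AE_I2)
  fix p assume "p \<in> space (PiM B (\<lambda>_. M) \<Otimes>\<^sub>M M)"
  then have "\<forall>y\<in>insert z B. ((fst p)(z := snd p)) y \<in> space M"
   by (auto simp: space_pair_measure space_PiM)
  then show "norm (case p of (x, t) => wt (insert z B) f u (x(z := t))) \<le> K"
   using K[of "(fst p)(z := snd p)"] less_imp_le[OF wt_pos[OF f u, of "insert z B" "(fst p)(z := snd p)"]]
   by (simp only: case_prod_beta real_norm_def abs_of_nonneg)
 qed (rule m)
 have in_eq: "(\<integral>x. wt (insert z B) f u (x(z := t)) \<partial>PiM B (\<lambda>_. M)) = u z t * Zf B f (ext_u f u z t)" for t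
  unfolding wt_insert[OF f B] Zf_def by simp
 have "Zf (insert z B) f u = (\<integral>x. (\<integral>t. wt (insert z B) f u (x(z := t)) \<partial>M) \<partial>PiM B (\<lambda>_. M))"
  unfolding Zf_def by (rule P.product_integral_insert[OF B int])
 also have "... = (\<integral>t. (\<integral>x. wt (insert z B) f u (x(z := t)) \<partial>PiM B (\<lambda>_. M)) \<partial>M)"
  using PP.Fubini_integral[OF i2] by simp
 finally show "Zf (insert z B) f u = (\<integral>t. u z t * Zf B f (ext_u f u z t) \<partial>M)" unfolding in_eq .
 have "(\<lambda>(t, x). wt (insert z B) f u (x(z := t))) \<in> borel_measurable (M \<Otimes>\<^sub>M PiM B (\<lambda>_. M))"
  using measurable_compose[OF measurable_pair_swap' m] by (simp add: case_prod_beta)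
 from PB.borel_measurable_lebesgue_integral[OF this]
 show "(\<lambda>t. u z t * Zf B f (ext_u f u z t)) \<in> borel_measurable M" unfolding in_eq .
qed

text \<open>The relative effect of a near-constant factor at \<open>y\<close>, as a function of the
  volume. The family contains all admissible \<open>f\<close>, \<open>u\<close> and
  \<open>h\<close>, so that a bound for it is uniform in them.\<close>

definition R1 :: "'v => ('v set => real) set" where
 "R1 y = {\<lambda>B. Zf B f (u(y := \<lambda>s. u y s * h s)) / Zf B f u - 1 | f u h. adm_f f \<and> adm_u u \<and> adm_h h}"

definition QN :: "'v set => ('v set => real) set" where
 "QN N = {\<lambda>B. Zf B f (\<lambda>y s. u y s * g y s) / Zf B f u - 1 | f u g.
   adm_f f \<and> adm_u u \<and> (\<forall>y. adm_h (g y)) \<and> (\<forall>y. y \<notin> N --> g y = (\<lambda>_. 1))}"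

text \<open>The weights are changed site by site and the ratios multiply. Written for the deviations
  from 1, a product is \<open>r * q' + (r + q')\<close>, so each site contributes one factor
  \<open>1 + dt\<close>.\<close>

lemma QN_bd:
 assumes V: "finite V" and R: "\<And>y. mob_bd V (R1 y) dt" and N: "finite N"
 shows "mob_bd V (QN N) ((1+dt)^card N - 1)"
 using N
proof (induction N)
 case empty
 show ?case
 proof (rule mob_bd_mono[OF mob_bd_zero])
  fix q assume "q \<in> QN {}"
  then obtain f u g where q: "q = (\<lambda>B. Zf B f (\<lambda>y s. u y s * g y s) / Zf B f u - 1)" "adm_f f" "adm_u u"
   "\<forall>y. g y = (\<lambda>_. 1)" unfolding QN_def by auto
  have "q B = 0" if "B \<subseteq> V" for B
   using Zf_pos[OF q(2,3), of B] finite_subset[OF that V] q(4) unfolding q(1) by simp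
  then show "\<exists>g\<in>{\<lambda>_. 0}. \<forall>B\<subseteq>V. q B = g B" by simp
 qed simp
next
 case (insert y N)
 let ?c = "(1+dt)^card N - 1"
 have bd: "mob_bd V {\<lambda>B. g B + h B | g h. g \<in> {\<lambda>B. g B * h B | g h. g \<in> R1 y \<and> h \<in> QN N} \<and>
   h \<in> {\<lambda>B. g B + h B | g h. g \<in> R1 y \<and> h \<in> QN N}} (dt * ?c + (dt + ?c))"
  by (intro mob_bd_add mob_bd_mult V R insert.IH)
 show ?case
 proof (rule mob_bd_mono[OF bd])
  show "dt * ?c + (dt + ?c) \<le> (1+dt)^card (insert y N) - 1"
   using insert.hyps by (simp add: algebra_simps)
  fix q assume "q \<in> QN (insert y N)"
  then obtain f u g where q: "q = (\<lambda>B. Zf B f (\<lambda>y s. u y s * g y s) / Zf B f u - 1)" "adm_f f" "adm_u u"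
   "\<And>y. adm_h (g y)" "\<And>y'. y' \<notin> insert y N ==> g y' = (\<lambda>_. 1)" unfolding QN_def by auto
  define g' where "g' = g(y := \<lambda>_. 1)"
  have g': "adm_h (g' y)" for y using q(4) eps by (simp add: g'_def adm_h_def)
  define u' where "u' = (\<lambda>y s. u y s * g' y s)"
  have u': "adm_u u'" unfolding u'_def by (rule adm_u_mult[OF q(3) g'])
  define r where "r = (\<lambda>B. Zf B f (u'(y := \<lambda>s. u' y s * g y s)) / Zf B f u' - 1)"
  define q' where "q' = (\<lambda>B. Zf B f (\<lambda>y s. u y s * g' y s) / Zf B f u - 1)"
  have r: "r \<in> R1 y" unfolding R1_def r_def using q(2,4) u' by blast
  have "\<forall>y'. y' \<notin> N --> g' y' = (\<lambda>_. 1)" using q(5) by (simp add: g'_def)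
  then have q': "q' \<in> QN N" unfolding QN_def q'_def using q(2,3) g' by blast
  have uu: "u'(y := \<lambda>s. u' y s * g y s) = (\<lambda>y s. u y s * g y s)"
   by (auto simp: u'_def g'_def fun_eq_iff)
  have "q B = r B * q' B + (r B + q' B)" if "B \<subseteq> V" for B
  proof -
   have fB: "finite B" using that V finite_subset by auto
   have "0 < Zf B f u'" "0 < Zf B f u" using Zf_pos q(2,3) u' fB by auto
   then show ?thesis unfolding r_def q'_def q(1) uu unfolding u'_def[symmetric]
    by (simp add: field_simps)
  qed
  note qeq = this
  let ?P = "{\<lambda>B. g B * h B | g h. g \<in> R1 y \<and> h \<in> QN N}" and ?S = "{\<lambda>B. g B + h B | g h. g \<in> R1 y \<and> h \<in> QN N}"
  have P: "(\<lambda>B. r B * q' B) \<in> ?P"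
   by (rule CollectI, rule exI[of _ r], rule exI[of _ q'], rule conjI[OF refl], rule conjI[OF r q'])
  have S: "(\<lambda>B. r B + q' B) \<in> ?S"
   by (rule CollectI, rule exI[of _ r], rule exI[of _ q'], rule conjI[OF refl], rule conjI[OF r q'])
  have PS: "(\<lambda>B. r B * q' B + (r B + q' B)) \<in> {\<lambda>B. g B + h B | g h. g \<in> ?P \<and> h \<in> ?S}"
   by (rule CollectI, rule exI[of _ "\<lambda>B. r B * q' B"], rule exI[of _ "\<lambda>B. r B + q' B"],
     rule conjI[OF refl], rule conjI[OF P S])
  show "\<exists>g\<in>{\<lambda>B. g B + h B | g h. g \<in> ?P \<and> h \<in> ?S}. \<forall>B\<subseteq>V. q B = g B"
   by (rule bexI[OF _ PS]) (simp add: qeq)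
 qed
qed

definition Wt :: "('a => real) set" where
 "Wt = {rh. rh \<in> borel_measurable M \<and> (\<forall>t\<in>space M. 0 < rh t) \<and> (\<exists>K. \<forall>t\<in>space M. rh t \<le> K) \<and> (\<integral>t. rh t \<partial>M) = 1}"

lemma Wt_integrable_mult:
 assumes rh: "rh \<in> Wt" and g: "g \<in> borel_measurable M" "\<And>t. t \<in> space M ==> \<bar>g t\<bar> \<le> C"
 shows "integrable M (\<lambda>t. rh t * g t)"
proof -
 obtain K where K: "\<forall>t\<in>space M. rh t \<le> K" using rh by (auto simp: Wt_def)
 show ?thesis
 proof (rule integrable_const_bound[of _ "K * C"], rule AE_I2)
  fix t assume t: "t \<in> space M"
  then have "0 < rh t" "rh t \<le> K" using rh K by (auto simp: Wt_def)
  then show "norm (rh t * g t) \<le> K * C" using g(2)[OF t] by (auto simp: abs_mult intro!: mult_mono)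
 qed (use rh g in \<open>auto simp: Wt_def\<close>)
qed

lemma Wt_integrable: "rh \<in> Wt ==> integrable M rh"
 using Wt_integrable_mult[of rh "\<lambda>_. 1" 1] by simp

text \<open>One plus such a function is \<open>Zf (insert z B) f u\<close> divided by
  \<open>Zf B f u\<close> and by the mean of \<open>u z\<close>; see
  \<open>Zf_ratio_eq\<close>.\<close>

definition Den :: "'v set => 'v set => ('v set => real) set" where
 "Den V N = {\<lambda>B. \<integral>t. rh t * q t B \<partial>M | rh q. rh \<in> Wt \<and> (\<forall>t\<in>space M. q t \<in> QN N) \<and>
   (\<forall>B\<subseteq>V. (\<lambda>t. q t B) \<in> borel_measurable M)}"

lemma Den_bd:
 assumes V: "finite V" and Q: "mob_bd V (QN N) eta"
 shows "mob_bd V (Den V N) eta"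
proof -
 have "mob_bd V (Den V N) (1 * eta)"
 proof (rule mob_bd_integral[OF V Q, of 1 "Den V N" M])
  fix h assume "h \<in> Den V N"
  then obtain rh q where h: "h = (\<lambda>B. \<integral>t. rh t * q t B \<partial>M)" "rh \<in> Wt" "\<forall>t\<in>space M. q t \<in> QN N"
   "\<forall>B\<subseteq>V. (\<lambda>t. q t B) \<in> borel_measurable M" unfolding Den_def by auto
  have "integrable M (\<lambda>t. rh t * q t B)" if "B \<subseteq> V" for B
   using h that mob_bd_bound[OF V Q _ that] by (intro Wt_integrable_mult) auto
  moreover have "(\<integral>t. \<bar>rh t\<bar> \<partial>M) = (\<integral>t. rh t \<partial>M)"
   using h(2) by (intro Bochner_Integration.integral_cong) (auto simp: Wt_def less_imp_le)
  ultimately show "\<exists>rh q. (\<forall>t\<in>space M. q t \<in> QN N) \<and> (\<forall>B\<subseteq>V. integrable M (\<lambda>t. rh t * q t B))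
    \<and> integrable M rh \<and> (\<integral>t. \<bar>rh t\<bar> \<partial>M) \<le> 1 \<and> (\<forall>B\<subseteq>V. h B = (\<integral>t. rh t * q t B \<partial>M))"
   using h Wt_integrable[OF h(2)] by (intro exI[of _ rh] exI[of _ q]) (auto simp: Wt_def)
 qed simp
 then show ?thesis by simp
qed

text \<open>The extra term produced by a factor \<open>h\<close> at the site that is integrated
  last; it is of order \<open>eps\<close> because \<open>h - 1\<close> is.\<close>

definition Num :: "'v set => 'v set => ('v set => real) set" where
 "Num V N = {\<lambda>B. \<integral>t. rh t * (h t - 1) * (1 + q t B) \<partial>M | rh h q. rh \<in> Wt \<and> adm_h h \<and> (\<forall>t\<in>space M. q t \<in> QN N) \<and>
   (\<forall>B\<subseteq>V. (\<lambda>t. q t B) \<in> borel_measurable M)}"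

lemma Num_bd:
 assumes V: "finite V" and Q: "mob_bd V (QN N) eta"
 shows "mob_bd V (Num V N) (eps * (1 + eta))"
proof -
 have Q1: "mob_bd V {\<lambda>B. g B + h B | g h. g \<in> {\<lambda>_. 1} \<and> h \<in> QN N} (1 + eta)"
  by (intro mob_bd_add mob_bd_const V Q)
 show ?thesis
 proof (rule mob_bd_integral[OF V Q1, of eps "Num V N" M])
  fix h' assume "h' \<in> Num V N"
  then obtain rh h q where h: "h' = (\<lambda>B. \<integral>t. rh t * (h t - 1) * (1 + q t B) \<partial>M)" "rh \<in> Wt" "\<forall>t\<in>space M. q t \<in> QN N"
   "\<forall>B\<subseteq>V. (\<lambda>t. q t B) \<in> borel_measurable M" "adm_h h" unfolding Num_def by auto
  have hb: "\<bar>h t - 1\<bar> \<le> eps" if "t \<in> space M" for t using h(5) that by (auto simp: adm_h_def)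
  have hm: "h \<in> borel_measurable M" using h(5) by (auto simp: adm_h_def)
  have i1: "integrable M (\<lambda>t. rh t * (h t - 1))" using hb hm by (intro Wt_integrable_mult[OF h(2)]) auto
  have "integrable M (\<lambda>t. rh t * (h t - 1) * (1 + q t B))" if B: "B \<subseteq> V" for B
  proof -
   have "integrable M (\<lambda>t. rh t * ((h t - 1) * (1 + q t B)))"
   proof (rule Wt_integrable_mult[OF h(2)])
    fix t assume t: "t \<in> space M"
    have "\<bar>1 + q t B\<bar> \<le> 1 + eta" using mob_bd_bound[OF V Q _ B, of "q t"] h(3) t by fastforce
    then show "\<bar>(h t - 1) * (1 + q t B)\<bar> \<le> eps * (1 + eta)"
     using hb[OF t] eps by (auto simp: abs_mult intro!: mult_mono)
   qed (use h(4) hm B in auto)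
   then show ?thesis by (simp add: mult.assoc)
  qed
  moreover have "(\<integral>t. \<bar>rh t * (h t - 1)\<bar> \<partial>M) \<le> (\<integral>t. rh t * eps \<partial>M)"
  proof (rule integral_mono)
   show "\<bar>rh t * (h t - 1)\<bar> \<le> rh t * eps" if "t \<in> space M" for t
    using h(2) hb[OF that] that by (auto simp: Wt_def abs_mult less_imp_le)
  qed (use i1 Wt_integrable[OF h(2)] in auto)
  moreover have "(\<integral>t. rh t * eps \<partial>M) = eps" using h(2) by (simp add: Wt_def)
  ultimately show "\<exists>rh q. (\<forall>t\<in>space M. q t \<in> {\<lambda>B. g B + h B | g h. g \<in> {\<lambda>_. 1} \<and> h \<in> QN N}) \<and> (\<forall>B\<subseteq>V. integrable M (\<lambda>t. rh t * q t B))
    \<and> integrable M rh \<and> (\<integral>t. \<bar>rh t\<bar> \<partial>M) \<le> eps \<and> (\<forall>B\<subseteq>V. h' B = (\<integral>t. rh t * q t B \<partial>M))"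
   using h(1,3) i1 by (intro exI[of _ "\<lambda>t. rh t * (h t - 1)"] exI[of _ "\<lambda>t B. 1 + q t B"]) auto
 qed (use eps in simp)
qed

text \<open>Conditioning on the variable at \<open>z\<close> alters only the weights of its
  neighbours, so the number of changed sites is bounded by the degree.\<close>

lemma ext_ratio_QN:
 assumes f: "adm_f f" and u: "adm_u u" and t: "t \<in> space M"
 shows "(\<lambda>B. Zf B f (ext_u f u z t) / Zf B f u - 1) \<in> QN (E `` {z})"
proof -
 have "(\<lambda>s. f z y t s * f y z s t) = (\<lambda>_. 1)" if "y \<notin> E `` {z}" for y
  using f that sym_E unfolding adm_f_def sym_def by (metis (no_types, lifting) Image_singleton_iff mult_1)
 then show ?thesis unfolding QN_def ext_u_def using f u adm_h_slice[OF f t]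
  by (intro CollectI exI[of _ f] exI[of _ u] exI[of _ "\<lambda>y s. f z y t s * f y z s t"]) auto
qed

lemma ext_ratio_measurable:
 assumes f: "adm_f f" and u: "adm_u u" and B: "finite B" "z \<notin> B"
 shows "(\<lambda>t. Zf B f (ext_u f u z t) / Zf B f u - 1) \<in> borel_measurable M"
proof -
 have "(\<lambda>t. (u z t * Zf B f (ext_u f u z t)) / u z t) \<in> borel_measurable M"
  using Zf_insert(2)[OF f u B] u by (intro borel_measurable_divide) (auto simp: adm_u_def)
 then have "(\<lambda>t. Zf B f (ext_u f u z t)) \<in> borel_measurable M"
 proof (rule measurable_cong[THEN iffD1, rotated])
  fix t assume "t \<in> space M"
  then have "0 < u z t" using u by (auto simp: adm_u_def)
  then show "u z t * Zf B f (ext_u f u z t) / u z t = Zf B f (ext_u f u z t)" by simp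
 qed
 then show ?thesis by measurable
qed

lemma normalize_Wt:
 assumes u: "adm_u u"
 shows "0 < (\<integral>t. u y t \<partial>M)" "(\<lambda>t. u y t / (\<integral>t. u y t \<partial>M)) \<in> Wt"
proof -
 obtain K where K: "\<forall>t\<in>space M. u y t \<le> K" using u unfolding adm_u_def by blast
 have i: "integrable M (u y)"
  using u K by (intro integrable_const_bound[of _ K] AE_I2) (auto simp: adm_u_def less_imp_le)
 show p: "0 < (\<integral>t. u y t \<partial>M)"
  using u i by (intro integral_pos_prob prob_space_axioms) (auto simp: adm_u_def)
 show "(\<lambda>t. u y t / (\<integral>t. u y t \<partial>M)) \<in> Wt"
  using u K p by (auto simp: Wt_def adm_u_def intro!: exI[of _ "K / (\<integral>t. u y t \<partial>M)"] divide_right_mono borel_measurable_divide)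
qed

lemma Zf_ratio_eq:
 assumes f: "adm_f f" and u: "adm_u u" and B: "finite B" "z \<notin> B" and V: "finite V" "B \<subseteq> V"
  and Q: "mob_bd V (QN (E `` {z})) eta"
 shows "Zf (insert z B) f u = (\<integral>t. u z t \<partial>M) * Zf B f u *
   (1 + (\<integral>t. (u z t / (\<integral>t. u z t \<partial>M)) * (Zf B f (ext_u f u z t) / Zf B f u - 1) \<partial>M))"
proof -
 let ?c = "\<integral>t. u z t \<partial>M" and ?Z = "Zf B f u"
 let ?q = "\<lambda>t. Zf B f (ext_u f u z t) / Zf B f u - 1"
 note W = normalize_Wt[OF u, of z]
 have Z: "0 < ?Z" using Zf_pos f u B by auto
 have i: "integrable M (\<lambda>t. u z t / ?c * ?q t)"
  using mob_bd_bound[OF V(1) Q ext_ratio_QN[OF f u] V(2)]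
  by (intro Wt_integrable_mult[OF W(2)] ext_ratio_measurable f u B) auto
 have "Zf (insert z B) f u = (\<integral>t. u z t * Zf B f (ext_u f u z t) \<partial>M)" by (rule Zf_insert(1)[OF f u B])
 also have "... = (\<integral>t. ?c * ?Z * (u z t / ?c + u z t / ?c * ?q t) \<partial>M)"
  using W(1) Z by (intro Bochner_Integration.integral_cong) (auto simp: field_simps)
 also have "... = ?c * ?Z * (\<integral>t. (u z t / ?c + u z t / ?c * ?q t) \<partial>M)" by simp
 also have "(\<integral>t. (u z t / ?c + u z t / ?c * ?q t) \<partial>M) = (\<integral>t. u z t / ?c \<partial>M) + (\<integral>t. u z t / ?c * ?q t \<partial>M)"
  using i Wt_integrable[OF W(2)] by (intro Bochner_Integration.integral_add) auto
 also have "(\<integral>t. u z t / ?c \<partial>M) = 1" using W(2) by (simp add: Wt_def)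
 finally show ?thesis .
qed

lemma nb_exponent: "(1 + 2 * eps)^card (E `` {z}) - 1 \<le> 1/3"
proof -
 have "(1 + 2 * eps)^card (E `` {z}) \<le> (1 + 2 * eps)^D" using eps card_nb by (intro power_increasing) auto
 then show ?thesis using eps(3) by linarith
qed

text \<open>The key contraction: integrating out \<open>y\<close> expresses the effect of a small change of the
 one-site weight at \<open>y\<close> through ratios in the smaller volume \<open>V - {y}\<close>.\<close>
lemma R1_bd: "finite V ==> mob_bd V (R1 y) (2 * eps)"
proof (induction "card V" arbitrary: V y rule: less_induct)
 case less
 note V = \<open>finite V\<close>
 show ?case
 proof (cases "y \<in> V")
  case False
  show ?thesis
  proof (rule mob_bd_mono[OF mob_bd_zero])
   fix q assume "q \<in> R1 y"
   then obtain f u h where q: "q = (\<lambda>B. Zf B f (u(y := \<lambda>s. u y s * h s)) / Zf B f u - 1)" "adm_f f" "adm_u u"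
    unfolding R1_def by auto
   have "q B = 0" if "B \<subseteq> V" for B
   proof -
    have "Zf B f (u(y := \<lambda>s. u y s * h s)) = Zf B f u" using that False by (intro Zf_cong) auto
    then show ?thesis using Zf_pos[OF q(2,3) finite_subset[OF that V]] by (simp add: q(1))
   qed
   then show "\<exists>g\<in>{\<lambda>_. 0}. \<forall>B\<subseteq>V. q B = g B" by simp
  qed (use eps in simp)
 next
  case True
  let ?V = "V - {y}" and ?N = "E `` {y}"
  define eta where "eta = (1 + 2 * eps)^card ?N - 1"
  have eta: "eta \<le> 1/3" using nb_exponent[of y] by (simp add: eta_def)
  have eta0: "0 \<le> eta" using eps by (simp add: eta_def)
  have V': "finite ?V" using V by simp
  have "card ?V < card V" using V True by (rule card_Diff1_less)
  then have Q: "mob_bd ?V (QN ?N) eta" unfolding eta_def using less.hyps V' fin_nb by (intro QN_bd) auto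
  have "mob_bd V {\<lambda>B. if y \<in> B then g (B - {y}) else 0 | g. g \<in> {\<lambda>B. g B * h B | g h. g \<in> Num ?V ?N \<and> h \<in> {\<lambda>B. 1 / (1 + g B) | g. g \<in> Den ?V ?N}}}
   (eps * (1 + eta) * (1 / (1 - eta)))"
   using eta by (intro mob_bd_shift V True mob_bd_mult V' Num_bd Den_bd Q mob_bd_inverse) auto
  then show ?thesis
  proof (rule mob_bd_mono)
   \<comment> \<open>The induction reproduces its own bound: the 4/3 in the locale gives
     \<open>eta \<le> 1/3\<close>, and then this quotient is at most 2.\<close>
   have "(1 + eta) / (1 - eta) \<le> 2" using eta by (simp add: divide_le_eq)
   then show "eps * (1 + eta) * (1 / (1 - eta)) \<le> 2 * eps" using eps mult_left_mono[of "(1 + eta) / (1 - eta)" 2 eps] by simp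
   fix r assume "r \<in> R1 y"
   then obtain f u h where r: "r = (\<lambda>B. Zf B f (u(y := \<lambda>s. u y s * h s)) / Zf B f u - 1)"
    and f: "adm_f f" and u: "adm_u u" and h: "adm_h h"
    unfolding R1_def by auto
   let ?c = "\<integral>t. u y t \<partial>M"
   define rh where "rh t = u y t / ?c" for t
   define q where "q t = (\<lambda>B. Zf B f (ext_u f u y t) / Zf B f u - 1)" for t
   note W = normalize_Wt[OF u, of y, folded rh_def]
   define nu where "nu = (\<lambda>B. \<integral>t. rh t * (h t - 1) * (1 + q t B) \<partial>M)"
   define de where "de = (\<lambda>B. \<integral>t. rh t * q t B \<partial>M)"
   have qQ: "\<forall>t\<in>space M. q t \<in> QN ?N" unfolding q_def using ext_ratio_QN[OF f u] by simp
   have qm: "\<forall>B\<subseteq>?V. (\<lambda>t. q t B) \<in> borel_measurable M"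
    unfolding q_def using ext_ratio_measurable[OF f u] V' finite_subset by (metis Diff_iff insertI1 subsetD)
   have nu: "nu \<in> Num ?V ?N" unfolding Num_def nu_def using W(2) h qQ qm by blast
   have de: "de \<in> Den ?V ?N" unfolding Den_def de_def using W(2) qQ qm by blast
   let ?u = "u(y := \<lambda>s. u y s * h s)"
   have u': "adm_u ?u" by (rule adm_u_upd[OF u h])
   \<comment> \<open>If \<open>y\<close> lies in \<open>B\<close>, both partition functions are
     written as integrals over the variable at \<open>y\<close> of quantities for
     \<open>B - {y}\<close>; the common factors cancel and leave numerator over denominator.
     Otherwise the weight at \<open>y\<close> does not enter.\<close>
   have main: "r B = (if y \<in> B then nu (B - {y}) * (1 / (1 + de (B - {y}))) else 0)" if B: "B \<subseteq> V" for B
   proof (cases "y \<in> B")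
    case yB: True
    let ?B = "B - {y}"
    have B': "?B \<subseteq> ?V" "finite ?B" "y \<notin> ?B" using B V finite_subset by auto
    have Z: "0 < Zf ?B f u" using Zf_pos f u B' by auto
    have ins: "insert y ?B = B" using yB by auto
    have ZB: "Zf B f u = ?c * Zf ?B f u * (1 + de ?B)"
     using Zf_ratio_eq[OF f u B'(2,3) V' B'(1) Q] unfolding ins de_def q_def rh_def .
    have ext: "Zf ?B f (ext_u f ?u y t) = Zf ?B f (ext_u f u y t)" for t
     by (intro Zf_cong) (auto simp: ext_u_def)
    have qb: "\<bar>q t ?B\<bar> \<le> eta" if "t \<in> space M" for t using mob_bd_bound[OF V' Q _ B'(1)] qQ that by auto
    have qmB: "(\<lambda>t. q t ?B) \<in> borel_measurable M" using qm B' by auto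
    have hm: "h \<in> borel_measurable M" using h by (simp add: adm_h_def)
    have i1: "integrable M (\<lambda>t. rh t * q t ?B)" by (rule Wt_integrable_mult[OF W(2) qmB qb])
    have i2: "integrable M (\<lambda>t. rh t * ((h t - 1) * (1 + q t ?B)))"
    proof (rule Wt_integrable_mult[OF W(2)])
     fix t assume t: "t \<in> space M"
     have "\<bar>h t - 1\<bar> \<le> eps" using h t by (simp add: adm_h_def)
     moreover have "\<bar>1 + q t ?B\<bar> \<le> 1 + eta" using qb[OF t] by linarith
     ultimately show "\<bar>(h t - 1) * (1 + q t ?B)\<bar> \<le> eps * (1 + eta)"
      using eps by (auto simp: abs_mult intro!: mult_mono)
    qed (use qmB hm in measurable)
    have "Zf B f ?u = (\<integral>t. ?u y t * Zf ?B f (ext_u f ?u y t) \<partial>M)"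
     using Zf_insert(1)[OF f u' B'(2,3)] unfolding ins .
    also have "... = (\<integral>t. ?c * Zf ?B f u * (rh t + (rh t * q t ?B + rh t * ((h t - 1) * (1 + q t ?B)))) \<partial>M)"
     unfolding ext using W(1) Z by (intro Bochner_Integration.integral_cong) (auto simp: rh_def q_def field_simps)
    also have "... = ?c * Zf ?B f u * (\<integral>t. (rh t + (rh t * q t ?B + rh t * ((h t - 1) * (1 + q t ?B)))) \<partial>M)" by simp
    also have "(\<integral>t. (rh t + (rh t * q t ?B + rh t * ((h t - 1) * (1 + q t ?B)))) \<partial>M)
     = (\<integral>t. rh t \<partial>M) + ((\<integral>t. rh t * q t ?B \<partial>M) + (\<integral>t. rh t * ((h t - 1) * (1 + q t ?B)) \<partial>M))"
     using i1 i2 Wt_integrable[OF W(2)] by simp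
    also have "... = 1 + de ?B + nu ?B" using W(2) by (simp add: Wt_def de_def nu_def mult.assoc)
    finally have ZB2: "Zf B f ?u = ?c * Zf ?B f u * (1 + de ?B + nu ?B)" .
    have "0 < Zf B f u" using Zf_pos f u finite_subset[OF B V] by auto
    then have "1 + de ?B \<noteq> 0" using ZB by auto
    then have "(1 + de ?B + nu ?B) / (1 + de ?B) = 1 + nu ?B * (1 / (1 + de ?B))"
     by (simp add: add_divide_distrib)
    moreover have "?c * Zf ?B f u \<noteq> 0" using W(1) Z by simp
    ultimately have "r B = nu ?B * (1 / (1 + de ?B))" unfolding r ZB ZB2 by simp
    then show ?thesis using yB by simp
   next
    case yB: False
    have "Zf B f ?u = Zf B f u" using yB by (intro Zf_cong) auto
    then show ?thesis using yB Zf_pos[OF f u finite_subset[OF B V]] by (simp add: r)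
   qed
   let ?D = "{\<lambda>B. 1 / (1 + g B) | g. g \<in> Den ?V ?N}"
   let ?P = "{\<lambda>B. g B * h B | g h. g \<in> Num ?V ?N \<and> h \<in> ?D}"
   have D: "(\<lambda>B. 1 / (1 + de B)) \<in> ?D" by (rule CollectI, rule exI[of _ de], rule conjI[OF refl de])
   have P: "(\<lambda>B. nu B * (1 / (1 + de B))) \<in> ?P"
    by (rule CollectI, rule exI[of _ nu], rule exI[of _ "\<lambda>B. 1 / (1 + de B)"], rule conjI[OF refl], rule conjI[OF nu D])
   have S: "(\<lambda>B. if y \<in> B then nu (B - {y}) * (1 / (1 + de (B - {y}))) else 0) \<in>
    {\<lambda>B. if y \<in> B then g (B - {y}) else 0 | g. g \<in> ?P}"
    by (rule CollectI, rule exI[of _ "\<lambda>B. nu B * (1 / (1 + de B))"], rule conjI[OF refl P])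
   show "\<exists>g\<in>{\<lambda>B. if y \<in> B then g (B - {y}) else 0 | g. g \<in> ?P}. \<forall>B\<subseteq>V. r B = g B"
    by (rule bexI[OF _ S]) (simp add: main)
  qed
 qed
qed

text \<open>With trivial weight at \<open>z\<close> the increment is \<open>ln (1 + de)\<close> for
  a member \<open>de\<close> of \<open>Den\<close>; the logarithmic series turns \<open>eta\<close>
  into \<open>eta / (1 - eta)\<close>, which is at most 1/2.\<close>

lemma ln_ratio_bd:
 assumes V: "finite V" and z: "z \<notin> V"
 shows "mob_bd V {\<lambda>B. ln (Zf (insert z B) f u) - ln (Zf B f u) | f u. adm_f f \<and> adm_u u \<and> u z = (\<lambda>_. 1)} (1/2)"
proof -
 let ?N = "E `` {z}"
 define eta where "eta = (1 + 2 * eps)^card ?N - 1"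
 have eta: "eta \<le> 1/3" using nb_exponent[of z] by (simp add: eta_def)
 have eta0: "0 \<le> eta" using eps by (simp add: eta_def)
 have Q: "mob_bd V (QN ?N) eta" unfolding eta_def using R1_bd[OF V] V fin_nb by (intro QN_bd) auto
 have D: "mob_bd V {\<lambda>B. ln (1 + g B) | g. g \<in> Den V ?N} (eta * (1 / (1 - eta)))"
  using eta by (intro mob_bd_ln Den_bd V Q) auto
 then show ?thesis
 proof (rule mob_bd_mono)
  show "eta * (1 / (1 - eta)) \<le> 1/2" using eta by (simp add: field_simps)
  fix r assume "r \<in> {\<lambda>B. ln (Zf (insert z B) f u) - ln (Zf B f u) | f u. adm_f f \<and> adm_u u \<and> u z = (\<lambda>_. 1)}"
  then obtain f u where r: "r = (\<lambda>B. ln (Zf (insert z B) f u) - ln (Zf B f u))"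
   and f: "adm_f f" and u: "adm_u u" and uz: "u z = (\<lambda>_. 1)" by blast
  define q where "q t = (\<lambda>B. Zf B f (ext_u f u z t) / Zf B f u - 1)" for t
  define de where "de = (\<lambda>B. \<integral>t. 1 * q t B \<partial>M)"
  have c: "(\<integral>t. u z t \<partial>M) = 1" using uz prob_space by simp
  have one: "(\<lambda>t. 1) \<in> Wt" using normalize_Wt(2)[OF u, of z] unfolding c unfolding uz by simp
  have qQ: "\<forall>t\<in>space M. q t \<in> QN ?N" unfolding q_def using ext_ratio_QN[OF f u] by simp
  have qm: "\<forall>B\<subseteq>V. (\<lambda>t. q t B) \<in> borel_measurable M"
   unfolding q_def using ext_ratio_measurable[OF f u] V z finite_subset by (metis subsetD)
  have de: "de \<in> Den V ?N" unfolding Den_def de_def using one qQ qm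
   by (intro CollectI exI[of _ "\<lambda>_. 1"] exI[of _ q]) auto
  have "r B = ln (1 + de B)" if B: "B \<subseteq> V" for B
  proof -
   have B': "finite B" "z \<notin> B" using B V z finite_subset by auto
   have Z: "0 < Zf B f u" "0 < Zf (insert z B) f u" using Zf_pos f u B' by auto
   have e: "Zf (insert z B) f u = Zf B f u * (1 + de B)"
    using Zf_ratio_eq[OF f u B' V B Q] unfolding c unfolding uz by (simp add: de_def q_def prob_space)
   then have "0 < 1 + de B" using Z by (simp add: zero_less_mult_iff)
   then show ?thesis using Z(1) unfolding r e by (simp add: ln_mult)
  qed
  then show "\<exists>g\<in>{\<lambda>B. ln (1 + g B) | g. g \<in> Den V ?N}. \<forall>B\<subseteq>V. r B = g B"
   using de by (intro bexI[of _ "\<lambda>B. ln (1 + de B)"]) auto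
 qed
qed

text \<open>So far each volume has its own majorant. The supremum over all models lies below every
  one of them, so it is a single function that serves all volumes and still sums to at most
  1/2.\<close>

theorem mob_ln_majorant:
 "\<exists>b. \<forall>V. finite V --> z \<notin> V --> (\<Sum>A\<in>Pow V. b A) \<le> (1/2::real) \<and>
   (\<forall>A\<subseteq>V. \<forall>f u. adm_f f --> adm_u u --> u z = (\<lambda>_. 1) --> \<bar>mob (\<lambda>B. ln (Zf B f u)) (insert z A)\<bar> \<le> b A)"
proof -
 define T where "T A = {\<bar>mob (\<lambda>B. ln (Zf B f u)) (insert z A)\<bar> | f u. adm_f f \<and> adm_u u \<and> u z = (\<lambda>_. 1)}" for A
 have one: "adm_f (\<lambda>_ _ _ _. 1)" "adm_u (\<lambda>_ _. 1)" using eps by (auto simp: adm_f_def adm_u_def)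
 then have Tne: "T A \<noteq> {}" for A unfolding T_def by (auto intro!: exI)
 show ?thesis
 proof (intro exI[of _ "\<lambda>A. Sup (T A)"] allI impI)
  fix V assume V: "finite V" "z \<notin> V"
  obtain b where b: "(\<Sum>A\<in>Pow V. b A) \<le> 1/2"
   "\<forall>g\<in>{\<lambda>B. ln (Zf (insert z B) f u) - ln (Zf B f u) | f u. adm_f f \<and> adm_u u \<and> u z = (\<lambda>_. 1)}. \<forall>A\<subseteq>V. \<bar>mob g A\<bar> \<le> b A"
   using ln_ratio_bd[OF V] unfolding mob_bd_def by blast
  have Tb: "x \<le> b A" if xT: "x \<in> T A" and A: "A \<subseteq> V" for x A
  proof -
   obtain f u where x: "x = \<bar>mob (\<lambda>B. ln (Zf B f u)) (insert z A)\<bar>" "adm_f f" "adm_u u" "u z = (\<lambda>_. 1)"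
    using xT unfolding T_def by blast
   have "\<bar>mob (\<lambda>B. ln (Zf (insert z B) f u) - ln (Zf B f u)) A\<bar> \<le> b A" using b(2) x(2-4) A by blast
   moreover have "finite A" "z \<notin> A" using A V finite_subset by auto
   ultimately show ?thesis unfolding x(1) by (subst (asm) mob_insert_diff)
  qed
  have "(\<Sum>A\<in>Pow V. Sup (T A)) \<le> (\<Sum>A\<in>Pow V. b A)"
   using Tb Tne by (intro sum_mono cSup_least) auto
  moreover have "\<bar>mob (\<lambda>B. ln (Zf B f u)) (insert z A)\<bar> \<le> Sup (T A)"
   if "A \<subseteq> V" "adm_f f" "adm_u u" "u z = (\<lambda>_. 1)" for A f u
   using that Tb[OF _ that(1)] by (intro cSup_upper bdd_aboveI[of _ "b A"]) (auto simp: T_def)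
  ultimately show "(\<Sum>A\<in>Pow V. Sup (T A)) \<le> 1/2 \<and>
   (\<forall>A\<subseteq>V. \<forall>f u. adm_f f --> adm_u u --> u z = (\<lambda>_. 1) --> \<bar>mob (\<lambda>B. ln (Zf B f u)) (insert z A)\<bar> \<le> Sup (T A))"
   using b(1) by auto
 qed
qed

end

section \<open>Plane rotors\<close>

definition md :: "real => real" where
 "md t = t - 2*pi*\<lfloor>t/(2*pi)\<rfloor>"

lemma md_range: "0 \<le> md t" "md t < 2*pi"
proof -
 have p: "0 < 2*pi" by simp
 have f: "of_int \<lfloor>t/(2*pi)\<rfloor> \<le> t/(2*pi)" "t/(2*pi) < of_int \<lfloor>t/(2*pi)\<rfloor> + 1" by linarith+
 have "of_int \<lfloor>t/(2*pi)\<rfloor> * (2*pi) \<le> t" "t < (of_int \<lfloor>t/(2*pi)\<rfloor> + 1) * (2*pi)"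
  by (rule pos_le_divide_eq[OF p, THEN iffD1, OF f(1)] pos_divide_less_eq[OF p, THEN iffD1, OF f(2)])+
 then show "0 \<le> md t" "md t < 2*pi" by (auto simp: md_def algebra_simps)
qed

lemma md_eq: "\<exists>k::int. md t = t + 2*pi* of_int k"
 unfolding md_def by (rule exI[of _ "- \<lfloor>t/(2*pi)\<rfloor>"]) simp

lemma md_add_period: "md (t + 2*pi* of_int k) = md t"
proof -
 have "(t + 2*pi* of_int k)/(2*pi) = t/(2*pi) + of_int k" by (simp add: field_simps)
 then show ?thesis by (simp add: md_def algebra_simps)
qed

lemma md_id: "0 \<le> t ==> t < 2*pi ==> md t = t"
proof -
 assume "0 \<le> t" "t < 2*pi"
 then have "\<lfloor>t/(2*pi)\<rfloor> = 0" by (simp add: floor_eq_iff)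
 then show ?thesis by (simp add: md_def)
qed

lemma md_measurable [measurable]: "md \<in> borel_measurable borel"
 unfolding md_def[abs_def] by measurable

lemma sets_XY_prior [simp, measurable_cong]: "sets XY_prior = sets borel"
 by (simp add: XY_prior_def)

lemma space_XY_prior [simp]: "space XY_prior = UNIV"
 by (simp add: XY_prior_def)

lemma prob_space_XY_prior: "prob_space XY_prior"
 unfolding XY_prior_def by (rule prob_space_uniform_measure) auto

lemma emeasure_XY_prior:
 assumes "A \<in> sets borel"
 shows "emeasure XY_prior A = (\<integral>\<^sup>+t. indicator A t * indicator {0..<2*pi} t \<partial>lborel) / ennreal (2*pi)"
proof -
 have "(\<lambda>t. indicator A t * indicator {0..<2*pi} t :: ennreal) = indicator ({0..<2*pi} \<inter> A)"
  by (auto split: split_indicator)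
 then have "emeasure lborel ({0..<2*pi} \<inter> A) = (\<integral>\<^sup>+t. indicator A t * indicator {0..<2*pi} t \<partial>lborel)"
  using assms by simp
 then show ?thesis using assms by (simp add: XY_prior_def emeasure_uniform_measure)
qed

lemma nn_integral_shift_ivl:
 fixes g :: "real => ennreal"
 assumes [measurable]: "g \<in> borel_measurable borel" and per: "\<And>t. g (t + c) = g t"
 shows "(\<integral>\<^sup>+t. g t * indicator {a+c..<b+c} t \<partial>lborel) = (\<integral>\<^sup>+t. g t * indicator {a..<b} t \<partial>lborel)"
proof -
 have "(\<integral>\<^sup>+t. g t * indicator {a+c..<b+c} t \<partial>lborel) = (\<integral>\<^sup>+t. g (c + 1*t) * indicator {a+c..<b+c} (c + 1*t) \<partial>lborel)"
  by (subst nn_integral_real_affine[where c=1 and t=c]) auto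
 also have "... = (\<integral>\<^sup>+t. g t * indicator {a..<b} t \<partial>lborel)"
  by (intro nn_integral_cong) (auto simp: per add.commute indicator_def)
 finally show ?thesis .
qed

lemma nn_integral_split_ivl:
 fixes g :: "real => ennreal"
 assumes [measurable]: "g \<in> borel_measurable borel" and "a \<le> b" "b \<le> c"
 shows "(\<integral>\<^sup>+t. g t * indicator {a..<c} t \<partial>lborel) =
   (\<integral>\<^sup>+t. g t * indicator {a..<b} t \<partial>lborel) + (\<integral>\<^sup>+t. g t * indicator {b..<c} t \<partial>lborel)"
 using assms by (subst nn_integral_add[symmetric]) (auto intro!: nn_integral_cong split: split_indicator)

lemma nn_integral_period:
 fixes g :: "real => ennreal"
 assumes g[measurable]: "g \<in> borel_measurable borel" and per: "\<And>t. g (t + 2*pi) = g t" and b: "0 \<le> b" "b < 2*pi"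
 shows "(\<integral>\<^sup>+t. g t * indicator {b..<b+2*pi} t \<partial>lborel) = (\<integral>\<^sup>+t. g t * indicator {0..<2*pi} t \<partial>lborel)"
proof -
 have "(\<integral>\<^sup>+t. g t * indicator {2*pi..<b+2*pi} t \<partial>lborel) = (\<integral>\<^sup>+t. g t * indicator {0..<b} t \<partial>lborel)"
  using nn_integral_shift_ivl[OF g per, of 0 b] by simp
 then show ?thesis
  using nn_integral_split_ivl[OF g, of b "2*pi" "b+2*pi"] nn_integral_split_ivl[OF g, of 0 b "2*pi"] b
  by (simp add: add.commute)
qed

lemma XY_prior_shift: "distr XY_prior XY_prior (\<lambda>t. md (t + b)) = XY_prior"
proof (rule measure_eqI)
 fix A assume "A \<in> sets (distr XY_prior XY_prior (\<lambda>t. md (t + b)))"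
 then have A[measurable]: "A \<in> sets borel" by simp
 define b' where "b' = md b"
 have b': "0 \<le> b'" "b' < 2*pi" by (auto simp: b'_def md_range)
 define g where "g t = (indicator A (md t) :: ennreal)" for t
 have g[measurable]: "g \<in> borel_measurable borel" unfolding g_def by measurable
 have per: "g (t + 2*pi) = g t" for t using md_add_period[of t 1] by (simp add: g_def)
 have bb: "md (t + b) = md (t + b')" for t
 proof -
  obtain k :: int where "b' = b + 2*pi* of_int k" using md_eq[of b] unfolding b'_def by auto
  then show ?thesis using md_add_period[of "t+b" k] by (simp add: add.assoc)
 qed
 have "(\<integral>\<^sup>+t. g (t + b') * indicator {0..<2*pi} t \<partial>lborel) = (\<integral>\<^sup>+t. g (b' + 1*t) * indicator {b'..<b'+2*pi} (b' + 1*t) \<partial>lborel)"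
  by (intro nn_integral_cong) (auto simp: add.commute indicator_def)
 also have "... = (\<integral>\<^sup>+t. g t * indicator {b'..<b'+2*pi} t \<partial>lborel)"
  using nn_integral_real_affine[of "\<lambda>t. g t * indicator {b'..<b'+2*pi} t" 1 b'] by simp
 also have "... = (\<integral>\<^sup>+t. g t * indicator {0..<2*pi} t \<partial>lborel)"
  by (rule nn_integral_period[OF g per b'])
 also have "... = (\<integral>\<^sup>+t. indicator A t * indicator {0..<2*pi} t \<partial>lborel)"
  by (intro nn_integral_cong) (auto simp: g_def md_id split: split_indicator)
 finally have eq: "(\<integral>\<^sup>+t. g (t + b') * indicator {0..<2*pi} t \<partial>lborel) = ..." .
 have "emeasure (distr XY_prior XY_prior (\<lambda>t. md (t + b))) A = emeasure XY_prior {t. md (t + b') \<in> A}"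
  by (subst emeasure_distr) (auto simp: bb vimage_def)
 also have "... = (\<integral>\<^sup>+t. indicator {t. md (t + b') \<in> A} t * indicator {0..<2*pi} t \<partial>lborel) / ennreal (2*pi)"
  by (rule emeasure_XY_prior) measurable
 also have "(\<integral>\<^sup>+t. indicator {t. md (t + b') \<in> A} t * indicator {0..<2*pi} t \<partial>lborel) =
   (\<integral>\<^sup>+t. g (t + b') * indicator {0..<2*pi} t \<partial>lborel)"
  by (intro nn_integral_cong) (auto simp: g_def split: split_indicator)
 finally show "emeasure (distr XY_prior XY_prior (\<lambda>t. md (t + b))) A = emeasure XY_prior A"
  unfolding eq using emeasure_XY_prior[OF A] by simp
qed simp

text \<open>Doubling covers the circle twice, which compensates the Jacobian 2. It is needed because
  the map from \<open>(u, v)\<close> to \<open>(u - v, u + v)\<close> has degree 2 on the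
  torus.\<close>

lemma XY_prior_double: "distr XY_prior XY_prior (\<lambda>t. md (2 * t)) = XY_prior"
proof (rule measure_eqI)
 fix A assume "A \<in> sets (distr XY_prior XY_prior (\<lambda>t. md (2 * t)))"
 then have A[measurable]: "A \<in> sets borel" by simp
 define g where "g t = (indicator A (md t) :: ennreal)" for t
 have g[measurable]: "g \<in> borel_measurable borel" unfolding g_def by measurable
 have per: "g (t + 2*pi) = g t" for t using md_add_period[of t 1] by (simp add: g_def)
 let ?I = "\<integral>\<^sup>+t. g t * indicator {0..<2*pi} t \<partial>lborel"
 have "(\<integral>\<^sup>+t. g t * indicator {0..<4*pi} t \<partial>lborel) = ?I + ?I"
  using nn_integral_split_ivl[OF g, of 0 "2*pi" "4*pi"] nn_integral_shift_ivl[OF g per, of 0 "2*pi"] by simp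
 moreover have "(\<integral>\<^sup>+t. g t * indicator {0..<4*pi} t \<partial>lborel) =
   ennreal 2 * (\<integral>\<^sup>+t. g (2 * t) * indicator {0..<4*pi} (2 * t) \<partial>lborel)"
  using nn_integral_real_affine[of "\<lambda>t. g t * indicator {0..<4*pi} t" 2 0] by simp
 moreover have "(\<integral>\<^sup>+t. g (2 * t) * indicator {0..<4*pi} (2 * t) \<partial>lborel) = (\<integral>\<^sup>+t. g (2 * t) * indicator {0..<2*pi} t \<partial>lborel)"
  by (intro nn_integral_cong) (auto simp: indicator_def)
 ultimately have "ennreal 2 * (\<integral>\<^sup>+t. g (2 * t) * indicator {0..<2*pi} t \<partial>lborel) = ?I + ?I"
  by (simp only:)
 also have "?I + ?I = ennreal 2 * ?I" by (simp only: mult_2 ennreal_numeral)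
 finally have "ennreal 2 * (\<integral>\<^sup>+t. g (2 * t) * indicator {0..<2*pi} t \<partial>lborel) = ennreal 2 * ?I" .
 then have "(\<integral>\<^sup>+t. g (2 * t) * indicator {0..<2*pi} t \<partial>lborel) = ?I"
  by (subst (asm) ennreal_mult_cancel_left) auto
 also have "?I = (\<integral>\<^sup>+t. indicator A t * indicator {0..<2*pi} t \<partial>lborel)"
  by (intro nn_integral_cong) (auto simp: g_def md_id split: split_indicator)
 finally have eq: "(\<integral>\<^sup>+t. g (2 * t) * indicator {0..<2*pi} t \<partial>lborel) = ..." .
 have "emeasure (distr XY_prior XY_prior (\<lambda>t. md (2 * t))) A = emeasure XY_prior {t. md (2 * t) \<in> A}"
  by (subst emeasure_distr) (auto simp: vimage_def)
 also have "... = (\<integral>\<^sup>+t. indicator {t. md (2 * t) \<in> A} t * indicator {0..<2*pi} t \<partial>lborel) / ennreal (2*pi)"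
  by (rule emeasure_XY_prior) measurable
 also have "(\<integral>\<^sup>+t. indicator {t. md (2 * t) \<in> A} t * indicator {0..<2*pi} t \<partial>lborel) =
   (\<integral>\<^sup>+t. g (2 * t) * indicator {0..<2*pi} t \<partial>lborel)"
  by (intro nn_integral_cong) (auto simp: g_def split: split_indicator)
 finally show "emeasure (distr XY_prior XY_prior (\<lambda>t. md (2 * t))) A = emeasure XY_prior A"
  unfolding eq using emeasure_XY_prior[OF A] by simp
qed simp

lemma distr_PiM_componentwise:
 assumes L: "finite L" and M: "\<And>x. x \<in> L ==> prob_space (M x)" and N: "\<And>x. prob_space (N x)"
  and f: "\<And>x. x \<in> L ==> f x \<in> measurable (M x) (N x)" and eq: "\<And>x. x \<in> L ==> distr (M x) (N x) (f x) = N x"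
 shows "distr (PiM L M) (PiM L N) (\<lambda>w. \<lambda>x\<in>L. f x (w x)) = PiM L N"
proof -
 \<comment> \<open>Point masses are placed outside \<open>L\<close>, since the product locale asks
   for a sigma-finite measure at every index while \<open>M\<close> is controlled on
   \<open>L\<close> only.\<close>
 define M' where "M' x = (if x \<in> L then M x else return (count_space UNIV) undefined)" for x
 have M': "PiM L M = PiM L M'" by (intro PiM_cong) (auto simp: M'_def)
 interpret M': product_sigma_finite M'
  using M N by (auto simp: product_sigma_finite_def M'_def intro!: prob_space_imp_sigma_finite prob_space_return)
 interpret N: product_sigma_finite N
  using N by (auto simp: product_sigma_finite_def intro!: prob_space_imp_sigma_finite)
 have m: "(\<lambda>w. \<lambda>x\<in>L. f x (w x)) \<in> measurable (PiM L M') (PiM L N)"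
 proof (rule measurable_restrict)
  fix x assume x: "x \<in> L"
  have "f x \<in> measurable (M' x) (N x)" using f[OF x] x by (simp add: M'_def)
  then show "(\<lambda>w. f x (w x)) \<in> measurable (PiM L M') (N x)"
   by (rule measurable_compose[OF measurable_component_singleton[OF x]])
 qed
 show ?thesis unfolding M'
 proof (rule N.PiM_eqI[OF L])
  fix A assume A: "\<And>i. i \<in> L ==> A i \<in> sets (N i)"
  have pre: "(\<lambda>w. \<lambda>x\<in>L. f x (w x)) -` Pi\<^sub>E L A \<inter> space (PiM L M') = Pi\<^sub>E L (\<lambda>x. f x -` A x \<inter> space (M x))"
   by (auto simp: space_PiM PiE_iff M'_def extensional_def)
  have "emeasure (distr (PiM L M') (PiM L N) (\<lambda>w. \<lambda>x\<in>L. f x (w x))) (Pi\<^sub>E L A)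
    = emeasure (PiM L M') (Pi\<^sub>E L (\<lambda>x. f x -` A x \<inter> space (M x)))"
   using A L by (subst emeasure_distr[OF m]) (auto simp: pre intro!: sets_PiM_I_finite)
  also have "... = (\<Prod>x\<in>L. emeasure (M x) (f x -` A x \<inter> space (M x)))"
   using A L f by (subst M'.emeasure_PiM) (auto simp: M'_def intro!: prod.cong measurable_sets)
  also have "... = (\<Prod>x\<in>L. emeasure (N x) (A x))"
  proof (rule prod.cong[OF refl])
   fix x assume x: "x \<in> L"
   have "emeasure (distr (M x) (N x) (f x)) (A x) = emeasure (M x) (f x -` A x \<inter> space (M x))"
    by (rule emeasure_distr[OF f[OF x] A[OF x]])
   then show "emeasure (M x) (f x -` A x \<inter> space (M x)) = emeasure (N x) (A x)" by (simp add: eq[OF x])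
  qed
  finally show "emeasure (distr (PiM L M') (PiM L N) (\<lambda>w. \<lambda>x\<in>L. f x (w x))) (Pi\<^sub>E L A) = (\<Prod>x\<in>L. emeasure (N x) (A x))" .
 qed simp
qed

abbreviation XYP :: "'v set => ('v => real) measure" where
 "XYP L \<equiv> PiM L (\<lambda>_. XY_prior)"

lemma prob_space_XYP: "prob_space (XYP L)"
 by (intro prob_space_PiM prob_space_XY_prior)

text \<open>The integer coefficients make cosines of \<open>lin\<close> insensitive to reducing
  angles modulo \<open>2*pi\<close>: these are the characters of the torus.\<close>

definition lin :: "'v set => ('v => int) => ('v => real) => real" where
 "lin L k w = (\<Sum>x\<in>L. of_int (k x) * w x)"

lemma lin_measurable [measurable]: "lin L k \<in> borel_measurable (XYP L)"
proof -
 have "(\<lambda>w. w x) \<in> borel_measurable (XYP L)" if "x \<in> L" for x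
  using measurable_component_singleton[OF that, of "\<lambda>_. XY_prior"] by (simp cong: measurable_cong_sets)
 then show ?thesis unfolding lin_def[abs_def] by (intro borel_measurable_sum borel_measurable_times) auto
qed

lemma lin_add: "lin L k (\<lambda>x. v x + w x) = lin L k v + lin L k w"
 by (simp add: lin_def sum.distrib distrib_left)

lemma lin_scale: "lin L k (\<lambda>x. c * w x) = c * lin L k w"
 by (simp add: lin_def sum_distrib_left algebra_simps)

lemma cos_add_int_period: "cos (t + 2*pi* of_int n) = cos t"
 using cos.plus_of_int[of t n] by (simp add: mult.commute)

lemma cos_lin_md: "cos (lin L k (\<lambda>x\<in>L. md (f x)) + c) = cos (lin L k f + c)"
proof -
 have "\<forall>x. \<exists>n::int. md (f x) = f x + 2*pi* of_int n" using md_eq by blast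
 then obtain n :: "'a => int" where n: "\<And>x. md (f x) = f x + 2*pi* of_int (n x)" by metis
 have "lin L k (\<lambda>x\<in>L. md (f x)) = (\<Sum>x\<in>L. of_int (k x) * f x + 2*pi* of_int (k x * n x))"
  unfolding lin_def by (intro sum.cong) (auto simp: n algebra_simps)
 also have "... = lin L k f + 2*pi* of_int (\<Sum>x\<in>L. k x * n x)"
  by (simp add: lin_def sum.distrib sum_distrib_left)
 finally have "lin L k (\<lambda>x\<in>L. md (f x)) + c = (lin L k f + c) + 2*pi* of_int (\<Sum>x\<in>L. k x * n x)" by simp
 then show ?thesis by (simp only: cos_add_int_period)
qed

lemma XYP_shift:
 fixes h :: "('v => real) => real"
 assumes "finite L" "h \<in> borel_measurable (XYP L)"
 shows "(\<integral>w. h w \<partial>XYP L) = (\<integral>w. h (\<lambda>x\<in>L. md (w x + b x)) \<partial>XYP L)"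
proof -
 have d: "distr (XYP L) (XYP L) (\<lambda>w. \<lambda>x\<in>L. md (w x + b x)) = XYP L"
  using assms by (intro distr_PiM_componentwise[where f="\<lambda>x t. md (t + b x)"] prob_space_XY_prior XY_prior_shift) auto
 have "(\<integral>w. h w \<partial>XYP L) = (\<integral>w. h w \<partial>distr (XYP L) (XYP L) (\<lambda>w. \<lambda>x\<in>L. md (w x + b x)))" unfolding d ..
 also have "... = (\<integral>w. h (\<lambda>x\<in>L. md (w x + b x)) \<partial>XYP L)"
  using assms by (intro integral_distr measurable_restrict) auto
 finally show ?thesis .
qed

lemma XYP_double:
 fixes h :: "('v => real) => real"
 assumes "finite L" "h \<in> borel_measurable (XYP L)"
 shows "(\<integral>w. h w \<partial>XYP L) = (\<integral>w. h (\<lambda>x\<in>L. md (2 * w x)) \<partial>XYP L)"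
proof -
 have d: "distr (XYP L) (XYP L) (\<lambda>w. \<lambda>x\<in>L. md (2 * w x)) = XYP L"
  using assms by (intro distr_PiM_componentwise[where f="\<lambda>x t. md (2 * t)"] prob_space_XY_prior XY_prior_double) auto
 have "(\<integral>w. h w \<partial>XYP L) = (\<integral>w. h w \<partial>distr (XYP L) (XYP L) (\<lambda>w. \<lambda>x\<in>L. md (2 * w x)))" unfolding d ..
 also have "... = (\<integral>w. h (\<lambda>x\<in>L. md (2 * w x)) \<partial>XYP L)"
  using assms by (intro integral_distr measurable_restrict) auto
 finally show ?thesis .
qed

section \<open>Positive definite kernels and the phase inequality\<close>

lemma (in prob_space) integrable_bounded:
 fixes f :: "'a => real"
 shows "f \<in> borel_measurable M ==> (\<And>x. x \<in> space M ==> \<bar>f x\<bar> \<le> B) ==> integrable M f"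
 by (rule integrable_const_bound[of _ B]) auto

context pair_prob_space
begin

lemma Fubini_bounded:
 fixes F :: "'a => 'b => real"
 assumes "case_prod F \<in> borel_measurable (M1 \<Otimes>\<^sub>M M2)" "\<And>x y. \<bar>F x y\<bar> \<le> B"
 shows "(\<integral>x. \<integral>y. F x y \<partial>M2 \<partial>M1) = (\<integral>y. \<integral>x. F x y \<partial>M1 \<partial>M2)"
  "(\<integral>x. \<integral>y. F x y \<partial>M2 \<partial>M1) = (\<integral>(x, y). F x y \<partial>(M1 \<Otimes>\<^sub>M M2))"
proof -
 have i: "integrable (M1 \<Otimes>\<^sub>M M2) (case_prod F)" using assms by (intro integrable_bounded[of _ B]) auto
 show "(\<integral>x. \<integral>y. F x y \<partial>M2 \<partial>M1) = (\<integral>y. \<integral>x. F x y \<partial>M1 \<partial>M2)" using Fubini_integral[OF i] by simp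
 show "(\<integral>x. \<integral>y. F x y \<partial>M2 \<partial>M1) = (\<integral>(x, y). F x y \<partial>(M1 \<Otimes>\<^sub>M M2))" using integral_fst'[OF i] by simp
qed

end

text \<open>One factor of the kernel splits into terms \<open>b e * C e u * C e v\<close>. Absorbing
  \<open>C e\<close> into \<open>s\<close> leaves an integral of the same form with a smaller power,
  and the power 0 gives a square.\<close>

lemma pos_def_power:
 fixes s :: "'b => real"
 assumes P: "prob_space P" and E: "finite E" and b: "\<And>e. e \<in> E ==> 0 \<le> b e"
  and C: "\<And>e. e \<in> E ==> C e \<in> borel_measurable P" "\<And>e u. e \<in> E ==> \<bar>C e u\<bar> \<le> 1"
  and s: "s \<in> borel_measurable P" "\<And>u. \<bar>s u\<bar> \<le> 1"
 shows "0 \<le> (\<integral>(u, v). s u * s v * (\<Sum>e\<in>E. b e * C e u * C e v)^n \<partial>(P \<Otimes>\<^sub>M P))"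
 using s
proof (induction n arbitrary: s)
 interpret P: prob_space P by fact
 interpret PP: pair_prob_space P P ..
 {
  case 0
  note [measurable] = 0(1)
  have "(\<integral>(u, v). s u * s v \<partial>(P \<Otimes>\<^sub>M P)) = (\<integral>u. \<integral>v. s u * s v \<partial>P \<partial>P)"
   using 0(2) by (subst PP.Fubini_bounded(2)[of _ 1]) (auto simp: abs_mult intro!: mult_le_one)
  also have "... = (\<integral>u. s u \<partial>P) * (\<integral>u. s u \<partial>P)" by simp
  also have "... \<ge> 0" by simp
  finally show ?case by simp
 next
  case (Suc n)
  note [measurable] = Suc(2) C(1)
  let ?K = "\<lambda>u v. \<Sum>e\<in>E. b e * C e u * C e v"
  have Kb: "\<bar>?K u v\<bar> \<le> (\<Sum>e\<in>E. b e)" for u v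
  proof (rule order_trans[OF sum_abs], rule sum_mono)
   fix e assume e: "e \<in> E"
   have "\<bar>C e u\<bar> * \<bar>C e v\<bar> \<le> 1 * 1" using C(2)[OF e] by (intro mult_mono) auto
   then show "\<bar>b e * C e u * C e v\<bar> \<le> b e" using b[OF e] by (simp add: abs_mult mult.assoc mult_left_le)
  qed
  have Km: "(\<lambda>(u, v). ?K u v) \<in> borel_measurable (P \<Otimes>\<^sub>M P)"
   unfolding case_prod_beta using C(1) by (intro borel_measurable_sum borel_measurable_times) auto
  have sb: "\<bar>s u * C e u\<bar> \<le> 1" if "e \<in> E" for e u
   using Suc(3)[of u] C(2)[OF that, of u] by (simp add: abs_mult mult_le_one)
  have sm: "(\<lambda>u. s u * C e u) \<in> borel_measurable P" if "e \<in> E" for e using that by measurable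
  let ?F = "\<lambda>e u v. (s u * C e u) * (s v * C e v) * ?K u v ^ n"
  have i: "integrable (P \<Otimes>\<^sub>M P) (\<lambda>(u,v). ?F e u v)" if e: "e \<in> E" for e
  proof (rule PP.integrable_bounded[of _ "(\<Sum>e\<in>E. b e)^n"])
   have "(\<lambda>p. (s (fst p) * C e (fst p)) * (s (snd p) * C e (snd p)) * (case p of (u, v) => ?K u v) ^ n) \<in> borel_measurable (P \<Otimes>\<^sub>M P)"
    using sm[OF e] by (intro borel_measurable_times borel_measurable_power Km)
      (auto intro: measurable_compose[OF measurable_fst] measurable_compose[OF measurable_snd] simp: e)
   then show "(\<lambda>(u,v). ?F e u v) \<in> borel_measurable (P \<Otimes>\<^sub>M P)" by (simp add: case_prod_beta)
   fix p
   have "\<bar>?F e (fst p) (snd p)\<bar> \<le> 1 * 1 * (\<Sum>e\<in>E. b e)^n"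
    unfolding abs_mult power_abs using sb[OF e] Kb
    by (intro mult_mono power_mono) (auto simp: abs_mult intro!: mult_nonneg_nonneg)
   then show "\<bar>case p of (u,v) => ?F e u v\<bar> \<le> (\<Sum>e\<in>E. b e)^n" by (simp add: case_prod_beta)
  qed
  have "(\<integral>(u, v). s u * s v * ?K u v ^ Suc n \<partial>(P \<Otimes>\<^sub>M P)) = (\<integral>p. (\<Sum>e\<in>E. b e * (case p of (u,v) => ?F e u v)) \<partial>(P \<Otimes>\<^sub>M P))"
   by (intro Bochner_Integration.integral_cong) (auto simp: sum_distrib_left sum_distrib_right algebra_simps)
  also have "... = (\<Sum>e\<in>E. b e * (\<integral>p. (case p of (u,v) => ?F e u v) \<partial>(P \<Otimes>\<^sub>M P)))"
   using i by (subst Bochner_Integration.integral_sum) auto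
  also have "... \<ge> 0"
   using b Suc.IH[OF sm sb] by (intro sum_nonneg mult_nonneg_nonneg) auto
  finally show ?case .
 }
qed

lemma pos_def_exp:
 fixes s :: "'b => real"
 assumes P: "prob_space P" and E: "finite E" and b: "\<And>e. e \<in> E ==> 0 \<le> b e"
  and C: "\<And>e. e \<in> E ==> C e \<in> borel_measurable P" "\<And>e u. e \<in> E ==> \<bar>C e u\<bar> \<le> 1"
  and s: "s \<in> borel_measurable P" "\<And>u. \<bar>s u\<bar> \<le> 1"
 shows "0 \<le> (\<integral>(u, v). s u * s v * exp (\<Sum>e\<in>E. b e * C e u * C e v) \<partial>(P \<Otimes>\<^sub>M P))"
proof -
 interpret P: prob_space P by fact
 interpret PP: pair_prob_space P P ..
 let ?K = "\<lambda>p. \<Sum>e\<in>E. b e * C e (fst p) * C e (snd p)"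
 let ?B = "\<Sum>e\<in>E. b e"
 have Kb: "\<bar>?K p\<bar> \<le> ?B" for p
 proof (rule order_trans[OF sum_abs], rule sum_mono)
  fix e assume e: "e \<in> E"
  have "\<bar>C e (fst p)\<bar> * \<bar>C e (snd p)\<bar> \<le> 1 * 1" using C(2)[OF e] by (intro mult_mono) auto
  then show "\<bar>b e * C e (fst p) * C e (snd p)\<bar> \<le> b e" using b[OF e] by (simp add: abs_mult mult.assoc mult_left_le)
 qed
 note [measurable] = C(1) s(1)
 have Km[measurable]: "?K \<in> borel_measurable (P \<Otimes>\<^sub>M P)"
  using C(1) by (intro borel_measurable_sum borel_measurable_times) auto
 let ?f = "\<lambda>N p. s (fst p) * s (snd p) * (\<Sum>n<N. ?K p ^ n /\<^sub>R fact n)"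
 let ?g = "\<lambda>p. s (fst p) * s (snd p) * exp (?K p)"
 have ss: "\<bar>s u * s v\<bar> \<le> 1" for u v using s(2)[of u] s(2)[of v] by (simp add: abs_mult mult_le_one)
 have lim: "(\<lambda>N. \<integral>p. ?f N p \<partial>(P \<Otimes>\<^sub>M P)) \<longlonglongrightarrow> (\<integral>p. ?g p \<partial>(P \<Otimes>\<^sub>M P))"
 proof (rule integral_dominated_convergence[where w="\<lambda>_. exp ?B"])
  show "AE p in P \<Otimes>\<^sub>M P. (\<lambda>N. ?f N p) \<longlonglongrightarrow> ?g p"
  proof (rule AE_I2)
   fix p show "(\<lambda>N. ?f N p) \<longlonglongrightarrow> ?g p"
    using exp_converges[of "?K p"] unfolding sums_def by (intro tendsto_mult tendsto_const)
  qed
  fix N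
  show "AE p in P \<Otimes>\<^sub>M P. norm (?f N p) \<le> exp ?B"
  proof (rule AE_I2)
   fix p
   have "\<bar>\<Sum>n<N. ?K p ^ n /\<^sub>R fact n\<bar> \<le> (\<Sum>n<N. ?B ^ n /\<^sub>R fact n)"
   proof (rule order_trans[OF sum_abs], rule sum_mono)
    fix n
    have "\<bar>?K p\<bar>^n \<le> ?B^n" using Kb by (intro power_mono) auto
    then show "\<bar>?K p ^ n /\<^sub>R fact n\<bar> \<le> ?B ^ n /\<^sub>R fact n" by (simp add: abs_mult power_abs mult_left_mono)
   qed
   also have "... \<le> exp ?B"
   proof -
    have B0: "0 \<le> ?B" using b by (intro sum_nonneg) auto
    have "(\<Sum>n<N. ?B ^ n /\<^sub>R fact n) \<le> (\<Sum>n. ?B ^ n /\<^sub>R fact n)"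
     by (rule sum_le_suminf[OF sums_summable[OF exp_converges]]) (use B0 in auto)
    also have "... = exp ?B" by (rule sums_unique[OF exp_converges, symmetric])
    finally show ?thesis .
   qed
   finally have "\<bar>s (fst p) * s (snd p)\<bar> * \<bar>\<Sum>n<N. ?K p ^ n /\<^sub>R fact n\<bar> \<le> 1 * exp ?B"
    using ss by (intro mult_mono) auto
   then show "norm (?f N p) \<le> exp ?B" by (simp add: abs_mult)
  qed
 qed (auto intro!: borel_measurable_times borel_measurable_sum borel_measurable_scaleR borel_measurable_power Km measurable_compose[OF measurable_fst] measurable_compose[OF measurable_snd] measurable_compose[OF Km] s)
 have "0 \<le> (\<integral>p. ?f N p \<partial>(P \<Otimes>\<^sub>M P))" for N
 proof -
  have i: "integrable (P \<Otimes>\<^sub>M P) (\<lambda>p. s (fst p) * s (snd p) * ?K p ^ n)" for n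
  proof (rule PP.integrable_bounded[of _ "?B ^ n"])
   fix p
   have "\<bar>s (fst p) * s (snd p)\<bar> * \<bar>?K p\<bar> ^ n \<le> 1 * ?B^n"
    using ss Kb by (intro mult_mono power_mono) auto
   then show "\<bar>s (fst p) * s (snd p) * ?K p ^ n\<bar> \<le> ?B ^ n" by (simp add: abs_mult power_abs)
  qed measurable
  have "(\<integral>p. ?f N p \<partial>(P \<Otimes>\<^sub>M P)) = (\<integral>p. (\<Sum>n<N. inverse (fact n) * (s (fst p) * s (snd p) * ?K p ^ n)) \<partial>(P \<Otimes>\<^sub>M P))"
   by (intro Bochner_Integration.integral_cong) (auto simp: sum_distrib_left algebra_simps)
  also have "... = (\<Sum>n<N. inverse (fact n) * (\<integral>p. s (fst p) * s (snd p) * ?K p ^ n \<partial>(P \<Otimes>\<^sub>M P)))"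
   using i by (subst Bochner_Integration.integral_sum) auto
  also have "... \<ge> 0"
  proof (intro sum_nonneg mult_nonneg_nonneg)
   show "0 \<le> (\<integral>p. s (fst p) * s (snd p) * ?K p ^ n \<partial>(P \<Otimes>\<^sub>M P))" for n
    using pos_def_power[where b=b and C=C and E=E and P=P and s=s and n=n, OF P E b C s] by (simp add: case_prod_unfold)
  qed simp
  finally show ?thesis .
 qed
 then have "0 \<le> (\<integral>p. ?g p \<partial>(P \<Otimes>\<^sub>M P))" by (intro LIMSEQ_le_const[OF lim]) auto
 then show ?thesis by (simp add: case_prod_unfold)
qed

text \<open>The phase is shared equally by the two copies, so that one and the same function appears
  at \<open>x\<close> and at \<open>y\<close>, as positive definiteness requires.\<close>

lemma cos_diff_product: "cos (x - y) - cos (x + y + c) = 2 * (sin (x + c/2) * sin (y + c/2))" for x y c :: real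
proof -
 have "cos ((x + c/2) - (y + c/2)) - cos ((x + c/2) + (y + c/2)) = 2 * (sin (x + c/2) * sin (y + c/2))"
  by (simp only: cos_diff cos_add)
 then show ?thesis by (simp add: algebra_simps)
qed

lemma cos_sum_product: "cos (x - y) + cos (x + y + c) = 2 * (cos (x + c/2) * cos (y + c/2))" for x y c :: real
proof -
 have "cos ((x + c/2) - (y + c/2)) + cos ((x + c/2) + (y + c/2)) = 2 * (cos (x + c/2) * cos (y + c/2))"
  by (simp only: cos_diff cos_add)
 then show ?thesis by (simp add: algebra_simps)
qed

text \<open>Phases in the interaction and in the observable can only decrease correlations
 (Messager, Miracle-Sole and Pfister).  Rotating the doubled system to \<open>(u - v, u + v)\<close> turns the
 difference of the two sides into the integral of a positive definite kernel.\<close>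
lemma phase_domination:
 fixes L :: "'v set" and k :: "'e => 'v => int" and om :: "'e => real"
 assumes L: "finite L" and E: "finite E" and b: "\<And>e. e \<in> E ==> 0 \<le> b e"
 defines "W \<equiv> \<lambda>om th. exp (\<Sum>e\<in>E. b e * cos (lin L (k e) th + om e))"
 shows "(\<integral>th. W om th * cos (lin L a th + c) \<partial>XYP L) * (\<integral>th. W (\<lambda>_. 0) th \<partial>XYP L)
   \<le> (\<integral>th. W (\<lambda>_. 0) th * cos (lin L a th) \<partial>XYP L) * (\<integral>th. W om th \<partial>XYP L)"
proof -
 let ?P = "XYP L"
 interpret P: prob_space ?P by (rule prob_space_XYP)
 interpret PP: pair_prob_space ?P ?P ..
 \<comment> \<open>\<open>G\<close> receives the shifted characters of the two copies as arguments,
   so a change of variables merely replaces the cosines inside.\<close>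
 define G where "G A B = (A a 0 - B a c) * exp (\<Sum>e\<in>E. b e * (A (k e) 0 + B (k e) (om e)))"
  for A B :: "('v => int) => real => real"
 define cs where "cs th = (\<lambda>k c. cos (lin L k th + c))" for th
 define BB where "BB = 2 * exp (\<Sum>e\<in>E. b e * 2)"
 have Gb: "\<bar>G A B\<bar> \<le> BB" if "\<And>k c. \<bar>A k c\<bar> \<le> 1" "\<And>k c. \<bar>B k c\<bar> \<le> 1" for A B
 proof -
  have "\<bar>A a 0 - B a c\<bar> \<le> 2" using that(1)[of a 0] that(2)[of a c] by linarith
  moreover have "(\<Sum>e\<in>E. b e * (A (k e) 0 + B (k e) (om e))) \<le> (\<Sum>e\<in>E. b e * 2)"
  proof (intro sum_mono mult_left_mono b)
   fix e show "A (k e) 0 + B (k e) (om e) \<le> 2" using that(1)[of "k e" 0] that(2)[of "k e" "om e"] by linarith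
  qed
  ultimately show ?thesis unfolding G_def BB_def by (auto simp: abs_mult intro!: mult_mono)
 qed
 have W_int: "integrable ?P (W om')" "integrable ?P (\<lambda>th. W om' th * cos (lin L a th + c'))" for om' c'
 proof -
  have Wm: "W om' \<in> borel_measurable ?P" unfolding W_def by measurable
  have Wb: "\<bar>W om' th\<bar> \<le> exp (\<Sum>e\<in>E. b e)" for th
   unfolding W_def using b by (auto intro!: sum_mono mult_left_le)
  show "integrable ?P (W om')" using Wm Wb by (rule P.integrable_bounded)
  show "integrable ?P (\<lambda>th. W om' th * cos (lin L a th + c'))"
  proof (rule P.integrable_bounded)
   show "\<bar>W om' th * cos (lin L a th + c')\<bar> \<le> exp (\<Sum>e\<in>E. b e) * 1" for th
    using Wb[of th] unfolding abs_mult by (intro mult_mono) auto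
  qed (use Wm in measurable)
 qed
 have Geq: "G (cs th) (cs th') = (cos (lin L a th) - cos (lin L a th' + c)) * (W (\<lambda>_. 0) th * W om th')" for th th'
  by (simp add: G_def cs_def W_def exp_add[symmetric] sum.distrib distrib_left)
 have "(\<integral>th. (\<integral>th'. G (cs th) (cs th') \<partial>?P) \<partial>?P)
   = (\<integral>th. (W (\<lambda>_. 0) th * cos (lin L a th)) * (\<integral>th'. W om th' \<partial>?P) -
      W (\<lambda>_. 0) th * (\<integral>th'. W om th' * cos (lin L a th' + c) \<partial>?P) \<partial>?P)"
 proof (rule Bochner_Integration.integral_cong[OF refl])
  fix th
  have "(\<integral>th'. G (cs th) (cs th') \<partial>?P) = (\<integral>th'. (W (\<lambda>_. 0) th * cos (lin L a th)) * W om th' -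
    W (\<lambda>_. 0) th * (W om th' * cos (lin L a th' + c)) \<partial>?P)"
   unfolding Geq by (intro Bochner_Integration.integral_cong) (auto simp: algebra_simps)
  also have "... = (W (\<lambda>_. 0) th * cos (lin L a th)) * (\<integral>th'. W om th' \<partial>?P) -
      W (\<lambda>_. 0) th * (\<integral>th'. W om th' * cos (lin L a th' + c) \<partial>?P)"
   using W_int by (subst Bochner_Integration.integral_diff) auto
  finally show "(\<integral>th'. G (cs th) (cs th') \<partial>?P) = ..." .
 qed
 also have "... = (\<integral>th. W (\<lambda>_. 0) th * cos (lin L a th) \<partial>?P) * (\<integral>th'. W om th' \<partial>?P) -
    (\<integral>th. W (\<lambda>_. 0) th \<partial>?P) * (\<integral>th'. W om th' * cos (lin L a th' + c) \<partial>?P)"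
  using W_int(2)[of "\<lambda>_. 0" 0] W_int(1)[of "\<lambda>_. 0"] by (subst Bochner_Integration.integral_diff) auto
 finally have total: "(\<integral>th. (\<integral>th'. G (cs th) (cs th') \<partial>?P) \<partial>?P) = ..." .
 \<comment> \<open>The measure-preserving substitutions \<open>v := v + u\<close>,
   \<open>v := 2 * v\<close> and \<open>u := u - v\<close>, in the order \<open>s3\<close>,
   \<open>s2\<close>, \<open>s1\<close>, compose to \<open>(u - v, u + v)\<close>.\<close>
 have s3: "(\<integral>v. G (cs u) (cs v) \<partial>?P) = (\<integral>v. G (cs u) (\<lambda>k c. cos (lin L k v + (lin L k u + c))) \<partial>?P)" for u
 proof -
  have "(\<lambda>v. G (cs u) (cs v)) \<in> borel_measurable ?P" unfolding G_def cs_def by measurable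
  from XYP_shift[OF L this, of u] show ?thesis
   by (simp add: cs_def cos_lin_md lin_add add.assoc)
 qed
 have s2: "(\<integral>v. G (cs u) (\<lambda>k c. cos (lin L k v + (lin L k u + c))) \<partial>?P) =
   (\<integral>v. G (cs u) (\<lambda>k c. cos (lin L k u + (2 * lin L k v + c))) \<partial>?P)" for u
 proof -
  have "(\<lambda>v. G (cs u) (\<lambda>k c. cos (lin L k v + (lin L k u + c)))) \<in> borel_measurable ?P" unfolding G_def cs_def by measurable
  from XYP_double[OF L this]
  have "(\<integral>v. G (cs u) (\<lambda>k c. cos (lin L k v + (lin L k u + c))) \<partial>?P) =
   (\<integral>v. G (cs u) (\<lambda>k c. cos (2 * lin L k v + (lin L k u + c))) \<partial>?P)"
   by (simp only: cos_lin_md lin_scale)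
  moreover have "2 * lin L k v + (lin L k u + c) = lin L k u + (2 * lin L k v + c)" for v k c by simp
  ultimately show ?thesis by presburger
 qed
 have s1: "(\<integral>u. G (cs u) (\<lambda>k c. cos (lin L k u + (2 * lin L k v + c))) \<partial>?P) =
   (\<integral>u. G (\<lambda>k c. cos (lin L k u - lin L k v + c)) (\<lambda>k c. cos (lin L k u + lin L k v + c)) \<partial>?P)" for v
 proof -
  have m: "(\<lambda>u. G (cs u) (\<lambda>k c. cos (lin L k u + (2 * lin L k v + c)))) \<in> borel_measurable ?P" unfolding G_def cs_def by measurable
  have n: "lin L k (\<lambda>x. u x + - v x) = lin L k u - lin L k v" for u k
   using lin_add[of L k u "\<lambda>x. (-1) * v x"] lin_scale[of L k "-1" v] by simp
  have "cos (lin L k u - lin L k v + (2 * lin L k v + c)) = cos (lin L k u + lin L k v + c)" for u k c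
   by (rule arg_cong[where f=cos]) simp
  then show ?thesis using XYP_shift[OF L m, of "\<lambda>x. - v x"]
   by (simp only: cs_def cos_lin_md n)
 qed
 have "(\<integral>u. (\<integral>v. G (cs u) (cs v) \<partial>?P) \<partial>?P) = (\<integral>u. (\<integral>v. G (cs u) (\<lambda>k c. cos (lin L k u + (2 * lin L k v + c))) \<partial>?P) \<partial>?P)"
  unfolding s3 s2 ..
 also have "... = (\<integral>v. (\<integral>u. G (cs u) (\<lambda>k c. cos (lin L k u + (2 * lin L k v + c))) \<partial>?P) \<partial>?P)"
 proof (rule PP.Fubini_bounded(1))
  show "(\<lambda>(u, v). G (cs u) (\<lambda>k c. cos (lin L k u + (2 * lin L k v + c)))) \<in> borel_measurable (?P \<Otimes>\<^sub>M ?P)"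
   unfolding G_def cs_def by measurable
 qed (rule Gb, auto simp: cs_def)
 also have "... = (\<integral>v. (\<integral>u. G (\<lambda>k c. cos (lin L k u - lin L k v + c)) (\<lambda>k c. cos (lin L k u + lin L k v + c)) \<partial>?P) \<partial>?P)"
  unfolding s1 ..
 also have "... = (\<integral>(v, u). G (\<lambda>k c. cos (lin L k u - lin L k v + c)) (\<lambda>k c. cos (lin L k u + lin L k v + c)) \<partial>(?P \<Otimes>\<^sub>M ?P))"
 proof (rule PP.Fubini_bounded(2))
  show "(\<lambda>(v, u). G (\<lambda>k c. cos (lin L k u - lin L k v + c)) (\<lambda>k c. cos (lin L k u + lin L k v + c))) \<in> borel_measurable (?P \<Otimes>\<^sub>M ?P)"
   unfolding G_def by measurable
 qed (rule Gb, auto)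
 also have "... = (\<integral>p. 2 * (case p of (u, v) => sin (lin L a u + c/2) * sin (lin L a v + c/2) *
    exp (\<Sum>e\<in>E. (2 * b e) * cos (lin L (k e) u + om e/2) * cos (lin L (k e) v + om e/2))) \<partial>(?P \<Otimes>\<^sub>M ?P))"
 proof (rule Bochner_Integration.integral_cong[OF refl], clarify)
  fix v u
  have "cos (lin L (k e) u - lin L (k e) v) + cos (lin L (k e) u + lin L (k e) v + om e)
   = 2 * (cos (lin L (k e) u + om e/2) * cos (lin L (k e) v + om e/2))" for e
   by (rule cos_sum_product)
  moreover have "cos (lin L a u - lin L a v) - cos (lin L a u + lin L a v + c) = 2 * (sin (lin L a u + c/2) * sin (lin L a v + c/2))"
   by (rule cos_diff_product)
  ultimately show "G (\<lambda>k c. cos (lin L k u - lin L k v + c)) (\<lambda>k c. cos (lin L k u + lin L k v + c)) =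
   2 * (sin (lin L a v + c/2) * sin (lin L a u + c/2) *
    exp (\<Sum>e\<in>E. (2 * b e) * cos (lin L (k e) v + om e/2) * cos (lin L (k e) u + om e/2)))"
   by (simp add: G_def algebra_simps)
 qed
 also have "... = 2 * (\<integral>(u, v). sin (lin L a u + c/2) * sin (lin L a v + c/2) *
    exp (\<Sum>e\<in>E. (2 * b e) * cos (lin L (k e) u + om e/2) * cos (lin L (k e) v + om e/2)) \<partial>(?P \<Otimes>\<^sub>M ?P))"
  by (rule integral_mult_right_zero)
 also have "... \<ge> 0"
  using b by (intro mult_nonneg_nonneg pos_def_exp P.prob_space_axioms E) auto
 finally show ?thesis using total by (simp add: mult.commute)
qed

section \<open>Gibbs specifications\<close>

definition avg :: "'s measure => ('d site set => ('d site => 's) => real)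
  => 'd site set => (('d site => 's) => real) => ('d site => 's) => real" where
 "avg nu H L g w =
   (\<integral>s. exp (- H L (merge_conf L s w)) * g (merge_conf L s w) \<partial>(PiM L (\<lambda>_. nu)))
   / (\<integral>s. exp (- H L (merge_conf L s w)) \<partial>(PiM L (\<lambda>_. nu)))"

lemma spec_eq_avg: "spec nu H L E w = avg nu H L (indicator E) w"
 by (simp add: spec_def avg_def)

lemma merge_conf_merge_conf: "merge_conf L s (merge_conf L t w) = merge_conf L s w"
 by (auto simp: merge_conf_def)

lemma integral_pos_prob':
 fixes g :: "'b => real"
 assumes "prob_space N" "integrable N g" "\<And>x. x \<in> space N ==> 0 < c \<and> c \<le> g x"
 shows "0 < (\<integral>x. g x \<partial>N)"
proof -
 interpret N: prob_space N by fact
 obtain x where "x \<in> space N" using N.not_empty by blast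
 then have "0 < c" using assms(3) by blast
 also have "c = (\<integral>x. c \<partial>N)" by (simp add: N.prob_space)
 also have "... \<le> (\<integral>x. g x \<partial>N)" using assms by (intro integral_mono) auto
 finally show ?thesis .
qed

text \<open>Only regularity of the Hamiltonian is assumed; consistency between two volumes is a
  hypothesis of \<open>avg_consistent\<close>. This admits the family \<open>H'\<close> of
  \<open>avg_defect\<close>, which is built for one pair of volumes.\<close>

locale gibbs_spec = nu: prob_space nu for nu :: "'s measure" +
 fixes H :: "'d site set => ('d site => 's) => real"
 assumes H_measurable: "finite L ==> H L \<in> borel_measurable (conf_space nu)"
  and H_bounded: "finite L ==> \<exists>C. \<forall>w\<in>space (conf_space nu). \<bar>H L w\<bar> \<le> C"
begin

abbreviation "CS \<equiv> (conf_space nu :: ('d site => 's) measure)"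
abbreviation "P \<equiv> (\<lambda>L::'d site set. PiM L (\<lambda>_. nu))"

lemma prob_P: "prob_space (P L)"
 by (intro prob_space_PiM nu.prob_space_axioms)

lemma space_CS: "w \<in> space CS \<longleftrightarrow> (\<forall>x. w x \<in> space nu)"
 by (auto simp: conf_space_def space_PiM)

lemma CS_nonempty: "space CS \<noteq> {}"
 using nu.not_empty by (simp add: conf_space_def space_PiM PiE_eq_empty_iff)

lemma measurable_merge_conf: "(\<lambda>(s, w). merge_conf L s w) \<in> measurable (P L \<Otimes>\<^sub>M CS) CS"
proof -
 have "(\<lambda>p. merge_conf L (fst p) (snd p) x) \<in> measurable (P L \<Otimes>\<^sub>M PiM UNIV (\<lambda>_. nu)) nu" for x
  by (cases "x \<in> L") (simp_all add: merge_conf_def)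
 then show ?thesis unfolding conf_space_def case_prod_beta
  by (intro measurable_PiM_single') (auto simp: space_pair_measure space_PiM merge_conf_def PiE_iff)
qed

lemma measurable_merge_conf1: "w \<in> space CS ==> (\<lambda>s. merge_conf L s w) \<in> measurable (P L) CS"
 using measurable_compose[OF _ measurable_merge_conf, of "\<lambda>s. (s, w)" "P L" L] by simp

lemma merge_conf_space: "s \<in> space (P L) ==> w \<in> space CS ==> merge_conf L s w \<in> space CS"
 by (auto simp: space_CS merge_conf_def space_PiM)

lemma exp_H_bounds:
 assumes "finite L"
 obtains C where "0 < C" "\<And>w. w \<in> space CS ==> exp (- C) \<le> exp (- H L w) \<and> exp (- H L w) \<le> exp C"
proof -
 obtain C where "\<forall>w\<in>space CS. \<bar>H L w\<bar> \<le> C" using H_bounded[OF assms] by blast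
 then have "exp (- \<bar>C\<bar> - 1) \<le> exp (- H L w) \<and> exp (- H L w) \<le> exp (\<bar>C\<bar> + 1)" if "w \<in> space CS" for w
  using that by force
 then show ?thesis using that[of "\<bar>C\<bar> + 1"] by simp
qed

lemma num_measurable2:
 assumes "finite L" and g: "g \<in> borel_measurable CS"
 shows "(\<lambda>(w, s). exp (- H L (merge_conf L s w)) * g (merge_conf L s w)) \<in> borel_measurable (CS \<Otimes>\<^sub>M P L)"
proof -
 have "(\<lambda>v. exp (- H L v) * g v) \<in> borel_measurable CS" using H_measurable[OF assms(1)] g by measurable
 from measurable_compose[OF measurable_merge_conf this]
 have "(\<lambda>p. case p of (s, w) => exp (- H L (merge_conf L s w)) * g (merge_conf L s w)) \<in> borel_measurable (P L \<Otimes>\<^sub>M CS)"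
  by (simp add: case_prod_unfold)
 from measurable_compose[OF measurable_pair_swap' this] show ?thesis by (simp add: case_prod_unfold)
qed

lemma num_integrable:
 assumes "finite L" and g: "g \<in> borel_measurable CS" and b: "\<And>v. v \<in> space CS ==> \<bar>g v\<bar> \<le> B" and w: "w \<in> space CS"
 shows "integrable (P L) (\<lambda>s. exp (- H L (merge_conf L s w)) * g (merge_conf L s w))"
proof -
 interpret PL: prob_space "P L" by (rule prob_P)
 obtain C where C: "\<And>w. w \<in> space CS ==> exp (- C) \<le> exp (- H L w) \<and> exp (- H L w) \<le> exp C"
  using exp_H_bounds[OF assms(1)] by blast
 have m: "(\<lambda>v. exp (- H L v) * g v) \<in> borel_measurable CS" using H_measurable[OF assms(1)] g by measurable
 show ?thesis
 proof (rule PL.integrable_const_bound[of _ "exp C * B"], rule AE_I2)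
  fix s assume "s \<in> space (P L)"
  then have "merge_conf L s w \<in> space CS" using w by (rule merge_conf_space)
  then show "norm (exp (- H L (merge_conf L s w)) * g (merge_conf L s w)) \<le> exp C * B"
   using b C by (auto simp: abs_mult intro!: mult_mono)
 qed (rule measurable_compose[OF measurable_merge_conf1[OF w] m])
qed

lemma den_integrable:
 assumes "finite L" "w \<in> space CS"
 shows "integrable (P L) (\<lambda>s. exp (- H L (merge_conf L s w)))"
 using num_integrable[OF assms(1), of "\<lambda>_. 1" 1 w] assms(2) by simp

lemma den_pos:
 assumes "finite L" "w \<in> space CS"
 shows "0 < (\<integral>s. exp (- H L (merge_conf L s w)) \<partial>P L)"
proof -
 obtain C where C: "\<And>w. w \<in> space CS ==> exp (- C) \<le> exp (- H L w) \<and> exp (- H L w) \<le> exp C"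
  using exp_H_bounds[OF assms(1)] by blast
 show ?thesis
  using C merge_conf_space[OF _ assms(2)] by (intro integral_pos_prob'[OF prob_P den_integrable[OF assms], of "exp (- C)"]) auto
qed

lemma avg_const: "finite L ==> w \<in> space CS ==> avg nu H L (\<lambda>_. c) w = c"
 using den_pos[of L w] by (simp add: avg_def)

lemma avg_mono:
 assumes L: "finite L" and w: "w \<in> space CS" and g: "g \<in> borel_measurable CS" "\<And>v. v \<in> space CS ==> \<bar>g v\<bar> \<le> B"
  and h: "h \<in> borel_measurable CS" "\<And>v. v \<in> space CS ==> \<bar>h v\<bar> \<le> B'" and le: "\<And>v. v \<in> space CS ==> g v \<le> h v"
 shows "avg nu H L g w \<le> avg nu H L h w"
 unfolding avg_def using den_pos[OF L w] le merge_conf_space[OF _ w]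
 by (intro divide_right_mono integral_mono num_integrable[OF L g w] num_integrable[OF L h w] mult_left_mono) auto

lemma avg_bounded:
 assumes L: "finite L" and w: "w \<in> space CS" and g: "g \<in> borel_measurable CS" "\<And>v. v \<in> space CS ==> \<bar>g v\<bar> \<le> B"
 shows "\<bar>avg nu H L g w\<bar> \<le> B"
proof -
 obtain v where v: "v \<in> space CS" using CS_nonempty by blast
 have "avg nu H L g w \<le> avg nu H L (\<lambda>_. B) w"
  using g(2) by (intro avg_mono[OF L w g, of _ "\<bar>B\<bar>"]) (auto simp: abs_le_iff)
 moreover have "avg nu H L (\<lambda>_. - B) w \<le> avg nu H L g w"
  using g by (intro avg_mono[OF L w, of _ "\<bar>B\<bar>" _ B]) (force simp: abs_le_iff)+
 ultimately show ?thesis using avg_const[OF L w] by (simp add: abs_le_iff)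
qed

lemma avg_add:
 assumes L: "finite L" and w: "w \<in> space CS" and g: "g \<in> borel_measurable CS" "\<And>v. v \<in> space CS ==> \<bar>g v\<bar> \<le> B"
  and h: "h \<in> borel_measurable CS" "\<And>v. v \<in> space CS ==> \<bar>h v\<bar> \<le> B'"
 shows "avg nu H L (\<lambda>v. g v + h v) w = avg nu H L g w + avg nu H L h w"
 unfolding avg_def distrib_left
 by (subst Bochner_Integration.integral_add[OF num_integrable[OF L g w] num_integrable[OF L h w]]) (simp_all add: add_divide_distrib)

lemma avg_cmult: "avg nu H L (\<lambda>v. c * g v) w = c * avg nu H L g w"
 unfolding avg_def by (simp add: mult.left_commute[of _ c])

lemma avg_measurable:
 assumes L: "finite L" and g: "g \<in> borel_measurable CS"
 shows "avg nu H L g \<in> borel_measurable CS"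
proof -
 interpret PL: prob_space "P L" by (rule prob_P)
 have "(\<lambda>w. \<integral>s. exp (- H L (merge_conf L s w)) * g (merge_conf L s w) \<partial>P L) \<in> borel_measurable CS"
  using num_measurable2[OF L g] by (rule PL.borel_measurable_lebesgue_integral)
 moreover have "(\<lambda>w. \<integral>s. exp (- H L (merge_conf L s w)) * 1 \<partial>P L) \<in> borel_measurable CS"
  using num_measurable2[OF L, of "\<lambda>_. 1"] by (intro PL.borel_measurable_lebesgue_integral) simp
 ultimately show ?thesis unfolding avg_def[abs_def] by simp
qed

lemma avg_local:
 assumes "\<And>x. x \<notin> L ==> w x = w' x"
 shows "avg nu H L g w = avg nu H L g w'"
proof -
 have "merge_conf L s w = merge_conf L s w'" for s using assms by (auto simp: merge_conf_def)
 then show ?thesis by (simp add: avg_def)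
qed

section \<open>The specification as a kernel and the DLR equations\<close>

definition kern :: "'d site set => ('d site => 's) => ('d site => 's) measure" where
 "kern L w = distr (density (P L) (\<lambda>s. ennreal (exp (- H L (merge_conf L s w)) / (\<integral>s. exp (- H L (merge_conf L s w)) \<partial>P L))))
   CS (\<lambda>s. merge_conf L s w)"

lemma sets_kern [simp]: "sets (kern L w) = sets CS" "space (kern L w) = space CS"
 by (simp_all add: kern_def)

lemma kern_integral:
 assumes L: "finite L" and w: "w \<in> space CS" and g: "g \<in> borel_measurable CS"
 shows "(\<integral>v. g v \<partial>kern L w) = avg nu H L g w"
proof -
 let ?Z = "\<integral>s. exp (- H L (merge_conf L s w)) \<partial>P L"
 have Z: "0 < ?Z" by (rule den_pos[OF L w])
 have m: "(\<lambda>s. merge_conf L s w) \<in> measurable (P L) CS" by (rule measurable_merge_conf1[OF w])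
 have Hm: "(\<lambda>s. exp (- H L (merge_conf L s w)) / ?Z) \<in> borel_measurable (P L)"
  using measurable_compose[OF m H_measurable[OF L]] by measurable
 have gm: "(\<lambda>s. g (merge_conf L s w)) \<in> borel_measurable (P L)" using measurable_compose[OF m g] .
 have "(\<integral>v. g v \<partial>kern L w) = (\<integral>s. g (merge_conf L s w) \<partial>density (P L) (\<lambda>s. ennreal (exp (- H L (merge_conf L s w)) / ?Z)))"
  unfolding kern_def using m g by (subst integral_distr) auto
 also have "... = (\<integral>s. exp (- H L (merge_conf L s w)) / ?Z * g (merge_conf L s w) \<partial>P L)"
  using Hm gm Z by (subst integral_density) auto
 also have "... = avg nu H L g w" by (simp add: avg_def)
 finally show ?thesis .
qed

lemma kern_prob:
 assumes L: "finite L" and w: "w \<in> space CS"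
 shows "prob_space (kern L w)"
proof -
 let ?Z = "\<integral>s. exp (- H L (merge_conf L s w)) \<partial>P L"
 have Z: "0 < ?Z" by (rule den_pos[OF L w])
 have m: "(\<lambda>s. merge_conf L s w) \<in> measurable (P L) CS" by (rule measurable_merge_conf1[OF w])
 have Hm: "(\<lambda>s. exp (- H L (merge_conf L s w)) / ?Z) \<in> borel_measurable (P L)"
  using measurable_compose[OF m H_measurable[OF L]] by measurable
 have "(\<integral>\<^sup>+s. ennreal (exp (- H L (merge_conf L s w)) / ?Z) \<partial>P L) = ennreal (\<integral>s. exp (- H L (merge_conf L s w)) / ?Z \<partial>P L)"
  using Z den_integrable[OF L w] by (intro nn_integral_eq_integral) auto
 also have "... = 1" using Z by simp
 finally have "prob_space (density (P L) (\<lambda>s. ennreal (exp (- H L (merge_conf L s w)) / ?Z)))"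
  using Hm by (intro prob_spaceI) (auto simp: emeasure_density cong: nn_integral_cong)
 then show ?thesis unfolding kern_def using m by (intro prob_space.prob_space_distr) auto
qed

lemma kern_measurable:
 assumes L: "finite L"
 shows "kern L \<in> measurable CS (subprob_algebra CS)"
proof (rule measurable_subprob_algebra)
 fix w assume w: "w \<in> space CS"
 show "subprob_space (kern L w)" using kern_prob[OF L w] by (rule prob_space_imp_subprob_space)
 show "sets (kern L w) = sets CS" by simp
next
 fix A assume A: "A \<in> sets CS"
 have "(\<lambda>w. ennreal (avg nu H L (indicator A) w)) \<in> borel_measurable CS"
  using avg_measurable[OF L, of "indicator A"] A by measurable
 moreover have "emeasure (kern L w) A = ennreal (avg nu H L (indicator A) w)" if w: "w \<in> space CS" for w
 proof -
  interpret K: prob_space "kern L w" by (rule kern_prob[OF L w])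
  have "measure (kern L w) A = (\<integral>v. indicator A v \<partial>kern L w)" using A by simp
  also have "... = avg nu H L (indicator A) w" using A by (intro kern_integral[OF L w]) auto
  finally show ?thesis by (simp add: K.emeasure_eq_measure)
 qed
 ultimately show "(\<lambda>w. emeasure (kern L w) A) \<in> borel_measurable CS"
  by (subst measurable_cong) auto
qed

lemma bind_kern_integral:
 assumes L: "finite L" and mu: "prob_space mu" "sets mu = sets CS"
  and g: "g \<in> borel_measurable CS" "\<And>v. v \<in> space CS ==> \<bar>g v\<bar> \<le> (B::real)"
 shows "(\<integral>v. g v \<partial>(mu \<bind> kern L)) = (\<integral>w. avg nu H L g w \<partial>mu)"
proof -
 interpret mu: prob_space mu by fact
 have sp: "space mu = space CS" using mu(2) by (rule sets_eq_imp_space_eq)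
 have K: "kern L \<in> measurable mu (subprob_algebra CS)"
  using kern_measurable[OF L] mu(2) by (simp cong: measurable_cong_sets)
 have "(\<integral>v. g v \<partial>(mu \<bind> kern L)) = (\<integral>w. (\<integral>v. g v \<partial>kern L w) \<partial>mu)"
 proof (rule integral_bind[OF g(1) _ K])
  show "AE x in mu. emeasure (kern L x) (space (kern L x)) \<le> ennreal 1"
   using kern_prob[OF L] by (intro AE_I2) (auto simp: sp prob_space.emeasure_space_1 simp del: sets_kern)
 qed (use g mu.finite_measure_axioms in auto)
 also have "... = (\<integral>w. avg nu H L g w \<partial>mu)"
  using kern_integral[OF L _ g(1)] by (intro Bochner_Integration.integral_cong) (auto simp: sp)
 finally show ?thesis .
qed

lemma bind_kern_sets: "finite L ==> sets mu = sets CS ==> prob_space mu ==> sets (mu \<bind> kern L) = sets CS"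
 by (rule sets_bind[where N=CS]) (auto simp: prob_space.not_empty)

lemma bind_kern_prob:
 assumes L: "finite L" and mu: "prob_space mu" "sets mu = sets CS"
 shows "prob_space (mu \<bind> kern L)"
proof (rule prob_space.prob_space_bind[OF mu(1)])
 show "AE x in mu. prob_space (kern L x)" using kern_prob[OF L] sets_eq_imp_space_eq[OF mu(2)] by (intro AE_I2) auto
 show "kern L \<in> measurable mu (subprob_algebra CS)"
  using kern_measurable[OF L] mu(2) by (simp cong: measurable_cong_sets)
qed

text \<open>The DLR equation for \<open>L\<close> says that \<open>mu\<close> is a fixed point of
  the kernel of \<open>L\<close>, and finite measures on the product space that agree on cylinders
  are equal.\<close>

lemma gibbs_measuresI:
 assumes mu: "prob_space mu" "sets mu = sets CS"
  and dlr: "\<And>L J A. finite L ==> finite J ==> (\<And>x. x \<in> J ==> A x \<in> sets nu) ==>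
   measure mu (prod_emb UNIV (\<lambda>_. nu) J (Pi\<^sub>E J A)) =
   (\<integral>w. avg nu H L (indicator (prod_emb UNIV (\<lambda>_. nu) J (Pi\<^sub>E J A))) w \<partial>mu)"
 shows "mu \<in> gibbs_measures nu H"
proof -
 interpret mu: prob_space mu by fact
 have eq: "mu \<bind> kern L = mu" if L: "finite L" for L
 proof -
  interpret B: prob_space "mu \<bind> kern L" by (rule bind_kern_prob[OF L mu])
  show ?thesis
  proof (rule measure_eqI_PiM_infinite[of _ UNIV "\<lambda>_. nu"])
   show "sets (mu \<bind> kern L) = sets (PiM UNIV (\<lambda>_. nu))" using bind_kern_sets[OF L mu(2,1)] by (simp add: conf_space_def)
   show "sets mu = sets (PiM UNIV (\<lambda>_. nu))" using mu(2) by (simp add: conf_space_def)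
   show "finite_measure (mu \<bind> kern L)" by unfold_locales
   fix J :: "'d site set" and A assume J: "finite J" and A: "\<And>i. i \<in> J ==> A i \<in> sets nu"
   let ?E = "prod_emb UNIV (\<lambda>_. nu) J (Pi\<^sub>E J A)"
   have E: "?E \<in> sets CS" using J A unfolding conf_space_def by (intro sets_PiM_I) auto
   have "measure (mu \<bind> kern L) ?E = (\<integral>v. indicator ?E v \<partial>(mu \<bind> kern L))"
    using E bind_kern_sets[OF L mu(2,1)] by simp
   also have "... = (\<integral>w. avg nu H L (indicator ?E) w \<partial>mu)"
    using E by (intro bind_kern_integral[OF L mu, of _ 1]) (auto split: split_indicator)
   also have "... = measure mu ?E" using dlr[OF L J A] by simp
   finally show "emeasure (mu \<bind> kern L) ?E = emeasure mu ?E"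
    by (simp add: B.emeasure_eq_measure mu.emeasure_eq_measure)
  qed
 qed
 have "measure mu E = (\<integral>w. spec nu H L E w \<partial>mu)" if L: "finite L" and E: "E \<in> sets mu" for L E
 proof -
  have "measure mu E = (\<integral>v. indicator E v \<partial>(mu \<bind> kern L))" using E eq[OF L] by simp
  also have "... = (\<integral>w. avg nu H L (indicator E) w \<partial>mu)"
   using E mu(2) by (intro bind_kern_integral[OF L mu, of _ 1]) (auto split: split_indicator)
  finally show ?thesis by (simp add: spec_eq_avg)
 qed
 then show ?thesis using mu by (simp add: gibbs_measures_def)
qed

lemma gibbs_measuresD:
 assumes "mu \<in> gibbs_measures nu H" and L: "finite L"
  and g: "g \<in> borel_measurable CS" "\<And>v. v \<in> space CS ==> \<bar>g v\<bar> \<le> (B::real)"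
 shows "(\<integral>v. g v \<partial>mu) = (\<integral>w. avg nu H L g w \<partial>mu)"
proof -
 have mu: "prob_space mu" "sets mu = sets CS" using assms(1) by (auto simp: gibbs_measures_def)
 interpret mu: prob_space mu by fact
 interpret B: prob_space "mu \<bind> kern L" by (rule bind_kern_prob[OF L mu])
 have "mu \<bind> kern L = mu"
 proof (rule measure_eqI)
  show s: "sets (mu \<bind> kern L) = sets mu" using bind_kern_sets[OF L mu(2,1)] mu(2) by simp
  fix E assume "E \<in> sets (mu \<bind> kern L)"
  then have E: "E \<in> sets mu" "E \<in> sets CS" using s mu(2) by auto
  have "measure (mu \<bind> kern L) E = (\<integral>v. indicator E v \<partial>(mu \<bind> kern L))" using E s by simp
  also have "... = (\<integral>w. avg nu H L (indicator E) w \<partial>mu)"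
   using E by (intro bind_kern_integral[OF L mu, of _ 1]) (auto split: split_indicator)
  also have "... = measure mu E" using assms(1) L E(1) by (simp add: gibbs_measures_def spec_eq_avg)
  finally show "emeasure (mu \<bind> kern L) E = emeasure mu E"
   by (simp add: B.emeasure_eq_measure mu.emeasure_eq_measure)
 qed
 then show ?thesis using bind_kern_integral[OF L mu g] by simp
qed

text \<open>The tower property. By \<open>compat\<close> the difference \<open>H L - H K\<close>
  does not see the spins in \<open>K\<close>, so given the spins off \<open>K\<close> the two
  weights are proportional.\<close>

lemma avg_consistent:
 assumes L: "finite L" and K: "K \<subseteq> L" and w: "w \<in> space CS"
  and compat: "\<And>s v. H L (merge_conf K s v) - H K (merge_conf K s v) = H L v - H K v"
  and g: "g \<in> borel_measurable CS" "\<And>v. v \<in> space CS ==> \<bar>g v\<bar> \<le> B"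
 shows "avg nu H L (avg nu H K g) w = avg nu H L g w"
proof -
 interpret PS: product_sigma_finite "\<lambda>_::'d => int. nu"
  by (simp add: product_sigma_finite_def nu.sigma_finite_measure_axioms)
 let ?I = "L - K"
 have fK: "finite K" "finite ?I" using L K finite_subset by auto
 have LI: "L = ?I \<union> K" "?I \<inter> K = {}" using K by auto
 have ag: "avg nu H K g \<in> borel_measurable CS" "\<And>v. v \<in> space CS ==> \<bar>avg nu H K g v\<bar> \<le> B"
  using avg_measurable[OF fK(1) g(1)] avg_bounded[OF fK(1) _ g] by auto
 have fold: "(\<integral>s. exp (- H L (merge_conf L s w)) * h (merge_conf L s w) \<partial>P L) =
   (\<integral>x. (\<integral>y. exp (- H L (merge_conf K y (merge_conf ?I x w))) * h (merge_conf K y (merge_conf ?I x w)) \<partial>P K) \<partial>P ?I)"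
  if h: "h \<in> borel_measurable CS" "\<And>v. v \<in> space CS ==> \<bar>h v\<bar> \<le> B" for h
 proof -
  have i: "integrable (P (?I \<union> K)) (\<lambda>s. exp (- H L (merge_conf L s w)) * h (merge_conf L s w))"
   using num_integrable[OF L h w] LI(1) by simp
  have "merge_conf L (merge ?I K (x, y)) w = merge_conf K y (merge_conf ?I x w)" for x y
   using K by (auto simp: merge_conf_def merge_def fun_eq_iff)
  then show ?thesis using PS.product_integral_fold[OF LI(2) fK(2,1) i] LI(1) by simp
 qed
 have inner: "(\<integral>y. exp (- H L (merge_conf K y v)) * avg nu H K g (merge_conf K y v) \<partial>P K) =
   (\<integral>y. exp (- H L (merge_conf K y v)) * g (merge_conf K y v) \<partial>P K)" if v: "v \<in> space CS" for v
 proof -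
  let ?c = "exp (- (H L v - H K v))"
  have e: "exp (- H L (merge_conf K y v)) = ?c * exp (- H K (merge_conf K y v))" for y
  proof -
   have "- H L (merge_conf K y v) = - (H L v - H K v) + - H K (merge_conf K y v)"
    using compat[of y v] by linarith
   then show ?thesis by (simp only: exp_add)
  qed
  have a: "avg nu H K g (merge_conf K y v) = avg nu H K g v" for y
   by (rule avg_local) (simp add: merge_conf_def)
  have "(\<integral>y. exp (- H L (merge_conf K y v)) * avg nu H K g (merge_conf K y v) \<partial>P K)
    = ?c * ((\<integral>y. exp (- H K (merge_conf K y v)) \<partial>P K) * avg nu H K g v)"
   unfolding e a by (simp add: mult.assoc)
  also have "... = ?c * (\<integral>y. exp (- H K (merge_conf K y v)) * g (merge_conf K y v) \<partial>P K)"
   using den_pos[OF fK(1) v] by (simp add: avg_def)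
  also have "... = (\<integral>y. exp (- H L (merge_conf K y v)) * g (merge_conf K y v) \<partial>P K)"
   unfolding e by (simp add: mult.assoc)
  finally show ?thesis .
 qed
 have 1: "(\<integral>s. exp (- H L (merge_conf L s w)) * avg nu H K g (merge_conf L s w) \<partial>P L) =
   (\<integral>x. (\<integral>y. exp (- H L (merge_conf K y (merge_conf ?I x w))) * avg nu H K g (merge_conf K y (merge_conf ?I x w)) \<partial>P K) \<partial>P ?I)"
  using ag by (rule fold)
 have 2: "(\<integral>s. exp (- H L (merge_conf L s w)) * g (merge_conf L s w) \<partial>P L) =
   (\<integral>x. (\<integral>y. exp (- H L (merge_conf K y (merge_conf ?I x w))) * g (merge_conf K y (merge_conf ?I x w)) \<partial>P K) \<partial>P ?I)"
  using g by (rule fold)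
 have 3: "(\<integral>x. (\<integral>y. exp (- H L (merge_conf K y (merge_conf ?I x w))) * avg nu H K g (merge_conf K y (merge_conf ?I x w)) \<partial>P K) \<partial>P ?I)
   = (\<integral>x. (\<integral>y. exp (- H L (merge_conf K y (merge_conf ?I x w))) * g (merge_conf K y (merge_conf ?I x w)) \<partial>P K) \<partial>P ?I)"
  using w by (intro Bochner_Integration.integral_cong refl inner merge_conf_space)
 have "(\<integral>s. exp (- H L (merge_conf L s w)) * avg nu H K g (merge_conf L s w) \<partial>P L) =
   (\<integral>s. exp (- H L (merge_conf L s w)) * g (merge_conf L s w) \<partial>P L)"
  unfolding 1 2 3 ..
 then show ?thesis by (simp add: avg_def)
qed

end

section \<open>Spontaneous magnetization of the plane rotor model\<close>

definition bonds :: "'d::finite site set => ('d site \<times> 'd site) set" where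
 "bonds L = {(i,j). adj i j \<and> (i \<in> L \<or> j \<in> L)}"

lemma adj_sym: "adj i j \<longleftrightarrow> adj j i"
 by (simp add: adj_def abs_minus_commute)

lemma adj_irrefl: "\<not> adj i i"
 by (simp add: adj_def)

lemma adj_translate: "adj (site_add i a) (site_add j a) \<longleftrightarrow> adj i j"
 by (simp add: adj_def site_add_def)

lemma finite_adj: "finite {j. adj (i :: 'd::finite => int) j}"
proof (rule finite_subset)
 show "{j. adj i j} \<subseteq> (\<Pi>\<^sub>E k\<in>UNIV. {i k - 1..i k + 1})"
 proof clarify
  fix j assume "adj i j"
  then have "(\<Sum>k\<in>UNIV. \<bar>i k - j k\<bar>) = 1" by (simp add: adj_def)
  then have "\<bar>i k - j k\<bar> \<le> 1" for k
   using member_le_sum[of k UNIV "\<lambda>k. \<bar>i k - j k\<bar>"] by simp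
  then have "j k \<in> {i k - 1..i k + 1}" for k by (simp add: abs_le_iff) (smt (verit))
  then show "j \<in> (\<Pi>\<^sub>E k\<in>UNIV. {i k - 1..i k + 1})" by auto
 qed
qed (rule finite_PiE, auto)

lemma finite_bonds:
 assumes "finite L"
 shows "finite (bonds L)"
proof (rule finite_subset)
 show "bonds L \<subseteq> (SIGMA i:L. {j. adj i j}) \<union> prod.swap ` (SIGMA i:L. {j. adj i j})"
  by (auto simp: bonds_def image_iff adj_sym)
qed (use assms finite_adj in auto)

definition bond_form :: "'d site \<times> 'd site => 'd site => int" where
 "bond_form e x = (if x = fst e then 1 else 0) - (if x = snd e then 1 else 0)"

text \<open>A boundary condition enters the energy only through phases on bonds, which brings it
  into the scope of \<open>phase_domination\<close>.\<close>

definition bond_phase :: "'d site set => ('d site => real) => 'd site \<times> 'd site => real" where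
 "bond_phase L w e = (if fst e \<in> L then 0 else w (fst e)) - (if snd e \<in> L then 0 else w (snd e))"

lemma lin_bond_form:
 assumes "finite L"
 shows "lin L (bond_form (i,j)) th = (if i \<in> L then th i else 0) - (if j \<in> L then th j else 0)"
proof -
 have "lin L (bond_form (i,j)) th = (\<Sum>x\<in>L. (if x = i then th x else 0)) - (\<Sum>x\<in>L. (if x = j then th x else 0))"
  unfolding lin_def bond_form_def sum_subtractf[symmetric]
  by (intro sum.cong) (auto simp: algebra_simps)
 then show ?thesis using assms by (simp add: sum.delta')
qed

lemma H_XY_merge:
 assumes "finite L"
 shows "- H_XY beta L (merge_conf L th w) = (\<Sum>e\<in>bonds L. beta/2 * cos (lin L (bond_form e) th + bond_phase L w e))"
proof -
 have "cos (merge_conf L th w i - merge_conf L th w j) = cos (lin L (bond_form (i,j)) th + bond_phase L w (i,j))" for i j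
  using assms by (simp add: lin_bond_form bond_phase_def merge_conf_def)
 then show ?thesis
  unfolding H_XY_def bonds_def[symmetric] by (simp add: sum_distrib_left sum_divide_distrib case_prod_unfold sum_negf)
qed

lemma H_XY_compat:
 assumes L: "finite L" and K: "K \<subseteq> L"
 shows "H_XY beta L (merge_conf K s v) - H_XY beta K (merge_conf K s v) = H_XY beta L v - H_XY beta K v"
proof -
 have d: "H_XY beta L w - H_XY beta K w = - beta * (\<Sum>(i,j)\<in>bonds L - bonds K. cos (w i - w j)) / 2" for w
 proof -
  have "bonds K \<subseteq> bonds L" using K by (auto simp: bonds_def)
  then have "(\<Sum>(i,j)\<in>bonds L. cos (w i - w j)) = (\<Sum>(i,j)\<in>bonds L - bonds K. cos (w i - w j)) + (\<Sum>(i,j)\<in>bonds K. cos (w i - w j))"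
   by (rule sum.subset_diff[OF _ finite_bonds[OF L]])
  then show ?thesis unfolding H_XY_def bonds_def[symmetric] by (simp add: field_simps)
 qed
 have "(\<Sum>(i,j)\<in>bonds L - bonds K. cos (merge_conf K s v i - merge_conf K s v j)) = (\<Sum>(i,j)\<in>bonds L - bonds K. cos (v i - v j))"
 proof (rule sum.cong[OF refl])
  fix e assume e: "e \<in> bonds L - bonds K"
  then have "fst e \<notin> K" "snd e \<notin> K" by (auto simp: bonds_def)
  then show "(case e of (i,j) => cos (merge_conf K s v i - merge_conf K s v j)) = (case e of (i,j) => cos (v i - v j))"
   by (simp add: case_prod_unfold merge_conf_def)
 qed
 then show ?thesis unfolding d by simp
qed

lemma measurable_coord: "(\<lambda>w. w x) \<in> borel_measurable (conf_space XY_prior)"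
proof -
 have "(\<lambda>w. w x) \<in> measurable (PiM UNIV (\<lambda>_. XY_prior)) XY_prior" by (rule measurable_component_singleton) simp
 then show ?thesis by (simp add: conf_space_def cong: measurable_cong_sets)
qed

lemma H_XY_bounded: "finite L ==> \<bar>H_XY beta L w\<bar> \<le> \<bar>beta\<bar> * card (bonds L)"
proof -
 have "\<bar>\<Sum>(i,j)\<in>bonds L. cos (w i - w j)\<bar> \<le> (\<Sum>e\<in>bonds L. 1)"
  by (rule order_trans[OF sum_abs], rule sum_mono) auto
 then have "\<bar>beta\<bar> * \<bar>\<Sum>(i,j)\<in>bonds L. cos (w i - w j)\<bar> \<le> \<bar>beta\<bar> * card (bonds L)" by (intro mult_left_mono) auto
 moreover have "0 \<le> \<bar>beta\<bar> * \<bar>\<Sum>(i,j)\<in>bonds L. cos (w i - w j)\<bar>" by simp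
 ultimately have "\<bar>beta\<bar> * \<bar>\<Sum>(i,j)\<in>bonds L. cos (w i - w j)\<bar> / 2 \<le> \<bar>beta\<bar> * card (bonds L)" by linarith
 then show ?thesis unfolding H_XY_def bonds_def[symmetric] by (simp add: abs_mult)
qed

lemma XY_gibbs_spec: "gibbs_spec XY_prior (H_XY beta :: 'd::finite site set => _)"
proof (intro gibbs_spec.intro prob_space_XY_prior gibbs_spec_axioms.intro)
 fix L :: "'d site set" assume L: "finite L"
 show "H_XY beta L \<in> borel_measurable (conf_space XY_prior)"
  unfolding H_XY_def[abs_def] case_prod_beta
  by (intro borel_measurable_divide borel_measurable_times borel_measurable_sum borel_measurable_const
   measurable_compose[OF _ borel_measurable_continuous_onI[of cos]] borel_measurable_diff measurable_coord continuous_intros)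
 show "\<exists>C. \<forall>w\<in>space (conf_space XY_prior). \<bar>H_XY beta L w\<bar> \<le> C" using H_XY_bounded[OF L] by blast
qed

lemma space_conf_XY [simp]: "space (conf_space XY_prior) = UNIV"
 by (auto simp: conf_space_def space_PiM)

abbreviation fin_supp :: "('v => int) => bool" where
 "fin_supp k \<equiv> finite {x. k x \<noteq> 0}"

definition linf :: "('v => int) => ('v => real) => real" where
 "linf k w = (\<Sum>x | k x \<noteq> 0. of_int (k x) * w x)"

lemma linf_merge:
 assumes k: "fin_supp k" and L: "finite L"
 shows "linf k (merge_conf L th w) = lin L k th + (\<Sum>x\<in>{x. k x \<noteq> 0} - L. of_int (k x) * w x)"
proof -
 have "linf k (merge_conf L th w) = (\<Sum>x\<in>{x. k x \<noteq> 0} \<inter> L. of_int (k x) * merge_conf L th w x)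
   + (\<Sum>x\<in>{x. k x \<noteq> 0} - L. of_int (k x) * merge_conf L th w x)"
  unfolding linf_def by (rule sum.Int_Diff[OF k])
 also have "(\<Sum>x\<in>{x. k x \<noteq> 0} \<inter> L. of_int (k x) * merge_conf L th w x) = lin L k th"
  unfolding lin_def using L by (intro sum.mono_neutral_cong_left) (auto simp: merge_conf_def)
 also have "(\<Sum>x\<in>{x. k x \<noteq> 0} - L. of_int (k x) * merge_conf L th w x) = (\<Sum>x\<in>{x. k x \<noteq> 0} - L. of_int (k x) * w x)"
  by (intro sum.cong) (auto simp: merge_conf_def)
 finally show ?thesis .
qed

lemma linf_measurable: "linf k \<in> borel_measurable (conf_space XY_prior)"
 unfolding linf_def[abs_def] by (intro borel_measurable_sum borel_measurable_times borel_measurable_const measurable_coord)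

lemma cos_obs_measurable: "(\<lambda>w. cos (linf k w + c)) \<in> borel_measurable (conf_space XY_prior)"
proof -
 have "(\<lambda>w. linf k w + c) \<in> borel_measurable (conf_space XY_prior)"
  by (intro borel_measurable_add linf_measurable borel_measurable_const)
 from measurable_compose[OF this borel_measurable_continuous_onI[of cos]] show ?thesis by (simp add: continuous_intros)
qed

lemma sin_obs_measurable: "(\<lambda>w. sin (linf k w)) \<in> borel_measurable (conf_space XY_prior)"
 using measurable_compose[OF linf_measurable borel_measurable_continuous_onI[of sin]] by (simp add: continuous_intros)

text \<open>The left side is a sinusoid in \<open>c\<close> whose amplitude is the Euclidean norm of
  \<open>(a, s)\<close>. If its maximum does not exceed \<open>a\<close>, then \<open>s\<close>
  vanishes. This stands in for the reflection symmetry of the angles.\<close>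

lemma rotate_max_zero:
 fixes a s :: real
 assumes "\<And>c. cos c * a - sin c * s \<le> a"
 shows "s = 0" "0 \<le> a"
proof -
 show a0: "0 \<le> a" using assms[of pi] by simp
 show "s = 0"
 proof (rule ccontr)
  assume s: "s \<noteq> 0"
  define r where "r = sqrt (a\<^sup>2 + s\<^sup>2)"
  have r2: "r\<^sup>2 = a\<^sup>2 + s\<^sup>2" by (simp add: r_def)
  have r: "0 < r" using s by (simp add: r_def sum_power2_gt_zero_iff)
  have "(a/r)\<^sup>2 + (-s/r)\<^sup>2 = 1" using r r2 by (simp add: power_divide add_divide_distrib[symmetric] flip: r2)
  then obtain c where c: "a/r = cos c" "-s/r = sin c" using sincos_total_2pi by metis
  have "cos c * a - sin c * s = (a\<^sup>2 + s\<^sup>2) / r"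
   unfolding c[symmetric] by (simp add: power2_eq_square add_divide_distrib)
  also have "... = r" unfolding r2[symmetric] using r by (simp add: power2_eq_square)
  finally have "r \<le> a" using assms[of c] by simp
  then have "r\<^sup>2 \<le> a\<^sup>2" using r by (intro power_mono) auto
  then show False using r2 s by simp
 qed
qed

locale xy_model =
 fixes beta :: real and dim :: "'d::finite itself"
 assumes beta: "0 \<le> beta"
begin

sublocale gibbs_spec XY_prior "H_XY beta :: 'd site set => _"
 by (rule XY_gibbs_spec)

abbreviation "HH \<equiv> (H_XY beta :: 'd site set => ('d site => real) => real)"
abbreviation "av \<equiv> avg XY_prior HH"

text \<open>The phases \<open>om\<close> are arbitrary on every bond and need not come from a
  boundary condition: the disorder average uses independent ones.\<close>

definition wW :: "'d site set => ('d site \<times> 'd site => real) => ('d site => real) => real" where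
 "wW L om th = exp (\<Sum>e\<in>bonds L. beta/2 * cos (lin L (bond_form e) th + om e))"

lemma exp_H: "finite L ==> exp (- HH L (merge_conf L th w)) = wW L (bond_phase L w) th"
 by (simp add: wW_def H_XY_merge)

lemma bond_phase_0: "bond_phase L (\<lambda>_. 0) = (\<lambda>_. 0)"
 by (auto simp: bond_phase_def)

lemma wW_measurable: "wW L om \<in> borel_measurable (XYP L)"
 unfolding wW_def[abs_def] by measurable

lemma wW_integral_pos: "0 < (\<integral>th. wW L om th \<partial>XYP L)"
proof -
 interpret PL: prob_space "XYP L" by (rule prob_space_XYP)
 let ?C = "\<Sum>e\<in>bonds L. \<bar>beta/2\<bar>"
 have "\<bar>\<Sum>e\<in>bonds L. beta/2 * cos (lin L (bond_form e) th + om e)\<bar> \<le> ?C" for th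
  by (rule order_trans[OF sum_abs], rule sum_mono) (simp add: abs_mult mult_left_le)
 then have b: "exp (- ?C) \<le> wW L om th \<and> wW L om th \<le> exp ?C" for th
  unfolding wW_def exp_le_cancel_iff by (meson abs_le_D1 abs_le_D2 minus_le_iff)
 have "integrable (XYP L) (wW L om)"
  using b by (intro PL.integrable_bounded[of _ "exp ?C"] wW_measurable) (simp add: wW_def)
 then show ?thesis
  using b by (intro integral_pos_prob'[OF prob_space_XYP, of L "wW L om" "exp (- ?C)"]) auto
qed

lemma cos_obs_bounded: "\<bar>cos (linf k w + c)\<bar> \<le> 1" by simp

definition fv :: "('d site => int) => 'd site set => real" where
 "fv k L = av L (\<lambda>w. cos (linf k w)) (\<lambda>_. 0)"

lemma fv_eq:
 assumes L: "finite L" and k: "fin_supp k"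
 shows "fv k L = (\<integral>th. wW L (\<lambda>_. 0) th * cos (lin L k th) \<partial>XYP L) / (\<integral>th. wW L (\<lambda>_. 0) th \<partial>XYP L)"
 unfolding fv_def avg_def exp_H[OF L] linf_merge[OF k L] bond_phase_0 by simp

lemma mmp_general:
 assumes L: "finite L" and k: "fin_supp k"
 shows "(\<integral>th. wW L om th * cos (lin L k th + c) \<partial>XYP L) \<le> fv k L * (\<integral>th. wW L om th \<partial>XYP L)"
proof -
 have "(\<integral>th. wW L om th * cos (lin L k th + c) \<partial>XYP L) * (\<integral>th. wW L (\<lambda>_. 0) th \<partial>XYP L)
   \<le> (\<integral>th. wW L (\<lambda>_. 0) th * cos (lin L k th) \<partial>XYP L) * (\<integral>th. wW L om th \<partial>XYP L)"
  using phase_domination[OF L finite_bonds[OF L], of "\<lambda>_. beta/2" bond_form om k c] beta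
  unfolding wW_def by simp
 then show ?thesis using wW_integral_pos[of L "\<lambda>_. 0"] unfolding fv_eq[OF L k] by (simp add: field_simps)
qed

lemma mmp:
 assumes L: "finite L" and k: "fin_supp k"
 shows "av L (\<lambda>w. cos (linf k w + c)) w \<le> fv k L"
 using mmp_general[OF L k, of "bond_phase L w" "(\<Sum>x\<in>{x. k x \<noteq> 0} - L. of_int (k x) * w x) + c"]
  wW_integral_pos[of L "bond_phase L w"]
 unfolding avg_def exp_H[OF L] linf_merge[OF k L] by (simp add: divide_le_eq add.assoc)

lemma av_consistent:
 assumes L: "finite L" and K: "K \<subseteq> L" and g: "g \<in> borel_measurable CS" "\<And>v. \<bar>g v\<bar> \<le> B"
 shows "av L (av K g) w = av L g w"
proof (rule avg_consistent[where B=B])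
 show "HH L (merge_conf K s v) - HH K (merge_conf K s v) = HH L v - HH K v" for s v
  by (rule H_XY_compat[OF L K])
qed (use assms in simp_all)

text \<open>Averaging first inside \<open>K\<close> turns the spins around \<open>K\<close> into a
  boundary condition, and every boundary condition is dominated by the zero one.\<close>

lemma fv_antimono:
 assumes L: "finite L" and K: "K \<subseteq> L" and k: "fin_supp k"
 shows "fv k L \<le> fv k K"
proof -
 have fK: "finite K" using K L finite_subset by auto
 have "fv k L = av L (\<lambda>w. av K (\<lambda>w. cos (linf k w)) w) (\<lambda>_. 0)"
  unfolding fv_def using av_consistent[OF L K, of "\<lambda>w. cos (linf k w)" 1 "\<lambda>_. 0"] cos_obs_measurable[of k 0] by simp
 also have "... \<le> av L (\<lambda>_. fv k K) (\<lambda>_. 0)"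
 proof (rule avg_mono[OF L, where B=1 and B'="\<bar>fv k K\<bar>"])
  show "av K (\<lambda>w. cos (linf k w)) v \<le> fv k K" for v using mmp[OF fK k, of 0 v] by simp
  show "\<bar>av K (\<lambda>w. cos (linf k w)) v\<bar> \<le> 1" for v by (rule avg_bounded[OF fK]) (use cos_obs_measurable[of k 0] in simp_all)
  show "\<bar>fv k K\<bar> \<le> \<bar>fv k K\<bar>" by simp
  show "av K (\<lambda>w. cos (linf k w)) \<in> borel_measurable CS"
   using cos_obs_measurable[of k 0] by (intro avg_measurable[OF fK]) simp
 qed simp_all
 also have "... = fv k K" by (rule avg_const[OF L]) simp
 finally show ?thesis .
qed

text \<open>As a function of the phase the expectation is a sinusoid, and domination puts its
  maximum at phase 0; so it has no sine part.\<close>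

lemma av_cos_shift:
 assumes L: "finite L" and k: "fin_supp k"
 shows "av L (\<lambda>w. cos (linf k w + c)) (\<lambda>_. 0) = cos c * fv k L" and fv_nonneg: "0 \<le> fv k L"
proof -
 define s where "s = av L (\<lambda>w. sin (linf k w)) (\<lambda>_. 0)"
 have eq: "av L (\<lambda>w. cos (linf k w + c)) (\<lambda>_. 0) = cos c * fv k L - sin c * s" for c
 proof -
  have "av L (\<lambda>w. cos (linf k w + c)) (\<lambda>_. 0) = av L (\<lambda>w. cos c * cos (linf k w) + - sin c * sin (linf k w)) (\<lambda>_. 0)"
   by (simp add: cos_add mult.commute)
  also have "... = av L (\<lambda>w. cos c * cos (linf k w)) (\<lambda>_. 0) + av L (\<lambda>w. - sin c * sin (linf k w)) (\<lambda>_. 0)"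
  proof (rule avg_add[OF L, where B=1 and B'=1])
   show "\<bar>cos c * cos (linf k v)\<bar> \<le> 1" for v by (simp add: abs_mult mult_le_one)
   show "\<bar>- sin c * sin (linf k v)\<bar> \<le> 1" for v by (simp add: abs_mult mult_le_one)
  qed (use cos_obs_measurable[of k 0] sin_obs_measurable[of k] in simp_all)
  finally show ?thesis using avg_cmult[of L "- sin c" "\<lambda>w. sin (linf k w)"] by (simp add: avg_cmult fv_def s_def)
 qed
 have le: "cos c * fv k L - sin c * s \<le> fv k L" for c
  using mmp[OF L k, of c "\<lambda>_. 0"] eq by simp
 show "av L (\<lambda>w. cos (linf k w + c)) (\<lambda>_. 0) = cos c * fv k L" "0 \<le> fv k L"
  using rotate_max_zero[OF le] eq[of c] by auto
qed

end

lemma cos_md: "cos (c + md t) = cos (c + t)"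
proof -
 obtain k :: int where "md t = t + 2*pi * of_int k" using md_eq by blast
 then have "c + md t = (c + t) + 2*pi * of_int k" by simp
 then show ?thesis by (simp only: cos_add_int_period)
qed

lemma cis_sum: "finite E ==> (\<Prod>e\<in>E. cis (f e)) = cis (\<Sum>e\<in>E. f e)"
 by (induction E rule: finite_induct) (auto simp: cis_mult)

lemma measurable_XYP_coord: "e \<in> E ==> (\<lambda>w. w e) \<in> borel_measurable (XYP E)"
 using measurable_component_singleton[of e E "\<lambda>_. XY_prior"] by (simp cong: measurable_cong_sets)

context xy_model
begin

section \<open>Disorder averages and the lower bound on the magnetization\<close>

definition w1 :: "real => real" where "w1 t = exp (beta/2 * cos t)"
definition NN :: real where "NN = (\<integral>t. w1 t \<partial>XY_prior)"
definition rho :: real where "rho = (\<integral>t. w1 t * cos t \<partial>XY_prior) / NN"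

lemma w1_measurable [measurable]: "w1 \<in> borel_measurable borel"
 unfolding w1_def[abs_def] by measurable

lemma w1_bounds: "0 < w1 t" "w1 t \<le> exp (beta/2)"
 using beta by (auto simp: w1_def mult_left_le)

lemma NN_pos: "0 < NN"
proof -
 have "exp (- (beta/2)) \<le> w1 t" for t
  using beta mult_left_mono[of "-1" "cos t" "beta/2"] by (simp add: w1_def)
 moreover have "integrable XY_prior w1"
  using w1_bounds by (intro nu.integrable_bounded[of _ "exp (beta/2)"]) (auto simp: less_imp_le)
 ultimately show ?thesis unfolding NN_def
  by (intro integral_pos_prob'[OF prob_space_XY_prior, where c="exp (- (beta/2))"]) auto
qed

text \<open>A system with one site and one bond in \<open>phase_domination\<close>: the mean of the
  shifted cosine is largest at shift 0.\<close>

lemma w1_sin_zero: "(\<integral>t. w1 t * sin t \<partial>XY_prior) = 0"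
proof -
 interpret PS: product_sigma_finite "\<lambda>_::unit. XY_prior"
  by (simp add: product_sigma_finite_def nu.sigma_finite_measure_axioms)
 have l: "lin {()} (\<lambda>_. 1) th = th ()" for th by (simp add: lin_def)
 have s: "(\<integral>th. f (th ()) \<partial>XYP {()}) = (\<integral>t. f t \<partial>XY_prior)" if "f \<in> borel_measurable borel" for f :: "real => real"
  using that by (intro PS.product_integral_singleton) (simp cong: measurable_cong_sets)
 have i: "integrable XY_prior (\<lambda>t. w1 t * cos t)" "integrable XY_prior (\<lambda>t. w1 t * sin t)"
  using w1_bounds by (auto intro!: nu.integrable_bounded[of _ "exp (beta/2)"] simp: abs_mult less_imp_le intro!: order_trans[OF mult_left_le])
 have "cos c * (\<integral>t. w1 t * cos t \<partial>XY_prior) - sin c * (\<integral>t. w1 t * sin t \<partial>XY_prior) \<le> (\<integral>t. w1 t * cos t \<partial>XY_prior)" for c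
 proof -
  have "(\<integral>th. w1 (th ()) * cos (th () + c) \<partial>XYP {()}) * (\<integral>th. w1 (th ()) \<partial>XYP {()})
   \<le> (\<integral>th. w1 (th ()) * cos (th ()) \<partial>XYP {()}) * (\<integral>th. w1 (th ()) \<partial>XYP {()})"
   using phase_domination[of "{()}" "{()}" "\<lambda>_. beta/2" "\<lambda>_ _. 1" "\<lambda>_. 0" "\<lambda>_. 1" c] beta
   by (simp add: l w1_def)
  then have "(\<integral>t. w1 t * cos (t + c) \<partial>XY_prior) * NN \<le> (\<integral>t. w1 t * cos t \<partial>XY_prior) * NN"
   by (subst (asm) (1 2 3 4) s) (simp_all add: NN_def)
  then have "(\<integral>t. w1 t * cos (t + c) \<partial>XY_prior) \<le> (\<integral>t. w1 t * cos t \<partial>XY_prior)" using NN_pos by simp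
  moreover have "(\<integral>t. w1 t * cos (t + c) \<partial>XY_prior) = (\<integral>t. cos c * (w1 t * cos t) - sin c * (w1 t * sin t) \<partial>XY_prior)"
   by (intro Bochner_Integration.integral_cong) (auto simp: cos_add algebra_simps)
  ultimately show ?thesis using i by simp
 qed
 from rotate_max_zero(1)[OF this] show ?thesis .
qed

lemma w1_cis:
 assumes "k \<in> {-1, 0, 1::int}"
 shows "integrable XY_prior (\<lambda>t. complex_of_real (w1 t) * cis (of_int k * t))"
  and "(\<integral>t. complex_of_real (w1 t) * cis (of_int k * t) \<partial>XY_prior) = of_real (NN * (if k = 0 then 1 else rho))"
proof -
 have cisb: "(\<lambda>t. cis (of_int k * t)) \<in> borel_measurable XY_prior"
  by (intro borel_measurable_continuous_onI[THEN measurable_cong_sets[OF sets_XY_prior refl, THEN equalityD2, THEN subsetD]] continuous_intros)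
 show i: "integrable XY_prior (\<lambda>t. complex_of_real (w1 t) * cis (of_int k * t))"
 proof (rule nu.integrable_const_bound[of _ "exp (beta/2)"])
  show "(\<lambda>t. complex_of_real (w1 t) * cis (of_int k * t)) \<in> borel_measurable XY_prior"
   by (intro borel_measurable_times cisb borel_measurable_of_real) (simp cong: measurable_cong_sets)
 qed (use w1_bounds in \<open>auto simp: norm_mult less_imp_le\<close>)
 have re: "Re (\<integral>t. complex_of_real (w1 t) * cis (of_int k * t) \<partial>XY_prior) = (\<integral>t. w1 t * cos (of_int k * t) \<partial>XY_prior)"
  using integral_Re[OF i] by simp
 have im: "Im (\<integral>t. complex_of_real (w1 t) * cis (of_int k * t) \<partial>XY_prior) = (\<integral>t. w1 t * sin (of_int k * t) \<partial>XY_prior)"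
  using integral_Im[OF i] by simp
 have "(\<integral>t. w1 t * cos (of_int k * t) \<partial>XY_prior) = NN * (if k = 0 then 1 else rho)"
  using assms NN_pos by (auto simp: NN_def[symmetric] rho_def)
 moreover have "(\<integral>t. w1 t * sin (of_int k * t) \<partial>XY_prior) = 0"
  using assms w1_sin_zero by auto
 ultimately show "(\<integral>t. complex_of_real (w1 t) * cis (of_int k * t) \<partial>XY_prior) = of_real (NN * (if k = 0 then 1 else rho))"
  using re im by (simp add: complex_eq_iff)
qed

text \<open>The bond phases are independent with density \<open>w1 / NN\<close>, whose Fourier
  coefficients at 1 and -1 are both \<open>rho\<close>. Every nonzero coefficient of
  \<open>k\<close> therefore costs one factor \<open>rho\<close>.\<close>

lemma noise_integral:
 fixes k :: "'e => int"
 assumes E: "finite E" and k: "\<And>e. k e \<in> {-1, 0, 1}"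
 shows "(\<integral>omg. (\<Prod>e\<in>E. w1 (omg e)) * cos (lin E k omg + c) \<partial>XYP E) = NN ^ card E * rho ^ card {e\<in>E. k e \<noteq> 0} * cos c"
proof -
 interpret PS: product_sigma_finite "\<lambda>_::'e. XY_prior"
  by (simp add: product_sigma_finite_def nu.sigma_finite_measure_axioms)
 let ?f = "\<lambda>e t. complex_of_real (w1 t) * cis (of_int (k e) * t)"
 have i: "integrable (XYP E) (\<lambda>omg. \<Prod>e\<in>E. ?f e (omg e))"
  by (intro PS.product_integrable_prod E w1_cis(1) k)
 have "(\<integral>omg. (\<Prod>e\<in>E. ?f e (omg e)) \<partial>XYP E) = (\<Prod>e\<in>E. \<integral>t. ?f e t \<partial>XY_prior)"
  by (intro PS.product_integral_prod E w1_cis(1) k)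
 also have "... = (\<Prod>e\<in>E. of_real (NN * (if k e = 0 then 1 else rho)))"
  by (intro prod.cong refl w1_cis(2) k)
 also have "... = of_real (NN ^ card E * rho ^ card {e\<in>E. k e \<noteq> 0})"
 proof -
  have "(\<Prod>e\<in>E. if k e = 0 then 1 else rho) = (\<Prod>e\<in>{e\<in>E. k e \<noteq> 0}. rho)"
   using E by (subst prod.inter_filter) (auto intro!: prod.cong)
  then show ?thesis by (simp add: of_real_prod[symmetric] prod.distrib)
 qed
 finally have I: "(\<integral>omg. (\<Prod>e\<in>E. ?f e (omg e)) \<partial>XYP E) = of_real (NN ^ card E * rho ^ card {e\<in>E. k e \<noteq> 0})" .
 have eq: "cis c * (\<Prod>e\<in>E. ?f e (omg e)) = of_real (\<Prod>e\<in>E. w1 (omg e)) * cis (lin E k omg + c)" for omg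
  unfolding prod.distrib cis_sum[OF E] lin_def cis_mult[symmetric] of_real_prod by (simp only: mult_ac)
 have "(\<integral>omg. (\<Prod>e\<in>E. w1 (omg e)) * cos (lin E k omg + c) \<partial>XYP E) = (\<integral>omg. Re (cis c * (\<Prod>e\<in>E. ?f e (omg e))) \<partial>XYP E)"
  unfolding eq by (simp del: of_real_prod)
 also have "... = Re (\<integral>omg. cis c * (\<Prod>e\<in>E. ?f e (omg e)) \<partial>XYP E)"
  using i by (intro integral_Re) auto
 also have "... = Re (cis c * of_real (NN ^ card E * rho ^ card {e\<in>E. k e \<noteq> 0}))"
  using I by simp
 finally show ?thesis by simp
qed

text \<open>Nishimori's gauge transformation: for a fixed spin configuration \<open>th\<close>, shifting the disorder by the
 gradient of \<open>th\<close> turns the Gibbs weight into the independent law of the disorder.\<close>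
lemma gauge_integral:
 fixes k :: "'d site \<times> 'd site => int"
 assumes L: "finite L" and k: "\<And>e. k e \<in> {-1, 0, 1}"
 shows "(\<integral>omg. wW L omg th * cos (lin (bonds L) k omg + c) \<partial>XYP (bonds L)) =
  NN ^ card (bonds L) * rho ^ card {e\<in>bonds L. k e \<noteq> 0} * cos (c - lin (bonds L) k (\<lambda>e. lin L (bond_form e) th))"
proof -
 let ?E = "bonds L"
 let ?a = "\<lambda>e. lin L (bond_form e) th"
 have E: "finite ?E" by (rule finite_bonds[OF L])
 have m: "(\<lambda>omg. wW L omg th * cos (lin ?E k omg + c)) \<in> borel_measurable (XYP ?E)"
 proof (intro borel_measurable_times)
  have "(\<lambda>omg. beta/2 * cos (?a e + omg e)) \<in> borel_measurable (XYP ?E)" if "e \<in> ?E" for e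
   using measurable_XYP_coord[OF that] by measurable
  then show "(\<lambda>omg. wW L omg th) \<in> borel_measurable (XYP ?E)"
   unfolding wW_def by (intro measurable_compose[OF borel_measurable_sum borel_measurable_exp]) auto
 qed measurable
 have w: "wW L (\<lambda>e\<in>?E. md (omg e + - ?a e)) th = (\<Prod>e\<in>?E. w1 (omg e))" for omg
 proof -
  have "wW L (\<lambda>e\<in>?E. md (omg e + - ?a e)) th = exp (\<Sum>e\<in>?E. beta/2 * cos (omg e))"
   unfolding wW_def by (intro arg_cong[where f=exp] sum.cong) (auto simp: cos_md)
  also have "... = (\<Prod>e\<in>?E. w1 (omg e))" using E by (simp add: exp_sum w1_def)
  finally show ?thesis .
 qed
 have l: "lin ?E k (\<lambda>e. omg e + - ?a e) + c = lin ?E k omg + (c - lin ?E k ?a)" for omg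
  using lin_add[of ?E k omg "\<lambda>e. (-1) * ?a e"] lin_scale[of ?E k "-1" ?a] by simp
 have "(\<integral>omg. wW L omg th * cos (lin ?E k omg + c) \<partial>XYP ?E) =
   (\<integral>omg. (\<Prod>e\<in>?E. w1 (omg e)) * cos (lin ?E k omg + (c - lin ?E k ?a)) \<partial>XYP ?E)"
  using XYP_shift[OF E m, of "\<lambda>e. - ?a e"] by (simp only: w cos_lin_md l)
 then show ?thesis using noise_integral[OF E k] by simp
qed

definition origin_form :: "'d site => int" where
 "origin_form x = (if x = (\<lambda>_. 0) then 1 else 0)"

lemma wW_joint_measurable:
 assumes "finite L"
 shows "(\<lambda>(omg, th). wW L omg th) \<in> borel_measurable (XYP (bonds L) \<Otimes>\<^sub>M XYP L)"
proof -
 have "(\<lambda>p. beta/2 * cos (lin L (bond_form e) (snd p) + fst p e)) \<in> borel_measurable (XYP (bonds L) \<Otimes>\<^sub>M XYP L)"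
  if "e \<in> bonds L" for e
  using measurable_compose[OF measurable_fst measurable_XYP_coord[OF that]] by measurable
 then show ?thesis unfolding wW_def case_prod_beta
  by (intro measurable_compose[OF borel_measurable_sum borel_measurable_exp]) auto
qed

lemma wW_bounded: "\<bar>wW L om th\<bar> \<le> exp (\<Sum>e\<in>bonds L. beta/2)"
proof -
 have "(\<Sum>e\<in>bonds L. beta/2 * cos (lin L (bond_form e) th + om e)) \<le> (\<Sum>e\<in>bonds L. beta/2)"
  using beta by (intro sum_mono mult_left_le) auto
 then show ?thesis by (simp only: wW_def abs_exp_cancel exp_le_cancel_iff)
qed

text \<open>The estimator \<open>Z\<close> averages the disorder along the paths \<open>\<gamma> U\<close>; its mean
 is fixed by gauge invariance, while its second moment is controlled by the intersections of two paths.\<close>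
lemma magnetization_lower_bound:
 fixes \<gamma> :: "'u => ('d site \<times> 'd site) set"
 assumes L: "finite L" and z: "(\<lambda>_. 0) \<in> L" and Om: "finite Om" "Om \<noteq> {}"
  and \<gamma>: "\<And>U. U \<in> Om ==> \<gamma> U \<subseteq> bonds L"
  and tel: "\<And>U th. U \<in> Om ==> (\<And>x. x \<notin> L ==> th x = (0::real)) ==> (\<Sum>(i,j)\<in>\<gamma> U. th i - th j) = th (\<lambda>_. 0)"
  and overlap: "(\<Sum>U\<in>Om. \<Sum>U'\<in>Om. (1+eta) ^ card (\<gamma> U \<inter> \<gamma> U')) \<le> 4 * (real (card Om))\<^sup>2"
  and rho: "0 < rho" "1 / rho\<^sup>2 \<le> 1 + eta"
 shows "2/5 \<le> fv origin_form L"
proof -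
 let ?E = "bonds L"
 let ?P = "XYP L" and ?Q = "XYP ?E"
 interpret P: prob_space ?P by (rule prob_space_XYP)
 interpret Q: prob_space ?Q by (rule prob_space_XYP)
 interpret QP: pair_prob_space ?Q ?P ..
 have E: "finite ?E" by (rule finite_bonds[OF L])
 define n where "n = real (card Om)"
 have n: "0 < n" using Om by (simp add: n_def card_gt_0_iff)
 define m where "m = fv origin_form L"
 have fs: "fin_supp origin_form" by (simp add: origin_form_def)
 have m0: "0 \<le> m" unfolding m_def by (rule fv_nonneg[OF L fs])
 have lin0: "lin L origin_form th = th (\<lambda>_. 0)" for th
 proof -
  have "lin L origin_form th = (\<Sum>x\<in>L. if x = (\<lambda>_. 0) then th x else 0)"
   unfolding lin_def origin_form_def by (intro sum.cong) auto
  then show ?thesis using L z by (simp add: sum.delta')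
 qed
 define g where "g U e = (if e \<in> \<gamma> U then 1 else 0 :: int)" for U e
 define a where "a th e = lin L (bond_form e) th" for th e
 have ga: "lin ?E (g U) (a th) = th (\<lambda>_. 0)" if U: "U \<in> Om" for U th
 proof -
  define th' where "th' x = (if x \<in> L then th x else 0)" for x
  have "lin ?E (g U) (a th) = (\<Sum>e\<in>\<gamma> U. a th e)"
   unfolding lin_def using \<gamma>[OF U] E by (intro sum.mono_neutral_cong_right) (auto simp: g_def)
  also have "... = (\<Sum>(i,j)\<in>\<gamma> U. th' i - th' j)"
   by (intro sum.cong) (auto simp: a_def lin_bond_form[OF L] th'_def)
  also have "... = th' (\<lambda>_. 0)" by (rule tel[OF U]) (simp add: th'_def)
  finally show ?thesis using z by (simp add: th'_def)
 qed
 \<comment> \<open>The gauge transformation gives the character of a path the mean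
   \<open>rho ^ card (\<gamma> U)\<close> up to the common normalisation; dividing by it lets every
   path contribute 1.\<close>
 define r where "r U = 1 / rho ^ card (\<gamma> U)" for U
 have r0: "0 < r U" for U using rho by (simp add: r_def)
 define S where "S omg ph = (\<Sum>U\<in>Om. r U * cos (lin ?E (g U) omg + ph))" for omg ph
 define A2 where "A2 omg = (\<Sum>U\<in>Om. \<Sum>U'\<in>Om. r U * r U' * cos (lin ?E (\<lambda>e. g U e - g U' e) omg))" for omg
 have lin_diff: "lin ?E (\<lambda>e. g U e - g U' e) omg = lin ?E (g U) omg - lin ?E (g U') omg" for U U' omg
  by (simp add: lin_def sum_subtractf[symmetric] algebra_simps)
 have per_om: "(\<integral>th. wW L omg th * S omg (th (\<lambda>_. 0)) \<partial>?P) \<le> m/2 * (n + A2 omg / n) * (\<integral>th. wW L omg th \<partial>?P)" for omg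
 proof -
  define Z where "Z = (\<Sum>U\<in>Om. complex_of_real (r U) * cis (lin ?E (g U) omg))"
  have Zp: "Z = complex_of_real (cmod Z) * cis (Arg Z)"
   using rcis_cmod_Arg[of Z] by (simp add: rcis_def)
  have SZ: "S omg ph = cmod Z * cos (ph + Arg Z)" for ph
  proof -
   have "S omg ph = Re (Z * cis ph)"
    by (simp add: S_def Z_def sum_distrib_right mult.assoc cis_mult)
   also have "Z * cis ph = complex_of_real (cmod Z) * cis (ph + Arg Z)"
    by (subst Zp) (simp add: cis_mult mult.assoc add.commute)
   finally show ?thesis by simp
  qed
  have AZ: "A2 omg = (cmod Z)\<^sup>2"
  proof -
   have "complex_of_real ((cmod Z)\<^sup>2) = Z * cnj Z" by (rule complex_norm_square)
   also have "... = (\<Sum>U\<in>Om. \<Sum>U'\<in>Om. complex_of_real (r U * r U') * cis (lin ?E (g U) omg - lin ?E (g U') omg))"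
    unfolding Z_def by (simp add: sum_product cis_cnj cis_mult mult_ac diff_conv_add_uminus del: add_uminus_conv_diff)
   finally have "(cmod Z)\<^sup>2 = Re ..." by (metis Re_complex_of_real)
   then show ?thesis by (simp add: A2_def lin_diff)
  qed
  have "(\<integral>th. wW L omg th * S omg (th (\<lambda>_. 0)) \<partial>?P) = cmod Z * (\<integral>th. wW L omg th * cos (lin L origin_form th + Arg Z) \<partial>?P)"
   unfolding SZ lin0 by (subst integral_mult_right_zero[symmetric]) (simp add: mult_ac)
  also have "... \<le> cmod Z * (m * (\<integral>th. wW L omg th \<partial>?P))"
   unfolding m_def by (intro mult_left_mono mmp_general[OF L fs]) auto
  \<comment> \<open>The elementary bound of \<open>2 * cmod Z\<close> by \<open>n\<close> plus the
    square of \<open>cmod Z\<close> over \<open>n\<close> replaces the modulus by a second moment,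
    whose disorder mean can be computed.\<close>
  also have "... \<le> ((n + A2 omg / n) / 2) * (m * (\<integral>th. wW L omg th \<partial>?P))"
  proof (rule mult_right_mono)
   have "0 \<le> (n - cmod Z)\<^sup>2 / n" using n by simp
   also have "(n - cmod Z)\<^sup>2 / n = n + (cmod Z)\<^sup>2 / n - 2 * cmod Z"
    using n by (simp add: power2_eq_square field_simps)
   finally show "cmod Z \<le> (n + A2 omg / n) / 2" unfolding AZ by simp
   show "0 \<le> m * (\<integral>th. wW L omg th \<partial>?P)" using m0 wW_integral_pos[of L omg] by simp
  qed
  finally show ?thesis by (simp add: mult_ac)
 qed
 define BS where "BS = (\<Sum>U\<in>Om. r U)"
 define BW where "BW = exp (\<Sum>e\<in>?E. beta/2)"
 have Sb: "\<bar>S omg ph\<bar> \<le> BS" for omg ph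
  unfolding S_def BS_def by (rule order_trans[OF sum_abs], rule sum_mono) (use r0 in \<open>simp add: abs_mult mult_left_le less_imp_le\<close>)
 have A2b: "\<bar>A2 omg\<bar> \<le> BS * BS" for omg
  unfolding A2_def BS_def sum_product
  by (rule order_trans[OF sum_abs], rule sum_mono, rule order_trans[OF sum_abs], rule sum_mono)
    (use r0 in \<open>simp add: abs_mult mult_left_le less_imp_le\<close>)
 have Sm: "(\<lambda>(omg, th). wW L omg th * S omg (th (\<lambda>_. 0))) \<in> borel_measurable (?Q \<Otimes>\<^sub>M ?P)"
 proof -
  have "(\<lambda>p. S (fst p) (lin L origin_form (snd p))) \<in> borel_measurable (?Q \<Otimes>\<^sub>M ?P)"
   unfolding S_def by measurable
  then show ?thesis using wW_joint_measurable[OF L] unfolding lin0 case_prod_beta by (intro borel_measurable_times) auto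
 qed
 have Am: "A2 \<in> borel_measurable ?Q" unfolding A2_def[abs_def] by measurable
 have RHm: "(\<lambda>(omg, th). (n + A2 omg / n) * wW L omg th) \<in> borel_measurable (?Q \<Otimes>\<^sub>M ?P)"
  using wW_joint_measurable[OF L] measurable_compose[OF measurable_fst Am] unfolding case_prod_beta
  by (intro borel_measurable_times borel_measurable_add borel_measurable_divide) auto
 have Sbb: "\<bar>wW L omg th * S omg (th (\<lambda>_. 0))\<bar> \<le> BW * BS" for omg th
  unfolding abs_mult BW_def using wW_bounded Sb by (intro mult_mono) auto
 have Rbb: "\<bar>(n + A2 omg / n) * wW L omg th\<bar> \<le> (n + BS * BS / n) * BW" for omg th
 proof -
  have "\<bar>A2 omg / n\<bar> \<le> BS * BS / n" using A2b[of omg] n by (simp add: divide_right_mono)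
  then have "\<bar>n + A2 omg / n\<bar> \<le> n + BS * BS / n" using n by linarith
  then show ?thesis unfolding abs_mult BW_def using wW_bounded by (intro mult_mono) auto
 qed
 \<comment> \<open>After the gauge shift the sum along a path telescopes to the spin at the origin
   and cancels the phase of the observable, so this mean is exact for each
   \<open>th\<close>.\<close>
 have lhs_inner: "(\<integral>omg. wW L omg th * S omg (th (\<lambda>_. 0)) \<partial>?Q) = NN ^ card ?E * n" for th
 proof -
  have "(\<integral>omg. wW L omg th * S omg (th (\<lambda>_. 0)) \<partial>?Q) = (\<integral>omg. (\<Sum>U\<in>Om. r U * (wW L omg th * cos (lin ?E (g U) omg + th (\<lambda>_. 0)))) \<partial>?Q)"
   by (intro Bochner_Integration.integral_cong) (auto simp: S_def sum_distrib_left mult_ac)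
  also have "... = (\<Sum>U\<in>Om. r U * (\<integral>omg. wW L omg th * cos (lin ?E (g U) omg + th (\<lambda>_. 0)) \<partial>?Q))"
  proof (subst Bochner_Integration.integral_sum)
   fix U
   have m1: "(\<lambda>omg. wW L omg th) \<in> borel_measurable ?Q" if "th \<in> space ?P" for th
    using measurable_compose[OF _ wW_joint_measurable[OF L], of "\<lambda>omg. (omg, th)"] that by simp
   have m2: "(\<lambda>omg. wW L omg th) \<in> borel_measurable ?Q"
   proof -
    have e: "wW L omg th = wW L omg (restrict th L)" for omg
     unfolding wW_def lin_def by (intro arg_cong[where f=exp] sum.cong refl arg_cong2[where f=times] arg_cong[where f=cos] arg_cong2[where f="(+)"]) auto
    show ?thesis unfolding e by (rule m1) (auto simp: space_PiM)
   qed
   show "integrable ?Q (\<lambda>omg. r U * (wW L omg th * cos (lin ?E (g U) omg + th (\<lambda>_. 0))))"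
   proof (intro integrable_mult_right Q.integrable_bounded[of _ "BW * 1"])
    show "\<bar>wW L omg th * cos (lin ?E (g U) omg + th (\<lambda>_. 0))\<bar> \<le> BW * 1" for omg
     unfolding abs_mult BW_def using wW_bounded by (intro mult_mono) auto
   qed (use m2 in measurable)
  qed simp
  also have "... = (\<Sum>U\<in>Om. NN ^ card ?E)"
  proof (rule sum.cong[OF refl])
   fix U assume U: "U \<in> Om"
   have "{e\<in>?E. g U e \<noteq> 0} = \<gamma> U" using \<gamma>[OF U] by (auto simp: g_def)
   then show "r U * (\<integral>omg. wW L omg th * cos (lin ?E (g U) omg + th (\<lambda>_. 0)) \<partial>?Q) = NN ^ card ?E"
    using gauge_integral[OF L, of "g U" th "th (\<lambda>_. 0)"] ga[OF U, of th] rho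
    by (simp add: a_def[abs_def] r_def g_def)
  qed
  finally show ?thesis by (simp add: n_def)
 qed
 have wWm: "(\<lambda>omg. wW L omg th) \<in> borel_measurable ?Q" for th
 proof -
  have e: "wW L omg th = wW L omg (restrict th L)" for omg
   unfolding wW_def lin_def by (intro arg_cong[where f=exp] sum.cong refl arg_cong2[where f=times] arg_cong[where f=cos] arg_cong2[where f="(+)"]) auto
  have "restrict th L \<in> space ?P" by (auto simp: space_PiM)
  then show ?thesis unfolding e
   using measurable_compose[OF _ wW_joint_measurable[OF L], of "\<lambda>omg. (omg, restrict th L)"] by simp
 qed
 have rhs_inner: "(\<integral>omg. (n + A2 omg / n) * wW L omg th \<partial>?Q) \<le> NN ^ card ?E * (5 * n)" for th
 proof -
  let ?k = "\<lambda>U U' e. g U e - g U' e"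
  have i: "integrable ?Q (\<lambda>omg. wW L omg th * cos (lin ?E k omg + 0))" for k
  proof (intro Q.integrable_bounded[of _ "BW * 1"])
   show "\<bar>wW L omg th * cos (lin ?E k omg + 0)\<bar> \<le> BW * 1" for omg
    unfolding abs_mult BW_def using wW_bounded by (intro mult_mono) auto
  qed (use wWm in measurable)
  have "(\<integral>omg. (n + A2 omg / n) * wW L omg th \<partial>?Q) =
   (\<integral>omg. n * (wW L omg th * cos (lin ?E (\<lambda>_. 0) omg + 0)) + (\<Sum>U\<in>Om. \<Sum>U'\<in>Om. r U * r U' / n * (wW L omg th * cos (lin ?E (?k U U') omg + 0))) \<partial>?Q)"
   by (intro Bochner_Integration.integral_cong)
     (auto simp: A2_def lin_def[of _ "\<lambda>_. 0"] sum_distrib_left sum_distrib_right sum_divide_distrib algebra_simps)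
  also have "... = n * (\<integral>omg. wW L omg th * cos (lin ?E (\<lambda>_. 0) omg + 0) \<partial>?Q) +
    (\<Sum>U\<in>Om. \<Sum>U'\<in>Om. r U * r U' / n * (\<integral>omg. wW L omg th * cos (lin ?E (?k U U') omg + 0) \<partial>?Q))"
   using i by (subst Bochner_Integration.integral_add) (auto simp: Bochner_Integration.integral_sum)
  also have "(\<integral>omg. wW L omg th * cos (lin ?E (\<lambda>_. 0) omg + 0) \<partial>?Q) = NN ^ card ?E"
   using gauge_integral[OF L, of "\<lambda>_. 0" th 0] by (simp add: lin_def)
  also have "(\<Sum>U\<in>Om. \<Sum>U'\<in>Om. r U * r U' / n * (\<integral>omg. wW L omg th * cos (lin ?E (?k U U') omg + 0) \<partial>?Q))
    = (\<Sum>U\<in>Om. \<Sum>U'\<in>Om. NN ^ card ?E / n * (1 / rho\<^sup>2) ^ card (\<gamma> U \<inter> \<gamma> U'))"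
  proof (intro sum.cong refl)
   fix U U' assume U: "U \<in> Om" "U' \<in> Om"
   have fin: "finite (\<gamma> U)" "finite (\<gamma> U')"
    by (rule finite_subset[OF \<gamma>[OF U(1)] E], rule finite_subset[OF \<gamma>[OF U(2)] E])
   have sd: "{e\<in>?E. ?k U U' e \<noteq> 0} = (\<gamma> U - \<gamma> U') \<union> (\<gamma> U' - \<gamma> U)"
    using \<gamma>[OF U(1)] \<gamma>[OF U(2)] by (auto simp: g_def)
   have c: "card (\<gamma> U) + card (\<gamma> U') = card {e\<in>?E. ?k U U' e \<noteq> 0} + 2 * card (\<gamma> U \<inter> \<gamma> U')"
   proof -
    have "card {e\<in>?E. ?k U U' e \<noteq> 0} = card (\<gamma> U - \<gamma> U') + card (\<gamma> U' - \<gamma> U)"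
     unfolding sd using fin by (intro card_Un_disjoint) auto
    moreover have "card (\<gamma> U) = card (\<gamma> U \<inter> \<gamma> U') + card (\<gamma> U - \<gamma> U')"
     using fin by (metis card_Int_Diff)
    moreover have "card (\<gamma> U') = card (\<gamma> U \<inter> \<gamma> U') + card (\<gamma> U' - \<gamma> U)"
     using fin by (metis Int_commute card_Int_Diff)
    ultimately show ?thesis by simp
   qed
   have "(\<integral>omg. wW L omg th * cos (lin ?E (?k U U') omg + 0) \<partial>?Q) = NN ^ card ?E * rho ^ card {e\<in>?E. ?k U U' e \<noteq> 0}"
    using gauge_integral[OF L, of "?k U U'" th 0] lin_diff[of U U' "a th"] ga[OF U(1), of th] ga[OF U(2), of th]
    by (simp add: a_def[abs_def] g_def)
   \<comment> \<open>In the difference of two path characters the common bonds drop out, while the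
     normalisation still counts them twice; what remains is \<open>rho\<close> to the power minus
     twice their number.\<close>
   moreover have "r U * r U' * rho ^ card {e\<in>?E. ?k U U' e \<noteq> 0} = (1 / rho\<^sup>2) ^ card (\<gamma> U \<inter> \<gamma> U')"
   proof -
    have "rho ^ card (\<gamma> U) * rho ^ card (\<gamma> U') = rho ^ card {e\<in>?E. ?k U U' e \<noteq> 0} * (rho\<^sup>2) ^ card (\<gamma> U \<inter> \<gamma> U')"
     by (simp only: power_add[symmetric] power_mult[symmetric] c)
    then show ?thesis using rho(1) by (simp add: r_def power_one_over field_simps)
   qed
   ultimately show "r U * r U' / n * (\<integral>omg. wW L omg th * cos (lin ?E (?k U U') omg + 0) \<partial>?Q)
    = NN ^ card ?E / n * (1 / rho\<^sup>2) ^ card (\<gamma> U \<inter> \<gamma> U')" by (simp add: mult_ac)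
  qed
  also have "... = NN ^ card ?E / n * (\<Sum>U\<in>Om. \<Sum>U'\<in>Om. (1 / rho\<^sup>2) ^ card (\<gamma> U \<inter> \<gamma> U'))"
   by (simp add: sum_distrib_left)
  also have "... \<le> NN ^ card ?E / n * (4 * n\<^sup>2)"
  proof (rule mult_left_mono)
   have "(\<Sum>U\<in>Om. \<Sum>U'\<in>Om. (1 / rho\<^sup>2) ^ card (\<gamma> U \<inter> \<gamma> U')) \<le> (\<Sum>U\<in>Om. \<Sum>U'\<in>Om. (1+eta) ^ card (\<gamma> U \<inter> \<gamma> U'))"
    using rho by (intro sum_mono power_mono) auto
   then show "(\<Sum>U\<in>Om. \<Sum>U'\<in>Om. (1 / rho\<^sup>2) ^ card (\<gamma> U \<inter> \<gamma> U')) \<le> 4 * n\<^sup>2" using overlap by (simp add: n_def)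
  qed (use n NN_pos in auto)
  also have "n * NN ^ card ?E + NN ^ card ?E / n * (4 * n\<^sup>2) = NN ^ card ?E * (5 * n)"
   using n by (simp add: power2_eq_square field_simps)
  finally show ?thesis by simp
 qed
 have "NN ^ card ?E * n = (\<integral>th. (\<integral>omg. wW L omg th * S omg (th (\<lambda>_. 0)) \<partial>?Q) \<partial>?P)"
  unfolding lhs_inner using P.prob_space by simp
 also have "... = (\<integral>omg. (\<integral>th. wW L omg th * S omg (th (\<lambda>_. 0)) \<partial>?P) \<partial>?Q)"
  by (rule QP.Fubini_bounded(1)[OF Sm Sbb, symmetric])
 also have "... \<le> (\<integral>omg. m/2 * (\<integral>th. (n + A2 omg / n) * wW L omg th \<partial>?P) \<partial>?Q)"
 proof (rule integral_mono)
  have "(\<lambda>omg. \<integral>th. wW L omg th * S omg (th (\<lambda>_. 0)) \<partial>?P) \<in> borel_measurable ?Q"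
   using Sm by (rule P.borel_measurable_lebesgue_integral)
  moreover have "\<bar>\<integral>th. f th \<partial>?P\<bar> \<le> B" if "\<And>th. \<bar>f th\<bar> \<le> B" for f :: "_ => real" and B
  proof (cases "integrable ?P f")
   case True
   have "\<bar>\<integral>th. f th \<partial>?P\<bar> \<le> (\<integral>th. \<bar>f th\<bar> \<partial>?P)" by (rule integral_abs_bound)
   also have "... \<le> (\<integral>th. B \<partial>?P)" using True that by (intro integral_mono) auto
   finally show ?thesis by (simp add: P.prob_space)
  next
   case False
   have "0 \<le> B" using that[of undefined] by linarith
   then show ?thesis using False by (simp add: not_integrable_integral_eq)
  qed
  note ib = this
  show "integrable ?Q (\<lambda>omg. \<integral>th. wW L omg th * S omg (th (\<lambda>_. 0)) \<partial>?P)"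
   using calculation ib[OF Sbb] by (rule Q.integrable_bounded)
  have "(\<lambda>omg. \<integral>th. (n + A2 omg / n) * wW L omg th \<partial>?P) \<in> borel_measurable ?Q"
   using RHm by (rule P.borel_measurable_lebesgue_integral)
  then show "integrable ?Q (\<lambda>omg. m/2 * (\<integral>th. (n + A2 omg / n) * wW L omg th \<partial>?P))"
   using ib[OF Rbb] by (intro integrable_mult_right Q.integrable_bounded)
  show "(\<integral>th. wW L omg th * S omg (th (\<lambda>_. 0)) \<partial>?P) \<le> m/2 * (\<integral>th. (n + A2 omg / n) * wW L omg th \<partial>?P)" for omg
   using per_om[of omg] by simp
 qed
 also have "... = m/2 * (\<integral>th. (\<integral>omg. (n + A2 omg / n) * wW L omg th \<partial>?Q) \<partial>?P)"
  by (subst QP.Fubini_bounded(1)[OF RHm Rbb, symmetric]) simp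
 also have "... \<le> m/2 * (\<integral>th. NN ^ card ?E * (5 * n) \<partial>?P)"
 proof (intro mult_left_mono integral_mono_AE')
  show "AE th in ?P. (\<integral>omg. (n + A2 omg / n) * wW L omg th \<partial>?Q) \<le> NN ^ card ?E * (5 * n)" using rhs_inner by simp
  show "AE th in ?P. 0 \<le> NN ^ card ?E * (5 * n)" using n NN_pos by simp
 qed (use m0 in auto)
 also have "... = m/2 * (NN ^ card ?E * (5 * n))" by (simp add: P.prob_space)
 \<comment> \<open>The factor \<open>5 * n\<close> is the \<open>n\<close> of the quadratic bound
   plus \<open>4 * n\<close> from the overlaps; halved, it yields the constant 2/5.\<close>
 finally have "(NN ^ card ?E * n) * 1 \<le> (NN ^ card ?E * n) * (5/2 * m)" by (simp add: mult_ac)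
 then have "1 \<le> 5/2 * m" using n NN_pos by (subst (asm) mult_le_cancel_left_pos) auto
 then show ?thesis by (simp add: m_def)
qed

end

section \<open>The single-bond mean at low temperature\<close>

lemma one_minus_cos_le: "1 - cos t \<le> t\<^sup>2 / 2" for t :: real
proof -
 have "\<bar>sin (t/2)\<bar> \<le> \<bar>t/2\<bar>" by (rule abs_sin_x_le_abs_x)
 then have "(sin (t/2))\<^sup>2 \<le> (t/2)\<^sup>2" by (rule abs_le_square_iff[THEN iffD1])
 moreover have "cos t = 1 - 2 * (sin (t/2))\<^sup>2" using cos_double_sin[of "t/2"] by simp
 ultimately show ?thesis by (simp add: power_divide)
qed

context xy_model
begin

text \<open>Angles with \<open>1 - cos t \<le> dt\<close> contribute at most \<open>dt\<close> to
  the deficit. Elsewhere the weight is at most \<open>exp (- (beta/2 * dt))\<close> times its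
  maximum, while \<open>NN\<close> is bounded below by an interval of length \<open>sqrt dt\<close>
  on which \<open>1 - cos t \<le> dt/2\<close>.\<close>

lemma rho_lower:
 assumes dt: "0 < dt" "dt \<le> 1"
 shows "1 - rho \<le> dt + 4 * pi / sqrt dt * exp (- (beta/2 * (dt/2)))"
proof -
 let ?b = "beta/2" and ?k = "sqrt dt"
 have k: "0 < ?k" "?k \<le> 1" using dt by auto
 have i0: "integrable XY_prior w1"
  using w1_bounds by (intro nu.integrable_bounded[of _ "exp ?b"]) (auto simp: less_imp_le)
 have ic: "integrable XY_prior (\<lambda>t. w1 t * cos t)"
  using w1_bounds by (auto intro!: nu.integrable_bounded[of _ "exp ?b"] simp: abs_mult less_imp_le intro!: order_trans[OF mult_left_le])
 have w: "w1 t = exp ?b * exp (- ?b * (1 - cos t))" for t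
 proof -
  have "beta/2 * cos t = ?b + (- ?b * (1 - cos t))" by (simp add: right_diff_distrib)
  then show ?thesis by (simp only: w1_def exp_add)
 qed
 have "NN * (1 - rho) = (\<integral>t. w1 t \<partial>XY_prior) - (\<integral>t. w1 t * cos t \<partial>XY_prior)"
  using NN_pos by (simp add: rho_def NN_def right_diff_distrib)
 also have "... = (\<integral>t. w1 t - w1 t * cos t \<partial>XY_prior)"
  using i0 ic by simp
 also have "... \<le> (\<integral>t. dt * w1 t + 2 * exp ?b * exp (- ?b * dt) \<partial>XY_prior)"
 proof (rule integral_mono)
  fix t :: real
  show "w1 t - w1 t * cos t \<le> dt * w1 t + 2 * exp ?b * exp (- ?b * dt)"
  proof (cases "1 - cos t \<le> dt")
   case True
   then have "w1 t * (1 - cos t) \<le> w1 t * dt" using w1_bounds(1)[of t] by (intro mult_left_mono) auto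
   then have "w1 t - w1 t * cos t \<le> dt * w1 t" by (simp add: algebra_simps)
   then show ?thesis by (rule order_trans) simp
  next
   case False
   then have "?b * dt \<le> ?b * (1 - cos t)" using beta by (intro mult_left_mono) auto
   then have "w1 t \<le> exp ?b * exp (- ?b * dt)" unfolding w by (intro mult_left_mono) auto
   moreover have "0 \<le> 1 - cos t" "1 - cos t \<le> 2" using cos_ge_minus_one[of t] by auto
   ultimately have "w1 t * (1 - cos t) \<le> (exp ?b * exp (- ?b * dt)) * 2"
    by (intro mult_mono) auto
   then have "w1 t - w1 t * cos t \<le> 2 * exp ?b * exp (- ?b * dt)" by (simp add: algebra_simps)
   then show ?thesis by (rule order_trans) (use dt w1_bounds(1)[of t] in simp)
  qed
 qed (use i0 ic in auto)
 also have "... = dt * NN + 2 * exp ?b * exp (- ?b * dt)"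
  using i0 nu.prob_space by (simp add: NN_def)
 finally have 1: "NN * (1 - rho) \<le> dt * NN + 2 * exp ?b * exp (- ?b * dt)" .
 have "measure XY_prior {0..<?k} = ?k / (2*pi)"
 proof -
  have "?k \<le> 2 * pi" using k pi_gt3 by linarith
  then have "{0..<2*pi} \<inter> {0..<?k} = {0..<?k}" by auto
  then show ?thesis unfolding XY_prior_def using k by (subst measure_uniform_measure) auto
 qed
 then have "exp ?b * exp (- ?b * (dt/2)) * (?k / (2*pi)) = (\<integral>t. exp ?b * exp (- ?b * (dt/2)) * indicator {0..<?k} t \<partial>XY_prior)"
  by simp
 also have "... \<le> NN" unfolding NN_def
 proof (rule integral_mono)
  show "integrable XY_prior (\<lambda>t. exp ?b * exp (- ?b * (dt/2)) * indicator {0..<?k} t :: real)"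
   by (intro integrable_mult_right nu.integrable_bounded[of _ 1]) (auto split: split_indicator)
  fix t :: real
  show "exp ?b * exp (- ?b * (dt/2)) * indicator {0..<?k} t \<le> w1 t"
  proof (cases "t \<in> {0..<?k}")
   case True
   then have "t\<^sup>2 \<le> ?k\<^sup>2" by (intro power_mono) auto
   then have "1 - cos t \<le> dt/2" using one_minus_cos_le[of t] dt by simp
   then have "?b * (1 - cos t) \<le> ?b * (dt/2)" using beta by (intro mult_left_mono) auto
   then show ?thesis using True unfolding w by simp
  qed (use w1_bounds(1)[of t] in \<open>simp add: less_imp_le\<close>)
 qed (rule i0)
 finally have 2: "exp ?b * exp (- ?b * (dt/2)) * (?k / (2*pi)) \<le> NN" .
 have "2 * exp ?b * exp (- ?b * dt) = (4 * pi / ?k * exp (- (?b * (dt/2)))) * (exp ?b * exp (- ?b * (dt/2)) * (?k / (2*pi)))"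
 proof -
  have "exp (- ?b * dt) = exp (- (?b * (dt/2))) * exp (- ?b * (dt/2))" by (simp add: exp_add[symmetric])
  then show ?thesis using k by (simp add: field_simps)
 qed
 also have "... \<le> (4 * pi / ?k * exp (- (?b * (dt/2)))) * NN"
  using 2 k by (intro mult_left_mono) auto
 finally have "NN * (1 - rho) \<le> NN * (dt + 4 * pi / ?k * exp (- (?b * (dt/2))))"
  using 1 by (simp add: algebra_simps)
 then show ?thesis using NN_pos by (simp only: mult_le_cancel_left_pos)
qed

end

lemma rho_close_to_1:
 assumes ep: "0 < ep" "ep \<le> 1"
 shows "\<exists>beta>0. 1 - ep \<le> xy_model.rho beta"
proof -
 define dt where "dt = ep / 2"
 \<comment> \<open>With \<open>exp (- X) \<le> 1/X\<close> the second term of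
   \<open>rho_lower\<close> becomes \<open>ep/2\<close> for this \<open>X\<close>;
   \<open>beta\<close> is then chosen so that \<open>X\<close> is the exponent.\<close>
 define X where "X = 8 * pi / (sqrt dt * ep)"
 define beta where "beta = 2 * (2 * X / dt)"
 have dt: "0 < dt" "dt \<le> 1" using ep by (auto simp: dt_def)
 have X: "0 < X" using dt ep by (simp add: X_def)
 have bpos: "0 < beta" using X dt by (simp add: beta_def)
 interpret xy_model beta "TYPE(bool)" by unfold_locales (use bpos in simp)
 have bX: "beta/2 * (dt/2) = X" using dt by (simp add: beta_def)
 have "exp (- X) \<le> 1 / X"
 proof -
  have "X \<le> exp X" using exp_ge_add_one_self[of X] by linarith
  then show ?thesis using X by (simp add: exp_minus field_simps)
 qed
 then have "4 * pi / sqrt dt * exp (- X) \<le> 4 * pi / sqrt dt * (1 / X)" using dt by (intro mult_left_mono) auto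
 also have "... = ep / 2" using dt ep by (simp add: X_def field_simps)
 finally have "1 - rho \<le> ep" using rho_lower[OF dt] unfolding bX by (simp add: dt_def)
 then show ?thesis using bpos by (intro exI[of _ beta]) auto
qed

theorem XY_magnetization:
 assumes "CARD('d::finite) \<ge> 3"
 shows "\<exists>beta>0. \<forall>L :: 'd site set. finite L --> 2/5 \<le> xy_model.fv beta xy_model.origin_form L"
proof -
 obtain eta where eta: "0 < eta" and paths: "\<forall>n. \<exists>(Om :: (bool \<times> nat \<times> nat => nat) set) (\<gamma> :: _ => ('d site \<times> 'd site) set).
  finite Om \<and> Om \<noteq> {} \<and>
  (\<forall>U\<in>Om. \<gamma> U \<subseteq> {(i,j). adj i j \<and> (i \<in> box n \<or> j \<in> box n)} \<and>
    (\<forall>th. (\<forall>x. x \<notin> box n --> th x = (0::real)) --> (\<Sum>(i,j)\<in>\<gamma> U. th i - th j) = th (\<lambda>_. 0))) \<and>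
  (\<Sum>U\<in>Om. \<Sum>U'\<in>Om. (1+eta) ^ card (\<gamma> U \<inter> \<gamma> U')) \<le> 4 * (real (card Om))\<^sup>2"
  using directed_paths[OF assms] by (elim exE conjE) (rule that)
 \<comment> \<open>For \<open>ep \<le> 1/2\<close> the reciprocal of \<open>rho\<close> is at most
   \<open>1 + 2*ep\<close>, and its square at most \<open>1 + 8*ep\<close>.\<close>
 define ep where "ep = min (1/2) (eta/8)"
 have ep: "0 < ep" "ep \<le> 1" "ep \<le> 1/2" "8 * ep \<le> eta" using eta by (auto simp: ep_def)
 obtain beta where bpos: "0 < beta" and rb: "1 - ep \<le> xy_model.rho beta" using rho_close_to_1[OF ep(1,2)] by blast
 interpret xy_model beta "TYPE('d)" by unfold_locales (use bpos in simp)
 have r0: "0 < rho" using rb ep by linarith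
 have "1 / rho\<^sup>2 \<le> (1 + 2 * ep)\<^sup>2"
 proof -
  have "(1 + 2 * ep) * (1 - ep) \<ge> 1" using ep(1,3) mult_left_mono[of ep "1/2" "2*ep"] by (simp add: algebra_simps)
  then have "1 / (1 - ep) \<le> 1 + 2 * ep" using ep(3) by (simp add: divide_le_eq)
  moreover have "1 / rho \<le> 1 / (1 - ep)" using rb ep(3) by (intro divide_left_mono) auto
  ultimately have "1 / rho \<le> 1 + 2 * ep" by linarith
  then have "(1 / rho)\<^sup>2 \<le> (1 + 2 * ep)\<^sup>2" using r0 by (intro power_mono) auto
  then show ?thesis by (simp add: power_one_over)
 qed
 also have "... \<le> 1 + 8 * ep" using ep mult_left_mono[of ep 1 ep] by (simp add: power2_eq_square algebra_simps)
 finally have r2: "1 / rho\<^sup>2 \<le> 1 + eta" using ep(4) by linarith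
 have "2/5 \<le> fv origin_form L" if L: "finite L" for L :: "'d site set"
 proof -
  \<comment> \<open>The paths are available for boxes only; a general volume is enclosed in a box,
    and the expectation can only grow when passing back to the smaller volume.\<close>
  define C where "C = (\<Sum>x\<in>L. \<Sum>i\<in>UNIV. nat \<bar>x i\<bar>)"
  have LC: "L \<subseteq> box C"
  proof
   fix x assume x: "x \<in> L"
   have "nat \<bar>x i\<bar> \<le> C" for i
   proof -
    have "nat \<bar>x i\<bar> \<le> (\<Sum>i\<in>UNIV. nat \<bar>x i\<bar>)" by (rule member_le_sum) auto
    also have "... \<le> C" unfolding C_def using x L by (intro member_le_sum) auto
    finally show ?thesis .
   qed
   then have "\<bar>x i\<bar> \<le> int C" for i by (simp add: nat_le_iff)
   then show "x \<in> box C" by (simp add: box_def)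
  qed
  have fB: "finite (box C :: 'd site set)"
  proof (rule finite_subset)
   show "box C \<subseteq> (\<Pi>\<^sub>E i\<in>(UNIV::'d set). {- int C..int C})" by (auto simp: box_def abs_le_iff) (smt (verit))+
  qed (rule finite_PiE, auto)
  obtain Om :: "(bool \<times> nat \<times> nat => nat) set" and \<gamma> :: "_ => ('d site \<times> 'd site) set" where
   Om: "finite Om" "Om \<noteq> {}" and
   g: "\<forall>U\<in>Om. \<gamma> U \<subseteq> {(i,j). adj i j \<and> (i \<in> box C \<or> j \<in> box C)} \<and>
    (\<forall>th. (\<forall>x. x \<notin> box C --> th x = (0::real)) --> (\<Sum>(i,j)\<in>\<gamma> U. th i - th j) = th (\<lambda>_. 0))" and
   ov: "(\<Sum>U\<in>Om. \<Sum>U'\<in>Om. (1+eta) ^ card (\<gamma> U \<inter> \<gamma> U')) \<le> 4 * (real (card Om))\<^sup>2"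
   using spec[OF paths, of C] by (elim exE conjE) (rule that)
  have "2/5 \<le> fv origin_form (box C)"
  proof (rule magnetization_lower_bound[OF fB _ Om _ _ ov r0 r2])
   show "(\<lambda>_. 0) \<in> box C" by (simp add: box_def)
   show "\<gamma> U \<subseteq> bonds (box C)" if "U \<in> Om" for U using g that by (simp add: bonds_def)
   show "(\<Sum>(i,j)\<in>\<gamma> U. th i - th j) = th (\<lambda>_. 0)" if "U \<in> Om" "\<And>x. x \<notin> box C ==> th x = 0" for U and th :: "'d site => real"
    using g that by blast
  qed
  also have "... \<le> fv origin_form L"
   by (rule fv_antimono[OF fB LC]) (simp add: origin_form_def)
  finally show ?thesis .
 qed
 then show ?thesis using bpos by blast
qed

section \<open>The infinite-volume state\<close>

definition unit_confs :: "('v => complex) set" where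
 "unit_confs = {z. \<forall>x. norm (z x) = 1}"

text \<open>Angle configurations range over all reals; the compactness required by Stone-Weierstrass
  is gained by passing to unit complex numbers.\<close>

lemma compact_unit_confs: "compact (unit_confs :: ('v => complex) set)"
proof -
 have "compactin (product_topology (\<lambda>_. euclidean) UNIV) (\<Pi>\<^sub>E x\<in>(UNIV::'v set). sphere 0 1 :: complex set)"
  by (simp add: compactin_PiE)
 moreover have "(\<Pi>\<^sub>E x\<in>(UNIV::'v set). sphere 0 1 :: complex set) = unit_confs"
  by (auto simp: unit_confs_def)
 ultimately show ?thesis by (simp add: euclidean_product_topology)
qed

definition depends_on :: "'v set => (('v => 's) => 'b) => bool" where
 "depends_on K h \<longleftrightarrow> (\<forall>w w'. (\<forall>x\<in>K. w x = w' x) --> h w = h w')"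

text \<open>The span of the observables to which domination applies. Product formulas for cosines
  make it an algebra, as Stone-Weierstrass demands.\<close>

inductive_set trig :: "(('v => real) => real) set" where
 cos: "fin_supp k ==> (\<lambda>w. cos (linf k w + c)) \<in> trig"
| scale: "f \<in> trig ==> (\<lambda>w. a * f w) \<in> trig"
| add: "f \<in> trig ==> g \<in> trig ==> (\<lambda>w. f w + g w) \<in> trig"

lemma linf_superset:
 assumes "finite A" "{x. k x \<noteq> 0} \<subseteq> A"
 shows "linf k w = (\<Sum>x\<in>A. of_int (k x) * w x)"
 unfolding linf_def using assms by (intro sum.mono_neutral_left) auto

lemma linf_add:
 assumes "fin_supp k" "fin_supp l"
 shows "linf (\<lambda>x. k x + l x) w = linf k w + linf l w" "fin_supp (\<lambda>x. k x + l x)"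
proof -
 let ?A = "{x. k x \<noteq> 0} \<union> {x. l x \<noteq> 0}"
 have A: "finite ?A" using assms by simp
 have sub: "{x. k x + l x \<noteq> 0} \<subseteq> ?A" by auto
 show "fin_supp (\<lambda>x. k x + l x)" using sub A finite_subset by blast
 show "linf (\<lambda>x. k x + l x) w = linf k w + linf l w"
  using linf_superset[OF A sub, of w] linf_superset[of ?A k w] linf_superset[of ?A l w] A
  by (simp add: sum.distrib[symmetric] distrib_right)
qed

lemma linf_diff:
 assumes "fin_supp k" "fin_supp l"
 shows "linf (\<lambda>x. k x - l x) w = linf k w - linf l w" "fin_supp (\<lambda>x. k x - l x)"
proof -
 let ?A = "{x. k x \<noteq> 0} \<union> {x. l x \<noteq> 0}"
 have A: "finite ?A" using assms by simp
 have sub: "{x. k x - l x \<noteq> 0} \<subseteq> ?A" by auto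
 show "fin_supp (\<lambda>x. k x - l x)" using sub A finite_subset by blast
 show "linf (\<lambda>x. k x - l x) w = linf k w - linf l w"
  using linf_superset[OF A sub, of w] linf_superset[of ?A k w] linf_superset[of ?A l w] A
  by (simp add: sum_subtractf[symmetric] left_diff_distrib)
qed

lemma trig_const: "(\<lambda>w. c) \<in> trig"
proof -
 have "(\<lambda>w. c * cos (linf (\<lambda>_. 0) w + 0)) \<in> trig" by (intro trig.scale trig.cos) simp
 then show ?thesis by (simp add: linf_def)
qed

lemma trig_mult_cos:
 assumes f: "f \<in> trig" and k: "fin_supp k"
 shows "(\<lambda>w. f w * cos (linf k w + c)) \<in> trig"
 using f
proof induction
 case (cos l d)
 have "(\<lambda>w. 1/2 * (cos (linf (\<lambda>x. l x + k x) w + (d + c)) + cos (linf (\<lambda>x. l x - k x) w + (d - c)))) \<in> trig"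
  using linf_add(2)[OF cos k] linf_diff(2)[OF cos k] by (intro trig.intros)
 moreover have "cos (linf l w + d) * cos (linf k w + c) =
   1/2 * (cos (linf (\<lambda>x. l x + k x) w + (d + c)) + cos (linf (\<lambda>x. l x - k x) w + (d - c)))" for w
  unfolding linf_add(1)[OF cos k] linf_diff(1)[OF cos k] cos_times_cos by (simp add: algebra_simps)
 ultimately show ?case by (simp only:)
next
 case (scale f a) then show ?case using trig.scale[OF scale.IH, of a] by (simp add: mult.assoc)
next
 case (add f g) then show ?case using trig.add[OF add.IH] by (simp add: distrib_right)
qed

lemma trig_mult:
 assumes f: "f \<in> trig" and g: "g \<in> trig"
 shows "(\<lambda>w. f w * g w) \<in> trig"
 using g
proof induction
 case (cos k c) then show ?case by (rule trig_mult_cos[OF f])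
next
 case (scale g a) then show ?case using trig.scale[OF scale.IH, of a] by (simp add: mult.left_commute)
next
 case (add g h) then show ?case using trig.add[OF add.IH] by (simp add: distrib_left)
qed

lemma trig_bounded: "f \<in> trig ==> \<exists>B. \<forall>w. \<bar>f w\<bar> \<le> B"
proof (induction rule: trig.induct)
 case (cos k c) then show ?case by (intro exI[of _ 1]) simp
next
 case (scale f a)
 then obtain B where "\<forall>w. \<bar>f w\<bar> \<le> B" by blast
 then show ?case by (intro exI[of _ "\<bar>a\<bar> * B"]) (auto simp: abs_mult intro!: mult_left_mono)
next
 case (add f g)
 then obtain B C where "\<forall>w. \<bar>f w\<bar> \<le> B" "\<forall>w. \<bar>g w\<bar> \<le> C" by blast
 then show ?case by (intro exI[of _ "B + C"]) (meson abs_triangle_ineq add_mono order_trans)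
qed

lemma trig_measurable: "f \<in> trig ==> f \<in> borel_measurable (conf_space XY_prior)"
proof (induction rule: trig.induct)
 case (cos k c) show ?case by (rule cos_obs_measurable)
next
 case (scale f a)
 then show ?case by (intro borel_measurable_times) auto
next
 case (add f g)
 then show ?case by (intro borel_measurable_add)
qed

definition cisf :: "('v => real) => 'v => complex" where
 "cisf w = (\<lambda>x. cis (w x))"

lemma cisf_unit: "cisf w \<in> unit_confs"
 by (simp add: cisf_def unit_confs_def)

lemma trig_coord: "(\<lambda>w. cos (w x + c)) \<in> trig"
proof -
 let ?k = "\<lambda>y. if y = x then 1 else 0 :: int"
 have l: "linf ?k w = w x" for w
  using linf_superset[of "{x}" ?k w] by auto
 show ?thesis using trig.cos[of ?k c] by (simp add: l)
qed

lemma trig_dense: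
 fixes f :: "('v::countable => complex) => real"
 assumes f: "continuous_on unit_confs f" and e: "0 < e"
 shows "\<exists>g\<in>trig. \<forall>w. \<bar>f (cisf w) - g w\<bar> < e"
proof -
 define R where "R = {f :: ('v => complex) => real. continuous_on unit_confs f \<and> (\<lambda>w. f (cisf w)) \<in> trig}"
 interpret R: function_ring_on R unit_confs
 proof
  fix z z' :: "'v => complex" assume z: "z \<in> unit_confs" "z' \<in> unit_confs" "z \<noteq> z'"
  then obtain x where x: "z x \<noteq> z' x" by blast
  have re: "(\<lambda>z :: 'v => complex. Re (z x)) \<in> R"
   using trig_coord[of x 0] unfolding R_def
   by (auto simp: cisf_def intro!: continuous_intros continuous_on_product_then_coordinatewise[OF continuous_on_id])
  have "(\<lambda>w. sin (w x)) \<in> trig" using trig_coord[of x "- (pi/2)"] by (simp add: cos_diff)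
  then have im: "(\<lambda>z :: 'v => complex. Im (z x)) \<in> R"
   unfolding R_def
   by (auto simp: cisf_def intro!: continuous_intros continuous_on_product_then_coordinatewise[OF continuous_on_id])
  show "\<exists>f\<in>R. f z \<noteq> f z'" using re im x by (metis complex_eqI)
 qed (auto simp: R_def compact_unit_confs trig_const intro!: trig.add trig_mult continuous_intros)
 obtain g where "g \<in> R" "\<forall>z\<in>unit_confs. \<bar>f z - g z\<bar> < e"
  using R.Stone_Weierstrass_basic[OF f e] by blast
 then show ?thesis using cisf_unit by (intro bexI[of _ "\<lambda>w. g (cisf w)"]) (auto simp: R_def)
qed

text \<open>Convergence is proved with one limit for all these sequences. Translates of an
  exhausting sequence are exhausting, which is how translation invariance of the limit
  arises.\<close>

definition exhausting :: "(nat => 'v set) => bool" where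
 "exhausting Ls \<longleftrightarrow> (\<forall>n. finite (Ls n)) \<and> (\<forall>K. finite K --> (\<forall>\<^sub>F n in sequentially. K \<subseteq> Ls n))"

lemma exhausting_exists: "\<exists>Ls. exhausting (Ls :: nat => 'd::finite site set)"
proof -
 have cnt: "countable (UNIV :: 'd site set)" by simp
 define Ls where "Ls n = from_nat_into (UNIV :: 'd site set) ` {..n}" for n
 have "\<forall>\<^sub>F n in sequentially. K \<subseteq> Ls n" if K: "finite K" for K
 proof -
  have "\<forall>\<^sub>F n in sequentially. \<forall>x\<in>K. x \<in> Ls n"
  proof (subst eventually_ball_finite_distrib[OF K], rule ballI)
   fix x :: "'d => int"
   have "\<exists>m. from_nat_into UNIV m = x" using from_nat_into_surj[OF cnt, of x] by simp
   then obtain m where m: "from_nat_into UNIV m = x" by blast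
   show "\<forall>\<^sub>F n in sequentially. x \<in> Ls n"
    using eventually_ge_at_top[of m] by eventually_elim (auto simp: Ls_def m[symmetric])
  qed
  then show ?thesis by eventually_elim auto
 qed
 then show ?thesis unfolding exhausting_def Ls_def by (intro exI[of _ Ls]) (auto simp: Ls_def)
qed

context xy_model
begin

section \<open>Convergence of finite-volume expectations\<close>

definition E0 :: "'d site set => (('d site => real) => real) => real" where
 "E0 L f = av L f (\<lambda>_. 0)"

lemma E0_add: "finite L ==> f \<in> borel_measurable CS ==> (\<And>v. \<bar>f v\<bar> \<le> B) ==>
  g \<in> borel_measurable CS ==> (\<And>v. \<bar>g v\<bar> \<le> C) ==> E0 L (\<lambda>w. f w + g w) = E0 L f + E0 L g"
 unfolding E0_def by (rule avg_add) auto

lemma E0_close: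
 assumes L: "finite L" and f: "f \<in> borel_measurable CS" "\<And>v. \<bar>f v\<bar> \<le> B"
  and g: "g \<in> borel_measurable CS" "\<And>v. \<bar>g v\<bar> \<le> C" and e: "\<And>v. \<bar>f v - g v\<bar> \<le> e"
 shows "\<bar>E0 L f - E0 L g\<bar> \<le> e"
proof -
 have "E0 L (\<lambda>w. f w + -1 * g w) = E0 L f + E0 L (\<lambda>w. -1 * g w)"
  using L f g by (intro E0_add[where B=B and C=C]) auto
 also have "E0 L (\<lambda>w. -1 * g w) = - E0 L g" unfolding E0_def avg_cmult by simp
 finally have "E0 L f - E0 L g = E0 L (\<lambda>w. f w + -1 * g w)" by simp
 moreover have "\<bar>E0 L (\<lambda>w. f w + -1 * g w)\<bar> \<le> e"
  unfolding E0_def using f g e by (intro avg_bounded[OF L]) auto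
 ultimately show ?thesis by simp
qed

text \<open>Monotonicity in the volume and nonnegativity make the infimum over all finite volumes
  the limit along every exhausting sequence.\<close>

lemma fv_limit:
 assumes k: "fin_supp k"
 shows "\<exists>l. \<forall>Ls. exhausting Ls --> (\<lambda>n. fv k (Ls n)) \<longlonglongrightarrow> l"
proof -
 define l where "l = Inf (fv k ` {L. finite L})"
 have bdd: "bdd_below (fv k ` {L. finite L})" using fv_nonneg[OF _ k] by (intro bdd_belowI2[of _ 0]) auto
 show ?thesis
 proof (intro exI[of _ l] allI impI LIMSEQ_I)
  fix Ls :: "nat => 'd site set" and r :: real assume Ls: "exhausting Ls" and r: "0 < r"
  have "\<exists>y\<in>fv k ` {L. finite L}. y < l + r"
   using r cInf_lessD[of "fv k ` {L. finite L}" "l + r"] by (auto simp: l_def)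
  then obtain K where K: "finite K" "fv k K < l + r" by auto
  have "\<forall>\<^sub>F n in sequentially. K \<subseteq> Ls n" using Ls K(1) by (simp add: exhausting_def)
  then obtain N where N: "\<And>n. n \<ge> N ==> K \<subseteq> Ls n" by (auto simp: eventually_sequentially)
  have "norm (fv k (Ls n) - l) < r" if "n \<ge> N" for n
  proof -
   have f: "finite (Ls n)" using Ls by (simp add: exhausting_def)
   have "fv k (Ls n) \<le> fv k K" by (rule fv_antimono[OF f N[OF that] k])
   moreover have "l \<le> fv k (Ls n)" unfolding l_def using f bdd by (intro cInf_lower) auto
   ultimately show ?thesis using K(2) by simp
  qed
  then show "\<exists>N. \<forall>n\<ge>N. norm (fv k (Ls n) - l) < r" by blast
 qed
qed

lemma trig_limit: "f \<in> trig ==> \<exists>l. \<forall>Ls. exhausting Ls --> (\<lambda>n. E0 (Ls n) f) \<longlonglongrightarrow> l"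
proof (induction rule: trig.induct)
 case (cos k c)
 then obtain l where l: "\<forall>Ls. exhausting Ls --> (\<lambda>n. fv k (Ls n)) \<longlonglongrightarrow> l" using fv_limit by blast
 have "(\<lambda>n. E0 (Ls n) (\<lambda>w. cos (linf k w + c))) \<longlonglongrightarrow> cos c * l" if Ls: "exhausting Ls" for Ls
 proof -
  have "E0 (Ls n) (\<lambda>w. cos (linf k w + c)) = cos c * fv k (Ls n)" for n
   unfolding E0_def using Ls by (intro av_cos_shift cos) (simp add: exhausting_def)
  then show ?thesis using l Ls by (auto intro!: tendsto_mult)
 qed
 then show ?case by blast
next
 case (scale f a)
 then obtain l where l: "\<forall>Ls. exhausting Ls --> (\<lambda>n. E0 (Ls n) f) \<longlonglongrightarrow> l" by blast
 have "E0 L (\<lambda>w. a * f w) = a * E0 L f" for L unfolding E0_def by (rule avg_cmult)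
 then show ?case using l by (intro exI[of _ "a * l"]) (auto intro!: tendsto_mult)
next
 case (add f g)
 then obtain l m where l: "\<forall>Ls. exhausting Ls --> (\<lambda>n. E0 (Ls n) f) \<longlonglongrightarrow> l"
  and m: "\<forall>Ls. exhausting Ls --> (\<lambda>n. E0 (Ls n) g) \<longlonglongrightarrow> m" by blast
 obtain B C where B: "\<forall>w. \<bar>f w\<bar> \<le> B" and C: "\<forall>w. \<bar>g w\<bar> \<le> C" using trig_bounded add.hyps by metis
 have "E0 L (\<lambda>w. f w + g w) = E0 L f + E0 L g" if "finite L" for L
  using that B C add.hyps trig_measurable by (intro E0_add[where B=B and C=C]) auto
 then have "(\<lambda>n. E0 (Ls n) (\<lambda>w. f w + g w)) \<longlonglongrightarrow> l + m" if "exhausting Ls" for Ls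
  using l m that by (auto simp: exhausting_def intro!: tendsto_add)
 then show ?case by blast
qed

text \<open>Approximation by \<open>trig\<close> is uniform in the configuration, so the error in
  the expectations is uniform in the volume and limits can be exchanged.\<close>

lemma cont_limit:
 assumes f: "continuous_on unit_confs f" and m: "(\<lambda>w. f (cisf w)) \<in> borel_measurable CS"
 shows "\<exists>l. \<forall>Ls. exhausting Ls --> (\<lambda>n. E0 (Ls n) (\<lambda>w. f (cisf w))) \<longlonglongrightarrow> l"
proof -
 let ?f = "\<lambda>w. f (cisf w)"
 have "bounded (f ` unit_confs)" by (intro compact_imp_bounded compact_continuous_image f compact_unit_confs)
 then obtain B where "\<forall>z\<in>unit_confs. \<bar>f z\<bar> \<le> B" by (auto simp: bounded_iff)
 then have B: "\<bar>?f w\<bar> \<le> B" for w using cisf_unit by auto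
 have approx: "\<exists>lg. \<forall>Ls. exhausting Ls --> (\<forall>\<^sub>F n in sequentially. \<bar>E0 (Ls n) ?f - lg\<bar> < e)" if e: "0 < e" for e
 proof -
  have e2: "0 < e/2" using e by simp
  obtain g where g: "g \<in> trig" "\<forall>w. \<bar>?f w - g w\<bar> < e/2" using trig_dense[OF f e2] by blast
  obtain lg where lg: "\<forall>Ls. exhausting Ls --> (\<lambda>n. E0 (Ls n) g) \<longlonglongrightarrow> lg" using trig_limit[OF g(1)] by blast
  obtain C where C: "\<And>w. \<bar>g w\<bar> \<le> C" using trig_bounded[OF g(1)] by blast
  have "\<forall>\<^sub>F n in sequentially. \<bar>E0 (Ls n) ?f - lg\<bar> < e" if Ls: "exhausting Ls" for Ls
  proof -
   have "\<forall>\<^sub>F n in sequentially. \<bar>E0 (Ls n) g - lg\<bar> < e/2"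
    using tendstoD[OF lg[rule_format, OF Ls] e2] by (simp add: dist_real_def)
   then show ?thesis
   proof eventually_elim
    case (elim n)
    have "\<bar>E0 (Ls n) ?f - E0 (Ls n) g\<bar> \<le> e/2"
     using Ls g(2) by (intro E0_close[OF _ m B trig_measurable[OF g(1)] C]) (auto simp: exhausting_def less_imp_le)
    then show ?case using elim by linarith
   qed
  qed
  then show ?thesis by blast
 qed
 obtain Bs :: "nat => 'd site set" where Bs: "exhausting Bs" using exhausting_exists by blast
 have "Cauchy (\<lambda>n. E0 (Bs n) ?f)"
 proof (rule CauchyI')
  fix e :: real assume "0 < e"
  then obtain lg where lg: "\<forall>\<^sub>F n in sequentially. \<bar>E0 (Bs n) ?f - lg\<bar> < e/2" using approx[of "e/2"] Bs by auto
  then obtain N where N: "\<And>n. n \<ge> N ==> \<bar>E0 (Bs n) ?f - lg\<bar> < e/2" by (auto simp: eventually_sequentially)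
  have "dist (E0 (Bs m) ?f) (E0 (Bs n) ?f) < e" if "m \<ge> N" "m < n" for m n
   using N[of m] N[of n] that unfolding dist_real_def by linarith
  then show "\<exists>M. \<forall>m\<ge>M. \<forall>n>m. dist (E0 (Bs m) ?f) (E0 (Bs n) ?f) < e" by blast
 qed
 then obtain l where l: "(\<lambda>n. E0 (Bs n) ?f) \<longlonglongrightarrow> l" using Cauchy_convergent convergent_def by blast
 have "(\<lambda>n. E0 (Ls n) ?f) \<longlonglongrightarrow> l" if Ls: "exhausting Ls" for Ls
 proof (rule tendstoI)
  fix e :: real assume "0 < e"
  then have e: "0 < e/4" by simp
  obtain lg where lg: "\<And>Ls. exhausting Ls ==> \<forall>\<^sub>F n in sequentially. \<bar>E0 (Ls n) ?f - lg\<bar> < e/4" using approx[OF e] by blast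
  have "\<forall>\<^sub>F n in sequentially. \<bar>E0 (Bs n) ?f - l\<bar> < e/4" using tendstoD[OF l e] by (simp add: dist_real_def)
  with lg[OF Bs] have "\<forall>\<^sub>F n in sequentially. \<bar>lg - l\<bar> < e/2" by eventually_elim linarith
  then have ll: "\<bar>lg - l\<bar> < e/2" by simp
  show "\<forall>\<^sub>F n in sequentially. dist (E0 (Ls n) ?f) l < e"
   using lg[OF Ls]
  proof eventually_elim
   case (elim n)
   then show ?case unfolding dist_real_def using ll by linarith
  qed
 qed
 then show ?thesis by blast
qed

text \<open>The Boltzmann factor with the boundary spins as complex numbers: in this form it is
  continuous in the boundary, while the spins inside remain angles to be integrated.\<close>

definition hz :: "'d site set => ('d site => real) => ('d site => complex) => real" where
 "hz J s z = exp (\<Sum>(i,j)\<in>bonds J. beta/2 * Re ((if i \<in> J then cis (s i) else z i) * cnj (if j \<in> J then cis (s j) else z j)))"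

lemma hz_cisf: "exp (- HH J (merge_conf J s w)) = hz J s (cisf w)"
proof -
 have "cos (merge_conf J s w i - merge_conf J s w j) =
   Re ((if i \<in> J then cis (s i) else cisf w i) * cnj (if j \<in> J then cis (s j) else cisf w j))" for i j
  by (simp add: merge_conf_def cisf_def cos_diff)
 then show ?thesis unfolding H_XY_def bonds_def[symmetric] hz_def
  by (simp add: sum_distrib_left sum_divide_distrib case_prod_unfold sum_negf)
qed

lemma hz_continuous: "continuous_on A (hz J s)"
proof -
 have c: "continuous_on A (\<lambda>z. if i \<in> J then cis (s i) else z i)" for i
  by (cases "i \<in> J") (auto intro!: continuous_intros continuous_on_product_then_coordinatewise[OF continuous_on_id])
 show ?thesis unfolding hz_def[abs_def] case_prod_unfold by (intro continuous_intros c)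
qed

lemma hz_bounds:
 assumes z: "z \<in> unit_confs"
 shows "exp (- (\<Sum>e\<in>bonds J. beta/2)) \<le> hz J s z" "hz J s z \<le> exp (\<Sum>e\<in>bonds J. beta/2)"
proof -
 let ?v = "\<lambda>i. if i \<in> J then cis (s i) else z i"
 have b: "\<bar>Re (?v i * cnj (?v j))\<bar> \<le> 1" for i j
 proof -
  have "norm (?v i) = 1" "norm (?v j) = 1" using z by (auto simp: unit_confs_def)
  then have "norm (?v i * cnj (?v j)) = 1" by (simp only: norm_mult complex_mod_cnj mult_1)
  then show ?thesis using abs_Re_le_cmod[of "?v i * cnj (?v j)"] by simp
 qed
 have pr: "- (beta/2) \<le> beta/2 * Re (?v i * cnj (?v j)) \<and> beta/2 * Re (?v i * cnj (?v j)) \<le> beta/2" for i j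
 proof -
  have "\<bar>beta/2 * Re (?v i * cnj (?v j))\<bar> \<le> beta/2 * 1"
   unfolding abs_mult using beta b[of i j] by (intro mult_mono) auto
  moreover have "\<bar>x\<bar> \<le> c ==> - c \<le> x \<and> x \<le> c" for x c :: real by linarith
  ultimately show ?thesis unfolding mult_1_right by blast
 qed
 show "exp (- (\<Sum>e\<in>bonds J. beta/2)) \<le> hz J s z"
  unfolding hz_def exp_le_cancel_iff sum_negf[symmetric] case_prod_unfold
  by (rule sum_mono, rule conjunct1[OF pr])
 show "hz J s z \<le> exp (\<Sum>e\<in>bonds J. beta/2)"
  unfolding hz_def exp_le_cancel_iff case_prod_unfold
  by (rule sum_mono, rule conjunct2[OF pr])
qed

lemma hz_measurable: "(\<lambda>s. hz J s z) \<in> borel_measurable (XYP J)"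
proof -
 have c: "(\<lambda>s. if i \<in> J then cis (s i) else z i) \<in> borel_measurable (XYP J)" for i
 proof (cases "i \<in> J")
  case True
  have "cis \<in> borel_measurable borel" by (intro borel_measurable_continuous_onI continuous_intros)
  then show ?thesis using measurable_compose[OF measurable_XYP_coord[OF True]] True by simp
 qed simp
 have "cnj \<in> borel_measurable borel" by (intro borel_measurable_continuous_onI continuous_intros)
 from measurable_compose[OF c this]
 have p: "(\<lambda>s. (if i \<in> J then cis (s i) else z i) * cnj (if j \<in> J then cis (s j) else z j)) \<in> borel_measurable (XYP J)" for i j
  by (intro borel_measurable_times c)
 have "(\<lambda>s. beta/2 * Re ((if i \<in> J then cis (s i) else z i) * cnj (if j \<in> J then cis (s j) else z j))) \<in> borel_measurable (XYP J)" for i j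
  by (intro borel_measurable_times borel_measurable_const measurable_compose[OF p borel_measurable_Re])
 then show ?thesis unfolding hz_def case_prod_unfold
  by (intro measurable_compose[OF borel_measurable_sum borel_measurable_exp]) auto
qed

lemma hz_integral:
 assumes z: "z \<in> unit_confs"
 shows "integrable (XYP J) (\<lambda>s. hz J s z)" "exp (- (\<Sum>e\<in>bonds J. beta/2)) \<le> (\<integral>s. hz J s z \<partial>XYP J)"
proof -
 interpret PJ: prob_space "XYP J" by (rule prob_space_XYP)
 show i: "integrable (XYP J) (\<lambda>s. hz J s z)"
  using hz_bounds[OF z] by (intro PJ.integrable_bounded[of _ "exp (\<Sum>e\<in>bonds J. beta/2)"] hz_measurable) (simp add: hz_def)
 have "exp (- (\<Sum>e\<in>bonds J. beta/2)) = (\<integral>s. exp (- (\<Sum>e\<in>bonds J. beta/2)) \<partial>XYP J)" by (simp add: PJ.prob_space)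
 also have "... \<le> (\<integral>s. hz J s z \<partial>XYP J)" using i hz_bounds[OF z] by (intro integral_mono) auto
 finally show "exp (- (\<Sum>e\<in>bonds J. beta/2)) \<le> (\<integral>s. hz J s z \<partial>XYP J)" .
qed

lemma hz_integral_continuous: "continuous_on unit_confs (\<lambda>z. \<integral>s. hz J s z \<partial>XYP J)"
proof (subst continuous_on_sequentially, intro allI ballI impI)
 interpret PJ: prob_space "XYP J" by (rule prob_space_XYP)
 fix x :: "nat => 'd site => complex" and a assume a: "a \<in> unit_confs" and x: "(\<forall>n. x n \<in> unit_confs) \<and> x \<longlonglongrightarrow> a"
 show "((\<lambda>z. \<integral>s. hz J s z \<partial>XYP J) \<circ> x) \<longlonglongrightarrow> (\<integral>s. hz J s a \<partial>XYP J)"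
  unfolding comp_def
 proof (rule integral_dominated_convergence[where w="\<lambda>_. exp (\<Sum>e\<in>bonds J. beta/2)"])
  show "AE s in XYP J. (\<lambda>n. hz J s (x n)) \<longlonglongrightarrow> hz J s a"
  proof (rule AE_I2)
   fix s
   have "continuous_on unit_confs (hz J s)" by (rule hz_continuous)
   then show "(\<lambda>n. hz J s (x n)) \<longlonglongrightarrow> hz J s a"
    using x a unfolding continuous_on_sequentially comp_def by blast
  qed
  show "AE s in XYP J. norm (hz J s (x n)) \<le> exp (\<Sum>e\<in>bonds J. beta/2)" for n
   using x hz_bounds(2)[of "x n" J] by (intro AE_I2) (auto simp: hz_def)
 qed (auto intro: hz_measurable)
qed

definition kdens :: "'d site set => ('d site => real) => ('d site => complex) => real" where
 "kdens J s z = hz J s z / (\<integral>s. hz J s z \<partial>XYP J)"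

lemma kdens_continuous: "continuous_on unit_confs (kdens J s)"
proof -
 have "(\<integral>s. hz J s z \<partial>XYP J) \<noteq> 0" if "z \<in> unit_confs" for z
  using hz_integral(2)[OF that, of J] exp_gt_zero[of "- (\<Sum>e\<in>bonds J. beta/2)"] by linarith
 then show ?thesis unfolding kdens_def[abs_def]
  by (intro continuous_on_divide hz_continuous hz_integral_continuous) auto
qed

lemma kdens_bounds:
 assumes z: "z \<in> unit_confs"
 shows "0 \<le> kdens J s z" "kdens J s z \<le> exp (2 * (\<Sum>e\<in>bonds J. beta/2))"
proof -
 let ?C = "\<Sum>e\<in>bonds J. beta/2"
 have Z: "exp (- ?C) \<le> (\<integral>s. hz J s z \<partial>XYP J)" by (rule hz_integral(2)[OF z])
 have Z0: "0 < (\<integral>s. hz J s z \<partial>XYP J)" using Z exp_gt_zero[of "- ?C"] by linarith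
 show "0 \<le> kdens J s z" using Z0 by (simp add: kdens_def hz_def)
 have "kdens J s z \<le> exp ?C / exp (- ?C)"
  unfolding kdens_def using Z hz_bounds(2)[OF z] by (intro frac_le) auto
 also have "... = exp (2 * ?C)" by (simp only: exp_diff[symmetric]) simp
 finally show "kdens J s z \<le> exp (2 * ?C)" .
qed

lemma av_kdens:
 assumes J: "finite J"
 shows "av J (\<lambda>w. g (restrict w J)) w = (\<integral>s. kdens J s (cisf w) * g s \<partial>XYP J)"
proof -
 have "restrict (merge_conf J s w) J = s" if "s \<in> space (XYP J)" for s
  using that by (auto simp: merge_conf_def space_PiM PiE_iff extensional_def)
 then have "(\<integral>s. exp (- HH J (merge_conf J s w)) * g (restrict (merge_conf J s w) J) \<partial>XYP J) = (\<integral>s. hz J s (cisf w) * g s \<partial>XYP J)"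
  by (intro Bochner_Integration.integral_cong) (auto simp: hz_cisf)
 then show ?thesis unfolding avg_def hz_cisf kdens_def by simp
qed

lemma measurable_restrict_conf: "(\<lambda>w. restrict w J) \<in> measurable CS (XYP J)"
 unfolding conf_space_def by (rule measurable_restrict_subset) simp

lemma kdens_joint_measurable:
 assumes J: "finite J"
 shows "(\<lambda>(w, s). kdens J s (cisf w)) \<in> borel_measurable (CS \<Otimes>\<^sub>M XYP J)"
proof -
 interpret PJ: prob_space "XYP J" by (rule prob_space_XYP)
 have m: "(\<lambda>(w, s). hz J s (cisf w)) \<in> borel_measurable (CS \<Otimes>\<^sub>M XYP J)"
  using num_measurable2[OF J, of "\<lambda>_. 1"] by (simp add: hz_cisf)
 have "(\<lambda>w. \<integral>s. hz J s (cisf w) \<partial>XYP J) \<in> borel_measurable CS"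
  using m by (rule PJ.borel_measurable_lebesgue_integral)
 from measurable_compose[OF measurable_fst this] m show ?thesis
  unfolding kdens_def case_prod_unfold by (intro borel_measurable_divide) auto
qed

text \<open>Local events are smoothed by one application of the kernel of \<open>J\<close>, so the limit of
 \<open>E0\<close> on continuous functions determines densities for the marginals of the limit state.\<close>
lemma local_limit:
 assumes J: "finite J"
 shows "\<exists>F. F \<in> borel_measurable (XYP J) \<and> (\<forall>s\<in>space (XYP J). 0 \<le> F s) \<and> (\<exists>C. \<forall>s\<in>space (XYP J). F s \<le> C) \<and>
  (\<forall>g B Ls. g \<in> borel_measurable (XYP J) --> (\<forall>s. \<bar>g s\<bar> \<le> B) --> exhausting Ls -->
   (\<lambda>n. E0 (Ls n) (\<lambda>w. g (restrict w J))) \<longlonglongrightarrow> (\<integral>s. F s * g s \<partial>XYP J))"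
proof -
 interpret PJ: prob_space "XYP J" by (rule prob_space_XYP)
 define C where "C = exp (2 * (\<Sum>e\<in>bonds J. beta/2))"
 obtain Bs :: "nat => 'd site set" where Bs: "exhausting Bs" using exhausting_exists by blast
 have km: "(\<lambda>w. kdens J s (cisf w)) \<in> borel_measurable CS" if "s \<in> space (XYP J)" for s
  using measurable_compose[OF _ kdens_joint_measurable[OF J], of "\<lambda>w. (w, s)"] that by simp
 have kb: "0 \<le> kdens J s (cisf w)" "kdens J s (cisf w) \<le> C" for s w
  using kdens_bounds[OF cisf_unit] by (auto simp: C_def)
 \<comment> \<open>Defined along the single sequence \<open>Bs\<close>; \<open>Flim\<close> shows
   that all exhausting sequences give the same value.\<close>
 define F where "F s = lim (\<lambda>n. E0 (Bs n) (\<lambda>w. kdens J s (cisf w)))" for s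
 have Flim: "(\<lambda>n. E0 (Ls n) (\<lambda>w. kdens J s (cisf w))) \<longlonglongrightarrow> F s" if Ls: "exhausting Ls" and s: "s \<in> space (XYP J)" for Ls s
 proof -
  obtain l where l: "\<forall>Ls. exhausting Ls --> (\<lambda>n. E0 (Ls n) (\<lambda>w. kdens J s (cisf w))) \<longlonglongrightarrow> l"
   using cont_limit[OF kdens_continuous km[OF s]] by blast
  then have "F s = l" using Bs unfolding F_def by (intro limI) blast
  then show ?thesis using l Ls by blast
 qed
 have E0b: "0 \<le> E0 L (\<lambda>w. kdens J s (cisf w))" "E0 L (\<lambda>w. kdens J s (cisf w)) \<le> C"
  if L: "finite L" and s: "s \<in> space (XYP J)" for L s
 proof -
  have "\<bar>E0 L (\<lambda>w. kdens J s (cisf w)) \<bar> \<le> C"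
   unfolding E0_def using kb km[OF s] by (intro avg_bounded[OF L]) auto
  then show "E0 L (\<lambda>w. kdens J s (cisf w)) \<le> C" by simp
  have "av L (\<lambda>_. 0) (\<lambda>_. 0) \<le> E0 L (\<lambda>w. kdens J s (cisf w))"
   unfolding E0_def using kb km[OF s] by (intro avg_mono[OF L, where B=0 and B'=C]) auto
  then show "0 \<le> E0 L (\<lambda>w. kdens J s (cisf w))" using avg_const[OF L, of "\<lambda>_. 0" 0] by simp
 qed
 have finB: "finite (Ls n)" if "exhausting Ls" for Ls :: "nat => 'd site set" and n using that by (simp add: exhausting_def)
 have E0k: "E0 L h = (\<integral>v. h v \<partial>kern L (\<lambda>_. 0))" if "finite L" "h \<in> borel_measurable CS" for L h
  unfolding E0_def using that by (intro kern_integral[symmetric]) auto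
 have km2: "(\<lambda>(v, s). kdens J s (cisf v)) \<in> borel_measurable (kern L w \<Otimes>\<^sub>M XYP J)" for L w
  using kdens_joint_measurable[OF J] by (simp cong: measurable_cong_sets sets_pair_measure_cong)
 have E0m: "(\<lambda>s. E0 L (\<lambda>w. kdens J s (cisf w))) \<in> borel_measurable (XYP J)" if L: "finite L" for L
 proof -
  interpret K: prob_space "kern L (\<lambda>_. 0)" by (rule kern_prob[OF L]) simp
  have "(\<lambda>(s, v). kdens J s (cisf v)) \<in> borel_measurable (XYP J \<Otimes>\<^sub>M kern L (\<lambda>_. 0))"
   using measurable_compose[OF measurable_pair_swap' km2] by (simp add: case_prod_unfold)
  from K.borel_measurable_lebesgue_integral[OF this] show ?thesis
   by (rule measurable_cong[THEN iffD1, rotated]) (use E0k[OF L km] in simp)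
 qed
 have Fm: "F \<in> borel_measurable (XYP J)"
  by (rule borel_measurable_LIMSEQ_real[OF Flim[OF Bs] E0m[OF finB[OF Bs]]])
 have F0: "0 \<le> F s" "F s \<le> C" if "s \<in> space (XYP J)" for s
  using LIMSEQ_le_const[OF Flim[OF Bs that]] LIMSEQ_le_const2[OF Flim[OF Bs that]] E0b[OF finB[OF Bs] that] by auto
 have main: "(\<lambda>n. E0 (Ls n) (\<lambda>w. g (restrict w J))) \<longlonglongrightarrow> (\<integral>s. F s * g s \<partial>XYP J)"
  if g: "g \<in> borel_measurable (XYP J)" "\<forall>s. \<bar>g s\<bar> \<le> B" and Ls: "exhausting Ls" for g B Ls
 proof -
  have lim: "(\<lambda>n. \<integral>s. E0 (Ls n) (\<lambda>w. kdens J s (cisf w)) * g s \<partial>XYP J) \<longlonglongrightarrow> (\<integral>s. F s * g s \<partial>XYP J)"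
  proof (rule integral_dominated_convergence[where w="\<lambda>_. C * B"])
   show "AE s in XYP J. (\<lambda>n. E0 (Ls n) (\<lambda>w. kdens J s (cisf w)) * g s) \<longlonglongrightarrow> F s * g s"
    using Flim[OF Ls] by (intro AE_I2 tendsto_mult tendsto_const) auto
   show "AE s in XYP J. norm (E0 (Ls n) (\<lambda>w. kdens J s (cisf w)) * g s) \<le> C * B" for n
   proof (rule AE_I2)
    fix s assume s: "s \<in> space (XYP J)"
    have "\<bar>E0 (Ls n) (\<lambda>w. kdens J s (cisf w))\<bar> \<le> C" "0 \<le> C" using E0b[OF finB[OF Ls] s, of n] by auto
    then show "norm (E0 (Ls n) (\<lambda>w. kdens J s (cisf w)) * g s) \<le> C * B"
     unfolding real_norm_def abs_mult using g(2) by (intro mult_mono) auto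
   qed
  qed (use Fm g(1) E0m[OF finB[OF Ls]] in \<open>auto intro!: borel_measurable_times\<close>)
  have gm: "(\<lambda>w. g (restrict w J)) \<in> borel_measurable CS" by (rule measurable_compose[OF measurable_restrict_conf g(1)])
  have eq: "E0 L (\<lambda>w. g (restrict w J)) = (\<integral>s. E0 L (\<lambda>w. kdens J s (cisf w)) * g s \<partial>XYP J)"
   if L: "finite L" and JL: "J \<subseteq> L" for L
  proof -
   interpret K: prob_space "kern L (\<lambda>_. 0)" by (rule kern_prob[OF L]) simp
   interpret KP: pair_prob_space "kern L (\<lambda>_. 0)" "XYP J" ..
   have "E0 L (\<lambda>w. g (restrict w J)) = av L (av J (\<lambda>w. g (restrict w J))) (\<lambda>_. 0)"
    unfolding E0_def using g(2) by (intro av_consistent[OF L JL gm, symmetric, of B]) auto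
   also have "... = (\<integral>v. av J (\<lambda>w. g (restrict w J)) v \<partial>kern L (\<lambda>_. 0))"
    by (intro kern_integral[symmetric] L avg_measurable[OF J gm]) simp
   also have "... = (\<integral>v. \<integral>s. kdens J s (cisf v) * g s \<partial>XYP J \<partial>kern L (\<lambda>_. 0))"
    unfolding av_kdens[OF J] ..
   also have "... = (\<integral>s. \<integral>v. kdens J s (cisf v) * g s \<partial>kern L (\<lambda>_. 0) \<partial>XYP J)"
   proof (rule KP.Fubini_bounded(1))
    show "(\<lambda>(v, s). kdens J s (cisf v) * g s) \<in> borel_measurable (kern L (\<lambda>_. 0) \<Otimes>\<^sub>M XYP J)"
     using km2 measurable_compose[OF measurable_snd g(1)] unfolding case_prod_unfold by (intro borel_measurable_times)
    show "\<bar>kdens J s (cisf v) * g s\<bar> \<le> C * B" for v s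
    proof -
     have "\<bar>kdens J s (cisf v)\<bar> \<le> C" "0 \<le> C" using kb[of s v] by auto
     then show ?thesis unfolding abs_mult using g(2) by (intro mult_mono) auto
    qed
   qed
   also have "... = (\<integral>s. E0 L (\<lambda>w. kdens J s (cisf w)) * g s \<partial>XYP J)"
    using E0k[OF L km] by (intro Bochner_Integration.integral_cong) auto
   finally show ?thesis .
  qed
  have "\<forall>\<^sub>F n in sequentially. J \<subseteq> Ls n" using Ls J by (simp add: exhausting_def)
  then have "\<forall>\<^sub>F n in sequentially. (\<integral>s. E0 (Ls n) (\<lambda>w. kdens J s (cisf w)) * g s \<partial>XYP J) = E0 (Ls n) (\<lambda>w. g (restrict w J))"
   by eventually_elim (rule eq[OF finB[OF Ls], symmetric])
  from Lim_transform_eventually[OF lim this] show ?thesis .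
 qed
 show ?thesis using Fm F0 main by (intro exI[of _ F]) blast
qed

end

section \<open>Translations, finite range and the Kolmogorov extension\<close>

lemma tr_measurable: "tr a \<in> measurable (conf_space nu) (conf_space nu)"
 unfolding conf_space_def tr_def[abs_def]
 by (rule measurable_PiM_single') (auto simp: space_PiM)

definition nbh :: "'d::finite site set => 'd site set" where
 "nbh L = L \<union> {j. \<exists>i\<in>L. adj i j}"

lemma finite_nbh: "finite L ==> finite (nbh L)"
proof -
 assume "finite L"
 then have "finite (\<Union>i\<in>L. {j. adj i j})" by (rule finite_UN_I) (rule finite_adj)
 moreover have "{j. \<exists>i\<in>L. adj i j} = (\<Union>i\<in>L. {j. adj i j})" by auto
 ultimately show ?thesis using \<open>finite L\<close> by (simp only: nbh_def finite_Un)
qed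

definition sh :: "'d site => 'd site set => 'd site set" where
 "sh a L = {x. site_add x a \<in> L}"

lemma site_add_inj: "inj (\<lambda>x. site_add x a)"
 by (rule injI) (auto simp: site_add_def fun_eq_iff)

lemma sh_image: "(\<lambda>x. site_add x a) ` sh a L = L"
proof -
 have "x \<in> (\<lambda>x. site_add x a) ` sh a L" if "x \<in> L" for x
  using that by (intro image_eqI[of _ _ "site_add x (\<lambda>i. - a i)"]) (auto simp: site_add_def sh_def)
 then show ?thesis by (auto simp: sh_def)
qed

lemma finite_sh: "finite L ==> finite (sh a L)"
 using sh_image[of a L] finite_imageD[of "\<lambda>x. site_add x a" "sh a L"] inj_on_subset[OF site_add_inj]
 by (metis subset_UNIV)

lemma exhausting_sh:
 assumes "exhausting Ls"
 shows "exhausting (\<lambda>n. sh a (Ls n))"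
proof -
 have "\<forall>\<^sub>F n in sequentially. K \<subseteq> sh a (Ls n)" if "finite K" for K
 proof -
  have "\<forall>\<^sub>F n in sequentially. (\<lambda>x. site_add x a) ` K \<subseteq> Ls n"
   using assms that by (simp add: exhausting_def)
  then show ?thesis by eventually_elim (auto simp: sh_def)
 qed
 then show ?thesis using assms finite_sh by (auto simp: exhausting_def)
qed

lemma H_XY_tr: "H_XY beta (sh a L) (tr a w) = H_XY beta L w"
proof -
 have "(\<Sum>(i,j)\<in>bonds L. cos (w i - w j)) = (\<Sum>(i,j)\<in>bonds (sh a L). cos (tr a w i - tr a w j))"
 proof (rule sum.reindex_bij_witness[of _ "\<lambda>(i,j). (site_add i a, site_add j a)"
    "\<lambda>(i,j). (site_add i (\<lambda>k. - a k), site_add j (\<lambda>k. - a k))"])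
  show "(case e of (i,j) => (site_add i (\<lambda>k. - a k), site_add j (\<lambda>k. - a k))) \<in> bonds (sh a L)" if "e \<in> bonds L" for e
   using that by (auto simp: bonds_def sh_def adj_translate) (auto simp: site_add_def)
  show "(case e of (i,j) => (site_add i a, site_add j a)) \<in> bonds L" if "e \<in> bonds (sh a L)" for e
   using that by (auto simp: bonds_def sh_def adj_translate)
 qed (auto simp: site_add_def tr_def)
 then show ?thesis by (simp add: H_XY_def bonds_def)
qed

context xy_model
begin

lemma E0_tr:
 assumes L: "finite L" and h: "h \<in> borel_measurable CS"
 shows "E0 L (\<lambda>w. h (tr a w)) = E0 (sh a L) h"
proof -
 let ?L = "sh a L"
 define r where "r s = (\<lambda>x\<in>?L. s (site_add x a))" for s :: "'d site => real"
 have d: "distr (XYP L) (XYP ?L) r = XYP ?L"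
  unfolding r_def
  by (rule distr_PiM_reindex) (auto intro: prob_space_XY_prior inj_on_subset[OF site_add_inj] simp: sh_def)
 have rm: "r \<in> measurable (XYP L) (XYP ?L)"
  unfolding r_def by (intro measurable_restrict measurable_component_singleton) (simp add: sh_def)
 have m: "tr a (merge_conf L s (\<lambda>_. 0)) = merge_conf ?L (r s) (\<lambda>_. 0)" for s
  by (auto simp: tr_def merge_conf_def r_def sh_def fun_eq_iff)
 have Hm: "HH L (merge_conf L s (\<lambda>_. 0)) = HH ?L (merge_conf ?L (r s) (\<lambda>_. 0))" for s
  using H_XY_tr[of beta a L "merge_conf L s (\<lambda>_. 0)"] m by simp
 have tm: "(\<integral>s. f (r s) \<partial>XYP L) = (\<integral>t. f t \<partial>XYP ?L)" if "f \<in> borel_measurable (XYP ?L)" for f :: "_ => real"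
  using integral_distr[OF rm that] d by simp
 have m1: "(\<lambda>t. exp (- HH ?L (merge_conf ?L t (\<lambda>_. 0))) * g (merge_conf ?L t (\<lambda>_. 0))) \<in> borel_measurable (XYP ?L)"
  if "g \<in> borel_measurable CS" for g
  using measurable_compose[OF _ num_measurable2[OF finite_sh[OF L] that], of "\<lambda>s. (\<lambda>_. 0, s)"] by simp
 show ?thesis unfolding E0_def avg_def m Hm
  using tm[OF m1[OF h]] tm[OF m1[of "\<lambda>_. 1"]] by simp
qed

lemma av_depends:
 assumes L: "finite L" and g: "depends_on J g"
 shows "depends_on (J \<union> nbh L) (av L g)"
proof (unfold depends_on_def, intro allI impI)
 fix w w' :: "'d site => real" assume eq: "\<forall>x\<in>J \<union> nbh L. w x = w' x"
 have H: "HH L (merge_conf L s w) = HH L (merge_conf L s w')" for s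
 proof -
  have "(\<Sum>(i,j)\<in>bonds L. cos (merge_conf L s w i - merge_conf L s w j)) = (\<Sum>(i,j)\<in>bonds L. cos (merge_conf L s w' i - merge_conf L s w' j))"
  proof (rule sum.cong[OF refl])
   fix e assume "e \<in> bonds L"
   then have a: "adj (fst e) (snd e)" "fst e \<in> L \<or> snd e \<in> L" by (auto simp: bonds_def)
   have "fst e \<in> nbh L" using a adj_sym[of "fst e" "snd e"] unfolding nbh_def by (elim disjE) blast+
   moreover have "snd e \<in> nbh L" using a unfolding nbh_def by (elim disjE) auto
   ultimately have "fst e \<in> nbh L" "snd e \<in> nbh L" .
   then show "(case e of (i,j) => cos (merge_conf L s w i - merge_conf L s w j)) = (case e of (i,j) => cos (merge_conf L s w' i - merge_conf L s w' j))"
    using eq by (simp add: case_prod_unfold merge_conf_def)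
  qed
  then show ?thesis by (simp add: H_XY_def bonds_def)
 qed
 have G: "g (merge_conf L s w) = g (merge_conf L s w')" for s
  using g eq unfolding depends_on_def by (simp add: merge_conf_def)
 show "av L g w = av L g w'" unfolding avg_def H G ..
qed

definition is_limit :: "('d site => real) measure => bool" where
 "is_limit mu \<longleftrightarrow> prob_space mu \<and> sets mu = sets CS \<and>
  (\<forall>K h B Ls. finite K --> depends_on K h --> h \<in> borel_measurable CS --> (\<forall>w. \<bar>h w\<bar> \<le> B) -->
    exhausting Ls --> (\<lambda>n. E0 (Ls n) h) \<longlonglongrightarrow> (\<integral>w. h w \<partial>mu))"

text \<open>The marginals are setwise limits of the marginals of finite-volume states along a common
  sequence; this makes them a projective family, to which the Kolmogorov extension applies.\<close>

theorem limit_exists: "\<exists>mu. is_limit mu"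
proof -
 define good where "good J F \<longleftrightarrow> F \<in> borel_measurable (XYP J) \<and> (\<forall>s\<in>space (XYP J). 0 \<le> F s) \<and> (\<exists>C. \<forall>s\<in>space (XYP J). F s \<le> C) \<and>
  (\<forall>g B Ls. g \<in> borel_measurable (XYP J) --> (\<forall>s. \<bar>g s\<bar> \<le> B) --> exhausting Ls -->
   (\<lambda>n. E0 (Ls n) (\<lambda>w. g (restrict w J))) \<longlonglongrightarrow> (\<integral>s. F s * g s \<partial>XYP J))" for J and F :: "('d site => real) => real"
 have "\<forall>J. \<exists>F. finite J --> good J F"
 proof (intro allI)
  fix J :: "'d site set"
  show "\<exists>F. finite J --> good J F"
  proof (cases "finite J")
   case True
   show ?thesis using local_limit[OF True, folded good_def] by (elim exE) (rule exI, rule impI)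
  qed simp
 qed
 then obtain F where F: "\<And>J. finite J ==> good J (F J)" by metis
 define P' where "P' J = density (XYP J) (\<lambda>s. ennreal (F J s))" for J
 obtain Bs :: "nat => 'd site set" where Bs: "exhausting Bs" using exhausting_exists by blast
 have setsP: "sets (P' J) = sets (XYP J)" "space (P' J) = space (XYP J)" for J by (simp_all add: P'_def)
 \<comment> \<open>The extension theorem speaks about products of \<open>borel\<close>; these have
   the same measurable sets as the products of \<open>XY_prior\<close>.\<close>
 have borelP: "sets (XYP J) = sets (PiM J (\<lambda>_. borel))" for J :: "'d site set" by (intro sets_PiM_cong) auto
 have lim: "(\<lambda>n. E0 (Ls n) (\<lambda>w. g (restrict w J))) \<longlonglongrightarrow> (\<integral>s. g s \<partial>P' J)"
  if J: "finite J" and g: "g \<in> borel_measurable (XYP J)" "\<And>s. \<bar>g s\<bar> \<le> B" and Ls: "exhausting Ls" for J g B Ls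
 proof -
  have "(\<integral>s. g s \<partial>P' J) = (\<integral>s. F J s * g s \<partial>XYP J)"
   unfolding P'_def using F[OF J] g(1) by (subst integral_density) (auto simp: good_def intro!: AE_I2)
  then show ?thesis using F[OF J] g Ls unfolding good_def by auto
 qed
 have probP: "prob_space (P' J)" if J: "finite J" for J
 proof -
  have F0: "AE s in XYP J. 0 \<le> F J s" using F[OF J] by (auto simp: good_def)
  obtain C where C: "\<forall>s\<in>space (XYP J). F J s \<le> C" using F[OF J] unfolding good_def by blast
  interpret PJ: prob_space "XYP J" by (rule prob_space_XYP)
  have i: "integrable (XYP J) (F J)"
   using F[OF J] C by (intro PJ.integrable_bounded[of _ C]) (auto simp: good_def)
  have "(\<lambda>n. E0 (Bs n) (\<lambda>_. 1)) \<longlonglongrightarrow> (\<integral>s. F J s * 1 \<partial>XYP J)"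
  proof -
   have "\<forall>g B Ls. g \<in> borel_measurable (XYP J) --> (\<forall>s. \<bar>g s\<bar> \<le> B) --> exhausting Ls -->
   (\<lambda>n. E0 (Ls n) (\<lambda>w. g (restrict w J))) \<longlonglongrightarrow> (\<integral>s. F J s * g s \<partial>XYP J)" using F[OF J] unfolding good_def by blast
   from this[rule_format, of "\<lambda>_. 1" 1 Bs] show ?thesis using Bs by simp
  qed
  moreover have "E0 (Bs n) (\<lambda>_. 1) = 1" for n
   unfolding E0_def using Bs by (intro avg_const) (auto simp: exhausting_def)
  ultimately have "(\<integral>s. F J s \<partial>XYP J) = 1" using LIMSEQ_unique[of "\<lambda>_. 1::real" 1] by simp
  then have "(\<integral>\<^sup>+s. ennreal (F J s) \<partial>XYP J) = 1" using nn_integral_eq_integral[OF i F0] by simp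
  moreover have "F J \<in> borel_measurable (XYP J)" using F[OF J] by (simp add: good_def)
  ultimately show ?thesis
   unfolding P'_def by (intro prob_spaceI) (simp add: emeasure_density cong: nn_integral_cong)
 qed
 have meas: "(\<lambda>n. E0 (Ls n) (\<lambda>w. indicator X (restrict w J))) \<longlonglongrightarrow> measure (P' J) X"
  if J: "finite J" and X: "X \<in> sets (XYP J)" and Ls: "exhausting Ls" for J X Ls
  using lim[OF J, of "indicator X" 1 Ls] X Ls by (auto simp: setsP split: split_indicator)
 have proj: "projective_family UNIV P' (\<lambda>_. borel)"
 proof (rule projective_family.intro)
  fix J H :: "'d site set" assume JH: "J \<subseteq> H" "finite H"
  then have fJ: "finite J" using finite_subset by blast
  interpret H: prob_space "P' H" by (rule probP[OF JH(2)])
  interpret J: prob_space "P' J" by (rule probP[OF fJ])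
  have rm: "(\<lambda>f. restrict f J) \<in> measurable (XYP H) (XYP J)" by (rule measurable_restrict_subset[OF JH(1)])
  have rm': "(\<lambda>f. restrict f J) \<in> measurable (P' H) (PiM J (\<lambda>_. borel))"
   using rm measurable_cong_sets[OF setsP(1)[of H] borelP[of J, symmetric]] by simp
  show "P' J = distr (P' H) (PiM J (\<lambda>_. borel)) (\<lambda>f. restrict f J)"
  proof (rule measure_eqI)
   show "sets (P' J) = sets (distr (P' H) (PiM J (\<lambda>_. borel)) (\<lambda>f. restrict f J))" by (simp add: setsP borelP)
   fix X assume "X \<in> sets (P' J)"
   then have X: "X \<in> sets (XYP J)" by (simp add: setsP)
   let ?Y = "(\<lambda>f. restrict f J) -` X \<inter> space (P' H)"
   have Y: "?Y \<in> sets (XYP H)" using measurable_sets[OF rm X] by (simp add: setsP)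
   have "indicator ?Y (restrict w H) = (indicator X (restrict w J) :: real)" for w :: "'d site => real"
    using JH by (auto simp: setsP space_PiM indicator_def Int_absorb1)
   then have "measure (P' J) X = measure (P' H) ?Y"
    using LIMSEQ_unique[OF meas[OF fJ X Bs]] meas[OF JH(2) Y Bs] by simp
   then show "emeasure (P' J) X = emeasure (distr (P' H) (PiM J (\<lambda>_. borel)) (\<lambda>f. restrict f J)) X"
    using X by (subst emeasure_distr[OF rm']) (auto simp: borelP H.emeasure_eq_measure J.emeasure_eq_measure)
  qed
 qed (rule probP)
 interpret Q: polish_projective UNIV P' by (rule polish_projective.intro[OF proj])
 define mu where "mu = Q.lim"
 have prob: "prob_space mu" unfolding mu_def by (rule Q.P.prob_space_axioms)
 have CSb: "sets CS = sets (PiM UNIV (\<lambda>_. borel))" unfolding conf_space_def by (intro sets_PiM_cong) auto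
 have smu: "sets mu = sets CS" unfolding mu_def Q.sets_lim CSb ..
 have marg: "distr mu (XYP K) (\<lambda>w. restrict w K) = P' K" if K: "finite K" for K
 proof (rule measure_eqI)
  have rm: "(\<lambda>w. restrict w K) \<in> measurable mu (XYP K)"
   using measurable_restrict_conf measurable_cong_sets[OF smu refl] by blast
  show "sets (distr mu (XYP K) (\<lambda>w. restrict w K)) = sets (P' K)" by (simp add: setsP)
  fix X assume "X \<in> sets (distr mu (XYP K) (\<lambda>w. restrict w K))"
  then have X: "X \<in> sets (XYP K)" by simp
  have "emeasure (distr mu (XYP K) (\<lambda>w. restrict w K)) X = emeasure mu (prod_emb UNIV (\<lambda>_. borel) K X)"
   using X by (subst emeasure_distr[OF rm]) (auto simp: prod_emb_def space_PiM mu_def)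
  also have "... = emeasure (P' K) X"
   unfolding mu_def using K X by (intro Q.emeasure_lim_emb) (auto simp: borelP)
  finally show "emeasure (distr mu (XYP K) (\<lambda>w. restrict w K)) X = emeasure (P' K) X" .
 qed
 have "(\<lambda>n. E0 (Ls n) h) \<longlonglongrightarrow> (\<integral>w. h w \<partial>mu)"
  if K: "finite K" and d: "depends_on K h" and h: "h \<in> borel_measurable CS" "\<forall>w. \<bar>h w\<bar> \<le> B" and Ls: "exhausting Ls" for K h B Ls
 proof -
  define g where "g s = h (merge_conf K s (\<lambda>_. 0))" for s
  have hg: "h w = g (restrict w K)" for w
   using d unfolding depends_on_def g_def by (simp add: merge_conf_def)
  have gm: "g \<in> borel_measurable (XYP K)" unfolding g_def
   by (rule measurable_compose[OF measurable_merge_conf1 h(1)]) simp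
  have rm: "(\<lambda>w. restrict w K) \<in> measurable mu (XYP K)"
   using measurable_restrict_conf measurable_cong_sets[OF smu refl] by blast
  have "(\<integral>w. h w \<partial>mu) = (\<integral>s. g s \<partial>distr mu (XYP K) (\<lambda>w. restrict w K))"
   unfolding hg by (rule integral_distr[OF rm gm, symmetric])
  also have "... = (\<integral>s. g s \<partial>P' K)" unfolding marg[OF K] ..
  finally show ?thesis unfolding hg using lim[OF K gm _ Ls, of B] h(2) by (simp add: g_def)
 qed
 then show ?thesis unfolding is_limit_def using prob smu by blast
qed

end

section \<open>The limit state: DLR equations, invariance and characters\<close>

locale xy_limit = xy_model beta dim for beta and dim :: "'d::finite itself" +
 fixes mu :: "('d site => real) measure"
 assumes lim: "is_limit mu"
begin

sublocale mu: prob_space mu using lim by (simp add: is_limit_def)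

lemma sets_mu: "sets mu = sets CS" using lim by (simp add: is_limit_def)

lemma space_mu [simp]: "space mu = UNIV" using sets_eq_imp_space_eq[OF sets_mu] by simp

lemma mu_measurable: "f \<in> borel_measurable CS \<longleftrightarrow> f \<in> borel_measurable mu"
 using measurable_cong_sets[OF sets_mu refl] by auto

lemma limitD: "finite K ==> depends_on K h ==> h \<in> borel_measurable CS ==> (\<And>w. \<bar>h w\<bar> \<le> B) ==>
    exhausting Ls ==> (\<lambda>n. E0 (Ls n) h) \<longlonglongrightarrow> (\<integral>w. h w \<partial>mu)"
 using lim unfolding is_limit_def by blast

lemma cylinder_sets:
 "finite J ==> (\<And>x. x \<in> J ==> A x \<in> sets XY_prior) ==> prod_emb UNIV (\<lambda>_. XY_prior) J (Pi\<^sub>E J A) \<in> sets CS"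
 unfolding conf_space_def by (intro sets_PiM_I) auto

lemma cylinder_depends: fixes J :: "'d site set"
 shows "depends_on J (indicator (prod_emb UNIV (\<lambda>_. XY_prior) J (Pi\<^sub>E J A)) :: _ => real)"
proof (unfold depends_on_def, intro allI impI)
 fix w w' :: "'d site => real" assume "\<forall>x\<in>J. w x = w' x"
 then have "w \<in> prod_emb UNIV (\<lambda>_. XY_prior) J (Pi\<^sub>E J A) \<longleftrightarrow> w' \<in> prod_emb UNIV (\<lambda>_. XY_prior) J (Pi\<^sub>E J A)"
  by (auto simp: prod_emb_def PiE_iff)
 then show "(indicator (prod_emb UNIV (\<lambda>_. XY_prior) J (Pi\<^sub>E J A)) w :: real) = indicator (prod_emb UNIV (\<lambda>_. XY_prior) J (Pi\<^sub>E J A)) w'"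
  by (simp add: indicator_def)
qed

text \<open>Averaging over \<open>L\<close> does not change the state in \<open>Ls n\<close> once
  \<open>Ls n\<close> contains \<open>L\<close>. Both the event and its average are local, so the
  identity passes to the limit.\<close>

lemma gibbs: "mu \<in> gibbs_measures XY_prior HH"
proof (rule gibbs_measuresI[OF mu.prob_space_axioms sets_mu])
 fix L J :: "'d site set" and A assume L: "finite L" and J: "finite J" and A: "\<And>x. x \<in> J ==> A x \<in> sets XY_prior"
 let ?E = "prod_emb UNIV (\<lambda>_. XY_prior) J (Pi\<^sub>E J A)"
 obtain Ls :: "nat => 'd site set" where Ls: "exhausting Ls" using exhausting_exists by blast
 have E: "?E \<in> sets CS" by (rule cylinder_sets[OF J A])
 have Em: "(indicator ?E :: _ => real) \<in> borel_measurable CS" using E by simp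
 have Eb: "\<bar>indicator ?E w :: real\<bar> \<le> 1" for w by (simp add: indicator_def)
 have 1: "(\<lambda>n. E0 (Ls n) (indicator ?E)) \<longlonglongrightarrow> (\<integral>w. indicator ?E w \<partial>mu)"
  by (rule limitD[OF J cylinder_depends Em Eb Ls])
 have 2: "(\<lambda>n. E0 (Ls n) (av L (indicator ?E))) \<longlonglongrightarrow> (\<integral>w. av L (indicator ?E) w \<partial>mu)"
 proof (rule limitD[OF _ av_depends[OF L cylinder_depends] avg_measurable[OF L Em] _ Ls])
  show "finite (J \<union> nbh L)" using J finite_nbh[OF L] by simp
  show "\<bar>av L (indicator ?E) w\<bar> \<le> 1" for w by (rule avg_bounded[OF L _ Em]) (auto simp: indicator_def)
 qed
 have "\<forall>\<^sub>F n in sequentially. L \<subseteq> Ls n" using Ls L by (simp add: exhausting_def)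
 then have "\<forall>\<^sub>F n in sequentially. E0 (Ls n) (av L (indicator ?E)) = E0 (Ls n) (indicator ?E)"
 proof eventually_elim
  case (elim n)
  then show ?case unfolding E0_def using Ls by (intro av_consistent[OF _ elim Em Eb]) (simp add: exhausting_def)
 qed
 from LIMSEQ_unique[OF Lim_transform_eventually[OF 2 this] 1]
 have "(\<integral>w. av L (indicator ?E) w \<partial>mu) = (\<integral>w. indicator ?E w \<partial>mu)" .
 moreover have "(\<integral>w. indicator ?E w \<partial>mu) = measure mu ?E" using E sets_mu by simp
 ultimately show "measure mu ?E = (\<integral>w. av L (indicator ?E) w \<partial>mu)" by simp
qed

text \<open>The expectation of a translated event is that of the event in the shifted volume, and
  the shifted volumes lead to the same limit.\<close>

lemma translation: "distr mu CS (tr a) = mu"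
proof (rule measure_eqI_PiM_infinite[of _ UNIV "\<lambda>_. XY_prior"])
 have trm: "tr a \<in> measurable mu CS" using tr_measurable measurable_cong_sets[OF sets_mu refl] by blast
 interpret D: prob_space "distr mu CS (tr a)" by (rule mu.prob_space_distr[OF trm])
 show "sets (distr mu CS (tr a)) = sets (PiM UNIV (\<lambda>_. XY_prior))" by (simp add: conf_space_def)
 show "sets mu = sets (PiM UNIV (\<lambda>_. XY_prior))" using sets_mu by (simp add: conf_space_def)
 show "finite_measure (distr mu CS (tr a))" by unfold_locales
 fix J :: "'d site set" and A assume J: "finite J" and A: "\<And>x. x \<in> J ==> A x \<in> sets XY_prior"
 let ?E = "prod_emb UNIV (\<lambda>_. XY_prior) J (Pi\<^sub>E J A)"
 obtain Ls :: "nat => 'd site set" where Ls: "exhausting Ls" using exhausting_exists by blast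
 have E: "?E \<in> sets CS" by (rule cylinder_sets[OF J A])
 have Em: "(indicator ?E :: _ => real) \<in> borel_measurable CS" using E by simp
 have Eb: "\<bar>indicator ?E w :: real\<bar> \<le> 1" for w by (simp add: indicator_def)
 have d: "depends_on ((\<lambda>x. site_add x a) ` J) (\<lambda>w. indicator ?E (tr a w) :: real)"
  using cylinder_depends[of J A] unfolding depends_on_def by (simp add: tr_def)
 have 1: "(\<lambda>n. E0 (Ls n) (\<lambda>w. indicator ?E (tr a w))) \<longlonglongrightarrow> (\<integral>w. indicator ?E (tr a w) \<partial>mu)"
  using J by (intro limitD[OF _ d _ Eb Ls] measurable_compose[OF tr_measurable Em]) auto
 have "(\<lambda>n. E0 (sh a (Ls n)) (indicator ?E)) \<longlonglongrightarrow> (\<integral>w. indicator ?E w \<partial>mu)"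
  by (rule limitD[OF J cylinder_depends Em Eb exhausting_sh[OF Ls]])
 moreover have "E0 (Ls n) (\<lambda>w. indicator ?E (tr a w)) = E0 (sh a (Ls n)) (indicator ?E)" for n
  using Ls by (intro E0_tr Em) (simp add: exhausting_def)
 ultimately have "(\<lambda>n. E0 (Ls n) (\<lambda>w. indicator ?E (tr a w))) \<longlonglongrightarrow> (\<integral>w. indicator ?E w \<partial>mu)" by (simp only:)
 then have eq: "(\<integral>w. indicator ?E (tr a w) \<partial>mu) = (\<integral>w. (indicator ?E w :: real) \<partial>mu)" by (rule LIMSEQ_unique[OF 1])
 have "measure (distr mu CS (tr a)) ?E = (\<integral>w. indicator ?E w \<partial>distr mu CS (tr a))" using E by simp
 also have "... = (\<integral>w. indicator ?E (tr a w) \<partial>mu)" by (rule integral_distr[OF trm Em])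
 also have "... = measure mu ?E" unfolding eq using E sets_mu by simp
 finally show "emeasure (distr mu CS (tr a)) ?E = emeasure mu ?E"
  by (simp add: D.emeasure_eq_measure mu.emeasure_eq_measure)
qed

lemma cos_depends: "depends_on {x. k x \<noteq> 0} (\<lambda>w. cos (linf k w + c))"
 unfolding depends_on_def linf_def by (auto intro!: arg_cong[where f=cos] sum.cong)

lemma cos_limit:
 assumes k: "fin_supp k" and Ls: "exhausting Ls"
 shows "(\<lambda>n. cos c * fv k (Ls n)) \<longlonglongrightarrow> (\<integral>w. cos (linf k w + c) \<partial>mu)"
proof -
 have "(\<lambda>n. E0 (Ls n) (\<lambda>w. cos (linf k w + c))) \<longlonglongrightarrow> (\<integral>w. cos (linf k w + c) \<partial>mu)"
  by (rule limitD[OF k cos_depends cos_obs_measurable cos_obs_bounded Ls])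
 moreover have "E0 (Ls n) (\<lambda>w. cos (linf k w + c)) = cos c * fv k (Ls n)" for n
  unfolding E0_def using Ls by (intro av_cos_shift k) (simp add: exhausting_def)
 ultimately show ?thesis by simp
qed

lemma cos_integral:
 assumes k: "fin_supp k"
 shows "(\<integral>w. cos (linf k w + c) \<partial>mu) = cos c * (\<integral>w. cos (linf k w) \<partial>mu)"
proof -
 obtain Ls :: "nat => 'd site set" where Ls: "exhausting Ls" using exhausting_exists by blast
 have "(\<lambda>n. cos c * fv k (Ls n)) \<longlonglongrightarrow> cos c * (\<integral>w. cos (linf k w) \<partial>mu)"
  using cos_limit[OF k Ls, of 0] by (intro tendsto_mult tendsto_const) simp
 then show ?thesis using LIMSEQ_unique[OF cos_limit[OF k Ls, of c]] by blast
qed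

lemma integrable_mu: "f \<in> borel_measurable CS ==> (\<And>w. \<bar>f w\<bar> \<le> (B::real)) ==> integrable mu f"
 by (rule mu.integrable_bounded) (auto simp: mu_measurable[symmetric])

lemma DLR: "finite L ==> f \<in> borel_measurable CS ==> (\<And>w. \<bar>f w\<bar> \<le> (B::real)) ==> (\<integral>w. f w \<partial>mu) = (\<integral>w. av L f w \<partial>mu)"
 by (rule gibbs_measuresD[OF gibbs])

end

section \<open>Ergodicity\<close>

lemma far_translate:
 assumes "finite J" "finite L"
 shows "\<exists>a. \<forall>x\<in>J. site_add x a \<notin> (L :: 'd::finite site set)"
proof -
 let ?B = "(\<lambda>(x,l). (\<lambda>i. l i - x i)) ` (J \<times> L)"
 have "inj (\<lambda>n i. n :: int) \<and> infinite (UNIV :: int set)" by (auto simp: inj_def fun_eq_iff)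
 then have "infinite (UNIV :: 'd site set)" using finite_imageD[of "\<lambda>n i. n" UNIV] finite_subset[OF subset_UNIV] by blast
 moreover have "finite ?B" using assms by simp
 ultimately obtain a where a: "a \<notin> ?B" using ex_new_if_finite by blast
 have "site_add x a \<notin> L" if x: "x \<in> J" for x
 proof
  assume "site_add x a \<in> L"
  then have "(\<lambda>(x,l). (\<lambda>i. l i - x i)) (x, site_add x a) \<in> ?B" using x by (intro imageI) simp
  then show False using a by (simp add: site_add_def)
 qed
 then show ?thesis by blast
qed

lemma (in prob_space) weighted_diff:
 fixes u v f :: "'a => real"
 assumes m: "u \<in> borel_measurable M" "v \<in> borel_measurable M" "f \<in> borel_measurable M"
  and b: "\<And>x. \<bar>u x\<bar> \<le> C" "\<And>x. \<bar>v x\<bar> \<le> D" "\<And>x. \<bar>f x\<bar> \<le> B"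
 shows "\<bar>(\<integral>x. u x * f x \<partial>M) - (\<integral>x. v x * f x \<partial>M)\<bar> \<le> B * (\<integral>x. \<bar>u x - v x\<bar> \<partial>M)"
proof -
 have B0: "0 \<le> B" "0 \<le> C" "0 \<le> D" using b by (meson abs_ge_zero order_trans)+
 have i: "integrable M (\<lambda>x. u x * f x)"
  using b(1,3) B0 by (intro integrable_bounded[of _ "C*B"] borel_measurable_times m) (simp add: abs_mult mult_mono)
 have i2: "integrable M (\<lambda>x. v x * f x)"
  using b(2,3) B0 by (intro integrable_bounded[of _ "D*B"] borel_measurable_times m) (simp add: abs_mult mult_mono)
 note i = i i2
 have ib: "integrable M (\<lambda>x. \<bar>u x - v x\<bar>)"
 proof (rule integrable_bounded[of _ "C + D"])
  show "\<bar>\<bar>u x - v x\<bar>\<bar> \<le> C + D" for x using b(1,2)[of x] by linarith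
 qed (intro borel_measurable_abs borel_measurable_diff m)
 have "\<bar>(\<integral>x. u x * f x \<partial>M) - (\<integral>x. v x * f x \<partial>M)\<bar> = \<bar>\<integral>x. u x * f x - v x * f x \<partial>M\<bar>" using i by simp
 also have "... \<le> (\<integral>x. \<bar>u x * f x - v x * f x\<bar> \<partial>M)" by (rule integral_abs_bound)
 also have "... \<le> (\<integral>x. B * \<bar>u x - v x\<bar> \<partial>M)"
 proof (rule integral_mono)
  show "integrable M (\<lambda>x. \<bar>u x * f x - v x * f x\<bar>)" using i by simp
  show "integrable M (\<lambda>x. B * \<bar>u x - v x\<bar>)" using ib by simp
  show "\<bar>u x * f x - v x * f x\<bar> \<le> B * \<bar>u x - v x\<bar>" for x
  proof -
   have "\<bar>u x * f x - v x * f x\<bar> = \<bar>f x\<bar> * \<bar>u x - v x\<bar>" by (simp add: abs_mult[symmetric] algebra_simps)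
   then show ?thesis using b(3)[of x] by (simp add: mult_right_mono)
  qed
 qed
 finally show ?thesis by simp
qed

context xy_limit
begin

definition local_obs :: "(('d site => real) => real) => bool" where
 "local_obs g \<longleftrightarrow> g \<in> borel_measurable CS \<and> (\<exists>B. \<forall>w. \<bar>g w\<bar> \<le> B) \<and> (\<exists>J. finite J \<and> depends_on J g)"

lemma local_obs_const: "local_obs (\<lambda>_. c)"
 unfolding local_obs_def by (auto simp: depends_on_def intro!: exI[of _ "{}"])

lemma local_obs_add:
 assumes "local_obs f" "local_obs g"
 shows "local_obs (\<lambda>w. f w + a * g w)"
proof -
 obtain B J C K where b: "\<forall>w. \<bar>f w\<bar> \<le> B" "finite J" "depends_on J f" "\<forall>w. \<bar>g w\<bar> \<le> C" "finite K" "depends_on K g"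
  using assms unfolding local_obs_def by blast
 have "\<bar>f w + a * g w\<bar> \<le> B + \<bar>a\<bar> * C" for w
  using abs_triangle_ineq[of "f w" "a * g w"] b(1)[rule_format, of w] mult_left_mono[OF b(4)[rule_format, of w], of "\<bar>a\<bar>"]
  by (simp add: abs_mult)
 moreover have "depends_on (J \<union> K) (\<lambda>w. f w + a * g w)"
  using b(3,6) unfolding depends_on_def by (metis UnI1 UnI2)
 ultimately show ?thesis using assms b unfolding local_obs_def
  by (auto intro!: borel_measurable_add borel_measurable_times exI[of _ "J \<union> K"])
qed

lemma local_obs_sum: "finite I ==> (\<And>i. i \<in> I ==> local_obs (f i)) ==> local_obs (\<lambda>w. \<Sum>i\<in>I. f i w)"
proof (induction I rule: finite_induct)
 case empty then show ?case by (simp add: local_obs_const)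
next
 case (insert i I)
 then show ?case using local_obs_add[of "f i" "\<lambda>w. \<Sum>i\<in>I. f i w" 1] by simp
qed

lemma local_obs_integrable: "local_obs f ==> integrable mu f"
 unfolding local_obs_def using integrable_mu by blast

lemma indicator_integrable: "E \<in> sets CS ==> integrable mu (indicator E :: _ => real)"
 using sets_mu by (simp add: integrable_indicator_iff less_top[symmetric])

text \<open>Induction over the sigma-algebra generated by cylinders: approximability in mean
  survives complements and countable disjoint unions.\<close>

lemma local_approx:
 assumes "E \<in> sets CS"
 shows "\<forall>e>0. \<exists>g. local_obs g \<and> (\<integral>w. \<bar>indicator E w - g w\<bar> \<partial>mu) < e"
proof -
 let ?G = "prod_algebra UNIV (\<lambda>_::'d => int. XY_prior)"
 have sC: "sets CS = sigma_sets UNIV ?G" by (simp add: conf_space_def sets_PiM)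
 have "E \<in> sigma_sets UNIV ?G" using assms sC by simp
 have "?G \<subseteq> Pow UNIV" by simp
 from this \<open>E \<in> sigma_sets UNIV ?G\<close> show ?thesis
 proof (induction rule: sigma_sets_induct_disjoint[OF Int_stable_prod_algebra, consumes 2, case_names basic empty compl union])
  case (basic A)
  then obtain J B where A: "A = prod_emb UNIV (\<lambda>_. XY_prior) J (Pi\<^sub>E J B)" "finite J" "\<And>i. i \<in> J ==> B i \<in> sets XY_prior"
   by (rule prod_algebraE) blast
  have "local_obs (indicator A)"
   unfolding local_obs_def A(1) using cylinder_sets[OF A(2,3)] cylinder_depends A(2)
   by (auto intro!: exI[of _ 1] simp: indicator_def)
  then show ?case by (intro allI impI exI[of _ "indicator A"]) simp
 next
  case empty
  show ?case by (intro allI impI exI[of _ "\<lambda>_. 0"]) (simp add: local_obs_const)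
 next
  case (compl A)
  show ?case
  proof (intro allI impI)
   fix e :: real assume "0 < e"
   then obtain g where g: "local_obs g" "(\<integral>w. \<bar>indicator A w - g w\<bar> \<partial>mu) < e" using compl(2) by blast
   have "\<bar>indicator (UNIV - A) w - (1 + (-1) * g w)\<bar> = \<bar>indicator A w - g w\<bar>" for w by (auto simp: indicator_def)
   then show "\<exists>g. local_obs g \<and> (\<integral>w. \<bar>indicator (UNIV - A) w - g w\<bar> \<partial>mu) < e"
    using g local_obs_add[OF local_obs_const[of 1] g(1), of "-1"] by (intro exI[of _ "\<lambda>w. 1 + (-1) * g w"]) simp
  qed
 next
  case (union A)
  show ?case
  proof (intro allI impI)
   fix e :: real assume e: "0 < e"
   let ?U = "\<Union>i. A i"
   have As: "A i \<in> sets CS" for i using union(2) sC by auto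
   then have Am: "A i \<in> sets mu" for i by (simp add: sets_mu)
   have Us: "?U \<in> sets CS" using As by blast
   have "(\<lambda>i. measure mu (A i)) sums measure mu ?U"
    by (rule mu.finite_measure_UNION) (use Am union(1) in auto)
   then have "(\<lambda>n. \<Sum>i<n. measure mu (A i)) \<longlonglongrightarrow> measure mu ?U" by (simp add: sums_def)
   then have "\<forall>\<^sub>F n in sequentially. \<bar>(\<Sum>i<n. measure mu (A i)) - measure mu ?U\<bar> < e/2"
    using e tendstoD[of _ _ _ "e/2"] by (fastforce simp: dist_real_def)
   then obtain n where n: "\<bar>(\<Sum>i<n. measure mu (A i)) - measure mu ?U\<bar> < e/2" by (auto simp: eventually_sequentially)
   define e' where "e' = e / (2 * (real n + 1))"
   have "0 < e'" using e by (simp add: e'_def)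
   then have "\<forall>i. \<exists>g. local_obs g \<and> (\<integral>w. \<bar>indicator (A i) w - g w\<bar> \<partial>mu) < e'" using union(3) by blast
   then obtain g where g: "\<And>i. local_obs (g i)" "\<And>i. (\<integral>w. \<bar>indicator (A i) w - g i w\<bar> \<partial>mu) < e'" by metis
   let ?g = "\<lambda>w. \<Sum>i<n. g i w"
   have ii: "integrable mu (\<lambda>w. \<bar>indicator (A i) w - g i w\<bar>)" for i
    using indicator_integrable[OF As] local_obs_integrable[OF g(1)] by simp
   have gi: "integrable mu ?g" by (intro Bochner_Integration.integrable_sum local_obs_integrable g)
   have IU: "integrable mu (indicator ?U :: _ => real)" by (rule indicator_integrable[OF Us])
   have IA: "integrable mu (\<lambda>w. \<Sum>i<n. indicator (A i) w :: real)"
    by (intro Bochner_Integration.integrable_sum indicator_integrable As)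
   have sub: "(\<Sum>i<n. indicator (A i) w) \<le> (indicator ?U w :: real)" for w
   proof -
    have "(\<Sum>i<n. indicator (A i) w) = (indicator (\<Union>i<n. A i) w :: real)"
     using union(1) by (intro indicator_UN_disjoint[symmetric]) (auto simp: disjoint_family_on_def)
    also have "... \<le> indicator ?U w" by (auto simp: indicator_def)
    finally show ?thesis .
   qed
   have "(\<integral>w. \<bar>indicator ?U w - ?g w\<bar> \<partial>mu)
     \<le> (\<integral>w. (indicator ?U w - (\<Sum>i<n. indicator (A i) w)) + (\<Sum>i<n. \<bar>indicator (A i) w - g i w\<bar>) \<partial>mu)"
   proof (rule integral_mono)
    show "integrable mu (\<lambda>w. \<bar>indicator ?U w - ?g w\<bar>)" using IU gi by simp
    show "integrable mu (\<lambda>w. (indicator ?U w - (\<Sum>i<n. indicator (A i) w)) + (\<Sum>i<n. \<bar>indicator (A i) w - g i w\<bar>))"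
     by (intro Bochner_Integration.integrable_add Bochner_Integration.integrable_diff IU IA Bochner_Integration.integrable_sum ii)
    show "\<bar>indicator ?U w - ?g w\<bar> \<le> (indicator ?U w - (\<Sum>i<n. indicator (A i) w)) + (\<Sum>i<n. \<bar>indicator (A i) w - g i w\<bar>)" for w
    proof -
     have "\<bar>(\<Sum>i<n. indicator (A i) w) - ?g w\<bar> \<le> (\<Sum>i<n. \<bar>indicator (A i) w - g i w\<bar>)"
      unfolding sum_subtractf[symmetric] by (rule sum_abs)
     then show ?thesis using sub[of w] by linarith
    qed
   qed
   also have "... = (measure mu ?U - (\<Sum>i<n. measure mu (A i))) + (\<Sum>i<n. \<integral>w. \<bar>indicator (A i) w - g i w\<bar> \<partial>mu)"
   proof -
    have "(\<integral>w. (\<Sum>i<n. indicator (A i) w) \<partial>mu) = (\<Sum>i<n. measure mu (A i))"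
     by (subst Bochner_Integration.integral_sum) (use indicator_integrable[OF As] Am in auto)
    moreover have "(\<integral>w. (\<Sum>i<n. \<bar>indicator (A i) w - g i w\<bar>) \<partial>mu) = (\<Sum>i<n. \<integral>w. \<bar>indicator (A i) w - g i w\<bar> \<partial>mu)"
     by (rule Bochner_Integration.integral_sum[OF ii])
    moreover have "(\<integral>w. indicator ?U w \<partial>mu) = measure mu ?U" using Us sets_mu by simp
    moreover have IS: "integrable mu (\<lambda>w. \<Sum>i<n. \<bar>indicator (A i) w - g i w\<bar>)" by (rule Bochner_Integration.integrable_sum) (rule ii)
    ultimately show ?thesis
     using Bochner_Integration.integral_add[OF Bochner_Integration.integrable_diff[OF IU IA] IS]
      Bochner_Integration.integral_diff[OF IU IA] by simp
   qed
   also have "... < e"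
   proof -
    have "(\<Sum>i<n. \<integral>w. \<bar>indicator (A i) w - g i w\<bar> \<partial>mu) \<le> (\<Sum>i<n. e')"
     using g(2) by (intro sum_mono) (simp add: less_imp_le)
    also have "... \<le> e/2" using e by (simp add: e'_def field_simps)
    finally show ?thesis using n by linarith
   qed
   finally show "\<exists>g. local_obs g \<and> (\<integral>w. \<bar>indicator ?U w - g w\<bar> \<partial>mu) < e"
    using local_obs_sum[of "{..<n}" g] g(1) by (intro exI[of _ ?g]) simp
  qed
 qed
qed

context
 fixes E assumes E: "E \<in> sets CS" and inv: "\<And>a. tr a -` E = E"
begin

text \<open>An invariant event equals its translates, so local observables arbitrarily far from
  \<open>L\<close> approximate it. These factor out of the average over \<open>L\<close>; in effect
  the event belongs to the tail, and conditioning on it keeps the DLR equations.\<close>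

lemma inv_tail:
 assumes L: "finite L" and f: "f \<in> borel_measurable CS" "\<And>w. \<bar>f w\<bar> \<le> (B::real)"
 shows "(\<integral>w. indicator E w * f w \<partial>mu) = (\<integral>w. indicator E w * av L f w \<partial>mu)"
proof -
 have avm: "av L f \<in> borel_measurable CS" by (rule avg_measurable[OF L f(1)])
 have avb: "\<bar>av L f w\<bar> \<le> B" for w by (rule avg_bounded[OF L _ f]) simp
 have B0: "0 \<le> B" using f(2) by (meson abs_ge_zero order_trans)
 have "\<bar>(\<integral>w. indicator E w * f w \<partial>mu) - (\<integral>w. indicator E w * av L f w \<partial>mu)\<bar> \<le> 2 * B * e" if e: "0 < e" for e
 proof -
  obtain g where g: "local_obs g" "(\<integral>w. \<bar>indicator E w - g w\<bar> \<partial>mu) < e" using local_approx[OF E] e by blast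
  obtain C J where C: "\<And>w. \<bar>g w\<bar> \<le> C" and J: "finite J" "depends_on J g" and gm: "g \<in> borel_measurable CS"
   using g(1) unfolding local_obs_def by blast
  obtain a where a: "\<forall>x\<in>J. site_add x a \<notin> L" using far_translate[OF J(1) L] by blast
  define h where "h w = g (tr a w)" for w
  have hm: "h \<in> borel_measurable CS" unfolding h_def by (rule measurable_compose[OF tr_measurable gm])
  have hb: "\<bar>h w\<bar> \<le> C" for w by (simp add: h_def C)
  have trm: "tr a \<in> measurable mu CS" using tr_measurable measurable_cong_sets[OF sets_mu refl] by blast
  have ie: "indicator E w = (indicator E (tr a w) :: real)" for w using inv[of a] by (auto simp: indicator_def)
  have "(\<integral>w. \<bar>indicator E w - h w\<bar> \<partial>mu) = (\<integral>w. (\<lambda>v. \<bar>indicator E v - g v\<bar>) (tr a w) \<partial>mu)"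
   by (simp add: h_def ie[symmetric])
  also have "... = (\<integral>v. \<bar>indicator E v - g v\<bar> \<partial>distr mu CS (tr a))"
   using E gm by (intro integral_distr[OF trm, symmetric]) auto
  finally have he: "(\<integral>w. \<bar>indicator E w - h w\<bar> \<partial>mu) < e" using g(2) translation by simp
  have hmerge: "h (merge_conf L s w) = h w" for s w
   using J(2) a unfolding h_def depends_on_def by (simp add: merge_conf_def tr_def)
  have "(\<integral>w. h w * f w \<partial>mu) = (\<integral>w. av L (\<lambda>w. h w * f w) w \<partial>mu)"
   using hm f hb C B0 by (intro DLR[OF L, where B="C*B"] borel_measurable_times) (auto simp: abs_mult intro!: mult_mono order_trans[OF abs_ge_zero C])
  also have "av L (\<lambda>w. h w * f w) = (\<lambda>w. h w * av L f w)"
  proof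
   fix w
   have "av L (\<lambda>w. h w * f w) w = av L (\<lambda>v. h w * f v) w" by (simp add: avg_def hmerge)
   then show "av L (\<lambda>w. h w * f w) w = h w * av L f w" by (simp add: avg_cmult)
  qed
  finally have eq: "(\<integral>w. h w * f w \<partial>mu) = (\<integral>w. h w * av L f w \<partial>mu)" .
  have Em: "(indicator E :: _ => real) \<in> borel_measurable mu" using E sets_mu by (intro borel_measurable_indicator) simp
  have "\<bar>(\<integral>w. indicator E w * f w \<partial>mu) - (\<integral>w. h w * f w \<partial>mu)\<bar> \<le> B * (\<integral>w. \<bar>indicator E w - h w\<bar> \<partial>mu)"
   using hm f hb Em by (intro mu.weighted_diff[where C=1 and D=C]) (auto simp: mu_measurable)
  moreover have "\<bar>(\<integral>w. indicator E w * av L f w \<partial>mu) - (\<integral>w. h w * av L f w \<partial>mu)\<bar> \<le> B * (\<integral>w. \<bar>indicator E w - h w\<bar> \<partial>mu)"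
   using hm avm avb hb Em by (intro mu.weighted_diff[where C=1 and D=C]) (auto simp: mu_measurable)
  moreover have "B * (\<integral>w. \<bar>indicator E w - h w\<bar> \<partial>mu) \<le> B * e" using he B0 by (intro mult_left_mono) auto
  ultimately show ?thesis using eq by linarith
 qed
 note main = this
 show ?thesis
 proof (rule ccontr)
  let ?d = "\<bar>(\<integral>w. indicator E w * f w \<partial>mu) - (\<integral>w. indicator E w * av L f w \<partial>mu)\<bar>"
  assume "\<not> ?thesis"
  then have d: "0 < ?d" by simp
  have "?d \<le> 2 * B * (?d / (2 * (2 * B + 1)))" using d B0 by (intro main) auto
  also have "... = ?d * (2 * B / (2 * (2 * B + 1)))" by simp
  also have "... < ?d * 1" using d B0 by (intro mult_strict_left_mono) (auto simp: field_simps)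
  finally show False by simp
 qed
qed

text \<open>On \<open>E\<close> the observable may be replaced by its average in any finite volume,
  where the zero boundary condition dominates; then the volume grows.\<close>

lemma inv_cos_le:
 assumes k: "fin_supp k"
 shows "(\<integral>w. indicator E w * cos (linf k w + c) \<partial>mu) \<le> measure mu E * (\<integral>w. cos (linf k w) \<partial>mu)"
proof -
 obtain Ls :: "nat => 'd site set" where Ls: "exhausting Ls" using exhausting_exists by blast
 have fin: "finite (Ls n)" for n using Ls by (simp add: exhausting_def)
 have Es: "E \<in> sets mu" using E sets_mu by simp
 have "(\<integral>w. indicator E w * cos (linf k w + c) \<partial>mu) \<le> measure mu E * fv k (Ls n)" for n
 proof -
  have "(\<integral>w. indicator E w * cos (linf k w + c) \<partial>mu) = (\<integral>w. indicator E w * av (Ls n) (\<lambda>w. cos (linf k w + c)) w \<partial>mu)"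
   by (rule inv_tail[OF fin cos_obs_measurable cos_obs_bounded])
  also have "... \<le> (\<integral>w. indicator E w * fv k (Ls n) \<partial>mu)"
  proof (rule integral_mono)
   have "\<bar>av (Ls n) (\<lambda>w. cos (linf k w + c)) w\<bar> \<le> 1" for w
    by (rule avg_bounded[OF fin _ cos_obs_measurable cos_obs_bounded]) simp
   then show "integrable mu (\<lambda>w. indicator E w * av (Ls n) (\<lambda>w. cos (linf k w + c)) w)"
    using E by (intro integrable_mu[where B=1] borel_measurable_times avg_measurable fin cos_obs_measurable) (auto simp: indicator_def)
   show "integrable mu (\<lambda>w. indicator E w * fv k (Ls n))" using indicator_integrable[OF E] by simp
   show "indicator E w * av (Ls n) (\<lambda>w. cos (linf k w + c)) w \<le> indicator E w * fv k (Ls n)" for w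
    by (intro mult_left_mono mmp fin k) simp
  qed
  also have "... = measure mu E * fv k (Ls n)" using Es by simp
  finally show ?thesis .
 qed
 moreover have "(\<lambda>n. measure mu E * fv k (Ls n)) \<longlonglongrightarrow> measure mu E * (\<integral>w. cos (linf k w) \<partial>mu)"
  using cos_limit[OF k Ls, of 0] by (intro tendsto_mult tendsto_const) simp
 ultimately show ?thesis by (intro LIMSEQ_le_const) auto
qed

end

text \<open>Integrals against \<open>cent E\<close> are covariances with \<open>E\<close>. They are
  shown to vanish for larger and larger classes of observables.\<close>

definition cent where "cent E w = indicator E w - measure mu E"

lemma cent:
 assumes E: "E \<in> sets CS"
 shows "cent E \<in> borel_measurable CS" "\<bar>cent E w\<bar> \<le> 1"
  "f \<in> borel_measurable CS ==> (\<And>w. \<bar>f w\<bar> \<le> B) ==> integrable mu (\<lambda>w. cent E w * f w)"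
  "f \<in> borel_measurable CS ==> (\<And>w. \<bar>f w\<bar> \<le> B) ==>
   (\<integral>w. cent E w * f w \<partial>mu) = (\<integral>w. indicator E w * f w \<partial>mu) - measure mu E * (\<integral>w. f w \<partial>mu)"
proof -
 show m: "cent E \<in> borel_measurable CS" using E unfolding cent_def[abs_def] by simp
 show b: "\<bar>cent E w\<bar> \<le> 1" for w unfolding cent_def using mu.prob_le_1[of E] measure_nonneg[of mu E] by (auto simp: indicator_def)
 assume f: "f \<in> borel_measurable CS" "\<And>w. \<bar>f w\<bar> \<le> B"
 have "\<bar>cent E w * f w\<bar> \<le> 1 * B" for w unfolding abs_mult using b f(2) by (intro mult_mono) auto
 then show "integrable mu (\<lambda>w. cent E w * f w)" using m f by (intro integrable_mu[where B="1*B"]) auto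
 have "\<bar>indicator E w * f w\<bar> \<le> B" for w using f(2)[of w] by (auto simp: indicator_def)
 then have i: "integrable mu (\<lambda>w. indicator E w * f w)" using E f by (intro integrable_mu[where B=B]) auto
 show "(\<integral>w. cent E w * f w \<partial>mu) = (\<integral>w. indicator E w * f w \<partial>mu) - measure mu E * (\<integral>w. f w \<partial>mu)"
  using i integrable_mu[OF f] by (simp add: cent_def left_diff_distrib)
qed

context
 fixes E assumes E: "E \<in> sets CS" and inv: "\<And>a. tr a -` E = E"
begin

text \<open>The bound holds for \<open>E\<close> and for its complement, and at phase 0 the two
  bounds add up to the exact value, so both are equalities. \<open>rotate_max_zero\<close> then
  removes the sine part.\<close>

lemma inv_cos:
 assumes k: "fin_supp k"
 shows "(\<integral>w. cent E w * cos (linf k w + c) \<partial>mu) = 0"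
proof -
 let ?m = "\<integral>w. cos (linf k w) \<partial>mu"
 define X where "X c = (\<integral>w. indicator E w * cos (linf k w + c) \<partial>mu)" for c
 have C: "UNIV - E \<in> sets CS" "\<And>a. tr a -` (UNIV - E) = UNIV - E" using sets.Diff[OF sets.top E] inv by auto
 have Xi: "integrable mu (\<lambda>w. indicator E w * cos (linf k w + c))" for c
  using E by (intro integrable_mu[where B=1] borel_measurable_times cos_obs_measurable) (auto simp: indicator_def)
 have cm: "integrable mu (\<lambda>w. cos (linf k w + c))" for c by (rule integrable_mu[OF cos_obs_measurable cos_obs_bounded])
 have "(\<integral>w. indicator (UNIV - E) w * cos (linf k w + c) \<partial>mu) = cos c * ?m - X c" for c
 proof -
  have "indicator (UNIV - E) w * cos (linf k w + c) = cos (linf k w + c) - indicator E w * cos (linf k w + c)" for w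
   by (auto simp: indicator_def)
  then show ?thesis unfolding X_def using Xi cm cos_integral[OF k, of c] by simp
 qed
 moreover have "measure mu (UNIV - E) = 1 - measure mu E" using mu.prob_compl[of E] E sets_mu by simp
 ultimately have lo: "cos c * ?m - X c \<le> (1 - measure mu E) * ?m" for c
  using inv_cos_le[OF C k, of c] by simp
 have hi: "X c \<le> measure mu E * ?m" for c unfolding X_def by (rule inv_cos_le[OF E inv k])
 have X0: "X 0 = measure mu E * ?m" using lo[of 0] hi[of 0] by (simp add: algebra_simps)
 define s where "s = (\<integral>w. indicator E w * sin (linf k w) \<partial>mu)"
 have Xs: "X c = cos c * X 0 - sin c * s" for c
 proof -
  have sm: "integrable mu (\<lambda>w. indicator E w * sin (linf k w))"
  proof -
   have "sin (linf k w) = cos (linf k w + (-pi/2))" for w by (simp add: cos_diff)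
   then show ?thesis using Xi[of "-pi/2"] by simp
  qed
  have "indicator E w * cos (linf k w + c) = cos c * (indicator E w * cos (linf k w + 0)) - sin c * (indicator E w * sin (linf k w))" for w
   by (simp add: cos_add algebra_simps)
  then show ?thesis unfolding X_def s_def using sm Xi[of 0] by simp
 qed
 have "s = 0"
 proof (rule rotate_max_zero(1))
  show "cos c * X 0 - sin c * s \<le> X 0" for c using hi[of c] Xs[of c] X0 by linarith
 qed
 then have "X c = measure mu E * (\<integral>w. cos (linf k w + c) \<partial>mu)" using Xs[of c] X0 cos_integral[OF k, of c] by simp
 then show ?thesis using cent(4)[OF E cos_obs_measurable cos_obs_bounded] by (simp add: X_def)
qed

lemma inv_trig: "f \<in> trig ==> (\<integral>w. cent E w * f w \<partial>mu) = 0"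
proof (induction rule: trig.induct)
 case (cos k c) then show ?case by (rule inv_cos)
next
 case (scale f a)
 have "(\<integral>w. cent E w * (a * f w) \<partial>mu) = (\<integral>w. a * (cent E w * f w) \<partial>mu)" by (simp add: mult_ac)
 then show ?case using scale by simp
next
 case (add f g)
 obtain B D where B: "\<And>w. \<bar>f w\<bar> \<le> B" and D: "\<And>w. \<bar>g w\<bar> \<le> D" using trig_bounded add.hyps by metis
 have "integrable mu (\<lambda>w. cent E w * f w)" "integrable mu (\<lambda>w. cent E w * g w)"
  using cent(3)[OF E trig_measurable B] cent(3)[OF E trig_measurable D] add.hyps by auto
 then show ?case using add.IH by (simp add: distrib_left)
qed

lemma inv_cont:
 assumes f: "continuous_on unit_confs f" and m: "(\<lambda>w. f (cisf w)) \<in> borel_measurable CS"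
 shows "(\<integral>w. cent E w * f (cisf w) \<partial>mu) = 0"
proof -
 have "bounded (f ` unit_confs)" by (intro compact_imp_bounded compact_continuous_image f compact_unit_confs)
 then obtain B where "\<forall>z\<in>unit_confs. \<bar>f z\<bar> \<le> B" by (auto simp: bounded_iff)
 then have B: "\<bar>f (cisf w)\<bar> \<le> B" for w using cisf_unit by auto
 have "\<bar>\<integral>w. cent E w * f (cisf w) \<partial>mu\<bar> \<le> e" if e: "0 < e" for e
 proof -
  obtain g where g: "g \<in> trig" "\<forall>w. \<bar>f (cisf w) - g w\<bar> < e" using trig_dense[OF f e] by blast
  obtain C where C: "\<And>w. \<bar>g w\<bar> \<le> C" using trig_bounded[OF g(1)] by blast
  have "\<bar>(\<integral>w. f (cisf w) * cent E w \<partial>mu) - (\<integral>w. g w * cent E w \<partial>mu)\<bar> \<le> 1 * (\<integral>w. \<bar>f (cisf w) - g w\<bar> \<partial>mu)"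
   using m trig_measurable[OF g(1)] cent(1,2)[OF E] B C by (intro mu.weighted_diff[where C=B and D=C]) (auto simp: mu_measurable)
  also have "... \<le> e"
  proof -
   have "integrable mu (\<lambda>w. \<bar>f (cisf w) - g w\<bar>)"
    using integrable_mu[OF m B] integrable_mu[OF trig_measurable[OF g(1)] C] by simp
   then have "(\<integral>w. \<bar>f (cisf w) - g w\<bar> \<partial>mu) \<le> (\<integral>w. e \<partial>mu)"
    using g(2) by (intro integral_mono) (auto simp: less_imp_le)
   then show ?thesis using mu.prob_space by simp
  qed
  finally show ?thesis using inv_trig[OF g(1)] by (simp add: mult.commute)
 qed
 then show ?thesis using field_le_epsilon[of "\<bar>\<integral>w. cent E w * f (cisf w) \<partial>mu\<bar>" 0] by simp
qed

text \<open>Local observables may be discontinuous. One average over \<open>J\<close>, legitimate on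
  \<open>E\<close> by \<open>inv_tail\<close>, replaces them by integrals of the continuous
  densities \<open>kdens\<close>.\<close>

lemma inv_local:
 assumes "local_obs h"
 shows "(\<integral>w. cent E w * h w \<partial>mu) = 0"
proof -
 obtain B J where hm: "h \<in> borel_measurable CS" and B: "\<And>w. \<bar>h w\<bar> \<le> B" and J: "finite J" and d: "depends_on J h"
  using assms unfolding local_obs_def by blast
 define g where "g s = h (merge_conf J s (\<lambda>_. 0))" for s
 have hg: "h w = g (restrict w J)" for w using d unfolding depends_on_def g_def by (simp add: merge_conf_def)
 have gm: "g \<in> borel_measurable (XYP J)" unfolding g_def
  by (rule measurable_compose[OF measurable_merge_conf1 hm]) simp
 have gb: "\<bar>g s\<bar> \<le> B" for s by (simp add: g_def B)
 define D where "D = exp (2 * (\<Sum>e\<in>bonds J. beta/2))"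
 have kb: "\<bar>kdens J s (cisf w)\<bar> \<le> D" for s w using kdens_bounds[OF cisf_unit, of J s w] by (simp add: D_def)
 have D0: "0 \<le> D" by (simp add: D_def)
 have avm: "av J h \<in> borel_measurable CS" and avb: "\<bar>av J h w\<bar> \<le> B" for w
  by (rule avg_measurable[OF J hm], rule avg_bounded[OF J _ hm B]) simp
 interpret PJ: prob_space "XYP J" by (rule prob_space_XYP)
 interpret KP: pair_prob_space mu "XYP J" ..
 have km: "(\<lambda>w. kdens J s (cisf w)) \<in> borel_measurable CS" if "s \<in> space (XYP J)" for s
  using measurable_compose[OF _ kdens_joint_measurable[OF J], of "\<lambda>w. (w, s)"] that by simp
 have km2: "(\<lambda>(v, s). kdens J s (cisf v)) \<in> borel_measurable (mu \<Otimes>\<^sub>M XYP J)"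
  using kdens_joint_measurable[OF J] sets_mu by (simp cong: measurable_cong_sets sets_pair_measure_cong)
 have avk: "av J h w = (\<integral>s. kdens J s (cisf w) * g s \<partial>XYP J)" for w
  unfolding hg using av_kdens[OF J] .
 have "(\<integral>w. cent E w * h w \<partial>mu) = (\<integral>w. cent E w * av J h w \<partial>mu)"
  unfolding cent(4)[OF E hm B] cent(4)[OF E avm avb] using inv_tail[OF E inv J hm B] DLR[OF J hm B] by simp
 also have "... = (\<integral>w. \<integral>s. cent E w * (kdens J s (cisf w) * g s) \<partial>XYP J \<partial>mu)" unfolding avk by simp
 also have "... = (\<integral>s. \<integral>w. cent E w * (kdens J s (cisf w) * g s) \<partial>mu \<partial>XYP J)"
 proof (rule KP.Fubini_bounded(1))
  have "cent E \<in> borel_measurable mu" using cent(1)[OF E] by (simp add: mu_measurable)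
  then show "(\<lambda>(w, s). cent E w * (kdens J s (cisf w) * g s)) \<in> borel_measurable (mu \<Otimes>\<^sub>M XYP J)"
   using km2 measurable_compose[OF measurable_snd gm] measurable_compose[OF measurable_fst]
   unfolding case_prod_unfold by (intro borel_measurable_times) auto
  show "\<bar>cent E w * (kdens J s (cisf w) * g s)\<bar> \<le> 1 * (D * B)" for w s
   unfolding abs_mult using cent(2)[OF E] kb gb D0 by (intro mult_mono) auto
 qed
 also have "... = (\<integral>s. 0 \<partial>XYP J)"
 proof (rule Bochner_Integration.integral_cong[OF refl])
  fix s assume s: "s \<in> space (XYP J)"
  have "(\<integral>w. cent E w * (kdens J s (cisf w) * g s) \<partial>mu) = (\<integral>w. (cent E w * kdens J s (cisf w)) * g s \<partial>mu)" by (simp add: mult.assoc)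
  also have "... = (\<integral>w. cent E w * kdens J s (cisf w) \<partial>mu) * g s" by simp
  finally show "(\<integral>w. cent E w * (kdens J s (cisf w) * g s) \<partial>mu) = 0" using inv_cont[OF kdens_continuous km[OF s]] by simp
 qed
 finally show ?thesis by simp
qed

text \<open>Local observables approximate \<open>E\<close> itself, and they are uncorrelated with
  \<open>E\<close>; hence \<open>E\<close> is independent of itself.\<close>

lemma inv_zero_one: "measure mu E = 0 \<or> measure mu E = 1"
proof -
 let ?p = "measure mu E"
 have Em: "(indicator E :: _ => real) \<in> borel_measurable mu" using E sets_mu by (intro borel_measurable_indicator) simp
 have main: "\<bar>?p - ?p * ?p\<bar> \<le> e" if e: "0 < e" for e
 proof -
  obtain g where g: "local_obs g" "(\<integral>w. \<bar>indicator E w - g w\<bar> \<partial>mu) < e" using local_approx[OF E] e by blast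
  obtain C where C: "\<And>w. \<bar>g w\<bar> \<le> C" and gm: "g \<in> borel_measurable CS" using g(1) unfolding local_obs_def by blast
  have "\<bar>(\<integral>w. indicator E w * cent E w \<partial>mu) - (\<integral>w. g w * cent E w \<partial>mu)\<bar> \<le> 1 * (\<integral>w. \<bar>indicator E w - g w\<bar> \<partial>mu)"
   using gm cent(1,2)[OF E] C Em by (intro mu.weighted_diff[where C=1 and D=C]) (auto simp: mu_measurable)
  moreover have "(\<integral>w. g w * cent E w \<partial>mu) = 0" using inv_local[OF g(1)] by (simp add: mult.commute)
  moreover have "(\<integral>w. indicator E w * cent E w \<partial>mu) = ?p - ?p * ?p"
  proof -
   have "(\<integral>w. indicator E w * cent E w \<partial>mu) = (\<integral>w. cent E w * indicator E w \<partial>mu)" by (simp add: mult.commute)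
   also have "... = (\<integral>w. indicator E w * indicator E w \<partial>mu) - ?p * (\<integral>w. indicator E w \<partial>mu)"
    using E by (intro cent(4)[OF E, where B=1]) (auto simp: indicator_def)
   also have "(\<lambda>w. indicator E w * indicator E w :: real) = indicator E" by (auto simp: indicator_def)
   finally show ?thesis using E sets_mu by simp
  qed
  ultimately show ?thesis using g(2) by linarith
 qed
 have "\<bar>?p - ?p * ?p\<bar> \<le> 0" by (rule field_le_epsilon) (use main in simp)
 then have "?p * (1 - ?p) = 0" by (simp add: algebra_simps)
 then show ?thesis by simp
qed

end

theorem ergodic_mu: "ergodic XY_prior mu"
 unfolding ergodic_def translation_invariant_def using translation inv_zero_one sets_mu by auto

end

section \<open>Rotated and discretised states\<close>

lemma cos_lipschitz: "\<bar>cos a - cos b\<bar> \<le> \<bar>a - b :: real\<bar>"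
proof -
 have "\<bar>cos a - cos b\<bar> = 2 * (\<bar>sin ((a + b)/2)\<bar> * \<bar>sin ((b - a)/2)\<bar>)" by (simp add: cos_diff_cos abs_mult)
 also have "... \<le> 2 * (1 * \<bar>(b - a)/2\<bar>)"
  by (intro mult_left_mono mult_mono abs_sin_le_one abs_sin_x_le_abs_x) auto
 finally show ?thesis by simp
qed

text \<open>In this form the label is a floor corrected by a multiple of \<open>q\<close>, so the
  effect of full turns and of shifts by whole arcs can be read off.\<close>

lemma disc_floor: "int (disc q t) = \<lfloor>t * real q / (2*pi)\<rfloor> - int q * \<lfloor>t/(2*pi)\<rfloor> + 1"
proof -
 have "(t - 2*pi*\<lfloor>t/(2*pi)\<rfloor>) * real q / (2*pi) = t * real q / (2*pi) - of_int (int q * \<lfloor>t/(2*pi)\<rfloor>)"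
  by (simp add: field_simps)
 then have "\<lfloor>(t - 2*pi*\<lfloor>t/(2*pi)\<rfloor>) * real q / (2*pi)\<rfloor> = \<lfloor>t * real q / (2*pi)\<rfloor> - int q * \<lfloor>t/(2*pi)\<rfloor>"
  by (simp only: floor_diff_of_int)
 moreover have "0 \<le> (t - 2*pi*\<lfloor>t/(2*pi)\<rfloor>) * real q / (2*pi)" using md_range(1)[of t] by (simp add: md_def)
 then have "int (disc q t) = \<lfloor>(t - 2*pi*\<lfloor>t/(2*pi)\<rfloor>) * real q / (2*pi)\<rfloor> + 1" unfolding disc_def by simp
 ultimately show ?thesis by (simp only:)
qed

lemma disc_range: "0 < q ==> disc q t \<in> {1..q}"
proof -
 assume q: "0 < q"
 have "md t * real q / (2*pi) < real q" using md_range(2)[of t] q by (simp add: field_simps)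
 moreover have "0 \<le> md t * real q / (2*pi)" using md_range(1)[of t] by simp
 ultimately have "nat \<lfloor>md t * real q / (2*pi)\<rfloor> < q" using q by (simp add: floor_less_iff nat_less_iff)
 then show ?thesis by (simp add: disc_def md_def)
qed

lemma disc_md: "disc q (md t) = disc q t"
proof -
 have "\<lfloor>md t / (2*pi)\<rfloor> = 0" using md_range[of t] by (simp add: floor_eq_iff)
 moreover have "disc q t = nat \<lfloor>md t * real q / (2*pi)\<rfloor> + 1" by (simp add: disc_def md_def)
 ultimately show ?thesis by (simp add: disc_def)
qed

lemma disc_cos:
 assumes "0 < q"
 shows "cos (2*pi / real q * real (disc q t)) = cos (2*pi / real q * (of_int \<lfloor>t * real q / (2*pi)\<rfloor> + 1))"
proof -
 have "real (disc q t) = of_int (int (disc q t))" by simp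
 also have "... = of_int \<lfloor>t * real q / (2*pi)\<rfloor> + 1 - real q * of_int \<lfloor>t/(2*pi)\<rfloor>" unfolding disc_floor by simp
 finally have eq: "real (disc q t) = of_int \<lfloor>t * real q / (2*pi)\<rfloor> + 1 - real q * of_int \<lfloor>t/(2*pi)\<rfloor>" .
 have "2*pi / real q * (real q * of_int \<lfloor>t/(2*pi)\<rfloor>) = 2*pi* of_int \<lfloor>t/(2*pi)\<rfloor>" using assms by simp
 then have "2*pi / real q * real (disc q t) = 2*pi / real q * (of_int \<lfloor>t * real q / (2*pi)\<rfloor> + 1) + 2*pi* of_int (- \<lfloor>t/(2*pi)\<rfloor>)"
  unfolding eq right_diff_distrib by simp
 then show ?thesis by (simp only: cos_int_2pin cos_add sin_int_2pin)
qed

lemma disc_cos_close: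
 assumes "0 < q"
 shows "\<bar>cos (2*pi / real q * real (disc q t)) - cos t\<bar> \<le> 2*pi / real q"
proof -
 let ?x = "t * real q / (2*pi)"
 have "\<bar>cos (2*pi / real q * real (disc q t)) - cos t\<bar> \<le> \<bar>2*pi / real q * (of_int \<lfloor>?x\<rfloor> + 1) - t\<bar>"
  unfolding disc_cos[OF assms] by (rule cos_lipschitz)
 also have "\<bar>2*pi / real q * (of_int \<lfloor>?x\<rfloor> + 1) - t\<bar> = 2*pi / real q * \<bar>of_int \<lfloor>?x\<rfloor> + 1 - ?x\<bar>"
 proof -
  have "2*pi / real q * ?x = t" using assms by simp
  then have "2*pi / real q * (of_int \<lfloor>?x\<rfloor> + 1) - t = 2*pi / real q * (of_int \<lfloor>?x\<rfloor> + 1 - ?x)" by (simp only: right_diff_distrib)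
  then show ?thesis by (simp only: abs_mult) simp
 qed
 also have "... \<le> 2*pi / real q * 1"
 proof (rule mult_left_mono)
  show "\<bar>of_int \<lfloor>?x\<rfloor> + 1 - ?x\<bar> \<le> 1" using of_int_floor_le[of ?x] floor_correct[of ?x] by linarith
 qed simp
 finally show ?thesis by simp
qed

lemma sets_clock_prior [simp]: "sets (clock_prior q) = Pow {1..q}"
 and space_clock_prior [simp]: "space (clock_prior q) = {1..q}"
 by (simp_all add: clock_prior_def sets_uniform_count_measure space_uniform_count_measure)

lemma disc_measurable:
 assumes "0 < q" shows "disc q \<in> measurable borel (clock_prior q)"
proof -
 have m: "disc q \<in> measurable borel (count_space UNIV)"
  unfolding disc_def[abs_def] by measurable
 have "disc q \<in> measurable borel (count_space {1..q})"
  using disc_range[OF assms] measurable_sets[OF m] by (auto simp: measurable_count_space_eq2)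
 then show ?thesis using measurable_cong_sets[of "borel :: real measure" borel "count_space {1..q}" "clock_prior q"] by simp
qed

lemma factor_measurable:
 assumes "phi \<in> measurable nu nu'"
 shows "(\<lambda>w x. phi (w x)) \<in> measurable (conf_space nu) (conf_space nu')"
 unfolding conf_space_def
 by (rule measurable_PiM_single') (use assms measurable_space[OF assms] in \<open>auto simp: space_PiM PiE_iff\<close>)

text \<open>A sitewise map commutes with translations, so invariant events pull back to invariant
  events.\<close>

lemma factor_ergodic:
 fixes mu :: "('d site => 's) measure" and nu' :: "'t measure"
 assumes erg: "ergodic nu mu" and s: "sets mu = sets (conf_space nu)" and phi: "phi \<in> measurable nu nu'"
 shows "ergodic nu' (distr mu (conf_space nu') (\<lambda>w x. phi (w x)))"
proof -
 let ?T = "\<lambda>w x. phi (w x)" and ?C = "conf_space nu' :: ('d site => 't) measure"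
 have T: "?T \<in> measurable mu ?C" using factor_measurable[OF phi] measurable_cong_sets[OF s refl] by blast
 have trm: "tr a \<in> measurable mu (conf_space nu)" for a using tr_measurable measurable_cong_sets[OF s refl] by blast
 have c: "tr a (?T w) = ?T (tr a w)" for a and w :: "'d site => 's" by (simp add: tr_def)
 have TI: "distr mu (conf_space nu) (tr a) = mu" for a using erg by (simp add: ergodic_def translation_invariant_def)
 have "distr (distr mu ?C ?T) ?C (tr a) = distr mu ?C ?T" for a
 proof -
  have "distr (distr mu ?C ?T) ?C (tr a) = distr mu ?C (tr a \<circ> ?T)" by (rule distr_distr[OF tr_measurable T])
  also have "tr a \<circ> ?T = ?T \<circ> tr a" by (simp add: fun_eq_iff c)
  also have "distr mu ?C (?T \<circ> tr a) = distr (distr mu (conf_space nu) (tr a)) ?C ?T"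
   by (rule distr_distr[OF factor_measurable[OF phi] trm, symmetric])
  finally show ?thesis unfolding TI .
 qed
 moreover have "measure (distr mu ?C ?T) E = 0 \<or> measure (distr mu ?C ?T) E = 1"
  if E: "E \<in> sets ?C" and inv: "\<forall>a. tr a -` E \<inter> space ?C = E" for E
 proof -
  let ?F = "?T -` E \<inter> space mu"
  have F: "?F \<in> sets mu" by (rule measurable_sets[OF T E])
  have "tr a -` ?F \<inter> space mu = ?F" for a
  proof (rule set_eqI)
   fix w
   have sw: "w \<in> space mu ==> tr a w \<in> space mu \<and> ?T w \<in> space ?C"
    using measurable_space[OF trm] measurable_space[OF T] sets_eq_imp_space_eq[OF s] by auto
   have "?T w \<in> space ?C ==> (tr a (?T w) \<in> E) = (?T w \<in> E)" using inv by blast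
   then show "(w \<in> tr a -` ?F \<inter> space mu) = (w \<in> ?F)" using sw unfolding c by auto
  qed
  then have "measure mu ?F = 0 \<or> measure mu ?F = 1" using erg F by (simp add: ergodic_def)
  then show ?thesis using measure_distr[OF T E] by simp
 qed
 ultimately show ?thesis by (simp add: ergodic_def translation_invariant_def)
qed

context xy_model
begin

section \<open>Global rotations\<close>

definition rot :: "real => ('d site => real) => 'd site => real" where
 "rot a w = (\<lambda>x. md (w x + a))"

lemma rot_measurable: "rot a \<in> measurable CS CS"
 unfolding rot_def[abs_def] by (rule factor_measurable) simp

lemma H_rot: "HH L (rot a w) = HH L w"
proof -
 have "cos (md (w i + a) - md (w j + a)) = cos (w i - w j)" for i j
 proof -
  obtain k l where "md (w i + a) = w i + a + 2*pi* of_int k" "md (w j + a) = w j + a + 2*pi* of_int l" using md_eq by metis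
  then have "md (w i + a) - md (w j + a) = w i - w j + 2*pi* of_int (k - l)" by (simp add: algebra_simps)
  then show ?thesis by (simp only: cos_add cos_int_2pin sin_int_2pin)
 qed
 then show ?thesis by (simp add: H_XY_def rot_def)
qed

lemma av_rot:
 assumes L: "finite L" and f: "f \<in> borel_measurable CS"
 shows "av L f (rot a w) = av L (\<lambda>w. f (rot a w)) w"
proof -
 have m: "(\<lambda>s. exp (- HH L (merge_conf L s v)) * g (merge_conf L s v)) \<in> borel_measurable (XYP L)"
  if "g \<in> borel_measurable CS" for g v
  using measurable_compose[OF _ num_measurable2[OF L that], of "\<lambda>s. (v, s)"] by simp
 have r: "merge_conf L (\<lambda>x\<in>L. md (s x + a)) (rot a w) = rot a (merge_conf L s w)" for s
  by (auto simp: merge_conf_def rot_def)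
 have "(\<integral>s. exp (- HH L (merge_conf L s (rot a w))) * g (merge_conf L s (rot a w)) \<partial>XYP L)
   = (\<integral>s. exp (- HH L (merge_conf L s w)) * g (rot a (merge_conf L s w)) \<partial>XYP L)"
  if "g \<in> borel_measurable CS" for g
  using XYP_shift[OF L m[OF that], of "rot a w" "\<lambda>_. a"] unfolding r H_rot .
 from this[OF f] this[of "\<lambda>_. 1"] show ?thesis unfolding avg_def by simp
qed

lemma rot_gibbs:
 assumes mu: "mu \<in> gibbs_measures XY_prior HH"
 shows "distr mu CS (rot a) \<in> gibbs_measures XY_prior HH"
proof -
 have p: "prob_space mu" and s: "sets mu = sets CS" using mu by (auto simp: gibbs_measures_def)
 interpret prob_space mu by fact
 have rm: "rot a \<in> measurable mu CS" using rot_measurable measurable_cong_sets[OF s refl] by blast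
 show ?thesis
 proof (rule gibbs_measuresI[OF prob_space_distr[OF rm] sets_distr])
  fix L J :: "'d site set" and A assume L: "finite L" and J: "finite J" and A: "\<And>x. x \<in> J ==> A x \<in> sets XY_prior"
  let ?E = "prod_emb UNIV (\<lambda>_. XY_prior) J (Pi\<^sub>E J A)"
  have E: "?E \<in> sets CS" unfolding conf_space_def using J A by (intro sets_PiM_I) auto
  then have Em: "(indicator ?E :: _ => real) \<in> borel_measurable CS" by simp
  have "measure (distr mu CS (rot a)) ?E = (\<integral>w. indicator ?E w \<partial>distr mu CS (rot a))" using E by simp
  also have "... = (\<integral>w. indicator ?E (rot a w) \<partial>mu)" by (rule integral_distr[OF rm Em])
  also have "... = (\<integral>w. av L (\<lambda>w. indicator ?E (rot a w)) w \<partial>mu)"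
   by (rule gibbs_measuresD[OF mu L, where B=1]) (rule measurable_compose[OF rot_measurable Em], simp add: indicator_def)
  also have "... = (\<integral>w. av L (indicator ?E) (rot a w) \<partial>mu)" unfolding av_rot[OF L Em] ..
  also have "... = (\<integral>w. av L (indicator ?E) w \<partial>distr mu CS (rot a))"
   by (rule integral_distr[OF rm avg_measurable[OF L Em], symmetric])
  finally show "measure (distr mu CS (rot a)) ?E = (\<integral>w. av L (indicator ?E) w \<partial>distr mu CS (rot a))" .
 qed
qed

end

section \<open>Continuity and sign change of the discretised magnetization\<close>

lemma XY_prior_avoids:
 assumes "countable N" shows "AE t in XY_prior. t \<notin> N"
 unfolding XY_prior_def
 using AE_not_in[OF countable_imp_null_set_lborel[OF assms]] by (intro AE_uniform_measureI) auto

context xy_limit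
begin

text \<open>By the DLR equation for one site the conditional law of a spin has a density with
  respect to \<open>XY_prior\<close>, which has no atoms.\<close>

lemma coord_AE:
 assumes N: "countable N"
 shows "AE w in mu. w x \<notin> N"
proof -
 define g where "g s = (indicator N (s x) :: real)" for s :: "'d site => real"
 have Ns: "N \<in> sets borel" using N by (rule sets.countable[rotated]) simp
 have gm: "(\<lambda>w. indicator N (w x) :: real) \<in> borel_measurable CS"
  by (rule measurable_compose[OF measurable_coord]) (use Ns in simp)
 have "AE s in XYP {x}. s x \<notin> N"
  by (rule AE_PiM_component) (auto intro: prob_space_XY_prior XY_prior_avoids[OF N])
 then have "AE s in XYP {x}. kdens {x} s (cisf w) * g s = 0" for w by eventually_elim (simp add: g_def)
 then have "(\<integral>s. kdens {x} s (cisf w) * g s \<partial>XYP {x}) = 0" for w by (rule integral_eq_zero_AE)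
 then have av0: "av {x} (\<lambda>w. indicator N (w x)) w = 0" for w
  using av_kdens[of "{x}" g w] by (simp add: g_def)
 have "(\<integral>w. indicator N (w x) \<partial>mu) = (\<integral>w. av {x} (\<lambda>w. indicator N (w x)) w \<partial>mu)"
  by (rule DLR[OF _ gm, of _ 1]) (auto simp: indicator_def)
 then have "(\<integral>w. indicator N (w x) \<partial>mu) = (0::real)" using av0 by simp
 then have "AE w in mu. (indicator N (w x) :: real) = 0"
  using integral_nonneg_eq_0_iff_AE[of mu "\<lambda>w. indicator N (w x) :: real"] integrable_mu[OF gm, of 1] by (auto simp: indicator_def)
 then show ?thesis by eventually_elim (simp add: indicator_def split: if_splits)
qed

abbreviation coarse :: "nat => real => ('d site => nat) measure" where
 "coarse q a \<equiv> distr (distr mu CS (rot a)) (conf_space (clock_prior q)) (\<lambda>w x. disc q (w x))"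

lemma coarse_eq:
 assumes "0 < q"
 shows "coarse q a = distr mu (conf_space (clock_prior q)) (\<lambda>w x. disc q (w x + a))"
proof -
 have rm: "rot a \<in> measurable mu CS" using rot_measurable measurable_cong_sets[OF sets_mu refl] by blast
 have "disc q \<in> measurable XY_prior (clock_prior q)" using disc_measurable[OF assms] by (simp cong: measurable_cong_sets)
 from distr_distr[OF factor_measurable[OF this] rm] show ?thesis by (simp add: comp_def rot_def disc_md)
qed

lemma shift_disc_measurable:
 assumes "0 < q" shows "(\<lambda>t. disc q (t + a)) \<in> measurable XY_prior (clock_prior q)"
proof -
 have "(\<lambda>t. t + a) \<in> measurable XY_prior borel" by (simp cong: measurable_cong_sets)
 from measurable_compose[OF this disc_measurable[OF assms]] show ?thesis .
qed

lemma coarse_ergodic: "0 < q ==> ergodic (clock_prior q) (coarse q a)"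
 unfolding coarse_eq by (rule factor_ergodic[OF ergodic_mu sets_mu shift_disc_measurable])

definition mag :: "nat => ('d site => nat) measure => real" where
 "mag q m = (\<integral>w. cos (2*pi / real q * real (w (\<lambda>_. 0))) \<partial>m)"

lemma mag_coarse:
 assumes q: "0 < q"
 shows "mag q (coarse q a) = (\<integral>w. cos (2*pi / real q * real (disc q (w (\<lambda>_. 0) + a))) \<partial>mu)"
proof -
 have Tm: "(\<lambda>w x. disc q (w x + a)) \<in> measurable mu (conf_space (clock_prior q))"
  using factor_measurable[OF shift_disc_measurable[OF q]] measurable_cong_sets[OF sets_mu refl] by blast
 have "(\<lambda>w. w (\<lambda>_. 0)) \<in> measurable (conf_space (clock_prior q) :: ('d site => nat) measure) (clock_prior q)"
  unfolding conf_space_def by (rule measurable_component_singleton) simp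
 moreover have "(\<lambda>n. cos (2*pi / real q * real n)) \<in> borel_measurable (clock_prior q)"
  by (simp add: measurable_def)
 ultimately have "(\<lambda>w. cos (2*pi / real q * real (w (\<lambda>_. 0)))) \<in> borel_measurable (conf_space (clock_prior q) :: ('d site => nat) measure)"
  by (rule measurable_compose)
 from integral_distr[OF Tm this] show ?thesis unfolding coarse_eq[OF q] mag_def .
qed

lemma disc_obs_measurable: "0 < q ==> (\<lambda>w. cos (2*pi / real q * real (disc q (w x + a)))) \<in> borel_measurable mu"
proof -
 assume q: "0 < q"
 have "(\<lambda>t. cos (2*pi / real q * real (disc q (t + a)))) \<in> borel_measurable borel"
  unfolding disc_def by measurable
 from measurable_compose[OF measurable_coord this] show "(\<lambda>w. cos (2*pi / real q * real (disc q (w x + a)))) \<in> borel_measurable mu"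
  by (rule mu_measurable[THEN iffD1])
qed

text \<open>For a fixed configuration the observable is discontinuous only when the rotated spin at
  the origin lies on an arc boundary, which is a countable set of values and hence null.\<close>

lemma mag_continuous:
 assumes q: "0 < q"
 shows "isCont (\<lambda>a. mag q (coarse q a)) a"
proof (unfold mag_coarse[OF q] continuous_at_sequentially comp_def, intro allI impI)
 fix b :: "nat => real" assume b: "b \<longlonglongrightarrow> a"
 let ?N = "(\<lambda>n::int. of_int n * (2*pi) / real q - a) ` UNIV"
 show "(\<lambda>n. \<integral>w. cos (2*pi / real q * real (disc q (w (\<lambda>_. 0) + b n))) \<partial>mu)
  \<longlonglongrightarrow> (\<integral>w. cos (2*pi / real q * real (disc q (w (\<lambda>_. 0) + a))) \<partial>mu)"
 proof (rule integral_dominated_convergence[where w="\<lambda>_. 1"])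
  have "AE w in mu. w (\<lambda>_. 0) \<notin> ?N" by (rule coord_AE) simp
  then show "AE w in mu. (\<lambda>n. cos (2*pi / real q * real (disc q (w (\<lambda>_. 0) + b n)))) \<longlonglongrightarrow> cos (2*pi / real q * real (disc q (w (\<lambda>_. 0) + a)))"
  proof eventually_elim
   case (elim w)
   let ?t = "w (\<lambda>_. 0)"
   have "(?t + a) * real q / (2*pi) \<notin> \<int>"
   proof
    assume "(?t + a) * real q / (2*pi) \<in> \<int>"
    then obtain n where "(?t + a) * real q / (2*pi) = of_int n" by (rule Ints_cases)
    then have "?t = of_int n * (2*pi) / real q - a" using q by (simp add: field_simps)
    then show False using elim by blast
   qed
   moreover have "(\<lambda>n. (?t + b n) * real q / (2*pi)) \<longlonglongrightarrow> (?t + a) * real q / (2*pi)" by (intro tendsto_intros b) simp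
   ultimately have "\<forall>\<^sub>F n in sequentially. \<lfloor>(?t + b n) * real q / (2*pi)\<rfloor> = \<lfloor>(?t + a) * real q / (2*pi)\<rfloor>"
    by (rule eventually_floor_eq[rotated])
   then have "\<forall>\<^sub>F n in sequentially. cos (2*pi / real q * real (disc q (?t + b n))) = cos (2*pi / real q * real (disc q (?t + a)))"
    unfolding disc_cos[OF q] by eventually_elim simp
   then show ?case by (rule tendsto_eventually)
  qed
 qed (rule disc_obs_measurable[OF q], rule disc_obs_measurable[OF q], simp, simp)
qed

lemma uncountable_coarse:
 assumes q: "16 \<le> q" and m: "2/5 \<le> (\<integral>w. cos (w (\<lambda>_. 0)) \<partial>mu)"
 shows "uncountable (range (coarse q))"
proof
 have q0: "0 < q" using q by simp
 \<comment> \<open>From 16 arcs on, the discretisation error is below the magnetization bound 2/5,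
   so the signs at the angles 0 and \<open>pi\<close> survive.\<close>
 have d: "2*pi / real q < 2/5" using pi_less_4 pi_approx(2) q by (simp add: field_simps)
 have cm: "(\<lambda>w. cos (w (\<lambda>_. 0) + a)) \<in> borel_measurable CS" for a
  by (rule measurable_compose[OF measurable_coord]) measurable
 have close: "\<bar>mag q (coarse q a) - (\<integral>w. cos (w (\<lambda>_. 0) + a) \<partial>mu)\<bar> \<le> 2*pi / real q" for a
 proof -
  let ?f = "\<lambda>w. cos (2*pi / real q * real (disc q (w (\<lambda>_. 0) + a)))" and ?g = "\<lambda>w. cos (w (\<lambda>_. 0) + a)"
  have i: "integrable mu ?f" "integrable mu ?g"
   using disc_obs_measurable[OF q0] cm by (auto intro!: integrable_mu[of _ 1] simp: mu_measurable)
  have "\<bar>(\<integral>w. ?f w \<partial>mu) - (\<integral>w. ?g w \<partial>mu)\<bar> = \<bar>\<integral>w. ?f w - ?g w \<partial>mu\<bar>" using i by simp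
  also have "... \<le> (\<integral>w. \<bar>?f w - ?g w\<bar> \<partial>mu)" by (rule integral_abs_bound)
  also have "... \<le> (\<integral>w. 2*pi / real q \<partial>mu)" using i by (intro integral_mono disc_cos_close q0) auto
  also have "... = 2*pi / real q" using mu.prob_space by simp
  finally show ?thesis unfolding mag_coarse[OF q0] .
 qed
 have lo: "0 < mag q (coarse q 0)" using close[of 0] m d by simp
 have hi: "mag q (coarse q pi) < 0" using close[of pi] m d by simp
 assume "countable (range (coarse q))"
 then have c: "countable (mag q ` range (coarse q))" by simp
 have "{mag q (coarse q pi)..mag q (coarse q 0)} \<subseteq> mag q ` range (coarse q)"
 proof
  fix y assume y: "y \<in> {mag q (coarse q pi)..mag q (coarse q 0)}"
  have "\<exists>x. 0 \<le> x \<and> x \<le> pi \<and> mag q (coarse q x) = y"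
   by (rule IVT2) (use y mag_continuous[OF q0] in auto)
  then show "y \<in> mag q ` range (coarse q)" by blast
 qed
 then have "countable {mag q (coarse q pi)..mag q (coarse q 0)}" using c countable_subset by blast
 then show False using uncountable_closed_interval[of "mag q (coarse q pi)" "mag q (coarse q 0)"] lo hi by simp
qed

end

section \<open>The potential of the discretised states\<close>

definition fr :: "nat => real => real" where
 "fr q t = frac (t * real q / (2*pi))"

definition ang :: "nat => nat => real => real" where
 "ang q s t = 2*pi / real q * (real s - 1 + fr q t)"

lemma fr_range: "0 \<le> fr q t" "fr q t < 1"
 by (simp_all add: fr_def frac_lt_1)

lemma fr_measurable [measurable]: "fr q \<in> borel_measurable borel"
 unfolding fr_def[abs_def] frac_def by measurable

lemma ang_disc:
 assumes "0 < q" shows "ang q (disc q t) t = md t"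
proof -
 have "real (disc q t) = of_int (int (disc q t))" by simp
 also have "... = of_int \<lfloor>t * real q / (2*pi)\<rfloor> - real q * of_int \<lfloor>t/(2*pi)\<rfloor> + 1" unfolding disc_floor by simp
 finally have "real (disc q t) - 1 + fr q t = t * real q / (2*pi) - real q * of_int \<lfloor>t/(2*pi)\<rfloor>"
  by (simp add: fr_def frac_def)
 then have "ang q (disc q t) t = 2*pi / real q * (t * real q / (2*pi)) - 2*pi / real q * (real q * of_int \<lfloor>t/(2*pi)\<rfloor>)"
  by (simp only: ang_def right_diff_distrib)
 moreover have "2*pi / real q * (t * real q / (2*pi)) = t" "2*pi / real q * (real q * of_int \<lfloor>t/(2*pi)\<rfloor>) = 2*pi* of_int \<lfloor>t/(2*pi)\<rfloor>"
  using assms by simp_all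
 ultimately show ?thesis by (simp only: md_def)
qed

lemma disc_ang:
 assumes s: "s \<in> {1..q}" shows "disc q (ang q s t) = s"
proof -
 let ?y = "real s - 1 + fr q t"
 have q: "0 < q" using s by auto
 have "ang q s t * real q / (2*pi) = ?y" using q by (simp add: ang_def)
 moreover have "\<lfloor>?y\<rfloor> = int s - 1" using fr_range[of q t] by (simp add: floor_eq_iff)
 ultimately have 1: "\<lfloor>ang q s t * real q / (2*pi)\<rfloor> = int s - 1" by simp
 have "real s \<le> real q" "1 \<le> real s" using s by auto
 then have y: "0 \<le> ?y" "?y < real q" using fr_range[of q t] by linarith+
 have "ang q s t / (2*pi) = ?y / real q" by (simp add: ang_def)
 then have "\<lfloor>ang q s t / (2*pi)\<rfloor> = 0" using y q by (simp add: floor_eq_iff)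
 then have "int (disc q (ang q s t)) = int s" unfolding disc_floor 1 by simp
 then show ?thesis by simp
qed

lemma fr_shift:
 assumes "0 < q" shows "fr q (t + 2*pi / real q * real k) = fr q t"
proof -
 have "(t + 2*pi / real q * real k) * real q / (2*pi) = t * real q / (2*pi) + of_int (int k)"
  using assms by (simp add: field_simps)
 then show ?thesis unfolding fr_def frac_def by (simp only: floor_add_int[symmetric])
qed

lemma prob_clock: "0 < q ==> prob_space (clock_prior q)"
 unfolding clock_prior_def by (intro prob_space_uniform_count_measure) auto

text \<open>Each rotation by one arc raises the label by 1 modulo \<open>q\<close>, whatever the
  initial angle, so the \<open>q\<close> rotations reach every arc once.\<close>

lemma clock_permute:
 assumes q: "0 < q"
 shows "distr (clock_prior q) (clock_prior q) (\<lambda>k. disc q (t + 2*pi / real q * real k)) = clock_prior q"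
proof -
 let ?p = "\<lambda>k. disc q (t + 2*pi / real q * real k)"
 have rng: "?p k \<in> {1..q}" for k by (rule disc_range[OF q])
 have inj: "inj_on ?p {1..q}"
 proof (rule inj_onI)
  fix a b assume ab: "a \<in> {1..q}" "b \<in> {1..q}" and eq: "?p a = ?p b"
  have fl: "\<lfloor>(t + 2*pi / real q * real k) * real q / (2*pi)\<rfloor> = \<lfloor>t * real q / (2*pi)\<rfloor> + int k" for k
  proof -
   have "(t + 2*pi / real q * real k) * real q / (2*pi) = t * real q / (2*pi) + of_int (int k)"
    using q by (simp add: field_simps)
   then show ?thesis by (simp only: floor_add_int)
  qed
  have "int (?p a) = int (?p b)" using eq by simp
  then have "int a - int b = int q * (\<lfloor>(t + 2*pi / real q * real a)/(2*pi)\<rfloor> - \<lfloor>(t + 2*pi / real q * real b)/(2*pi)\<rfloor>)"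
   unfolding disc_floor fl by (simp add: algebra_simps)
  then have "int q dvd int a - int b" by simp
  moreover have "\<bar>int a - int b\<bar> < int q" using ab by auto
  ultimately have "int a - int b = 0" by (metis dvd_imp_le_int not_le abs_of_nat)
  then show "a = b" by simp
 qed
 have m: "?p \<in> measurable (clock_prior q) (clock_prior q)"
  using rng by (auto simp: measurable_def)
 show ?thesis
 proof (rule measure_eqI)
  fix A assume "A \<in> sets (distr (clock_prior q) (clock_prior q) ?p)"
  then have A: "A \<subseteq> {1..q}" by simp
  let ?B = "?p -` A \<inter> {1..q}"
  have "?p ` {1..q} = {1..q}" using rng by (intro endo_inj_surj inj) auto
  moreover have "?p ` ?B = ?p ` {1..q} \<inter> A" by blast
  ultimately have "?p ` ?B = A" using A by (simp only: Int_absorb1)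
  then have "card ?B = card A" using card_image[OF inj_on_subset[OF inj Int_lower2[of "?p -` A"]]] by simp
  moreover have "emeasure (distr (clock_prior q) (clock_prior q) ?p) A = emeasure (clock_prior q) ?B"
   using A by (subst emeasure_distr[OF m]) auto
  ultimately show "emeasure (distr (clock_prior q) (clock_prior q) ?p) A = emeasure (clock_prior q) A"
   using A by (simp add: clock_prior_def emeasure_uniform_count_measure)
 qed simp
qed

abbreviation "CKP q L \<equiv> PiM L (\<lambda>_. clock_prior q)"

lemma clock_coord: "x \<in> L ==> (\<lambda>s. real (s x)) \<in> borel_measurable (CKP q L)"
 by (rule measurable_compose[OF measurable_component_singleton]) (auto simp: measurable_def)

text \<open>Rotations by multiples of \<open>2*pi/q\<close> preserve the prior and permute the arcs without moving the position
 inside the arc, so arc and position are independent.  The position \<open>fr q t\<close> is kept as a function of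
 a full angle \<open>t\<close>, which makes \<open>XY_prior\<close> itself the single-site measure of the pair model.\<close>
theorem XYP_resolve:
 fixes F :: "('v => real) => real"
 assumes L: "finite L" and q: "0 < q" and F: "F \<in> borel_measurable (XYP L)" "\<And>w. \<bar>F w\<bar> \<le> B"
 shows "(\<integral>w. F w \<partial>XYP L) = (\<integral>s. \<integral>t. F (\<lambda>x\<in>L. ang q (s x) (t x)) \<partial>XYP L \<partial>CKP q L)"
proof -
 interpret PT: prob_space "XYP L" by (rule prob_space_XYP)
 interpret PS: prob_space "CKP q L" by (intro prob_space_PiM prob_clock q)
 interpret PP: pair_prob_space "CKP q L" "XYP L" ..
 let ?d = "2*pi / real q"
 have cm: "(\<lambda>p. real (fst p x)) \<in> borel_measurable (CKP q L \<Otimes>\<^sub>M XYP L)" if "x \<in> L" for x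
  by (rule measurable_compose[OF measurable_fst clock_coord[OF that]])
 have tm: "(\<lambda>p. snd p x) \<in> borel_measurable (CKP q L \<Otimes>\<^sub>M XYP L)" if "x \<in> L" for x
  by (rule measurable_compose[OF measurable_snd measurable_XYP_coord[OF that]])
 have m1: "(\<lambda>p. F (\<lambda>x\<in>L. md (snd p x + ?d * real (fst p x)))) \<in> borel_measurable (CKP q L \<Otimes>\<^sub>M XYP L)"
 proof (rule measurable_compose[OF _ F(1)], rule measurable_restrict)
  fix x assume x: "x \<in> L"
  have "(\<lambda>p. snd p x + ?d * real (fst p x)) \<in> borel_measurable (CKP q L \<Otimes>\<^sub>M XYP L)"
   by (intro borel_measurable_add borel_measurable_times borel_measurable_const cm[OF x] tm[OF x])
  from measurable_compose[OF this md_measurable]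
  show "(\<lambda>p. md (snd p x + ?d * real (fst p x))) \<in> measurable (CKP q L \<Otimes>\<^sub>M XYP L) XY_prior" by (simp cong: measurable_cong_sets)
 qed
 have m2: "(\<lambda>p. F (\<lambda>x\<in>L. ang q (fst p x) (snd p x))) \<in> borel_measurable (CKP q L \<Otimes>\<^sub>M XYP L)"
 proof (rule measurable_compose[OF _ F(1)], rule measurable_restrict)
  fix x assume x: "x \<in> L"
  have "(\<lambda>p. ang q (fst p x) (snd p x)) \<in> borel_measurable (CKP q L \<Otimes>\<^sub>M XYP L)"
   unfolding ang_def
   by (intro borel_measurable_add borel_measurable_diff borel_measurable_times borel_measurable_const cm[OF x]
     measurable_compose[OF tm[OF x] fr_measurable])
  then show "(\<lambda>p. ang q (fst p x) (snd p x)) \<in> measurable (CKP q L \<Otimes>\<^sub>M XYP L) XY_prior" by (simp cong: measurable_cong_sets)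
 qed
 have "(\<integral>w. F w \<partial>XYP L) = (\<integral>s. \<integral>w. F w \<partial>XYP L \<partial>CKP q L)" by (simp add: PS.prob_space)
 also have "... = (\<integral>s. \<integral>t. F (\<lambda>x\<in>L. md (t x + ?d * real (s x))) \<partial>XYP L \<partial>CKP q L)"
  by (intro Bochner_Integration.integral_cong refl XYP_shift L F)
 also have "... = (\<integral>t. \<integral>s. F (\<lambda>x\<in>L. md (t x + ?d * real (s x))) \<partial>CKP q L \<partial>XYP L)"
  by (rule PP.Fubini_bounded(1)[where B=B]) (use m1 F(2) in \<open>simp_all add: case_prod_unfold\<close>)
 also have "... = (\<integral>t. \<integral>s. F (\<lambda>x\<in>L. ang q (s x) (t x)) \<partial>CKP q L \<partial>XYP L)"
 proof (rule Bochner_Integration.integral_cong[OF refl])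
  fix t assume t: "t \<in> space (XYP L)"
  let ?p = "\<lambda>s. \<lambda>x\<in>L. disc q (t x + ?d * real (s x))"
  have d: "distr (CKP q L) (CKP q L) ?p = CKP q L"
   by (rule distr_PiM_componentwise[where f="\<lambda>x k. disc q (t x + ?d * real k)", OF L prob_clock[OF q] prob_clock[OF q] _ clock_permute[OF q]])
    (use disc_range[OF q] in \<open>auto simp: measurable_def\<close>)
  have pm: "?p \<in> measurable (CKP q L) (CKP q L)"
  proof (rule measurable_restrict)
   fix x assume "x \<in> L"
   have "(\<lambda>k. disc q (t x + ?d * real k)) \<in> measurable (clock_prior q) (clock_prior q)"
    using disc_range[OF q] by (auto simp: measurable_def)
   from measurable_compose[OF measurable_component_singleton[OF \<open>x \<in> L\<close>] this]
   show "(\<lambda>s. disc q (t x + ?d * real (s x))) \<in> measurable (CKP q L) (clock_prior q)" .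
  qed
  have Fm: "(\<lambda>s. F (\<lambda>x\<in>L. ang q (s x) (t x))) \<in> borel_measurable (CKP q L)"
   using measurable_compose[OF _ m2, of "\<lambda>s. (s, t)" "CKP q L"] t by simp
  have "(\<lambda>x\<in>L. md (t x + ?d * real (s x))) = (\<lambda>x\<in>L. ang q (?p s x) (t x))" for s
  proof
   fix x
   have "md (t x + ?d * real (s x)) = ang q (disc q (t x + ?d * real (s x))) (t x)"
    using ang_disc[OF q, of "t x + ?d * real (s x)"] fr_shift[OF q] by (simp add: ang_def)
   then show "(\<lambda>x\<in>L. md (t x + ?d * real (s x))) x = (\<lambda>x\<in>L. ang q (?p s x) (t x)) x" by simp
  qed
  then have "(\<integral>s. F (\<lambda>x\<in>L. md (t x + ?d * real (s x))) \<partial>CKP q L) = (\<integral>s. F (\<lambda>x\<in>L. ang q (?p s x) (t x)) \<partial>CKP q L)"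
   by (simp only:)
  also have "... = (\<integral>s. F (\<lambda>x\<in>L. ang q (s x) (t x)) \<partial>distr (CKP q L) (CKP q L) ?p)"
   by (rule integral_distr[OF pm Fm, symmetric])
  finally show "(\<integral>s. F (\<lambda>x\<in>L. md (t x + ?d * real (s x))) \<partial>CKP q L) = (\<integral>s. F (\<lambda>x\<in>L. ang q (s x) (t x)) \<partial>CKP q L)"
   unfolding d .
 qed
 also have "... = (\<integral>s. \<integral>t. F (\<lambda>x\<in>L. ang q (s x) (t x)) \<partial>XYP L \<partial>CKP q L)"
  by (rule PP.Fubini_bounded(1)[where B=B, symmetric]) (use m2 F(2) in \<open>simp_all add: case_prod_unfold\<close>)
 finally show ?thesis .
qed

lemma CKP_sets:
 assumes "finite J" shows "sets (CKP q J) = Pow (Pi\<^sub>E J (\<lambda>_. {1..q}))"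
proof -
 have "sets (CKP q J) = sets (PiM J (\<lambda>_. count_space {1..q}))" by (intro sets_PiM_cong) auto
 also have "... = sets (count_space (Pi\<^sub>E J (\<lambda>_. {1..q})))" using assms by (subst count_space_PiM_finite) auto
 finally show ?thesis by simp
qed

lemma space_clock_conf: "w \<in> space (conf_space (clock_prior q)) \<longleftrightarrow> w \<in> conf q"
 by (auto simp: conf_space_def space_PiM conf_def)

text \<open>The configuration space of finitely many clock spins is discrete, so dependence on
  finitely many sites already gives measurability.\<close>

lemma clock_local_measurable:
 fixes f :: "('d site => nat) => 'b::topological_space"
 assumes J: "finite J" and d: "\<And>w w'. w \<in> conf q ==> w' \<in> conf q ==> (\<forall>x\<in>J. w x = w' x) ==> f w = f w'"
 shows "f \<in> borel_measurable (conf_space (clock_prior q))"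
proof -
 define g where "g s = f (merge_conf J s (\<lambda>_. 1))" for s
 have "g \<in> borel_measurable (CKP q J)"
  using CKP_sets[OF J, of q] sets.sets_into_space by (auto simp: measurable_def space_PiM)
 moreover have "(\<lambda>w. restrict w J) \<in> measurable (conf_space (clock_prior q)) (CKP q J)"
  unfolding conf_space_def by (rule measurable_restrict_subset) simp
 ultimately have "(\<lambda>w. g (restrict w J)) \<in> borel_measurable (conf_space (clock_prior q))" by (rule measurable_compose[rotated])
 moreover have "g (restrict w J) = f w" if "w \<in> space (conf_space (clock_prior q))" for w
  unfolding g_def using that unfolding space_clock_conf
  by (intro d) (auto simp: merge_conf_def conf_def split: if_splits)
 ultimately show ?thesis by (subst measurable_cong[where g="\<lambda>w. g (restrict w J)"]) auto
qed

lemma exp_close: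
 assumes "\<bar>x\<bar> \<le> e/2" "e < (1::real)" shows "\<bar>exp x - 1\<bar> \<le> e"
proof (cases "0 \<le> x")
 case True
 have x: "x \<le> 1/2" "x \<le> e/2" using assms True by auto
 have "exp x \<le> 1 + x + x^2" using True x by (intro exp_bound) auto
 also have "x^2 \<le> x * 1" unfolding power2_eq_square using True x by (intro mult_left_mono) auto
 finally show ?thesis using x True by simp
next
 case False
 have "1 + x \<le> exp x" by (rule exp_ge_add_one_self)
 moreover have "exp x \<le> 1" using False by simp
 ultimately show ?thesis using assms by linarith
qed

lemma mob_image:
 assumes "inj h" shows "mob g (h ` A) = mob (\<lambda>B. g (h ` B)) A"
proof -
 have P: "Pow (h ` A) = image h ` Pow A" by (rule image_Pow_surj[OF refl, symmetric])
 have c: "card (h ` B) = card B" for B by (rule card_image[OF inj_on_subset[OF assms subset_UNIV]])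
 have i: "inj_on (image h) (Pow A)" by (rule inj_on_image_Pow[OF inj_on_subset[OF assms subset_UNIV]])
 show ?thesis unfolding mob_def P by (simp add: sum.reindex[OF i] comp_def c)
qed

section \<open>The clock potential and its majorant\<close>

locale clock_model = xy_model beta dim +
 pm: pair_model XY_prior "{(i, j). adj i (j :: 'd => int)}" D eps
 for beta and dim :: "'d::finite itself" and D and eps +
 fixes q :: nat
 assumes q: "0 < q" and small: "beta * (2*pi / real q) \<le> eps / 2"
begin

abbreviation dl where "dl \<equiv> 2*pi / real q"

text \<open>The bond weight relative to that of two spins at equal positions inside their arcs. Only
  this ratio is close to 1; the bond weight itself is strong.\<close>

definition fc :: "('d site => nat) => 'd site => 'd site => real => real => real" where
 "fc sgm i j t s = (if adj i j then exp (beta/2 * (cos (dl * (real (sgm i) - real (sgm j) + (fr q t - fr q s)))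
   - cos (dl * (real (sgm i) - real (sgm j))))) else 1)"

text \<open>The positions change the angle difference by at most one arc, and the cosine is
  1-Lipschitz; the locale assumption \<open>small\<close> bounds the resulting exponent.\<close>

lemma fc_product: "\<bar>fc sgm i j t s * fc sgm j i s t - 1\<bar> \<le> eps"
proof (cases "adj i j")
 case True
 let ?x = "real (sgm i) - real (sgm j)" and ?y = "fr q t - fr q s"
 have c: "cos (dl * (real (sgm j) - real (sgm i) + (fr q s - fr q t))) = cos (dl * (?x + ?y))"
  "cos (dl * (real (sgm j) - real (sgm i))) = cos (dl * ?x)"
 proof -
  have "real (sgm j) - real (sgm i) + (fr q s - fr q t) = - (?x + ?y)" "real (sgm j) - real (sgm i) = - ?x" by simp_all
  then show "cos (dl * (real (sgm j) - real (sgm i) + (fr q s - fr q t))) = cos (dl * (?x + ?y))"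
   "cos (dl * (real (sgm j) - real (sgm i))) = cos (dl * ?x)" by (simp_all only: mult_minus_right cos_minus)
 qed
 have "fc sgm i j t s * fc sgm j i s t = exp (beta * (cos (dl * (?x + ?y)) - cos (dl * ?x)))"
 proof -
  have a: "adj i j" "adj j i" using True adj_sym by blast+
  have h: "beta/2 * x + beta/2 * x = beta * x" for x by simp
  show ?thesis unfolding fc_def by (simp only: a if_True c exp_add[symmetric] h)
 qed
 moreover have "\<bar>beta * (cos (dl * (?x + ?y)) - cos (dl * ?x))\<bar> \<le> eps / 2"
 proof -
  have "\<bar>cos (dl * (?x + ?y)) - cos (dl * ?x)\<bar> \<le> \<bar>dl * (?x + ?y) - dl * ?x\<bar>" by (rule cos_lipschitz)
  also have "... = dl * \<bar>?y\<bar>" unfolding right_diff_distrib[symmetric] abs_mult by simp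
  also have "... \<le> dl * 1" using fr_range[of q t] fr_range[of q s] by (intro mult_left_mono) auto
  finally have "\<bar>beta\<bar> * \<bar>cos (dl * (?x + ?y)) - cos (dl * ?x)\<bar> \<le> beta * dl"
   using beta by (intro mult_mono) auto
  then show ?thesis using small by (simp add: abs_mult)
 qed
 ultimately show ?thesis using exp_close pm.eps(2) by simp
next
 case False
 then show ?thesis using pm.eps(1) adj_sym[of i j] by (simp add: fc_def)
qed

lemma fc_pos: "0 < fc sgm i j t s"
 by (simp add: fc_def)

lemma fc_le: "fc sgm i j t s \<le> exp beta"
proof -
 have "beta/2 * (cos x - cos y) \<le> beta" for x y
  using mult_left_mono[OF _ beta, of "cos x - cos y" 2] cos_le_one[of x] cos_ge_minus_one[of y] by simp
 then show ?thesis using beta by (simp add: fc_def)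
qed

lemma fc_measurable: "case_prod (fc sgm i j) \<in> borel_measurable (XY_prior \<Otimes>\<^sub>M XY_prior)"
 by (cases "adj i j") (simp_all add: fc_def case_prod_unfold, measurable)

lemma adm_fc: "pm.adm_f (fc sgm)"
 unfolding pm.adm_f_def
proof (intro conjI allI ballI impI)
 show "\<exists>K. \<forall>i j. \<forall>t\<in>space XY_prior. \<forall>s\<in>space XY_prior. fc sgm i j t s \<le> K" using fc_le by blast
 show "fc sgm i j = (\<lambda>_ _. 1)" if "(i, j) \<notin> {(i, j). adj i j}" for i j using that by (simp add: fc_def fun_eq_iff)
qed (rule fc_measurable fc_pos fc_product)+

lemma adm_one: "pm.adm_u (\<lambda>_ _. 1)"
 by (auto simp: pm.adm_u_def)

lemma Zf_local:
 assumes "\<And>x. x \<in> B ==> sgm x = sgm' x" "\<And>x. x \<in> B ==> u x = u' x"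
 shows "pm.Zf B (fc sgm) u = pm.Zf B (fc sgm') u'"
proof -
 have "pm.wt B (fc sgm) u = pm.wt B (fc sgm') u'"
  unfolding pm.wt_def fun_eq_iff using assms
  by (intro allI arg_cong2[where f=times] prod.cong) (auto simp: fc_def)
 then show ?thesis by (simp add: pm.Zf_def)
qed

text \<open>Trivial one-site weights mean free boundary conditions for the positions, so the
  coefficient at \<open>A\<close> depends on the arcs in \<open>A\<close> alone.\<close>

definition pot :: "('d site => nat) => 'd site set => real" where
 "pot sgm A = mob (\<lambda>B. ln (pm.Zf B (fc sgm) (\<lambda>_ _. 1))) A"

definition pairs :: "'d site set => ('d site \<times> 'd site) set" where
 "pairs A = {(i, j). adj i j \<and> {i, j} = A}"

definition bare :: "('d site => nat) => 'd site set => real" where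
 "bare sgm A = - beta/2 * (\<Sum>(i,j)\<in>pairs A. cos (dl * (real (sgm i) - real (sgm j))))"

text \<open>\<open>pot\<close> expands the logarithm of a weight, and energies are negative
  logarithms; hence the minus sign.\<close>

definition Phi :: "'d site set => ('d site => nat) => real" where
 "Phi A sgm = bare sgm A - pot sgm A"

definition maj :: "'d site => 'd site set => real" where
 "maj z = (SOME b. \<forall>V. finite V --> z \<notin> V --> (\<Sum>A\<in>Pow V. b A) \<le> (1/2::real) \<and>
   (\<forall>A\<subseteq>V. \<forall>f u. pm.adm_f f --> pm.adm_u u --> u z = (\<lambda>_. 1) -->
    \<bar>mob (\<lambda>B. ln (pm.Zf B f u)) (insert z A)\<bar> \<le> b A))"

lemma maj:
 assumes "finite V" "z \<notin> V"
 shows "(\<Sum>A\<in>Pow V. maj z A) \<le> 1/2"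
  "A \<subseteq> V ==> pm.adm_f f ==> pm.adm_u u ==> u z = (\<lambda>_. 1) ==> \<bar>mob (\<lambda>B. ln (pm.Zf B f u)) (insert z A)\<bar> \<le> maj z A"
 using someI_ex[OF pm.mob_ln_majorant[of z], folded maj_def] assms by blast+

lemma mob_le_maj:
 assumes "finite A" "z \<in> A" "pm.adm_u u" "u z = (\<lambda>_. 1)"
 shows "\<bar>mob (\<lambda>B. ln (pm.Zf B (fc sgm) u)) A\<bar> \<le> maj z (A - {z})"
 using maj(2)[of "A - {z}" z "A - {z}" "fc sgm" u] assms adm_fc by (simp add: insert_absorb)

lemma pot_le_maj: "finite A ==> z \<in> A ==> \<bar>pot sgm A\<bar> \<le> maj z (A - {z})"
 unfolding pot_def by (rule mob_le_maj) (auto simp: adm_one)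

lemma maj_nonneg: "finite A ==> z \<notin> A ==> 0 \<le> maj z A"
 using pot_le_maj[of "insert z A" z "\<lambda>_. 0"] by (simp add: order_trans[OF abs_ge_zero])

text \<open>The partial sums of the nonnegative majorant stay below 1/2. A volume whose sum is
  within \<open>e\<close> of the supremum leaves at most \<open>e\<close> for the sets that are not
  inside it.\<close>

lemma maj_tail:
 assumes e: "0 < e"
 shows "\<exists>V0. finite V0 \<and> z \<in> V0 \<and> (\<forall>F. finite F --> (\<forall>A\<in>F. finite A \<and> z \<in> A \<and> \<not> A \<subseteq> V0) --> (\<Sum>A\<in>F. maj z (A - {z})) \<le> e)"
proof -
 define S where "S = (\<lambda>V. \<Sum>A\<in>Pow V. maj z A) ` {V. finite V \<and> z \<notin> V}"
 have bdd: "bdd_above S" unfolding S_def using maj(1) by (intro bdd_aboveI2[of _ _ "1/2"]) auto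
 have ne: "S \<noteq> {}" by (auto simp: S_def)
 obtain s where "s \<in> S" "Sup S - e < s" using less_cSupD[OF ne, of "Sup S - e"] e by auto
 then obtain V1 where V1: "finite V1" "z \<notin> V1" "Sup S - e < (\<Sum>A\<in>Pow V1. maj z A)" by (auto simp: S_def)
 have "(\<Sum>A\<in>F. maj z (A - {z})) \<le> e" if F: "finite F" "\<forall>A\<in>F. finite A \<and> z \<in> A \<and> \<not> A \<subseteq> insert z V1" for F
 proof -
  define W where "W = (\<Union>F - {z}) \<union> V1"
  have W: "finite W" "z \<notin> W" using F V1 by (auto simp: W_def)
  have inj: "inj_on (\<lambda>A. A - {z}) F" using F(2) by (intro inj_onI) (metis insert_Diff)
  have "(\<Sum>A\<in>F. maj z (A - {z})) = (\<Sum>B\<in>(\<lambda>A. A - {z}) ` F. maj z B)" by (simp add: sum.reindex[OF inj])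
  also have "... \<le> (\<Sum>B\<in>Pow W - Pow V1. maj z B)"
  proof (rule sum_mono2)
   show "(\<lambda>A. A - {z}) ` F \<subseteq> Pow W - Pow V1" using F(2) by (auto simp: W_def)
   show "0 \<le> maj z B" if "B \<in> Pow W - Pow V1 - (\<lambda>A. A - {z}) ` F" for B
    using that W by (intro maj_nonneg) (auto intro: finite_subset)
  qed (use W in simp)
  also have "... = (\<Sum>B\<in>Pow W. maj z B) - (\<Sum>B\<in>Pow V1. maj z B)"
   using W V1 by (intro sum_diff) (auto simp: W_def)
  also have "(\<Sum>B\<in>Pow W. maj z B) \<le> Sup S" using W by (intro cSup_upper bdd) (auto simp: S_def)
  finally show ?thesis using V1(3) by linarith
 qed
 then show ?thesis using V1(1) by (intro exI[of _ "insert z V1"]) blast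
qed

text \<open>Every set that meets \<open>L\<close> is charged to one of its points in
  \<open>L\<close>. The statement covers all \<open>x\<close> below the majorant, so that
  \<open>V0\<close> depends neither on the arcs nor on the boundary weights.\<close>

lemma maj_tails:
 assumes L: "finite L" and e: "0 < e"
 shows "\<exists>V0. finite V0 \<and> L \<subseteq> V0 \<and> (\<forall>V. V0 \<subseteq> V --> (\<forall>F x. finite F -->
  (\<forall>A\<in>F. finite A \<and> A \<inter> L \<noteq> {} \<and> \<not> A \<subseteq> V \<and> (\<forall>z\<in>A \<inter> L. x A \<le> maj z (A - {z}))) --> sum x F \<le> e))"
proof -
 define e' where "e' = e / (real (card L) + 1)"
 have e': "0 < e'" using e by (simp add: e'_def)
 obtain V where V: "\<And>z. finite (V z) \<and> z \<in> V z \<and> (\<forall>F. finite F --> (\<forall>A\<in>F. finite A \<and> z \<in> A \<and> \<not> A \<subseteq> V z) --> (\<Sum>A\<in>F. maj z (A - {z})) \<le> e')"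
  using maj_tail[OF e'] by metis
 let ?V0 = "\<Union>z\<in>L. V z"
 have "sum x F \<le> e" if W: "?V0 \<subseteq> W" and F: "finite F"
  "\<forall>A\<in>F. finite A \<and> A \<inter> L \<noteq> {} \<and> \<not> A \<subseteq> W \<and> (\<forall>z\<in>A \<inter> L. x A \<le> maj z (A - {z}))" for W F x
 proof -
  have "sum x F \<le> (\<Sum>A\<in>F. \<Sum>z\<in>{z\<in>L. z \<in> A}. maj z (A - {z}))"
  proof (rule sum_mono)
   fix A assume A: "A \<in> F"
   then obtain z where z: "z \<in> A" "z \<in> L" using F(2) by blast
   have "x A \<le> maj z (A - {z})" using F(2) A z by blast
   also have "... \<le> (\<Sum>z\<in>{z\<in>L. z \<in> A}. maj z (A - {z}))"
    using L z F(2) A by (intro member_le_sum maj_nonneg) auto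
   finally show "x A \<le> (\<Sum>z\<in>{z\<in>L. z \<in> A}. maj z (A - {z}))" .
  qed
  also have "... = (\<Sum>z\<in>L. \<Sum>A\<in>{A\<in>F. z \<in> A}. maj z (A - {z}))" by (rule sum.swap_restrict[OF F(1) L])
  also have "... \<le> (\<Sum>z\<in>L. e')"
  proof (rule sum_mono)
   fix z assume z: "z \<in> L"
   have VW: "V z \<subseteq> W" by (rule order_trans[OF UN_upper[OF z] W])
   have "finite A \<and> z \<in> A \<and> \<not> A \<subseteq> V z" if "A \<in> {A\<in>F. z \<in> A}" for A
   proof -
    have A: "A \<in> F" "z \<in> A" using that by simp_all
    note FA = bspec[OF F(2) A(1)]
    have "\<not> A \<subseteq> V z" using conjunct1[OF conjunct2[OF conjunct2[OF FA]]] order_trans[OF _ VW, of A] by (rule contrapos_nn)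
    then show ?thesis using conjunct1[OF FA] A(2) by (intro conjI)
   qed
   then show "(\<Sum>A\<in>{A\<in>F. z \<in> A}. maj z (A - {z})) \<le> e'" using conjunct2[OF conjunct2[OF V[of z]]] F(1) by simp
  qed
  also have "... \<le> e" using e by (simp add: e'_def field_simps)
  finally show ?thesis .
 qed
 then have "\<forall>V. ?V0 \<subseteq> V --> (\<forall>F x. finite F -->
  (\<forall>A\<in>F. finite A \<and> A \<inter> L \<noteq> {} \<and> \<not> A \<subseteq> V \<and> (\<forall>z\<in>A \<inter> L. x A \<le> maj z (A - {z}))) --> sum x F \<le> e)"
  by (intro allI impI)
 moreover have "finite ?V0" "L \<subseteq> ?V0" using L V by auto
 ultimately show ?thesis by (intro exI[of _ ?V0] conjI)
qed

lemma pairs_subset: "z \<in> A ==> pairs A \<subseteq> bonds {z}"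
 by (auto simp: pairs_def bonds_def)

lemma bare_abs: "\<bar>bare sgm A\<bar> \<le> beta/2 * real (card (pairs A))"
proof -
 have "\<bar>\<Sum>(i,j)\<in>pairs A. cos (dl * (real (sgm i) - real (sgm j)))\<bar> \<le> (\<Sum>e\<in>pairs A. 1)"
  by (intro order_trans[OF sum_abs] sum_mono) (auto simp: case_prod_unfold)
 then have "\<bar>\<Sum>(i,j)\<in>pairs A. cos (dl * (real (sgm i) - real (sgm j)))\<bar> \<le> real (card (pairs A))" by simp
 from mult_left_mono[OF this, of "beta/2"] show ?thesis using beta by (simp add: bare_def abs_mult)
qed

lemma Phi_local:
 assumes "\<forall>x\<in>A. w x = w' x" shows "Phi A w = Phi A w'"
proof -
 have "bare w A = bare w' A"
  unfolding bare_def using assms by (intro arg_cong2[where f=times] refl sum.cong) (auto simp: pairs_def)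
 moreover have "pot w A = pot w' A"
  unfolding pot_def using assms by (intro mob_cong arg_cong[where f=ln] Zf_local) auto
 ultimately show ?thesis by (simp add: Phi_def)
qed

lemma Zf_translate:
 assumes B: "finite B"
 shows "pm.Zf ((\<lambda>x. site_add x a) ` B) (fc sgm) (\<lambda>_ _. 1) = pm.Zf B (fc (tr a sgm)) (\<lambda>_ _. 1)"
proof -
 let ?h = "\<lambda>x. site_add x a"
 let ?r = "\<lambda>omg. \<lambda>x\<in>B. omg (?h x)"
 have inj: "inj_on ?h B" by (rule inj_on_subset[OF site_add_inj]) simp
 have d: "distr (XYP (?h ` B)) (XYP B) ?r = XYP B"
  by (rule distr_PiM_reindex[of "?h ` B" "\<lambda>_. XY_prior" ?h B, OF prob_space_XY_prior inj]) (rule funcsetI, rule imageI)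
 have rm: "?r \<in> measurable (XYP (?h ` B)) (XYP B)"
  by (intro measurable_restrict measurable_component_singleton imageI)
 have "pm.wt (?h ` B) (fc sgm) (\<lambda>_ _. 1) omg = pm.wt B (fc (tr a sgm)) (\<lambda>_ _. 1) (?r omg)" for omg
 proof -
  have e: "?h ` B \<times> ?h ` B = map_prod ?h ?h ` (B \<times> B)" by auto
  have i: "inj_on (map_prod ?h ?h) (B \<times> B)" using inj by (intro map_prod_inj_on)
  show ?thesis unfolding pm.wt_def e prod.reindex[OF i] prod.neutral_const mult_1_right
   by (rule prod.cong[OF refl]) (auto simp: fc_def tr_def adj_translate)
 qed
 then have "pm.Zf (?h ` B) (fc sgm) (\<lambda>_ _. 1) = (\<integral>omg. pm.wt B (fc (tr a sgm)) (\<lambda>_ _. 1) (?r omg) \<partial>XYP (?h ` B))"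
  by (simp add: pm.Zf_def)
 also have "... = (\<integral>x. pm.wt B (fc (tr a sgm)) (\<lambda>_ _. 1) x \<partial>distr (XYP (?h ` B)) (XYP B) ?r)"
  by (rule integral_distr[OF rm pm.wt_measurable[OF adm_fc adm_one B], symmetric])
 finally show ?thesis unfolding d pm.Zf_def .
qed

lemma Phi_translate: "Phi ((\<lambda>x. site_add x a) ` A) sgm = Phi A (tr a sgm)"
proof -
 let ?h = "\<lambda>x. site_add x a" and ?g = "\<lambda>x. site_add x (\<lambda>k. - a k)"
 have gh: "?g (?h x) = x" "?h (?g x) = x" for x by (simp_all add: site_add_def)
 have "(\<Sum>(i,j)\<in>pairs (?h ` A). cos (dl * (real (sgm i) - real (sgm j)))) = (\<Sum>(i,j)\<in>pairs A. cos (dl * (real (tr a sgm i) - real (tr a sgm j))))"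
 proof (rule sum.reindex_bij_witness[of _ "map_prod ?h ?h" "map_prod ?g ?g"])
  show "map_prod ?g ?g e \<in> pairs A" if "e \<in> pairs (?h ` A)" for e
  proof -
   obtain i j where e: "e = (i,j)" "adj i j" "{i,j} = ?h ` A" using \<open>e \<in> pairs (?h ` A)\<close> by (auto simp: pairs_def)
   have "?g ` {i,j} = A" unfolding e(3) image_image gh by simp
   then have "{?g i, ?g j} = A" by (simp only: image_insert image_empty)
   then show ?thesis using e(2) by (simp add: e(1) pairs_def adj_translate)
  qed
  show "map_prod ?h ?h e \<in> pairs (?h ` A)" if "e \<in> pairs A" for e
   using that by (auto simp: pairs_def adj_translate)
 qed (auto simp: gh tr_def)
 then have "bare sgm (?h ` A) = bare (tr a sgm) A" by (simp add: bare_def)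
 moreover have "pot sgm (?h ` A) = pot (tr a sgm) A"
 proof (cases "finite A")
  case True
  then show ?thesis unfolding pot_def mob_image[OF site_add_inj]
   by (intro mob_cong arg_cong[where f=ln] Zf_translate) (auto intro: finite_subset)
 next
  case False
  then have "infinite (?h ` A)" using finite_imageD[OF _ inj_on_subset[OF site_add_inj subset_UNIV]] by blast
  then show ?thesis using False by (simp add: pot_def mob_def)
 qed
 ultimately show ?thesis by (simp add: Phi_def)
qed

lemma conf_nonempty: "conf q \<noteq> ({} :: ('d site => nat) set)"
 using q by (auto simp: conf_def intro!: exI[of _ "\<lambda>_. 1"])

lemma Phi_abs: "finite A ==> z \<in> A ==> \<bar>Phi A sgm\<bar> \<le> beta/2 * real (card (pairs A)) + maj z (A - {z})"
 unfolding Phi_def using bare_abs[of sgm A] pot_le_maj[of A z sgm] by linarith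

text \<open>Among the sets through the origin, \<open>bare\<close> lives on finitely many, and
  \<open>pot\<close> lies below a majorant that is independent of the configuration, so the supremum
  can stand inside the sum.\<close>

theorem interaction_Phi: "is_interaction q Phi"
 unfolding is_interaction_def
proof (intro conjI allI impI ballI)
 show "Phi A w = Phi A w'" if "\<forall>x\<in>A. w x = w' x" for A w w' using that by (rule Phi_local)
 show "Phi ((\<lambda>x. site_add x a) ` A) w = Phi A (tr a w)" for a A w by (rule Phi_translate)
 let ?z = "\<lambda>_. 0 :: int" and ?X = "{A. finite A \<and> (\<lambda>_. 0 :: int) \<in> (A :: 'd site set)}"
 let ?g = "\<lambda>A. beta/2 * real (card (pairs A)) + maj ?z (A - {?z})"
 have "(\<lambda>A. beta/2 * real (card (pairs A))) summable_on ?X"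
 proof (rule finite_nonzero_values_imp_summable_on, rule finite_subset)
  show "{A\<in>?X. beta/2 * real (card (pairs A)) \<noteq> 0} \<subseteq> (\<lambda>(i,j). {i,j}) ` bonds {?z}"
  proof
   fix A assume "A \<in> {A\<in>?X. beta/2 * real (card (pairs A)) \<noteq> 0}"
   then have A: "?z \<in> A" "pairs A \<noteq> {}" by auto
   then obtain i j where "(i,j) \<in> pairs A" by fastforce
   moreover from this have "(i,j) \<in> bonds {?z}" "A = {i,j}" using pairs_subset[OF A(1)] by (auto simp: pairs_def)
   ultimately show "A \<in> (\<lambda>(i,j). {i,j}) ` bonds {?z}" by (intro image_eqI[of _ _ "(i,j)"]) auto
  qed
 qed (simp add: finite_bonds)
 moreover have "(\<lambda>A. maj ?z (A - {?z})) summable_on ?X"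
 proof (rule nonneg_bdd_above_summable_on)
  show "0 \<le> maj ?z (A - {?z})" if "A \<in> ?X" for A using that by (intro maj_nonneg) auto
  show "bdd_above (sum (\<lambda>A. maj ?z (A - {?z})) ` {F. F \<subseteq> ?X \<and> finite F})"
  proof (rule bdd_aboveI2)
   fix F assume "F \<in> {F. F \<subseteq> ?X \<and> finite F}"
   then have F: "finite F" "\<And>A. A \<in> F ==> finite A \<and> ?z \<in> A" by auto
   let ?W = "\<Union>F - {?z}"
   have inj: "inj_on (\<lambda>A. A - {?z}) F" using F(2) by (intro inj_onI) (metis insert_Diff)
   have "(\<Sum>A\<in>F. maj ?z (A - {?z})) = (\<Sum>B\<in>(\<lambda>A. A - {?z}) ` F. maj ?z B)" by (simp add: sum.reindex[OF inj])
   also have "... \<le> (\<Sum>B\<in>Pow ?W. maj ?z B)"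
    using F by (intro sum_mono2 maj_nonneg) (auto intro: finite_subset[of _ ?W])
   also have "... \<le> 1/2" using F by (intro maj(1)) auto
   finally show "(\<Sum>A\<in>F. maj ?z (A - {?z})) \<le> 1/2" .
  qed
 qed
 ultimately have g: "?g summable_on ?X" by (rule summable_on_add)
 show "(\<lambda>A. SUP w\<in>conf q. \<bar>Phi A w\<bar>) summable_on ?X"
 proof (rule summable_on_comparison_test[OF g])
  fix A assume A: "A \<in> ?X"
  have le: "\<bar>Phi A w\<bar> \<le> ?g A" for w using A by (intro Phi_abs) auto
  show "(SUP w\<in>conf q. \<bar>Phi A w\<bar>) \<le> ?g A" by (rule cSUP_least[OF conf_nonempty le])
  obtain w :: "'d site => nat" where w: "w \<in> conf q" using conf_nonempty by blast
  have "\<bar>Phi A w\<bar> \<le> (SUP w\<in>conf q. \<bar>Phi A w\<bar>)" using w le by (intro cSUP_upper bdd_aboveI2[of _ _ "?g A"])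
  then show "0 \<le> (SUP w\<in>conf q. \<bar>Phi A w\<bar>)" by (rule order_trans[OF abs_ge_zero])
 qed
qed

theorem clock_invariant_Phi: "clock_invariant q Phi"
 unfolding clock_invariant_def
proof (intro allI ballI)
 fix A and w :: "'d site => nat"
 let ?w = "\<lambda>x. w x mod q + 1"
 \<comment> \<open>Relabelling adds 1 to every label up to multiples of \<open>q\<close>, and
   \<open>q\<close> arcs are a full turn, so cosines of label differences are unchanged.\<close>
 have c: "cos (dl * (real (?w i) - real (?w j) + r)) = cos (dl * (real (w i) - real (w j) + r))" for i j r
 proof -
  have m: "real (w x) = real (?w x) - 1 + real q * real (w x div q)" for x
   using arg_cong[OF mod_mult_div_eq[of "w x" q], of real] by (simp only: of_nat_add of_nat_mult of_nat_1)
  have "real (w i) - real (w j) + r = (real (?w i) - real (?w j) + r) + real q * (real (w i div q) - real (w j div q))"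
   unfolding right_diff_distrib using m[of i] m[of j] by linarith
  then have "dl * (real (w i) - real (w j) + r) = dl * ((real (?w i) - real (?w j) + r) + real q * (real (w i div q) - real (w j div q)))"
   by (simp only:)
  also have "... = dl * (real (?w i) - real (?w j) + r) + dl * real q * of_int (int (w i div q) - int (w j div q))"
   unfolding distrib_left by (simp only: mult.assoc of_int_diff of_int_of_nat_eq)
  also have "dl * real q = 2*pi" using q by simp
  finally show ?thesis by (simp only: cos_add cos_int_2pin sin_int_2pin)
 qed
 have "fc ?w = fc w" unfolding fc_def using c[of _ _ 0] by (intro ext) (simp only: c add_0_right)
 moreover have "bare ?w = bare w" unfolding bare_def using c[of _ _ 0] by (intro ext) (simp only: add_0_right)
 ultimately show "Phi A ?w = Phi A w" by (simp add: Phi_def pot_def)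
qed

end

lemma clock_local_bounded:
 fixes f :: "('d site => nat) => real"
 assumes J: "finite J" and q: "0 < q" and d: "\<And>w w'. w \<in> conf q ==> w' \<in> conf q ==> (\<forall>x\<in>J. w x = w' x) ==> f w = f w'"
 shows "\<exists>C. \<forall>w\<in>conf q. \<bar>f w\<bar> \<le> C"
proof -
 let ?S = "(\<lambda>s. \<bar>f (merge_conf J s (\<lambda>_. 1))\<bar>) ` (Pi\<^sub>E J (\<lambda>_. {1..q}))"
 have "finite ?S" using J by (intro finite_imageI finite_PiE) auto
 moreover have "\<bar>f w\<bar> \<in> ?S" if w: "w \<in> conf q" for w
 proof (rule image_eqI[of _ _ "restrict w J"])
  show "\<bar>f w\<bar> = \<bar>f (merge_conf J (restrict w J) (\<lambda>_. 1))\<bar>"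
   by (intro arg_cong[where f=abs] d w) (use w q in \<open>auto simp: merge_conf_def conf_def\<close>)
  show "restrict w J \<in> Pi\<^sub>E J (\<lambda>_. {1..q})" using w by (auto simp: conf_def)
 qed
 ultimately show ?thesis by (intro exI[of _ "Max ?S"]) (auto intro: Max_ge)
qed

context clock_model
begin

section \<open>The Hamiltonian of the potential and its local approximations\<close>

abbreviation sc :: "('d site => nat) => 'd site => real" where
 "sc sgm \<equiv> \<lambda>x. dl * real (sgm x)"

abbreviation meets :: "'d site set => 'd site set set" where
 "meets L \<equiv> {A. finite A \<and> A \<inter> L \<noteq> {}}"

definition psum :: "'d site set => 'd site set => ('d site => nat) => real" where
 "psum V L sgm = (\<Sum>A\<in>{A\<in>Pow V. A \<inter> L \<noteq> {}}. pot sgm A)"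

text \<open>\<open>bare\<close> groups the ordered bonds by their pair of sites, and a bond belongs
  to \<open>bonds L\<close> exactly when that pair meets \<open>L\<close>; regrouping recovers the
  energy of the angles \<open>sc sgm\<close>.\<close>

lemma bare_infsum:
 assumes L: "finite L"
 shows "bare sgm summable_on meets L" "infsum (bare sgm) (meets L) = HH L (sc sgm)"
proof -
 let ?h = "\<lambda>(i,j). {i,j}" and ?g = "\<lambda>(i,j). cos (dl * (real (sgm i) - real (sgm j)))"
 let ?A = "?h ` bonds L"
 have fA: "finite ?A" using finite_bonds[OF L] by simp
 have sub: "?A \<subseteq> meets L" by (auto simp: bonds_def)
 have z: "bare sgm A = 0" if "A \<in> meets L - ?A" for A
 proof -
  have "pairs A = {}"
  proof (rule ccontr)
   assume "pairs A \<noteq> {}"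
   then obtain i j where ij: "(i,j) \<in> pairs A" by fastforce
   then have "(i,j) \<in> bonds L" "A = ?h (i,j)" using that by (auto simp: pairs_def bonds_def)
   then show False using that by blast
  qed
  then show ?thesis by (simp add: bare_def)
 qed
 have "bare sgm summable_on meets L \<longleftrightarrow> bare sgm summable_on ?A"
  by (rule summable_on_cong_neutral) (use z sub in auto)
 then show "bare sgm summable_on meets L" using fA by simp
 have "infsum (bare sgm) (meets L) = infsum (bare sgm) ?A"
  by (rule infsum_cong_neutral) (use z sub in auto)
 also have "... = (\<Sum>A\<in>?A. bare sgm A)" using fA by simp
 also have "... = (\<Sum>A\<in>?A. \<Sum>e\<in>{e\<in>bonds L. ?h e = A}. - beta/2 * ?g e)"
 proof (rule sum.cong[OF refl])
  fix A assume "A \<in> ?A"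
  then have "pairs A = {e\<in>bonds L. ?h e = A}" by (auto simp: pairs_def bonds_def doubleton_eq_iff)
  then show "bare sgm A = (\<Sum>e\<in>{e\<in>bonds L. ?h e = A}. - beta/2 * ?g e)" by (simp only: bare_def sum_distrib_left)
 qed
 also have "... = (\<Sum>e\<in>bonds L. - beta/2 * ?g e)" by (rule sum.group[OF finite_bonds[OF L] fA]) simp
 also have "... = HH L (sc sgm)"
  unfolding H_XY_def bonds_def[symmetric] sum_distrib_left sum_divide_distrib
  by (intro sum.cong refl) (simp add: case_prod_unfold right_diff_distrib)
 finally show "infsum (bare sgm) (meets L) = HH L (sc sgm)" .
qed

lemma pot_summable:
 assumes L: "finite L"
 shows "(\<lambda>A. \<bar>pot sgm A\<bar>) summable_on meets L"
proof -
 obtain V0 where V0: "finite V0" "L \<subseteq> V0"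
  and t: "\<And>F x. finite F ==> \<forall>A\<in>F. finite A \<and> A \<inter> L \<noteq> {} \<and> \<not> A \<subseteq> V0 \<and> (\<forall>z\<in>A \<inter> L. x A \<le> maj z (A - {z})) ==> sum x F \<le> 1"
  using maj_tails[OF L zero_less_one] by (elim exE conjE) (erule allE, drule mp, rule order_refl, rule that, assumption, assumption, meson)
 show ?thesis
 proof (rule nonneg_bdd_above_summable_on)
  show "bdd_above (sum (\<lambda>A. \<bar>pot sgm A\<bar>) ` {F. F \<subseteq> meets L \<and> finite F})"
  proof (rule bdd_aboveI2)
   fix F assume "F \<in> {F. F \<subseteq> meets L \<and> finite F}"
   then have F: "finite F" "\<And>A. A \<in> F ==> finite A \<and> A \<inter> L \<noteq> {}" by auto
   let ?F1 = "F \<inter> Pow V0" and ?F2 = "F - Pow V0"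
   have "sum (\<lambda>A. \<bar>pot sgm A\<bar>) F = sum (\<lambda>A. \<bar>pot sgm A\<bar>) ?F1 + sum (\<lambda>A. \<bar>pot sgm A\<bar>) ?F2"
    by (rule sum.Int_Diff[OF F(1)])
   also have "sum (\<lambda>A. \<bar>pot sgm A\<bar>) ?F1 \<le> (\<Sum>A\<in>Pow V0. \<bar>pot sgm A\<bar>)"
    using V0 by (intro sum_mono2) auto
   also have "sum (\<lambda>A. \<bar>pot sgm A\<bar>) ?F2 \<le> 1"
    using F by (intro t) (auto intro!: pot_le_maj)
   finally show "sum (\<lambda>A. \<bar>pot sgm A\<bar>) F \<le> (\<Sum>A\<in>Pow V0. \<bar>pot sgm A\<bar>) + 1" by simp
  qed
 qed simp
qed

text \<open>The error is a tail of the majorant and thus uniform in the configuration, which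
  exhibits \<open>H_int\<close> as a uniform limit of local functions.\<close>

lemma H_int_approx:
 assumes L: "finite L" and e: "0 < e"
 shows "\<exists>V0. finite V0 \<and> (\<forall>V sgm. finite V --> V0 \<subseteq> V --> \<bar>H_int Phi L sgm - (HH L (sc sgm) - psum V L sgm)\<bar> \<le> e)"
proof -
 obtain V0 where V0: "finite V0" and t: "\<forall>V. V0 \<subseteq> V --> (\<forall>F x. finite F -->
  (\<forall>A\<in>F. finite A \<and> A \<inter> L \<noteq> {} \<and> \<not> A \<subseteq> V \<and> (\<forall>z\<in>A \<inter> L. x A \<le> maj z (A - {z}))) --> sum x F \<le> e)"
  using maj_tails[OF L e] by (elim exE conjE)
 have "\<bar>H_int Phi L sgm - (HH L (sc sgm) - psum V L sgm)\<bar> \<le> e" if V: "finite V" "V0 \<subseteq> V" for V sgm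
 proof -
  let ?F = "{A\<in>Pow V. A \<inter> L \<noteq> {}}" and ?R = "meets L - {A\<in>Pow V. A \<inter> L \<noteq> {}}"
  have sub: "?F \<subseteq> meets L" using V by (auto intro: finite_subset)
  have fF: "finite ?F" using V by simp
  have ab: "(\<lambda>A. norm (pot sgm A)) summable_on meets L" using pot_summable[OF L] by simp
  then have ps: "pot sgm summable_on meets L" by (rule abs_summable_summable)
  have abR: "(\<lambda>A. norm (pot sgm A)) summable_on ?R" by (rule summable_on_subset[OF ab]) auto
  have "H_int Phi L sgm = infsum (\<lambda>A. bare sgm A - pot sgm A) (meets L)" by (simp add: H_int_def Phi_def)
  also have "... = HH L (sc sgm) - infsum (pot sgm) (meets L)"
   using infsum_add[OF bare_infsum(1)[OF L] summable_on_uminus[THEN iffD2, OF ps]] by (simp add: bare_infsum(2)[OF L] infsum_uminus)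
  also have "meets L = ?F \<union> ?R" using sub by blast
  also have "infsum (pot sgm) (?F \<union> ?R) = psum V L sgm + infsum (pot sgm) ?R"
   using fF by (subst infsum_Un_disjoint) (use abs_summable_summable[OF abR] in \<open>auto simp: psum_def\<close>)
  finally have eq: "H_int Phi L sgm - (HH L (sc sgm) - psum V L sgm) = - infsum (pot sgm) ?R" by simp
  have "\<bar>infsum (pot sgm) ?R\<bar> \<le> infsum (\<lambda>A. norm (pot sgm A)) ?R" using norm_infsum_bound[OF abR] by simp
  also have "... \<le> e"
  proof (rule infsum_le_finite_sums[OF abR])
   fix F assume F: "finite F" "F \<subseteq> ?R"
   show "(\<Sum>A\<in>F. norm (pot sgm A)) \<le> e"
    by (rule t[rule_format, OF V(2) F(1)]) (use F(2) in \<open>auto intro!: pot_le_maj\<close>)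
  qed
  finally show ?thesis unfolding eq by simp
 qed
 then show ?thesis using V0 by (intro exI[of _ V0]) simp
qed

lemma HH_sc_local:
 assumes "\<forall>x\<in>nbh L. w x = w' x" shows "HH L (sc w) = HH L (sc w')"
proof -
 have "(\<Sum>(i,j)\<in>bonds L. cos (sc w i - sc w j)) = (\<Sum>(i,j)\<in>bonds L. cos (sc w' i - sc w' j))"
 proof (rule sum.cong[OF refl])
  fix e assume "e \<in> bonds L"
  then have a: "adj (fst e) (snd e)" "fst e \<in> L \<or> snd e \<in> L" by (auto simp: bonds_def)
  have "fst e \<in> nbh L" using a adj_sym[of "fst e" "snd e"] unfolding nbh_def by (elim disjE) blast+
  moreover have "snd e \<in> nbh L" using a unfolding nbh_def by (elim disjE) auto
  ultimately show "(case e of (i,j) => cos (sc w i - sc w j)) = (case e of (i,j) => cos (sc w' i - sc w' j))"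
   using assms by (simp add: case_prod_unfold)
 qed
 then show ?thesis by (simp add: H_XY_def bonds_def)
qed

lemma pot_local: "\<forall>x\<in>A. w x = w' x ==> pot w A = pot w' A"
 unfolding pot_def by (intro mob_cong arg_cong[where f=ln] Zf_local) auto

lemma approx_local:
 assumes "\<forall>x\<in>nbh L \<union> V. w x = w' x" shows "HH L (sc w) - psum V L w = HH L (sc w') - psum V L w'"
proof -
 have "psum V L w = psum V L w'" unfolding psum_def using assms by (intro sum.cong refl pot_local) auto
 then show ?thesis using HH_sc_local[of L w w'] assms by simp
qed

lemma clock_gibbs_spec: "gibbs_spec (clock_prior q) (H_int Phi :: 'd site set => _)"
proof (rule gibbs_spec.intro[OF prob_clock[OF q]], unfold gibbs_spec_axioms_def, intro conjI allI impI)
 fix L :: "'d site set" assume L: "finite L"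
 have "\<exists>V. finite V \<and> (\<forall>sgm. \<bar>H_int Phi L sgm - (HH L (sc sgm) - psum V L sgm)\<bar> \<le> e)" if "0 < e" for e
  using H_int_approx[OF L that] by (elim exE conjE, intro exI conjI allI) auto
 then have "\<forall>n. \<exists>V. finite V \<and> (\<forall>sgm. \<bar>H_int Phi L sgm - (HH L (sc sgm) - psum V L sgm)\<bar> \<le> 1 / real (Suc n))" by simp
 then obtain V where V: "\<And>n. finite (V n)" "\<And>n sgm. \<bar>H_int Phi L sgm - (HH L (sc sgm) - psum (V n) L sgm)\<bar> \<le> 1 / real (Suc n)" by metis
 have fin: "finite (nbh L \<union> V n)" for n using finite_nbh[OF L] V(1) by simp
 show "H_int Phi L \<in> borel_measurable (conf_space (clock_prior q))"
 proof (rule borel_measurable_LIMSEQ_real)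
  show "(\<lambda>n. HH L (sc sgm) - psum (V n) L sgm) \<longlonglongrightarrow> H_int Phi L sgm" for sgm
  proof (rule LIM_zero_cancel, rule Lim_null_comparison)
   show "(\<lambda>n. 1 / real (Suc n)) \<longlonglongrightarrow> 0" by (rule LIMSEQ_Suc) (rule lim_1_over_n)
   show "\<forall>\<^sub>F n in sequentially. norm (HH L (sc sgm) - psum (V n) L sgm - H_int Phi L sgm) \<le> 1 / real (Suc n)"
    using V(2)[of sgm] by (simp only: real_norm_def abs_minus_commute[of "HH L (sc sgm) - psum (V _) L sgm"]) simp
  qed
  show "(\<lambda>sgm. HH L (sc sgm) - psum (V n) L sgm) \<in> borel_measurable (conf_space (clock_prior q))" for n
   by (rule clock_local_measurable[OF fin]) (rule approx_local)
 qed
 obtain C where C: "\<forall>w\<in>conf q. \<bar>HH L (sc w) - psum (V 0) L w\<bar> \<le> C"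
 proof -
  have "\<exists>C. \<forall>w\<in>conf q. \<bar>HH L (sc w) - psum (V 0) L w\<bar> \<le> C"
   by (rule clock_local_bounded[OF fin[of 0] q]) (rule approx_local)
  then show ?thesis using that by blast
 qed
 show "\<exists>C. \<forall>w\<in>space (conf_space (clock_prior q)). \<bar>H_int Phi L w\<bar> \<le> C"
 proof (intro exI[of _ "C + 1"] ballI)
  fix w :: "'d site => nat" assume "w \<in> space (conf_space (clock_prior q))"
  then have "w \<in> conf q" by (simp add: space_clock_conf)
  then show "\<bar>H_int Phi L w\<bar> \<le> C + 1" using C V(2)[of w 0] by force
 qed
qed

section \<open>Weights of the arcs after integrating out the positions\<close>

definition bu :: "'d site set => ('d site => real) => ('d site => nat) => 'd site => real => real" where
 "bu V th sgm y t = (\<Prod>j\<in>{j. adj y j} - V. fc sgm y j t (th j) * fc sgm j y (th j) t)"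

lemma fc_slice: "(\<lambda>t. fc sgm i j t s) \<in> borel_measurable XY_prior" "(\<lambda>t. fc sgm i j s t) \<in> borel_measurable XY_prior"
 using measurable_compose[OF _ fc_measurable, of "\<lambda>t. (t, s)" XY_prior] measurable_compose[OF _ fc_measurable, of "\<lambda>t. (s, t)" XY_prior]
 by simp_all

text \<open>The exact spins outside \<open>V\<close> act on the positions inside as admissible
  one-site weights, so the majorant applies whatever these spins are.\<close>

lemma adm_bu: "pm.adm_u (bu V th sgm)"
 unfolding pm.adm_u_def
proof (intro conjI allI ballI)
 fix y
 show "bu V th sgm y \<in> borel_measurable XY_prior"
  unfolding bu_def[abs_def] by (intro borel_measurable_prod borel_measurable_times fc_slice)
 show "0 < bu V th sgm y t" for t unfolding bu_def by (intro prod_pos mult_pos_pos fc_pos)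
 have "bu V th sgm y t \<le> (\<Prod>j\<in>{j. adj y j} - V. exp beta * exp beta)" for t
  unfolding bu_def by (intro prod_mono conjI mult_mono fc_le) (simp_all add: less_imp_le fc_pos)
 then show "\<exists>K. \<forall>t\<in>space XY_prior. bu V th sgm y t \<le> K" by blast
qed

text \<open>The unnormalised conditional weight of the arcs in \<open>V\<close>, given the exact
  spins \<open>th\<close> outside, after integration over the positions in \<open>V\<close>; see
  \<open>resolve_num\<close>.\<close>

definition Rw :: "'d site set => ('d site => real) => ('d site => nat) => real" where
 "Rw V th sgm = exp (- HH V (sc sgm)) * pm.Zf V (fc sgm) (bu V th sgm)"

lemma Rw_pos: "finite V ==> 0 < Rw V th sgm"
 unfolding Rw_def by (intro mult_pos_pos pm.Zf_pos adm_fc adm_bu) simp_all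

lemma bu_local:
 assumes "y \<in> V" "\<forall>x\<in>nbh V. sgm x = sgm' x"
 shows "bu V th sgm y = bu V th sgm' y"
proof -
 have "y \<in> nbh V" "\<And>j. adj y j ==> j \<in> nbh V" using assms(1) by (auto simp: nbh_def)
 then show ?thesis using assms(2) unfolding bu_def fc_def
  by (intro ext prod.cong refl) simp
qed

lemma Rw_local:
 assumes "\<forall>x\<in>nbh V. sgm x = sgm' x" shows "Rw V th sgm = Rw V th sgm'"
proof -
 have "pm.Zf V (fc sgm) (bu V th sgm) = pm.Zf V (fc sgm') (bu V th sgm')"
  using assms bu_local by (intro Zf_local) (auto simp: nbh_def)
 then show ?thesis using HH_sc_local[OF assms] by (simp add: Rw_def)
qed

lemma cos_ang:
 "cos (ang q a t - ang q b s) = cos (dl * (real a - real b + (fr q t - fr q s)))"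
proof -
 have "ang q a t - ang q b s = dl * ((real a - 1 + fr q t) - (real b - 1 + fr q s))"
  by (simp only: ang_def right_diff_distrib)
 also have "(real a - 1 + fr q t) - (real b - 1 + fr q s) = real a - real b + (fr q t - fr q s)" by simp
 finally show ?thesis by simp
qed

lemma bond_weight:
 assumes "adj i j"
 shows "exp (beta/2 * cos (dl * (real (sgm i) - real (sgm j) + (fr q t - fr q s))))
  = exp (beta/2 * cos (sc sgm i - sc sgm j)) * fc sgm i j t s"
proof -
 have "sc sgm i - sc sgm j = dl * (real (sgm i) - real (sgm j))" by (simp only: right_diff_distrib)
 then show ?thesis unfolding fc_def using assms by (simp only: if_True exp_add[symmetric] right_diff_distrib) simp
qed

lemma exp_HH: "exp (- HH V w) = (\<Prod>(i,j)\<in>bonds V. exp (beta/2 * cos (w i - w j)))" if "finite V"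
proof -
 have "- HH V w = (\<Sum>e\<in>bonds V. beta/2 * cos (w (fst e) - w (snd e)))"
  unfolding H_XY_def bonds_def[symmetric] by (simp add: sum_distrib_left sum_divide_distrib case_prod_unfold sum_negf)
 then show ?thesis using finite_bonds[OF that] by (simp add: exp_sum case_prod_unfold)
qed

text \<open>Separates the bonds inside \<open>V\<close>, which become the pair factors of
  \<open>wt\<close>, from the crossing bonds, whose two orientations become the boundary weights
  \<open>bu\<close>.\<close>

lemma prod_bonds:
 fixes F :: "'d site => 'd site => real"
 assumes V: "finite V" and F: "\<And>i j. \<not> adj i j ==> F i j = 1"
 shows "(\<Prod>(i,j)\<in>bonds V. F i j) = (\<Prod>(i,j)\<in>V\<times>V. F i j) * (\<Prod>y\<in>V. \<Prod>j\<in>{j. adj y j} - V. F y j * F j y)"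
proof -
 let ?N = "\<lambda>y. {j. adj y j} - V"
 let ?S = "SIGMA y:V. ?N y"
 let ?I = "{(i,j)\<in>V\<times>V. adj i j}"
 have fN: "finite (?N y)" for y using finite_adj[of y] by simp
 have fS: "finite ?S" using V fN by simp
 have fI: "finite ?I" by (rule finite_subset[of _ "V \<times> V"]) (use V in auto)
 have b: "bonds V = (?I \<union> ?S) \<union> prod.swap ` ?S"
  by (auto simp: bonds_def image_iff adj_sym)
 have inj: "inj_on prod.swap ?S" by (simp add: inj_on_def)
 have "(\<Prod>(i,j)\<in>bonds V. F i j) = (\<Prod>(i,j)\<in>?I. F i j) * (\<Prod>(i,j)\<in>?S. F i j) * (\<Prod>(i,j)\<in>prod.swap ` ?S. F i j)"
  unfolding b using fI fS by (subst prod.union_disjoint, simp, simp, fastforce, subst prod.union_disjoint) auto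
 also have "(\<Prod>(i,j)\<in>?I. F i j) = (\<Prod>(i,j)\<in>V\<times>V. F i j)"
  using V F by (intro prod.mono_neutral_left) auto
 also have "(\<Prod>(i,j)\<in>prod.swap ` ?S. F i j) = (\<Prod>(i,j)\<in>?S. F j i)"
  by (subst prod.reindex[OF inj]) (simp add: comp_def case_prod_unfold)
 also have "(\<Prod>(i,j)\<in>?S. F i j) = (\<Prod>y\<in>V. \<Prod>j\<in>?N y. F y j)" using V fN by (subst prod.Sigma) auto
 also have "(\<Prod>(i,j)\<in>?S. F j i) = (\<Prod>y\<in>V. \<Prod>j\<in>?N y. F j y)" using V fN by (subst prod.Sigma) auto
 finally show ?thesis by (simp add: prod.distrib mult.assoc)
qed

lemma exp_HH_resolved:
 fixes th :: "'d site => real" and s :: "'d site => nat"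
 assumes V: "finite V" and sgm: "sgm = merge_conf V s (\<lambda>x. disc q (th x))"
 shows "exp (- HH V (merge_conf V (\<lambda>x\<in>V. ang q (s x) (t x)) th)) = exp (- HH V (sc sgm)) * pm.wt V (fc sgm) (bu V th sgm) t"
proof -
 let ?v = "merge_conf V (\<lambda>x\<in>V. ang q (s x) (t x)) th"
 define ta where "ta = merge_conf V t th"
 \<comment> \<open>An outer angle \<open>th i\<close> need not lie in \<open>[0, 2*pi)\<close>; it
   agrees with its representation by arc and position up to full turns.\<close>
 have "\<exists>k::int. ?v i = ang q (sgm i) (ta i) + 2*pi* of_int k" for i
 proof (cases "i \<in> V")
  case True
  then show ?thesis by (intro exI[of _ 0]) (simp add: merge_conf_def sgm ta_def)
 next
  case False
  obtain k where "md (th i) = th i + 2*pi* of_int k" using md_eq by blast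
  then have "th i = md (th i) + 2*pi* of_int (-k)" by simp
  then show ?thesis using False ang_disc[OF q, of "th i"] by (intro exI[of _ "-k"]) (simp add: merge_conf_def sgm ta_def)
 qed
 then obtain k :: "'d site => int" where k: "\<And>i. ?v i = ang q (sgm i) (ta i) + 2*pi* of_int (k i)" by metis
 have c: "cos (?v i - ?v j) = cos (dl * (real (sgm i) - real (sgm j) + (fr q (ta i) - fr q (ta j))))" for i j
 proof -
  have "?v i - ?v j = (ang q (sgm i) (ta i) - ang q (sgm j) (ta j)) + 2*pi* of_int (k i - k j)"
   unfolding k by (simp add: algebra_simps)
  then have "cos (?v i - ?v j) = cos (ang q (sgm i) (ta i) - ang q (sgm j) (ta j))"
   by (simp only: cos_add[of _ "2*pi* of_int (k i - k j)"] cos_int_2pin sin_int_2pin)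
  then show ?thesis by (simp only: cos_ang)
 qed
 have "exp (- HH V ?v) = (\<Prod>(i,j)\<in>bonds V. exp (beta/2 * cos (sc sgm i - sc sgm j)) * fc sgm i j (ta i) (ta j))"
  unfolding exp_HH[OF V] c
 proof (rule prod.cong[OF refl], clarify)
  fix i j assume "(i, j) \<in> bonds V"
  then have "adj i j" by (simp add: bonds_def)
  then show "exp (beta/2 * cos (dl * (real (sgm i) - real (sgm j) + (fr q (ta i) - fr q (ta j)))))
   = exp (beta/2 * cos (sc sgm i - sc sgm j)) * fc sgm i j (ta i) (ta j)" by (rule bond_weight)
 qed
 also have "... = exp (- HH V (sc sgm)) * (\<Prod>(i,j)\<in>bonds V. fc sgm i j (ta i) (ta j))"
  unfolding exp_HH[OF V] case_prod_unfold prod.distrib ..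
 also have "(\<Prod>(i,j)\<in>bonds V. fc sgm i j (ta i) (ta j)) = (\<Prod>(i,j)\<in>V\<times>V. fc sgm i j (ta i) (ta j)) * (\<Prod>y\<in>V. \<Prod>j\<in>{j. adj y j} - V. fc sgm y j (ta y) (ta j) * fc sgm j y (ta j) (ta y))"
  by (rule prod_bonds[OF V]) (simp add: fc_def)
 also have "... = pm.wt V (fc sgm) (bu V th sgm) t"
  unfolding pm.wt_def bu_def by (intro arg_cong2[where f=times] prod.cong refl) (auto simp: ta_def merge_conf_def)
 finally show ?thesis .
qed

abbreviation coarsen :: "('d site => real) => 'd site => nat" where
 "coarsen w \<equiv> \<lambda>x. disc q (w x)"

lemma coarsen_measurable: "coarsen \<in> measurable CS (conf_space (clock_prior q))"
proof -
 have "disc q \<in> measurable XY_prior (clock_prior q)" using disc_measurable[OF q] by (simp cong: measurable_cong_sets)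
 then show ?thesis by (rule factor_measurable)
qed

lemma coarsen_conf: "coarsen w \<in> conf q"
 unfolding conf_def using disc_range[OF q] by simp

text \<open>For observables of the arcs the rotor weights can be replaced by \<open>Rw\<close>.
  Applied to numerator and denominator this expresses rotor averages as averages over clock
  spins.\<close>

lemma resolve_num:
 fixes g :: "('d site => nat) => real"
 assumes V: "finite V" and g: "g \<in> borel_measurable (conf_space (clock_prior q))" "\<And>w. w \<in> conf q ==> \<bar>g w\<bar> \<le> B"
 shows "(\<integral>s. exp (- HH V (merge_conf V s th)) * g (coarsen (merge_conf V s th)) \<partial>XYP V) =
   (\<integral>s. Rw V th (merge_conf V s (coarsen th)) * g (merge_conf V s (coarsen th)) \<partial>CKP q V)"
proof -
 let ?F = "\<lambda>w. exp (- HH V (merge_conf V w th)) * g (coarsen (merge_conf V w th))"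
 have gm: "(\<lambda>w. g (coarsen w)) \<in> borel_measurable CS" by (rule measurable_compose[OF coarsen_measurable g(1)])
 have Fm: "?F \<in> borel_measurable (XYP V)"
  using measurable_compose[OF _ num_measurable2[OF V gm], of "\<lambda>s. (th, s)"] by simp
 have Fb: "\<bar>?F w\<bar> \<le> exp (\<bar>beta\<bar> * card (bonds V)) * B" for w
  unfolding abs_mult
 proof (rule mult_mono)
  show "\<bar>exp (- HH V (merge_conf V w th))\<bar> \<le> exp (\<bar>beta\<bar> * card (bonds V))"
   using H_XY_bounded[OF V, of beta "merge_conf V w th"] by simp
  show "\<bar>g (coarsen (merge_conf V w th))\<bar> \<le> B" by (rule g(2)[OF coarsen_conf])
 qed auto
 have "(\<integral>w. ?F w \<partial>XYP V) = (\<integral>s. \<integral>t. ?F (\<lambda>x\<in>V. ang q (s x) (t x)) \<partial>XYP V \<partial>CKP q V)"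
  by (rule XYP_resolve[OF V q Fm Fb])
 also have "... = (\<integral>s. Rw V th (merge_conf V s (coarsen th)) * g (merge_conf V s (coarsen th)) \<partial>CKP q V)"
 proof (rule Bochner_Integration.integral_cong[OF refl])
  fix s assume "s \<in> space (CKP q V)"
  then have s: "x \<in> V ==> s x \<in> {1..q}" for x by (auto simp: space_PiM)
  let ?sgm = "merge_conf V s (coarsen th)"
  have "coarsen (merge_conf V (\<lambda>x\<in>V. ang q (s x) (t x)) th) = ?sgm" for t
   using disc_ang[OF s] by (auto simp: merge_conf_def)
  then have "(\<integral>t. ?F (\<lambda>x\<in>V. ang q (s x) (t x)) \<partial>XYP V)
    = (\<integral>t. (exp (- HH V (sc ?sgm)) * pm.wt V (fc ?sgm) (bu V th ?sgm) t) * g ?sgm \<partial>XYP V)"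
   unfolding exp_HH_resolved[OF V refl] by (simp only:)
  also have "... = Rw V th ?sgm * g ?sgm" by (simp add: Rw_def pm.Zf_def)
  finally show "(\<integral>t. ?F (\<lambda>x\<in>V. ang q (s x) (t x)) \<partial>XYP V) = Rw V th ?sgm * g ?sgm" .
 qed
 finally show ?thesis .
qed

end

lemma osc_arith:
 fixes r :: real
 assumes "r = - v + p + s + t" "r' = - v' + p' + s' + t'" "p = p'" "\<bar>t\<bar> \<le> e/4" "\<bar>t'\<bar> \<le> e/4"
  and "v' - l' = v - l" "\<bar>h - (l - s)\<bar> \<le> e/4" "\<bar>h' - (l' - s')\<bar> \<le> e/4"
 shows "\<bar>(r + h) - (r' + h')\<bar> \<le> e"
 using assms by linarith

context clock_model
begin

section \<open>Comparison with the specification of the potential\<close>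

lemma bu_trivial:
 assumes "{j. adj y j} \<subseteq> V" shows "bu V th sgm y = (\<lambda>_. 1)"
 using assms by (simp add: bu_def fun_eq_iff Diff_eq_empty_iff[THEN iffD2])

text \<open>Moebius coefficients of sets that miss \<open>L\<close> do not see the spins in \<open>L\<close>, those of sets inside \<open>W\<close> do
 not see the boundary weights, and the remaining ones are small by the majorant.\<close>
lemma log_weight_osc:
 assumes L: "finite L" and e: "0 < e"
 shows "\<exists>V. finite V \<and> L \<subseteq> V \<and> L \<noteq> V \<and> (\<forall>th sgm sgm'. (\<forall>x. x \<notin> L --> sgm x = sgm' x) -->
  \<bar>(ln (Rw V th sgm) + H_int Phi L sgm) - (ln (Rw V th sgm') + H_int Phi L sgm')\<bar> \<le> e)"
proof -
 have e4: "0 < e/4" using e by simp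
 obtain V0 where V0: "finite V0" "L \<subseteq> V0" and t: "\<forall>V. V0 \<subseteq> V --> (\<forall>F x. finite F -->
  (\<forall>A\<in>F. finite A \<and> A \<inter> L \<noteq> {} \<and> \<not> A \<subseteq> V \<and> (\<forall>z\<in>A \<inter> L. x A \<le> maj z (A - {z}))) --> sum x F \<le> e/4)"
  using maj_tails[OF L e4] by (elim exE conjE)
 obtain V1 where V1: "finite V1" and H: "\<forall>V sgm. finite V --> V1 \<subseteq> V --> \<bar>H_int Phi L sgm - (HH L (sc sgm) - psum V L sgm)\<bar> \<le> e/4"
  using H_int_approx[OF L e4] by (elim exE conjE)
 \<comment> \<open>A site off \<open>L\<close> that enlarges \<open>W\<close>, so that the final
   volume differs from \<open>L\<close>; \<open>avg_defect\<close> defines a Hamiltonian by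
   distinguishing these two volumes.\<close>
 obtain a where a: "\<forall>x\<in>{\<lambda>_. 0}. site_add x a \<notin> L" using far_translate[of "{\<lambda>_. 0}" L] L by auto
 define W where "W = insert (site_add (\<lambda>_. 0) a) (V0 \<union> V1)"
 have W: "finite W" "V0 \<subseteq> W" "V1 \<subseteq> W" "L \<subseteq> W" "L \<noteq> W" using V0 V1 a by (auto simp: W_def)
 \<comment> \<open>One more layer of sites: every neighbour of a site in \<open>W\<close> then lies
   in \<open>?V\<close>, so the boundary weights are trivial on \<open>W\<close>.\<close>
 let ?V = "nbh W"
 have V: "finite ?V" by (rule finite_nbh[OF W(1)])
 have WV: "W \<subseteq> ?V" by (auto simp: nbh_def)
 have LV: "L \<subseteq> ?V" using W(4) WV by (rule order_trans)
 have LnV: "L \<noteq> ?V" using W(4,5) WV by blast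
 have bW: "bu ?V th sgm y = (\<lambda>_. 1)" if "y \<in> W" for th sgm y
  by (rule bu_trivial) (use that in \<open>auto simp: nbh_def\<close>)
 define c where "c th sgm A = mob (\<lambda>B. ln (pm.Zf B (fc sgm) (bu ?V th sgm))) A" for th sgm A
 let ?P0 = "{A\<in>Pow ?V. A \<inter> L = {}}" and ?P1 = "{A\<in>Pow W. A \<inter> L \<noteq> {}}" and ?P2 = "{A\<in>Pow ?V. A \<inter> L \<noteq> {} \<and> \<not> A \<subseteq> W}"
 have split: "ln (Rw ?V th sgm) = - HH ?V (sc sgm) + (\<Sum>A\<in>?P0. c th sgm A) + psum W L sgm + (\<Sum>A\<in>?P2. c th sgm A)" for th sgm
 proof -
  have Z: "0 < pm.Zf ?V (fc sgm) (bu ?V th sgm)" by (rule pm.Zf_pos[OF adm_fc adm_bu V])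
  have "ln (Rw ?V th sgm) = - HH ?V (sc sgm) + ln (pm.Zf ?V (fc sgm) (bu ?V th sgm))"
   unfolding Rw_def using Z by (simp add: ln_mult)
  also have "ln (pm.Zf ?V (fc sgm) (bu ?V th sgm)) = (\<Sum>A\<in>Pow ?V. c th sgm A)"
   unfolding c_def by (rule mob_inversion[OF V])
  also have "Pow ?V = ?P0 \<union> ?P1 \<union> ?P2" using WV by blast
  also have "(\<Sum>A\<in>?P0 \<union> ?P1 \<union> ?P2. c th sgm A) = (\<Sum>A\<in>?P0. c th sgm A) + (\<Sum>A\<in>?P1. c th sgm A) + (\<Sum>A\<in>?P2. c th sgm A)"
   using V W(1) by (subst sum.union_disjoint, simp, simp, blast, subst sum.union_disjoint) auto
  also have "(\<Sum>A\<in>?P1. c th sgm A) = psum W L sgm"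
   unfolding psum_def
  proof (rule sum.cong[OF refl])
   fix A assume "A \<in> ?P1"
   then show "c th sgm A = pot sgm A" unfolding c_def pot_def
    by (intro mob_cong arg_cong[where f=ln] Zf_local bW refl) blast
  qed
  finally show ?thesis by simp
 qed
 have "\<bar>(ln (Rw ?V th sgm) + H_int Phi L sgm) - (ln (Rw ?V th sgm') + H_int Phi L sgm')\<bar> \<le> e"
  if ag: "\<forall>x. x \<notin> L --> sgm x = sgm' x" for th sgm sgm'
 proof -
  have bl: "bu ?V th sgm y = bu ?V th sgm' y" if "y \<in> ?V" for y
  proof (cases "y \<in> W")
   case True
   then show ?thesis by (simp add: bW)
  next
   case False
   then have "y \<notin> L" using W(4) by blast
   then show ?thesis unfolding bu_def fc_def using ag LV by (intro ext prod.cong refl) auto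
  qed
  have P0: "(\<Sum>A\<in>?P0. c th sgm A) = (\<Sum>A\<in>?P0. c th sgm' A)"
  proof (rule sum.cong[OF refl])
   fix A assume "A \<in> ?P0"
   then have A: "A \<subseteq> ?V" "\<And>x. x \<in> A ==> x \<notin> L" by auto
   show "c th sgm A = c th sgm' A" unfolding c_def
    using A ag bl by (intro mob_cong arg_cong[where f=ln] Zf_local) blast+
  qed
  have P2: "\<bar>\<Sum>A\<in>?P2. c th rh A\<bar> \<le> e/4" for rh
  proof (rule order_trans[OF sum_abs], rule t[rule_format, OF W(2)])
   show "finite ?P2" using V by simp
   fix A assume "A \<in> ?P2"
   then have A: "A \<subseteq> ?V" "A \<inter> L \<noteq> {}" "\<not> A \<subseteq> W" by auto
   have fA: "finite A" using A(1) V by (rule finite_subset)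
   show "finite A \<and> A \<inter> L \<noteq> {} \<and> \<not> A \<subseteq> W \<and> (\<forall>z\<in>A \<inter> L. \<bar>c th rh A\<bar> \<le> maj z (A - {z}))"
    using fA A W(4) unfolding c_def by (intro conjI ballI mob_le_maj adm_bu bW) auto
  qed
  have mg: "merge_conf L (sc sgm') (sc sgm) = sc sgm'" using ag by (auto simp: merge_conf_def fun_eq_iff)
  have comp: "HH ?V (sc sgm') - HH L (sc sgm') = HH ?V (sc sgm) - HH L (sc sgm)"
   using H_XY_compat[OF V LV, of beta "sc sgm'" "sc sgm"] unfolding mg .
  have "\<bar>H_int Phi L rh - (HH L (sc rh) - psum W L rh)\<bar> \<le> e/4" for rh using H W(1,3) by blast
  from osc_arith[OF split split P0 P2 P2 comp this this] show ?thesis .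
 qed
 then show ?thesis by (intro exI[of _ ?V] conjI V LV LnV allI impI)
qed

interpretation C: gibbs_spec "clock_prior q" "H_int Phi :: 'd site set => _"
 by (rule clock_gibbs_spec)

abbreviation "CC \<equiv> (conf_space (clock_prior q) :: ('d site => nat) measure)"
abbreviation "avC \<equiv> avg (clock_prior q) (H_int Phi :: 'd site set => _)"

text \<open>Replacing \<open>- ln (Rw V th)\<close> by the nearby \<open>G\<close>, which differs from \<open>H_int Phi L\<close> by a function of the
 spins off \<open>L\<close>, makes the conditional averages in \<open>L\<close> exactly consistent.\<close>
lemma avg_defect:
 assumes L: "finite L" and e: "0 < e" "e < 1/2"
  and h: "h \<in> borel_measurable CC" "\<And>v. v \<in> conf q ==> \<bar>h v\<bar> \<le> 1"
 shows "\<exists>V. finite V \<and> (\<forall>th. \<bar>av V (\<lambda>w. h (coarsen w) - avC L h (coarsen w)) th\<bar> \<le> 4 * e)"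
proof -
 obtain V where V: "finite V" "L \<subseteq> V" "L \<noteq> V" and osc: "\<And>th sgm sgm'. (\<forall>x. x \<notin> L --> sgm x = sgm' x) ==>
  \<bar>(ln (Rw V th sgm) + H_int Phi L sgm) - (ln (Rw V th sgm') + H_int Phi L sgm')\<bar> \<le> e"
  using log_weight_osc[OF L e(1)] by (elim exE conjE) (rule that, assumption, assumption, assumption, simp)
 have hC: "\<And>v. v \<in> space CC ==> \<bar>h v\<bar> \<le> 1" using h(2) by (simp add: space_clock_conf)
 have am: "avC L h \<in> borel_measurable CC" by (rule C.avg_measurable[OF L h(1)])
 have ab: "\<bar>avC L h v\<bar> \<le> 1" if "v \<in> conf q" for v
  by (rule C.avg_bounded[OF L _ h(1) hC]) (use that in \<open>simp_all add: space_clock_conf\<close>)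
 define F where "F v = h v - avC L h v" for v
 have Fm: "F \<in> borel_measurable CC" unfolding F_def[abs_def] using h(1) am by simp
 have Fb: "\<bar>F v\<bar> \<le> 2" if "v \<in> conf q" for v using h(2)[OF that] ab[OF that] unfolding F_def by linarith
 have "\<bar>av V (\<lambda>w. F (coarsen w)) th\<bar> \<le> 4 * e" for th
 proof -
  let ?one = "\<lambda>x\<in>L. 1 :: nat"
  \<comment> \<open>The correction to \<open>H_int Phi L\<close> is evaluated with the spins in
    \<open>L\<close> frozen at 1, so it does not depend on them; by \<open>osc\<close> the freezing
    moves \<open>G\<close> by at most \<open>e\<close> away from
    \<open>- ln (Rw V th v)\<close>.\<close>
  define G where "G v = H_int Phi L v - (ln (Rw V th (merge_conf L ?one v)) + H_int Phi L (merge_conf L ?one v))" for v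
  \<comment> \<open>Assigns \<open>H_int Phi L\<close> to \<open>L\<close> and \<open>G\<close> to
    \<open>V\<close>, so that \<open>avg_consistent\<close> can be used for this pair of
    volumes.\<close>
  define H' where "H' X = (if X = L then H_int Phi L else G)" for X
  have one: "?one \<in> space (CKP q L)" using q by (simp add: space_PiM PiE_iff)
  have mm: "(\<lambda>v. merge_conf L ?one v) \<in> measurable CC CC"
   using measurable_compose[OF measurable_Pair1'[OF one] C.measurable_merge_conf] by simp
  have mconf: "merge_conf L ?one v \<in> conf q" if "v \<in> conf q" for v
   using that q by (auto simp: conf_def merge_conf_def)
  have Rm: "Rw V th \<in> borel_measurable CC"
   by (rule clock_local_measurable[OF finite_nbh[OF V(1)]]) (rule Rw_local)
  obtain K where K: "\<And>v. v \<in> conf q ==> \<bar>Rw V th v\<bar> \<le> K"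
  proof -
   have "\<exists>C. \<forall>w\<in>conf q. \<bar>Rw V th w\<bar> \<le> C"
    by (rule clock_local_bounded[OF finite_nbh[OF V(1)] q]) (rule Rw_local)
   then show ?thesis using that by blast
  qed
  have "\<exists>C. \<forall>w\<in>conf q. \<bar>ln (Rw V th w)\<bar> \<le> C"
   by (rule clock_local_bounded[OF finite_nbh[OF V(1)] q]) (rule arg_cong[where f=ln], rule Rw_local)
  then obtain K' where K': "\<And>v. v \<in> conf q ==> \<bar>ln (Rw V th v)\<bar> \<le> K'" by blast
  obtain K'' where "\<forall>v\<in>space CC. \<bar>H_int Phi L v\<bar> \<le> K''" using C.H_bounded[OF L] by (elim exE)
  then have K'': "\<bar>H_int Phi L v\<bar> \<le> K''" if "v \<in> conf q" for v using that by (simp add: space_clock_conf)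
  have Gm: "G \<in> borel_measurable CC"
   unfolding G_def[abs_def]
   using measurable_compose[OF mm Rm] measurable_compose[OF mm C.H_measurable[OF L]] C.H_measurable[OF L]
   by (intro borel_measurable_diff borel_measurable_add borel_measurable_ln)
  have Gb: "\<bar>G v\<bar> \<le> 2 * K'' + K'" if "v \<in> conf q" for v
   using K''[OF that] K''[OF mconf[OF that]] K'[OF mconf[OF that]] unfolding G_def by linarith
  have spec': "gibbs_spec (clock_prior q) H'"
  proof (rule gibbs_spec.intro[OF prob_clock[OF q]], unfold gibbs_spec_axioms_def, intro conjI allI impI)
   fix X show "H' X \<in> borel_measurable (conf_space (clock_prior q))" using Gm C.H_measurable[OF L] by (simp add: H'_def)
   show "\<exists>C. \<forall>w\<in>space (conf_space (clock_prior q)). \<bar>H' X w\<bar> \<le> C"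
   proof (intro exI[of _ "max (2 * K'' + K') K''"] ballI)
    fix w assume "w \<in> space CC"
    then have w: "w \<in> conf q" by (simp add: space_clock_conf)
    show "\<bar>H' X w\<bar> \<le> max (2 * K'' + K') K''"
     using Gb[OF w] K''[OF w] unfolding H'_def le_max_iff_disj by (cases "X = L") simp_all
   qed
  qed
  interpret G: gibbs_spec "clock_prior q" H' by (rule spec')
  have HV: "H' V = G" "H' L = H_int Phi L" using V(3) by (auto simp: H'_def)
  have avL: "avg (clock_prior q) H' L h = avC L h" by (simp add: avg_def HV fun_eq_iff)
  let ?omg = "coarsen th" and ?m = "\<lambda>s. merge_conf V s (coarsen th)"
  have wC: "?omg \<in> space CC" using coarsen_conf by (simp add: space_clock_conf)
  have ms: "?m s \<in> conf q" if "s \<in> space (CKP q V)" for s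
   using C.merge_conf_space[OF that wC] by (simp add: space_clock_conf)
  have "avg (clock_prior q) H' V (avC L h) ?omg = avg (clock_prior q) H' V h ?omg"
  proof -
   have "merge_conf L ?one (merge_conf L s v) = merge_conf L ?one v" for s v by (rule merge_conf_merge_conf)
   then show ?thesis unfolding avL[symmetric]
    by (intro G.avg_consistent[OF V(1,2) wC _ h(1) hC]) (simp_all add: HV G_def)
  qed
  then have "(\<integral>s. exp (- G (?m s)) * avC L h (?m s) \<partial>CKP q V) = (\<integral>s. exp (- G (?m s)) * h (?m s) \<partial>CKP q V)"
   using G.den_pos[OF V(1) wC] by (simp add: avg_def HV)
  moreover have ih: "integrable (CKP q V) (\<lambda>s. exp (- G (?m s)) * h (?m s))"
   using G.num_integrable[OF V(1) h(1) hC wC] by (simp add: HV)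
  moreover have ia: "integrable (CKP q V) (\<lambda>s. exp (- G (?m s)) * avC L h (?m s))"
   using G.num_integrable[OF V(1) am _ wC, of 1] ab by (simp add: HV space_clock_conf)
  ultimately have F0: "(\<integral>s. exp (- G (?m s)) * F (?m s) \<partial>CKP q V) = 0"
   by (simp add: F_def right_diff_distrib)
  have iF: "integrable (CKP q V) (\<lambda>s. exp (- G (?m s)) * F (?m s))"
   using Bochner_Integration.integrable_diff[OF ih ia] by (simp add: F_def right_diff_distrib)
  interpret PV: prob_space "CKP q V" by (intro prob_space_PiM prob_clock q)
  have mmeas: "?m \<in> measurable (CKP q V) CC" by (rule C.measurable_merge_conf1[OF wC])
  have R0: "0 < Rw V th v" for v by (rule Rw_pos[OF V(1)])
  have iR: "integrable (CKP q V) (\<lambda>s. Rw V th (?m s))"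
   by (rule PV.integrable_bounded[OF measurable_compose[OF mmeas Rm], of K]) (use K ms in simp)
  have K0: "0 \<le> K" using K[OF coarsen_conf[of th]] by (meson abs_ge_zero order_trans)
  have iRF: "integrable (CKP q V) (\<lambda>s. Rw V th (?m s) * F (?m s))"
   by (rule PV.integrable_bounded[OF borel_measurable_times[OF measurable_compose[OF mmeas Rm] measurable_compose[OF mmeas Fm]], of "K * 2"])
    (use K Fb ms K0 in \<open>simp add: abs_mult mult_mono\<close>)
  \<comment> \<open>The ratio of the two weights is within \<open>2 * e\<close> of 1 by
    \<open>osc\<close> and \<open>exp_close\<close>, and \<open>F\<close> is bounded by 2; this
    gives the 4.\<close>
  have close: "\<bar>Rw V th v * F v - exp (- G v) * F v\<bar> \<le> 4 * e * Rw V th v" if v: "v \<in> conf q" for v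
  proof -
   have "\<bar>(ln (Rw V th v) + H_int Phi L v) - (ln (Rw V th (merge_conf L ?one v)) + H_int Phi L (merge_conf L ?one v))\<bar> \<le> e"
    by (rule osc) (simp add: merge_conf_def)
   then have "\<bar>- G v - ln (Rw V th v)\<bar> \<le> (2*e)/2" unfolding G_def by linarith
   then have "\<bar>exp (- G v - ln (Rw V th v)) - 1\<bar> \<le> 2 * e" using e by (intro exp_close) auto
   moreover have "exp (- G v - ln (Rw V th v)) = exp (- G v) / Rw V th v" using R0 by (simp add: exp_diff)
   ultimately have "\<bar>exp (- G v) / Rw V th v - 1\<bar> * Rw V th v \<le> 2 * e * Rw V th v" using R0[of v] by (intro mult_right_mono) auto
   moreover have "\<bar>exp (- G v) / Rw V th v - 1\<bar> * Rw V th v = \<bar>Rw V th v - exp (- G v)\<bar>"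
   proof -
    have "\<bar>exp (- G v) / Rw V th v - 1\<bar> * Rw V th v = \<bar>(exp (- G v) / Rw V th v - 1) * Rw V th v\<bar>"
     using R0[of v] by (simp add: abs_mult)
    also have "(exp (- G v) / Rw V th v - 1) * Rw V th v = exp (- G v) - Rw V th v" using R0[of v] by (simp add: left_diff_distrib)
    finally show ?thesis by (simp add: abs_minus_commute)
   qed
   ultimately have "\<bar>Rw V th v - exp (- G v)\<bar> \<le> 2 * e * Rw V th v" by simp
   moreover have "\<bar>Rw V th v * F v - exp (- G v) * F v\<bar> = \<bar>Rw V th v - exp (- G v)\<bar> * \<bar>F v\<bar>"
    by (simp add: abs_mult[symmetric] left_diff_distrib)
   moreover have "\<bar>Rw V th v - exp (- G v)\<bar> * \<bar>F v\<bar> \<le> (2 * e * Rw V th v) * 2"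
    using calculation(1) Fb[OF v] R0[of v] e by (intro mult_mono) auto
   ultimately show ?thesis by simp
  qed
  let ?N = "\<integral>s. Rw V th (?m s) * F (?m s) \<partial>CKP q V" and ?Z = "\<integral>s. Rw V th (?m s) \<partial>CKP q V"
  have "?N = (\<integral>s. Rw V th (?m s) * F (?m s) - exp (- G (?m s)) * F (?m s) \<partial>CKP q V)" using iRF iF F0 by simp
  then have "\<bar>?N\<bar> \<le> (\<integral>s. \<bar>Rw V th (?m s) * F (?m s) - exp (- G (?m s)) * F (?m s)\<bar> \<partial>CKP q V)" by simp
  also have "... \<le> (\<integral>s. 4 * e * Rw V th (?m s) \<partial>CKP q V)"
   using iRF iF iR ms by (intro integral_mono close) auto
  finally have N: "\<bar>?N\<bar> \<le> 4 * e * ?Z" by simp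
  have "0 < (\<integral>s. exp (- HH V (merge_conf V s th)) \<partial>XYP V)" by (rule den_pos[OF V(1)]) simp
  also have "... = ?Z" using resolve_num[OF V(1), of "\<lambda>_. 1" 1 th] by simp
  finally have Z: "0 < ?Z" .
  have "av V (\<lambda>w. F (coarsen w)) th = ?N / ?Z"
   unfolding avg_def using resolve_num[OF V(1) Fm Fb, of th] resolve_num[OF V(1), of "\<lambda>_. 1" 1 th] by simp
  then show ?thesis using N Z by (simp add: abs_divide divide_le_eq)
 qed
 then show ?thesis using V(1) unfolding F_def by blast
qed

text \<open>The mean of the defect under \<open>mu\<close> equals the mean of its average in any
  finite volume. Choosing the volume according to \<open>e\<close> bounds it by
  \<open>4 * e\<close>, and since the mean itself is independent of \<open>e\<close>, it
  vanishes.\<close>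

theorem coarsen_gibbs:
 assumes mu: "mu \<in> gibbs_measures XY_prior HH"
 shows "distr mu CC (\<lambda>w x. disc q (w x)) \<in> gibbs_measures (clock_prior q) (H_int Phi)"
proof -
 have p: "prob_space mu" and s: "sets mu = sets CS" using mu by (auto simp: gibbs_measures_def)
 interpret mu: prob_space mu by fact
 have cm: "coarsen \<in> measurable mu CC" using coarsen_measurable measurable_cong_sets[OF s refl] by blast
 show ?thesis
 proof (rule C.gibbs_measuresI[OF mu.prob_space_distr[OF cm] sets_distr])
  fix L J :: "'d site set" and A assume L: "finite L" and J: "finite J" and A: "\<And>x. x \<in> J ==> A x \<in> sets (clock_prior q)"
  let ?E = "prod_emb UNIV (\<lambda>_. clock_prior q) J (Pi\<^sub>E J A)"
  let ?h = "indicator ?E :: _ => real"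
  have E: "?E \<in> sets CC" unfolding conf_space_def using J A by (intro sets_PiM_I) auto
  have h: "?h \<in> borel_measurable CC" "\<And>v. \<bar>?h v\<bar> \<le> 1" using E by (auto simp: indicator_def)
  have am: "avC L ?h \<in> borel_measurable CC" by (rule C.avg_measurable[OF L h(1)])
  have ab: "\<bar>avC L ?h v\<bar> \<le> 1" if "v \<in> conf q" for v
   by (rule C.avg_bounded[OF L _ h(1) h(2)]) (use that in \<open>simp add: space_clock_conf\<close>)
  let ?F = "\<lambda>w. ?h (coarsen w) - avC L ?h (coarsen w)"
  have m: "(\<lambda>w. ?h (coarsen w)) \<in> borel_measurable CS" "(\<lambda>w. avC L ?h (coarsen w)) \<in> borel_measurable CS"
   by (rule measurable_compose[OF coarsen_measurable h(1)], rule measurable_compose[OF coarsen_measurable am])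
  then have Fm: "?F \<in> borel_measurable CS" by (rule borel_measurable_diff)
  have Fb: "\<bar>?F w\<bar> \<le> 2" for w using h(2)[of "coarsen w"] ab[OF coarsen_conf, of w] by linarith
  have "\<bar>\<integral>w. ?F w \<partial>mu\<bar> \<le> 4 * e" if e: "0 < e" "e < 1/2" for e
  proof -
   obtain V where V: "finite V" "\<And>th. \<bar>av V ?F th\<bar> \<le> 4 * e" using avg_defect[OF L e h] by blast
   have "(\<integral>w. ?F w \<partial>mu) = (\<integral>w. av V ?F w \<partial>mu)" by (rule gibbs_measuresD[OF mu V(1) Fm, of 2]) (rule Fb)
   moreover have avm: "av V ?F \<in> borel_measurable mu"
    using avg_measurable[OF V(1) Fm] measurable_cong_sets[OF s refl] by blast
   have "integrable mu (av V ?F)" by (rule mu.integrable_bounded[OF avm V(2)])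
   then have "\<bar>\<integral>w. av V ?F w \<partial>mu\<bar> \<le> (\<integral>w. 4 * e \<partial>mu)"
    using V(2) by (intro order_trans[OF integral_abs_bound] integral_mono) auto
   ultimately show ?thesis using mu.prob_space by simp
  qed
  note bnd = this
  have F0: "(\<integral>w. ?F w \<partial>mu) = 0"
  proof (rule ccontr)
   let ?x = "\<bar>\<integral>w. ?F w \<partial>mu\<bar>"
   assume "(\<integral>w. ?F w \<partial>mu) \<noteq> 0"
   then have x: "0 < ?x" by simp
   have "?x \<le> 4 * min (?x / 8) (1/4)" using x by (intro bnd) auto
   then show False using x by linarith
  qed
  have i: "integrable mu (\<lambda>w. ?h (coarsen w))" "integrable mu (\<lambda>w. avC L ?h (coarsen w))"
   using m ab[OF coarsen_conf] h(2) s by (auto intro!: mu.integrable_bounded[of _ 1] simp: measurable_cong_sets[OF s refl])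
  have "measure (distr mu CC coarsen) ?E = (\<integral>w. ?h w \<partial>distr mu CC coarsen)" using E by simp
  also have "... = (\<integral>w. ?h (coarsen w) \<partial>mu)" by (rule integral_distr[OF cm h(1)])
  also have "... = (\<integral>w. avC L ?h (coarsen w) \<partial>mu)" using F0 i by simp
  also have "... = (\<integral>w. avC L ?h w \<partial>distr mu CC coarsen)" by (rule integral_distr[OF cm am, symmetric])
  finally show "measure (distr mu CC coarsen) ?E = (\<integral>w. avC L ?h w \<partial>distr mu CC coarsen)" .
 qed
qed

end

section \<open>Choice of the constants and conclusion\<close>

lemma pair_model_lattice:
 fixes dim :: "'d::finite itself"
 defines "D \<equiv> card {j :: 'd => int. adj (\<lambda>_. 0) j}"
 shows "pair_model XY_prior {(i, j). adj i (j :: 'd => int)} D (1 / (8 * (real D + 1)))"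
proof (rule pair_model.intro[OF prob_space_XY_prior], unfold pair_model_axioms_def, intro conjI allI)
 let ?E = "{(i, j). adj i (j :: 'd => int)}" and ?e = "1 / (8 * (real D + 1))"
 have nb: "?E `` {z} = {j. adj z j}" for z by auto
 show "sym ?E" using adj_sym by (auto simp: sym_def)
 show "(i, i) \<notin> ?E" for i by (simp add: adj_irrefl)
 show "finite (?E `` {z})" for z unfolding nb by (rule finite_adj)
 show "card (?E `` {z}) \<le> D" for z
 proof -
  have "{j. adj z j} \<subseteq> (\<lambda>j. site_add j z) ` {j. adj (\<lambda>_. 0) j}"
  proof
   fix j assume "j \<in> {j. adj z j}"
   then have "adj (site_add (\<lambda>_. 0) z) (site_add (\<lambda>k. j k - z k) z)" by (simp add: site_add_def)
   then have "(\<lambda>k. j k - z k) \<in> {j. adj (\<lambda>_. 0) j}" by (simp only: adj_translate mem_Collect_eq)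
   then show "j \<in> (\<lambda>j. site_add j z) ` {j. adj (\<lambda>_. 0) j}"
    by (rule rev_image_eqI) (simp add: site_add_def)
  qed
  then show ?thesis unfolding nb D_def using finite_adj by (rule surj_card_le[rotated])
 qed
 show e0: "0 < ?e" and e1: "?e < 1" by (simp_all add: field_simps)
 \<comment> \<open>The value of \<open>?e\<close> makes \<open>D * 2 * ?e\<close> at most 1/4, and
   the quadratic bound for \<open>exp (1/4)\<close> gives 21/16, which is below 4/3.\<close>
 have "(1 + 2 * ?e)^D \<le> exp (2 * ?e)^D" using e0 by (intro power_mono) auto
 also have "... = exp (real D * (2 * ?e))" by (rule exp_of_nat_mult[symmetric])
 also have "... \<le> exp (1/4)" by (simp add: field_simps)
 also have "... \<le> 1 + 1/4 + (1/4)^2" by (rule exp_bound) auto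
 also have "... \<le> 4/3" by (simp add: power2_eq_square)
 finally show "(1 + 2 * ?e)^D \<le> 4/3" .
qed

theorem theorem2:
  assumes "CARD('d::finite) \<ge> 3"
  shows "\<exists>beta>0. \<exists>q0::nat. \<forall>q\<ge>q0.
    \<exists>Phi :: ('d \<Rightarrow> int) set \<Rightarrow> (('d \<Rightarrow> int) \<Rightarrow> nat) \<Rightarrow> real.
      is_interaction q Phi \<and> clock_invariant q Phi \<and>
      (\<forall>mu \<in> gibbs_measures XY_prior (H_XY beta :: ('d \<Rightarrow> int) set \<Rightarrow> _ \<Rightarrow> real).
         distr mu (conf_space (clock_prior q)) (\<lambda>w x. disc q (w x))
           \<in> gibbs_measures (clock_prior q) (H_int Phi)) \<and>
      uncountable {mu \<in> gibbs_measures (clock_prior q) (H_int Phi).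
         translation_invariant (clock_prior q) mu \<and> ergodic (clock_prior q) mu}"
proof -
 obtain beta where b: "0 < beta" and fv: "\<forall>L::'d site set. finite L --> 2/5 \<le> xy_model.fv beta xy_model.origin_form L"
  using XY_magnetization[OF assms] by blast
 define D where "D = card {j :: 'd => int. adj (\<lambda>_. 0) j}"
 define eps where "eps = 1 / (8 * (real D + 1))"
 have eps: "0 < eps" by (simp add: eps_def)
 interpret pair_model XY_prior "{(i, j). adj i (j :: 'd => int)}" D eps
  unfolding eps_def D_def by (rule pair_model_lattice)
 interpret X: xy_model beta "TYPE('d)" by unfold_locales (use b in simp)
 obtain mu where mu: "X.is_limit mu" using X.limit_exists by blast
 interpret Y: xy_limit beta "TYPE('d)" mu by unfold_locales (rule mu)
 have mag: "2/5 \<le> (\<integral>w. cos (w (\<lambda>_. 0)) \<partial>mu)"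
 proof -
  obtain Ls :: "nat => 'd site set" where Ls: "exhausting Ls" using exhausting_exists by blast
  have "linf X.origin_form w = w (\<lambda>_. 0)" for w
   using linf_superset[of "{\<lambda>_. 0}" X.origin_form w] by (simp add: X.origin_form_def)
  then have "(\<lambda>n. X.fv X.origin_form (Ls n)) \<longlonglongrightarrow> (\<integral>w. cos (w (\<lambda>_. 0)) \<partial>mu)"
   using Y.cos_limit[of X.origin_form Ls 0] Ls by (simp add: X.origin_form_def)
  moreover have "2/5 \<le> X.fv X.origin_form (Ls n)" for n using fv Ls by (simp add: exhausting_def)
  ultimately show ?thesis by (intro LIMSEQ_le_const) auto
 qed
 \<comment> \<open>16 is what \<open>uncountable_coarse\<close> requires; the other bound is the
   condition \<open>small\<close> solved for \<open>q\<close>, with \<open>beta\<close> and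
   \<open>eps\<close> already fixed.\<close>
 define q0 where "q0 = max 16 (nat \<lceil>4 * pi * beta / eps\<rceil>)"
 show ?thesis
 proof (intro exI[of _ beta] conjI exI[of _ q0] allI impI b)
  fix q assume "q0 \<le> q"
  then have q16: "16 \<le> q" and "4 * pi * beta / eps \<le> real q" by (auto simp: q0_def)
  then have "beta * (2*pi / real q) \<le> eps / 2" using eps by (simp add: field_simps)
  then interpret M: clock_model beta "TYPE('d)" D eps q by unfold_locales (use q16 in simp_all)
  let ?S = "{mu \<in> gibbs_measures (clock_prior q) (H_int M.Phi).
     translation_invariant (clock_prior q) mu \<and> ergodic (clock_prior q) mu}"
  have "range (Y.coarse q) \<subseteq> ?S"
  proof
   fix nu assume "nu \<in> range (Y.coarse q)"
   then obtain a where nu: "nu = Y.coarse q a" by blast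
   have "ergodic (clock_prior q) nu" unfolding nu by (rule Y.coarse_ergodic) (use q16 in simp)
   moreover have "nu \<in> gibbs_measures (clock_prior q) (H_int M.Phi)"
    unfolding nu by (rule M.coarsen_gibbs[OF X.rot_gibbs[OF Y.gibbs]])
   ultimately show "nu \<in> ?S" by (simp add: ergodic_def)
  qed
  moreover have "uncountable (range (Y.coarse q))" by (rule Y.uncountable_coarse[OF q16 mag])
  ultimately have "uncountable ?S" using countable_subset by blast
  then show "\<exists>Phi :: 'd site set => ('d site => nat) => real.
   is_interaction q Phi \<and> clock_invariant q Phi \<and>
   (\<forall>mu \<in> gibbs_measures XY_prior (H_XY beta :: 'd site set => _ => real).
     distr mu (conf_space (clock_prior q)) (\<lambda>w x. disc q (w x))
      \<in> gibbs_measures (clock_prior q) (H_int Phi)) \<and>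
   uncountable {mu \<in> gibbs_measures (clock_prior q) (H_int Phi).
     translation_invariant (clock_prior q) mu \<and> ergodic (clock_prior q) mu}"
   using M.interaction_Phi M.clock_invariant_Phi M.coarsen_gibbs by (intro exI[of _ M.Phi]) blast
 qed
qed

end
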